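(* Let $(s_n)_{n\ge0}$ be natural numbers with $s_{n+1}\ge s_n>0$, let $(a_j)_{j\in\mathbb N}$ be real numbers with $\sup_ja_j-\inf_ja_j<4$, and let $V_n=V_n(\omega)$ ($n\ge0$) be independent random Hermitian $s_n\times s_n$ matrices on a probability space $(\Omega,\mathcal A,\mathbb P)$ with $$\sum_{n=1}^\infty\left(\|\mathbb E(V_n)\|+\mathbb E(\|V_n\|^2+\|V_n\|^4)\right)<\infty .$$ Let $H^{(1)}_\omega=\Delta^{(1)}+\bigoplus_nV_n(\omega)$ on $\ell^2(\mathbb G_1)$ (see context) and $$I_1=\bigcap_{j=1}^\infty(-2+a_j,\,2+a_j).$$ Then almost surely the random operator $H^{(1)}_\omega$ has purely absolutely continuous spectrum in $I_1$, i.e. for $\mathbb P$-almost all $\omega\in\Omega$, $$I_1\subset\operatorname{spec}_{ac}(H^{(1)}_\omega),\qquad I_1\cap\operatorname{spec}_{pp}(H^{(1)}_\omega)=\emptyset,\qquad I_1\cap\operatorname{spec}_{sc}(H^{(1)}_\omega)=\emptyset .$$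
   Context: $\mathbb G_1=\{(n,j):n\in\mathbb N_0,\ j\in\{1,\ldots,s_n\}\}$, $S_n=\{n\}\times\{1,\ldots,s_n\}$. For $\psi=(\psi_{n,j})\in\ell^2(\mathbb G_1)$ write $\psi_n=(\psi_{n,1},\ldots,\psi_{n,s_n})^\top\in\ell^2(S_n)=\mathbb C^{s_n}$. The free operator is $$(\Delta^{(1)}\psi)_{n,j}=-\psi_{n-1,j}-\psi_{n+1,j}+a_j\psi_{n,j},\qquad j\in\{1,\ldots,s_n\},$$ with the convention $\psi_{n-1,j}=0$ if $j>s_{n-1}$ or $n=0$. The random operator is $(H^{(1)}_\omega\psi)_n=(\Delta^{(1)}\psi)_n+V_n(\omega)\psi_n$. $\|\cdot\|$ is the standard matrix norm on $\mathbb C^{s_n\times s_n}$ and $\mathbb E$ the expectation. $\operatorname{spec}_{ac},\operatorname{spec}_{pp},\operatorname{spec}_{sc}$ denote the absolutely continuous, pure point and singular continuous spectrum, as closed sets.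
   Formalization: The disjointness of I_1 from spec_pp and spec_sc is shown for the interior of I_1, i.e. (-2+sup a_j, 2+inf a_j); it can fail at an endpoint lying in I_1 when sup or inf is not attained (e.g. a_j=-1/j, s_n=n+1, eigenvalues accumulating at -2). *)

theory Defs
  imports "HOL-Probability.Probability"
begin

section \<open>Square-summable functions\<close>

definition ell2 :: "'i set \<Rightarrow> ('i \<Rightarrow> complex) set" where
  "ell2 G = {\<psi>. (\<forall>x. x \<notin> G \<longrightarrow> \<psi> x = 0) \<and> (\<lambda>x. (cmod (\<psi> x))\<^sup>2) summable_on G}"

definition ell2_inner :: "'i set \<Rightarrow> ('i \<Rightarrow> complex) \<Rightarrow> ('i \<Rightarrow> complex) \<Rightarrow> complex" where
  "ell2_inner G \<phi> \<psi> = (\<Sum>\<^sub>\<infinity>x\<in>G. cnj (\<phi> x) * \<psi> x)"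

definition ell2_norm :: "'i set \<Rightarrow> ('i \<Rightarrow> complex) \<Rightarrow> real" where
  "ell2_norm G \<psi> = sqrt (\<Sum>\<^sub>\<infinity>x\<in>G. (cmod (\<psi> x))\<^sup>2)"

section \<open>Spectral resolution of a self-adjoint operator\<close>

text \<open>A (possibly unbounded) operator on \<open>ell2 G\<close> is given by its domain \<open>D\<close> and a map \<open>T\<close>,
  of which only the values on \<open>D\<close> matter.\<close>

type_synonym 'i op = "('i \<Rightarrow> complex) \<Rightarrow> ('i \<Rightarrow> complex)"

definition orthogonal_projection :: "'i set \<Rightarrow> 'i op \<Rightarrow> bool" where
  "orthogonal_projection G P \<longleftrightarrow>
     (\<forall>\<psi>\<in>ell2 G. P \<psi> \<in> ell2 G \<and> P (P \<psi>) = P \<psi>) \<and>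
     (\<forall>\<phi>\<in>ell2 G. \<forall>\<psi>\<in>ell2 G. \<forall>c. P (\<lambda>x. c * \<phi> x + \<psi> x) = (\<lambda>x. c * P \<phi> x + P \<psi> x)) \<and>
     (\<forall>\<phi>\<in>ell2 G. \<forall>\<psi>\<in>ell2 G. ell2_inner G (P \<phi>) \<psi> = ell2_inner G \<phi> (P \<psi>))"

definition projection_valued_measure :: "'i set \<Rightarrow> (real set \<Rightarrow> 'i op) \<Rightarrow> bool" where
  "projection_valued_measure G E \<longleftrightarrow>
     (\<forall>B\<in>sets borel. orthogonal_projection G (E B)) \<and>
     (\<forall>\<psi>\<in>ell2 G. E UNIV \<psi> = \<psi>) \<and>
     (\<forall>B. range B \<subseteq> sets borel \<longrightarrow> disjoint_family B \<longrightarrow>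
        (\<forall>\<psi>\<in>ell2 G.
          (\<lambda>N. ell2_norm G (\<lambda>x. (\<Sum>n<N. E (B n) \<psi> x) - E (\<Union>n. B n) \<psi> x)) \<longlonglongrightarrow> 0))"

definition vector_measure :: "'i set \<Rightarrow> (real set \<Rightarrow> 'i op) \<Rightarrow> ('i \<Rightarrow> complex) \<Rightarrow> real measure" where
  "vector_measure G E \<psi> =
     measure_of UNIV (sets borel) (\<lambda>B. ennreal (Re (ell2_inner G \<psi> (E B \<psi>))))"

text \<open>\<open>T\<close> is the integral of the identity function against \<open>E\<close>, including equality of domains.
  The quadratic form determines \<open>T\<close> by polarization, the domain being a complex subspace.\<close>

definition is_spectral_resolution ::
    "'i set \<Rightarrow> ('i \<Rightarrow> complex) set \<Rightarrow> 'i op \<Rightarrow> (real set \<Rightarrow> 'i op) \<Rightarrow> bool" where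
  "is_spectral_resolution G D T E \<longleftrightarrow>
     projection_valued_measure G E \<and>
     D = {\<psi> \<in> ell2 G. (\<integral>\<^sup>+x. ennreal (x\<^sup>2) \<partial>vector_measure G E \<psi>) < \<infinity>} \<and>
     (\<forall>\<psi>\<in>D. T \<psi> \<in> ell2 G \<and>
        ell2_inner G \<psi> (T \<psi>) = complex_of_real (\<integral>x. x \<partial>vector_measure G E \<psi>))"

text \<open>For self-adjoint \<open>T\<close> such an \<open>E\<close> exists by the spectral theorem, and it is unique on Borel
  sets and on \<open>ell2 G\<close>. The choice operator only fixes its irrelevant values elsewhere.\<close>

definition spectral_resolution ::
    "'i set \<Rightarrow> ('i \<Rightarrow> complex) set \<Rightarrow> 'i op \<Rightarrow> (real set \<Rightarrow> 'i op)" where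
  "spectral_resolution G D T = (SOME E. is_spectral_resolution G D T E)"

definition spectral_measure ::
    "'i set \<Rightarrow> ('i \<Rightarrow> complex) set \<Rightarrow> 'i op \<Rightarrow> ('i \<Rightarrow> complex) \<Rightarrow> real measure" where
  "spectral_measure G D T \<psi> = vector_measure G (spectral_resolution G D T) \<psi>"

section \<open>Absolutely continuous, pure point and singular continuous spectrum\<close>

definition pure_point_measure :: "real measure \<Rightarrow> bool" where
  "pure_point_measure \<mu> \<longleftrightarrow> (\<exists>C. countable C \<and> emeasure \<mu> (- C) = 0)"

definition singular_continuous_measure :: "real measure \<Rightarrow> bool" where
  "singular_continuous_measure \<mu> \<longleftrightarrow>
     (\<forall>x. emeasure \<mu> {x} = 0) \<and>
     (\<exists>N\<in>sets borel. emeasure lborel N = 0 \<and> emeasure \<mu> (- N) = 0)"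

definition ac_subspace :: "'i set \<Rightarrow> ('i \<Rightarrow> complex) set \<Rightarrow> 'i op \<Rightarrow> ('i \<Rightarrow> complex) set" where
  "ac_subspace G D T = {\<psi> \<in> ell2 G. absolutely_continuous lborel (spectral_measure G D T \<psi>)}"

definition pp_subspace :: "'i set \<Rightarrow> ('i \<Rightarrow> complex) set \<Rightarrow> 'i op \<Rightarrow> ('i \<Rightarrow> complex) set" where
  "pp_subspace G D T = {\<psi> \<in> ell2 G. pure_point_measure (spectral_measure G D T \<psi>)}"

definition sc_subspace :: "'i set \<Rightarrow> ('i \<Rightarrow> complex) set \<Rightarrow> 'i op \<Rightarrow> ('i \<Rightarrow> complex) set" where
  "sc_subspace G D T = {\<psi> \<in> ell2 G. singular_continuous_measure (spectral_measure G D T \<psi>)}"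

text \<open>Spectrum of the part of \<open>T\<close> in a closed reducing subspace \<open>K\<close>.\<close>

definition spectrum_on ::
    "'i set \<Rightarrow> ('i \<Rightarrow> complex) set \<Rightarrow> 'i op \<Rightarrow> ('i \<Rightarrow> complex) set \<Rightarrow> complex set" where
  "spectrum_on G D T K = {z. \<not>
     (bij_betw (\<lambda>\<psi> x. T \<psi> x - z * \<psi> x) (D \<inter> K) K \<and>
      (\<exists>C. \<forall>\<psi>\<in>D \<inter> K. ell2_norm G \<psi> \<le> C * ell2_norm G (\<lambda>x. T \<psi> x - z * \<psi> x)))}"

text \<open>All three are closed sets; in particular \<open>spec_pp\<close> is the closure of the set of
  eigenvalues.\<close>

definition spec_ac :: "'i set \<Rightarrow> ('i \<Rightarrow> complex) set \<Rightarrow> 'i op \<Rightarrow> complex set" where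
  "spec_ac G D T = spectrum_on G D T (ac_subspace G D T)"

definition spec_pp :: "'i set \<Rightarrow> ('i \<Rightarrow> complex) set \<Rightarrow> 'i op \<Rightarrow> complex set" where
  "spec_pp G D T = spectrum_on G D T (pp_subspace G D T)"

definition spec_sc :: "'i set \<Rightarrow> ('i \<Rightarrow> complex) set \<Rightarrow> 'i op \<Rightarrow> complex set" where
  "spec_sc G D T = spectrum_on G D T (sc_subspace G D T)"

section \<open>The random operator\<close>

text \<open>A \<open>k \<times> k\<close> matrix is a function of two indices, of which only the values on
  \<open>{1..k} \<times> {1..k}\<close> matter. Its norm is the operator norm for the Euclidean norm.\<close>

definition mat_norm :: "nat \<Rightarrow> (nat \<Rightarrow> nat \<Rightarrow> complex) \<Rightarrow> real" where
  "mat_norm k A =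
     (SUP x \<in> {x. L2_set (\<lambda>j. cmod (x j)) {1..k} \<le> 1}.
        L2_set (\<lambda>i. cmod (\<Sum>j\<in>{1..k}. A i j * x j)) {1..k})"

definition hermitian :: "nat \<Rightarrow> (nat \<Rightarrow> nat \<Rightarrow> complex) \<Rightarrow> bool" where
  "hermitian k A \<longleftrightarrow> (\<forall>i\<in>{1..k}. \<forall>j\<in>{1..k}. A i j = cnj (A j i))"

definition G1 :: "(nat \<Rightarrow> nat) \<Rightarrow> (nat \<times> nat) set" where
  "G1 s = (SIGMA n:UNIV. {1..s n})"

definition free_op :: "(nat \<Rightarrow> nat) \<Rightarrow> (nat \<Rightarrow> real) \<Rightarrow> (nat \<times> nat) op" where
  "free_op s a \<psi> = (\<lambda>(n, j). if (n, j) \<in> G1 s then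
       - (if n = 0 \<or> j > s (n - 1) then 0 else \<psi> (n - 1, j)) - \<psi> (n + 1, j)
         + complex_of_real (a j) * \<psi> (n, j)
     else 0)"

definition block_op ::
    "(nat \<Rightarrow> nat) \<Rightarrow> (nat \<Rightarrow> nat \<Rightarrow> nat \<Rightarrow> complex) \<Rightarrow> (nat \<times> nat) op" where
  "block_op s W \<psi> = (\<lambda>(n, j). if (n, j) \<in> G1 s then \<Sum>k\<in>{1..s n}. W n j k * \<psi> (n, k) else 0)"

definition H1_op ::
    "(nat \<Rightarrow> nat) \<Rightarrow> (nat \<Rightarrow> real) \<Rightarrow> (nat \<Rightarrow> nat \<Rightarrow> nat \<Rightarrow> complex) \<Rightarrow> (nat \<times> nat) op" where
  "H1_op s a W \<psi> = (\<lambda>x. free_op s a \<psi> x + block_op s W \<psi> x)"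

text \<open>The maximal domain. For bounded \<open>a\<close> and Hermitian blocks the operator is self-adjoint on it;
  if the blocks are moreover uniformly bounded, it is all of \<open>ell2 (G1 s)\<close>.\<close>

definition H1_dom ::
    "(nat \<Rightarrow> nat) \<Rightarrow> (nat \<Rightarrow> real) \<Rightarrow> (nat \<Rightarrow> nat \<Rightarrow> nat \<Rightarrow> complex) \<Rightarrow> (nat \<times> nat \<Rightarrow> complex) set"
    where
  "H1_dom s a W = {\<psi> \<in> ell2 (G1 s). H1_op s a W \<psi> \<in> ell2 (G1 s)}"

text \<open>This infinite intersection need not be open: it contains the point \<open>- 2 + sup a\<close>
  (\<open>2 + inf a\<close>) when the supremum (infimum) of \<open>a\<close> is not attained. At such a point purity of the
  absolutely continuous spectrum can fail, since eigenvalues outside may accumulate there. Hence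
  the absence of the other spectral types is to be claimed on the interior.\<close>

definition I1 :: "(nat \<Rightarrow> real) \<Rightarrow> real set" where
  "I1 a = (\<Inter>j\<in>{1..}. {- 2 + a j <..< 2 + a j})"

end

theory Submission
  imports Defs "HOL-Computational_Algebra.Polynomial" "HOL-Real_Asymp.Real_Asymp"
begin

text \<open>
  Fix a site \<open>x = (n0, j0)\<close>, let \<open>v\<close> be the formal solution of \<open>(H - l) v = \<delta>\<^sub>x\<close> at the real energy \<open>l\<close> which
  vanishes on the levels up to \<open>n0\<close> and vanishes on every channel where the channel opens, and let
  \<open>u = (H - l - \<i> / L)\<^sup>-\<^sup>1 \<delta>\<^sub>x\<close>. Green's identity for \<open>v\<close> and \<open>u\<close>, averaged over \<open>L\<close> consecutive levels, gives
  \<open>\<parallel>u\<parallel>\<^sup>2 / L \<le> (9 / L) \<Sum>\<^bsub>m \<le> L\<^esub> \<parallel>v\<^bsub>n0 + m\<^esub>\<parallel>\<^sup>2\<close>. The left side is \<open>\<pi>\<close> times the Poisson integral of the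
  spectral measure of \<open>\<delta>\<^sub>x\<close>, so this measure is absolutely continuous on an interval \<open>J\<close> as soon as
  \<open>\<integral>\<^sub>J (1 / L) \<Sum>\<^bsub>m \<le> L\<^esub> \<parallel>v\<^bsub>n0 + m\<^esub>\<parallel>\<^sup>4\<close> has finite lower limit as \<open>L \<rightarrow> \<infinity>\<close>.

  If \<open>\<bar>a\<^sub>j - l\<bar>\<close> is bounded away from \<open>2\<close>, then the free evolution preserves the energy
  \<open>\<Sum>\<^sub>j \<bar>v\<^bsub>n,j\<^esub>\<bar>\<^sup>2 + \<bar>v\<^bsub>n+1,j\<^esub>\<bar>\<^sup>2 - (a\<^sub>j - l) Re (cnj v\<^bsub>n,j\<^esub> v\<^bsub>n+1,j\<^esub>)\<close>, which is comparable to the squared norm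
  uniformly in the number of channels. As \<open>V\<^sub>n\<close> is independent of the past, one random step multiplies the
  mean of the squared energy by at most \<open>1 + C (\<parallel>\<bbbE> V\<^sub>n\<parallel> + \<bbbE> (\<parallel>V\<^sub>n\<parallel>\<^sup>2 + \<parallel>V\<^sub>n\<parallel>\<^sup>4))\<close>. Hence the fourth
  moments stay bounded, and Fatou's lemma yields the criterion almost surely. That the interval belongs to the
  spectrum follows from plane waves on the first channel, since \<open>V\<^sub>n \<rightarrow> 0\<close> almost surely.
\<close>

section \<open>The Hilbert space of square-summable functions\<close>

text \<open>The spectral subspaces are defined through a choice operator, so nothing is known about
  spectral measures until some resolution has been constructed and until the needed facts have been
  derived from the bare definition, which records only projections and a quadratic form. Since the
  potential tends to zero almost surely, the operator is bounded, and a construction from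
  polynomials suffices. Fourth moments of \<open>v\<close> are needed because Poisson integrals that
  are merely bounded in mean could still concentrate on a null set in the limit; square
  integrability in the energy prevents this. Taking the distance \<open>1 / L\<close> to the real
  axis gives the boundary and the bulk terms of Green's identity the same size. The number of
  channels may grow without bound, so no estimate may depend on \<open>s n\<close>: hence a sum of
  channel energies measured against the operator norm of the potential. A newly opened channel
  carries no energy. The comparison of energy and norm degenerates at the ends of the interval, so
  the estimates run on countably many shorter intervals that exhaust it.\<close>

typedef 'i l2 = "{f :: 'i \<Rightarrow> complex. (\<lambda>x. (cmod (f x))\<^sup>2) summable_on UNIV}"
  morphisms l2_fun L2
  by (rule exI[of _ "\<lambda>_. 0"]) simp

setup_lifting type_definition_l2

lemma square_norm_add_le: "(cmod (a + b))\<^sup>2 \<le> 2 * (cmod a)\<^sup>2 + 2 * (cmod b)\<^sup>2"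
proof -
  have "(cmod (a + b))\<^sup>2 \<le> (cmod a + cmod b)\<^sup>2"
    by (intro power_mono norm_triangle_ineq) auto
  also have "\<dots> \<le> 2 * (cmod a)\<^sup>2 + 2 * (cmod b)\<^sup>2"
    using sum_squares_bound[of "cmod a" "cmod b"] by (simp add: power2_sum)
  finally show ?thesis .
qed

lemma square_summable_add:
  fixes f g :: "'i \<Rightarrow> complex"
  assumes "(\<lambda>x. (cmod (f x))\<^sup>2) summable_on S" "(\<lambda>x. (cmod (g x))\<^sup>2) summable_on S"
  shows "(\<lambda>x. (cmod (f x + g x))\<^sup>2) summable_on S"
proof (rule summable_on_comparison_test)
  show "(\<lambda>x. 2 * (cmod (f x))\<^sup>2 + 2 * (cmod (g x))\<^sup>2) summable_on S"
    by (intro summable_on_add summable_on_cmult_right assms)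
qed (auto simp: square_norm_add_le)

lemma square_summable_mult:
  fixes f :: "'i \<Rightarrow> complex"
  assumes "(\<lambda>x. (cmod (f x))\<^sup>2) summable_on S" "\<And>x. x \<in> S \<Longrightarrow> cmod (c x) \<le> B"
  shows "(\<lambda>x. (cmod (c x * f x))\<^sup>2) summable_on S"
proof (rule summable_on_comparison_test)
  show "(\<lambda>x. B\<^sup>2 * (cmod (f x))\<^sup>2) summable_on S"
    by (intro summable_on_cmult_right assms)
  show "(cmod (c x * f x))\<^sup>2 \<le> B\<^sup>2 * (cmod (f x))\<^sup>2" if "x \<in> S" for x
    using assms(2)[OF that] by (simp add: norm_mult power_mult_distrib mult_right_mono power_mono)
qed auto

lemma product_abs_summable:
  fixes f g :: "'i \<Rightarrow> complex"
  assumes "(\<lambda>x. (cmod (f x))\<^sup>2) summable_on S" "(\<lambda>x. (cmod (g x))\<^sup>2) summable_on S"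
  shows "(\<lambda>x. norm (cnj (f x) * g x)) summable_on S"
proof (rule summable_on_comparison_test)
  show "(\<lambda>x. (cmod (f x))\<^sup>2 + (cmod (g x))\<^sup>2) summable_on S"
    by (intro summable_on_add assms)
  show "norm (cnj (f x) * g x) \<le> (cmod (f x))\<^sup>2 + (cmod (g x))\<^sup>2" for x
    using sum_squares_bound[of "cmod (f x)" "cmod (g x)"]
      mult_nonneg_nonneg[of "cmod (f x)" "cmod (g x)"]
    by (simp add: norm_mult del: mult_nonneg_nonneg)
qed auto

lemma product_summable:
  fixes f g :: "'i \<Rightarrow> complex"
  assumes "(\<lambda>x. (cmod (f x))\<^sup>2) summable_on S" "(\<lambda>x. (cmod (g x))\<^sup>2) summable_on S"
  shows "(\<lambda>x. cnj (f x) * g x) summable_on S"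
  using product_abs_summable[OF assms] by (rule abs_summable_summable)

instantiation l2 :: (type) real_vector
begin

lift_definition zero_l2 :: "'a l2" is "\<lambda>_. 0" by simp
lift_definition plus_l2 :: "'a l2 \<Rightarrow> 'a l2 \<Rightarrow> 'a l2" is "\<lambda>f g x. f x + g x"
  by (rule square_summable_add)
lift_definition uminus_l2 :: "'a l2 \<Rightarrow> 'a l2" is "\<lambda>f x. - f x" by simp
lift_definition minus_l2 :: "'a l2 \<Rightarrow> 'a l2 \<Rightarrow> 'a l2" is "\<lambda>f g x. f x - g x"
  subgoal for f g
    using square_summable_add[of f UNIV "\<lambda>x. - g x"] by simp
  done
lift_definition scaleR_l2 :: "real \<Rightarrow> 'a l2 \<Rightarrow> 'a l2" is "\<lambda>r f x. complex_of_real r * f x"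
  subgoal for r f
    using square_summable_mult[of f UNIV "\<lambda>_. complex_of_real r" "\<bar>r\<bar>"] by simp
  done

instance
  by standard (transfer; auto simp: algebra_simps)+

end

text \<open>Complex scalars act through a separate operation because the type is made a real inner
  product space below: the abstract spectral theory runs over the reals, and multiplication by
  \<open>\<i>\<close> re-enters as a bounded operator that commutes with the one under
  study.\<close>

lift_definition scaleC :: "complex \<Rightarrow> 'a l2 \<Rightarrow> 'a l2" is "\<lambda>c f x. c * f x"
  subgoal for c f
    using square_summable_mult[of f UNIV "\<lambda>_. c" "cmod c"] by simp
  done

lift_definition cinner :: "'a l2 \<Rightarrow> 'a l2 \<Rightarrow> complex"
  is "\<lambda>f g. \<Sum>\<^sub>\<infinity>x. cnj (f x) * g x" .

lemma cinner_add_left: "cinner (f + g) h = cinner f h + cinner g h"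
  by transfer (simp add: distrib_right infsum_add product_summable)

lemma cinner_commute: "cinner f g = cnj (cinner g f)"
  unfolding cinner.rep_eq by (subst infsum_cnj[symmetric]) (simp add: mult.commute)

lemma cinner_scaleC_left: "cinner (scaleC c f) g = cnj c * cinner f g"
  by transfer (simp add: mult.assoc infsum_cmult_right')

lemma scaleR_scaleC: "r *\<^sub>R f = scaleC (complex_of_real r) f"
  by transfer simp

lemma cinner_same: "cinner f f = complex_of_real (\<Sum>\<^sub>\<infinity>x. (cmod (l2_fun f x))\<^sup>2)"
proof -
  have "cnj (l2_fun f x) * l2_fun f x = complex_of_real ((cmod (l2_fun f x))\<^sup>2)" for x
    by (subst complex_norm_square) (simp add: mult.commute)
  then have "cinner f f = (\<Sum>\<^sub>\<infinity>x. complex_of_real ((cmod (l2_fun f x))\<^sup>2))"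
    by (simp add: cinner.rep_eq)
  also have "\<dots> = complex_of_real (\<Sum>\<^sub>\<infinity>x. (cmod (l2_fun f x))\<^sup>2)"
    by (rule infsumI, rule has_sum_of_real, rule has_sum_infsum) (use l2_fun in auto)
  finally show ?thesis .
qed

instantiation l2 :: (type) real_inner
begin

definition "inner f g = Re (cinner f g)" for f :: "'a l2"
definition "norm f = sqrt (inner f f)" for f :: "'a l2"
definition "dist f g = norm (f - g)" for f :: "'a l2"
definition "sgn f = f /\<^sub>R norm f" for f :: "'a l2"
definition [code del]: "uniformity = (INF e\<in>{0<..}. principal {(x :: 'a l2, y). dist x y < e})"
definition [code del]: "open (U :: 'a l2 set) = (\<forall>x\<in>U. \<forall>\<^sub>F (x', y) in uniformity. x' = x \<longrightarrow> y \<in> U)"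

instance
proof
  fix x y z :: "'a l2" and r :: real
  show "inner x y = inner y x"
    unfolding inner_l2_def by (subst cinner_commute) simp
  show "inner (x + y) z = inner x z + inner y z"
    unfolding inner_l2_def by (simp add: cinner_add_left)
  show "inner (r *\<^sub>R x) y = r * inner x y"
    unfolding inner_l2_def by (simp add: scaleR_scaleC cinner_scaleC_left)
  show "0 \<le> inner x x"
    unfolding inner_l2_def by (simp add: cinner_same infsum_nonneg)
  show "inner x x = 0 \<longleftrightarrow> x = 0"
  proof
    assume "inner x x = 0"
    then have "(\<Sum>\<^sub>\<infinity>t. (cmod (l2_fun x t))\<^sup>2) = 0"
      by (simp add: inner_l2_def cinner_same)
    then have "(cmod (l2_fun x t))\<^sup>2 = 0" for t
      using l2_fun[of x] by (intro nonneg_infsum_le_0D[where A = UNIV]) auto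
    then have "l2_fun x = (\<lambda>_. 0)" by auto
    then show "x = 0"
      by (subst l2_fun_inject[symmetric]) (simp only: zero_l2.rep_eq)
  next
    assume "x = 0"
    then show "inner x x = 0"
      by (simp add: inner_l2_def cinner_same zero_l2.rep_eq)
  qed
qed (auto simp: norm_l2_def dist_l2_def sgn_l2_def uniformity_l2_def open_l2_def)

end

lemma norm_l2_square: "(norm f)\<^sup>2 = (\<Sum>\<^sub>\<infinity>x. (cmod (l2_fun f x))\<^sup>2)"
proof -
  have "(norm f)\<^sup>2 = inner f f" by (rule power2_norm_eq_inner)
  then show ?thesis unfolding inner_l2_def cinner_same Re_complex_of_real .
qed

lemma l2_fun_summable: "(\<lambda>x. (cmod (l2_fun f x))\<^sup>2) summable_on S"
  using l2_fun[of f] by (auto intro: summable_on_subset_banach)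

lemma sum_le_norm_l2:
  assumes "finite S"
  shows "(\<Sum>x\<in>S. (cmod (l2_fun f x))\<^sup>2) \<le> (norm f)\<^sup>2"
  unfolding norm_l2_square using assms
  by (intro finite_sum_le_infsum l2_fun_summable) auto

lemma norm_l2_le:
  assumes "\<And>S. finite S \<Longrightarrow> (\<Sum>x\<in>S. (cmod (l2_fun f x))\<^sup>2) \<le> C\<^sup>2" "0 \<le> C"
  shows "norm f \<le> C"
proof -
  have "(norm f)\<^sup>2 \<le> C\<^sup>2"
    unfolding norm_l2_square using assms by (intro infsum_le_finite_sums l2_fun_summable) auto
  then show ?thesis using assms(2) by (rule power2_le_imp_le)
qed

lemma cmod_l2_fun_le: "cmod (l2_fun f x) \<le> norm f"
proof (rule power2_le_imp_le)
  show "(cmod (l2_fun f x))\<^sup>2 \<le> (norm f)\<^sup>2"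
    using sum_le_norm_l2[of "{x}" f] by simp
qed simp

lemma l2_fun_simps [simp]:
  "l2_fun (f + g) x = l2_fun f x + l2_fun g x"
  "l2_fun (f - g) x = l2_fun f x - l2_fun g x"
  "l2_fun (- f) x = - l2_fun f x"
  "l2_fun 0 x = 0"
  "l2_fun (r *\<^sub>R f) x = complex_of_real r * l2_fun f x"
  "l2_fun (scaleC c f) x = c * l2_fun f x"
  by (simp_all add: plus_l2.rep_eq minus_l2.rep_eq uminus_l2.rep_eq zero_l2.rep_eq
      scaleR_l2.rep_eq scaleC.rep_eq)

lemma l2_eqI: "(\<And>x. l2_fun f x = l2_fun g x) \<Longrightarrow> f = g"
  by (metis ext l2_fun_inject)

text \<open>Coordinates converge because each is dominated by the norm. The Cauchy bound on finite
  partial sums passes to the pointwise limit, which yields at once that the limit is square-summable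
  and that convergence holds in norm.\<close>

instance l2 :: (type) complete_space
proof
  fix X :: "nat \<Rightarrow> 'a l2"
  assume X: "Cauchy X"
  have "Cauchy (\<lambda>n. l2_fun (X n) x)" for x
  proof (rule metric_CauchyI)
    fix e :: real assume "0 < e"
    then obtain N where "\<And>m n. m \<ge> N \<Longrightarrow> n \<ge> N \<Longrightarrow> dist (X m) (X n) < e"
      using metric_CauchyD[OF X \<open>0 < e\<close>] by blast
    moreover have "dist (l2_fun (X m) x) (l2_fun (X n) x) \<le> dist (X m) (X n)" for m n
      using cmod_l2_fun_le[of "X m - X n" x] by (simp add: dist_norm)
    ultimately show "\<exists>M. \<forall>m\<ge>M. \<forall>n\<ge>M. dist (l2_fun (X m) x) (l2_fun (X n) x) < e"
      by (meson le_less_trans)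
  qed
  then have "\<exists>l. (\<lambda>n. l2_fun (X n) x) \<longlonglongrightarrow> l" for x
    by (simp add: Cauchy_convergent_iff convergent_def)
  then obtain g where g: "\<And>x. (\<lambda>n. l2_fun (X n) x) \<longlonglongrightarrow> g x" by metis
  have close: "\<exists>N. \<forall>n\<ge>N. \<forall>S. finite S \<longrightarrow> (\<Sum>x\<in>S. (cmod (l2_fun (X n) x - g x))\<^sup>2) \<le> e\<^sup>2" if "0 < e" for e
  proof -
    obtain N where N: "\<And>m n. m \<ge> N \<Longrightarrow> n \<ge> N \<Longrightarrow> dist (X m) (X n) < e"
      using metric_CauchyD[OF X \<open>0 < e\<close>] by blast
    have "(\<Sum>x\<in>S. (cmod (l2_fun (X n) x - g x))\<^sup>2) \<le> e\<^sup>2" if "n \<ge> N" "finite S" for n S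
    proof (rule LIMSEQ_le_const2)
      show "(\<lambda>m. \<Sum>x\<in>S. (cmod (l2_fun (X n) x - l2_fun (X m) x))\<^sup>2)
          \<longlonglongrightarrow> (\<Sum>x\<in>S. (cmod (l2_fun (X n) x - g x))\<^sup>2)"
        by (intro tendsto_intros g)
      have "(\<Sum>x\<in>S. (cmod (l2_fun (X n) x - l2_fun (X m) x))\<^sup>2) \<le> e\<^sup>2" if "m \<ge> N" for m
      proof -
        have "(\<Sum>x\<in>S. (cmod (l2_fun (X n) x - l2_fun (X m) x))\<^sup>2) \<le> (norm (X n - X m))\<^sup>2"
          using sum_le_norm_l2[OF \<open>finite S\<close>, of "X n - X m"] by simp
        also have "\<dots> \<le> e\<^sup>2"
          using N[of n m] \<open>n \<ge> N\<close> that by (intro power_mono) (auto simp: dist_norm)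
        finally show ?thesis .
      qed
      then show "\<exists>M. \<forall>m\<ge>M. (\<Sum>x\<in>S. (cmod (l2_fun (X n) x - l2_fun (X m) x))\<^sup>2) \<le> e\<^sup>2" by blast
    qed
    then show ?thesis by blast
  qed
  have diff: "(\<lambda>x. (cmod (l2_fun (X n) x - g x))\<^sup>2) summable_on UNIV"
    if "\<forall>S. finite S \<longrightarrow> (\<Sum>x\<in>S. (cmod (l2_fun (X n) x - g x))\<^sup>2) \<le> B" for n B
    using that by (intro nonneg_bdd_above_summable_on) (auto simp: bdd_above_def)
  obtain N where N: "\<forall>n\<ge>N. \<forall>S. finite S \<longrightarrow> (\<Sum>x\<in>S. (cmod (l2_fun (X n) x - g x))\<^sup>2) \<le> 1\<^sup>2"
    using close[of 1] by auto
  have "(\<lambda>x. (cmod (l2_fun (X N) x + - (l2_fun (X N) x - g x)))\<^sup>2) summable_on UNIV"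
    using diff[of N "1\<^sup>2"] N
    by (intro square_summable_add l2_fun_summable) (simp add: norm_minus_commute)
  then have gS: "(\<lambda>x. (cmod (g x))\<^sup>2) summable_on UNIV" by simp
  then have G: "l2_fun (L2 g) = g" by (simp add: L2_inverse)
  have "X \<longlonglongrightarrow> L2 g"
  proof (rule metric_LIMSEQ_I)
    fix e :: real assume "0 < e"
    then obtain N where N: "\<forall>n\<ge>N. \<forall>S. finite S \<longrightarrow> (\<Sum>x\<in>S. (cmod (l2_fun (X n) x - g x))\<^sup>2) \<le> (e/2)\<^sup>2"
      using close[of "e/2"] by auto
    have "norm (X n - L2 g) \<le> e / 2" if "n \<ge> N" for n
      using N that \<open>0 < e\<close> by (intro norm_l2_le) (auto simp: G)
    then show "\<exists>N. \<forall>n\<ge>N. dist (X n) (L2 g) < e"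
      using \<open>0 < e\<close> by (intro exI[of _ N]) (force simp: dist_norm)
  qed
  then show "convergent X" by (auto simp: convergent_def)
qed

lemma scaleC_simps:
  "scaleC c (f + g) = scaleC c f + scaleC c g" "scaleC c (f - g) = scaleC c f - scaleC c g"
  "scaleC c (scaleC d f) = scaleC (c * d) f" "scaleC c (r *\<^sub>R f) = r *\<^sub>R scaleC c f"
  "scaleC (c + d) f = scaleC c f + scaleC d f" "scaleC 1 f = f" "scaleC 0 f = 0" "scaleC c 0 = 0"
  by (rule l2_eqI; simp add: algebra_simps)+

lemma norm_scaleC: "norm (scaleC c f) = cmod c * norm f"
proof -
  have "(norm (scaleC c f))\<^sup>2 = (cmod c * norm f)\<^sup>2"
    unfolding norm_l2_square power_mult_distrib
    by (simp add: norm_mult power_mult_distrib infsum_cmult_right')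
  then show ?thesis by simp
qed

lemma bounded_linear_scaleC: "bounded_linear (scaleC c)"
  by (rule bounded_linear_intro[of _ "cmod c"])
     (auto simp: scaleC_simps norm_scaleC mult.commute)

lemma cinner_eq_inner: "cinner f g = Complex (inner f g) (inner (scaleC \<i> f) g)"
  by (rule complex_eqI) (simp_all add: inner_l2_def cinner_scaleC_left)

lemma inner_scaleC: "inner (scaleC c f) g = inner f (scaleC (cnj c) g)"
proof -
  have "cinner f (scaleC (cnj c) g) = cinner (scaleC c f) g"
    by (subst cinner_commute) (simp add: cinner_scaleC_left flip: cinner_commute)
  then show ?thesis by (simp add: inner_l2_def)
qed

lemma inner_scaleC_ii: "inner (scaleC \<i> f) g = - inner f (scaleC \<i> g)"
proof -
  have "scaleC (- \<i>) g = - scaleC \<i> g" by (rule l2_eqI) simp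
  then show ?thesis by (simp add: inner_scaleC)
qed

section \<open>Existence of spectral resolutions\<close>

definition poly_op :: "('a::real_vector \<Rightarrow> 'a) \<Rightarrow> real poly \<Rightarrow> 'a \<Rightarrow> 'a" where
  "poly_op S p x = fold_coeffs (\<lambda>a y. a *\<^sub>R x + S y) p 0"

abbreviation XX :: "real poly" where "XX \<equiv> [:0, 1:]"

text \<open>Cauchy-Schwarz for \<open>g * h\<close> with \<open>g\<close> bounded by one: expand the
  nonnegative integral of \<open>(m * k t - c)\<^sup>2\<close>, where \<open>m\<close> is the total
  mass and \<open>c\<close> the integral to be estimated.\<close>

lemma integral_square_le:
  fixes h g :: "real \<Rightarrow> real"
  assumes "finite_measure M" and [measurable]: "h \<in> borel_measurable M" "g \<in> borel_measurable M"
    and g: "\<And>t. \<bar>g t\<bar> \<le> 1" and h: "integrable M (\<lambda>t. (h t)\<^sup>2)"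
  shows "(\<integral>t. g t * h t \<partial>M)\<^sup>2 \<le> measure M (space M) * (\<integral>t. (h t)\<^sup>2 \<partial>M)"
proof -
  interpret finite_measure M by fact
  define k where "k t = g t * h t" for t
  define m where "m = measure M (space M)"
  have [measurable]: "k \<in> borel_measurable M" unfolding k_def by measurable
  have k2: "(k t)\<^sup>2 \<le> (h t)\<^sup>2" for t
    using g[of t] by (auto simp: k_def power_mult_distrib abs_square_le_1 intro!: mult_left_le_one_le)
  have i2: "integrable M (\<lambda>t. (k t)\<^sup>2)"
    by (rule Bochner_Integration.integrable_bound[OF h]) (use k2 in auto)
  have i1: "integrable M k"
  proof (rule Bochner_Integration.integrable_bound)
    show "integrable M (\<lambda>t. 1 + (k t)\<^sup>2)" using i2 by simp
    have "\<bar>k t\<bar> \<le> 1 + (k t)\<^sup>2" for t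
      using sum_squares_bound[of 1 "\<bar>k t\<bar>"] by simp
    then show "AE t in M. norm (k t) \<le> norm (1 + (k t)\<^sup>2)" by auto
  qed simp
  define c where "c = (\<integral>t. k t \<partial>M)"
  have "0 \<le> (\<integral>t. (m * k t - c)\<^sup>2 \<partial>M)" by simp
  also have "(\<lambda>t. (m * k t - c)\<^sup>2) = (\<lambda>t. m\<^sup>2 * (k t)\<^sup>2 - 2 * m * c * k t + c\<^sup>2)"
    by (auto simp: power2_eq_square algebra_simps)
  also have "(\<integral>t. m\<^sup>2 * (k t)\<^sup>2 - 2 * m * c * k t + c\<^sup>2 \<partial>M)
      = m\<^sup>2 * (\<integral>t. (k t)\<^sup>2 \<partial>M) - 2 * m * c * c + c\<^sup>2 * m"
    using i1 i2 by (simp add: c_def m_def)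
  finally have "m * c\<^sup>2 \<le> m * (m * (\<integral>t. (k t)\<^sup>2 \<partial>M))"
    by (simp add: power2_eq_square algebra_simps)
  moreover have "m \<ge> 0" by (simp add: m_def)
  \<comment> \<open>The expanded inequality still carries a factor \<open>m\<close>; for zero mass
    it says nothing, and the integral vanishes directly.\<close>
  moreover have "c = 0" if "m = 0"
  proof -
    have "emeasure M (space M) = 0" using that by (simp add: m_def emeasure_eq_measure)
    then have "AE t in M. k t = 0" by (auto intro!: AE_I[where N = "space M"])
    then show "c = 0" unfolding c_def by (subst integral_cong_AE[where g = "\<lambda>_. 0"]) auto
  qed
  ultimately have "c\<^sup>2 \<le> m * (\<integral>t. (k t)\<^sup>2 \<partial>M)"
    by (cases "m = 0") auto
  also have "\<dots> \<le> m * (\<integral>t. (h t)\<^sup>2 \<partial>M)"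
    using \<open>m \<ge> 0\<close> k2 by (intro mult_left_mono integral_mono i2 h) auto
  finally show ?thesis by (simp add: c_def k_def m_def)
qed

text \<open>Both terms are products of \<open>m\<close> factors, so their difference is at most the
  sum of the differences of the factors. The condition \<open>2 * m < n\<close> keeps every factor
  at modulus at most one, even the negative ones with \<open>k < i\<close>.\<close>

lemma choose_ratio_power_diff:
  assumes "k \<le> n" "2 * m < n"
  shows "\<bar>real (k choose m) / real (n choose m) - (real k / real n) ^ m\<bar> \<le> real m * (real m / (real n - real m))"
proof -
  have "real (k choose m) / real (n choose m) = (\<Prod>i<m. (real k - real i) / (real n - real i))"
    by (simp add: binomial_gbinomial gbinomial_prod_rev prod_dividef atLeast0LessThan)
  moreover have "(real k / real n) ^ m = (\<Prod>i<m. real k / real n)" by simp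
  moreover have "norm ((\<Prod>i<m. (real k - real i) / (real n - real i)) - (\<Prod>i<m. real k / real n))
      \<le> (\<Sum>i<m. norm ((real k - real i) / (real n - real i) - real k / real n))"
    using assms by (intro norm_prod_diff) (auto simp: divide_simps)
  moreover have "norm ((real k - real i) / (real n - real i) - real k / real n) \<le> real m / (real n - real m)"
    if "i < m" for i
  proof -
    have n: "real n > 0" "real n - real i > 0" "real n - real m > 0" using assms that by auto
    have "(real k - real i) / (real n - real i) - real k / real n
        = - (real i / (real n - real i)) * ((real n - real k) / real n)"
      using n by (simp add: field_simps)
    also have "norm \<dots> = (real i / (real n - real i)) * ((real n - real k) / real n)"
      using n assms by (simp add: abs_mult)
    also have "\<dots> \<le> (real i / (real n - real i)) * 1"
      using n assms by (intro mult_left_mono) auto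
    also have "\<dots> \<le> real m / (real n - real m)"
      using n that by (simp, intro frac_le) auto
    finally show ?thesis .
  qed
  ultimately show ?thesis
    using sum_bounded_above[of "{..<m}" "\<lambda>i. norm ((real k - real i) / (real n - real i) - real k / real n)"
        "real m / (real n - real m)"] by simp
qed

section \<open>Bernstein polynomials of a positive contraction\<close>

definition bernstein_poly :: "nat \<Rightarrow> nat \<Rightarrow> real poly" where
  "bernstein_poly n k = smult (real (n choose k)) (XX ^ k * (1 - XX) ^ (n - k))"

text \<open>These are the factorial moments of the binomial distribution, which are exact, unlike
  those of ordinary powers: after \<open>(n choose k) * (k choose m) = (n choose m) * ((n - m)
  choose (k - m))\<close> only the binomial theorem for \<open>XX + (1 - XX)\<close>
  remains.\<close>

lemma sum_bernstein_poly_choose: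
  assumes "m \<le> n"
  shows "(\<Sum>k\<le>n. smult (real (k choose m)) (bernstein_poly n k)) = smult (real (n choose m)) (XX ^ m)"
proof -
  have "(\<Sum>k\<le>n. smult (real (k choose m)) (bernstein_poly n k))
      = (\<Sum>k=m..n. smult (real (k choose m)) (bernstein_poly n k))"
    by (intro sum.mono_neutral_right) (auto simp: not_le)
  also have "\<dots> = (\<Sum>k=m..n. smult (real (n choose m) * real ((n - m) choose (k - m)))
        (XX ^ k * (1 - XX) ^ (n - k)))"
  proof (rule sum.cong)
    fix k assume k: "k \<in> {m..n}"
    then have "real (n choose k) * real (k choose m) = real (n choose m) * real ((n - m) choose (k - m))"
      using choose_mult[of m k n] by (simp flip: of_nat_mult)
    then show "smult (real (k choose m)) (bernstein_poly n k)
        = smult (real (n choose m) * real ((n - m) choose (k - m))) (XX ^ k * (1 - XX) ^ (n - k))"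
      by (simp add: bernstein_poly_def mult.commute)
  qed simp
  also have "\<dots> = (\<Sum>i\<le>n-m. smult (real (n choose m) * real ((n - m) choose i))
        (XX ^ (i + m) * (1 - XX) ^ (n - m - i)))"
    by (rule sum.reindex_bij_witness[of _ "\<lambda>i. i + m" "\<lambda>k. k - m"]) (use assms in auto)
  also have "\<dots> = smult (real (n choose m)) (XX ^ m) *
      (\<Sum>i\<le>n-m. of_nat ((n - m) choose i) * XX ^ i * (1 - XX) ^ (n - m - i))"
    by (simp add: sum_distrib_left power_add of_nat_poly mult_ac)
  also have "(\<Sum>i\<le>n-m. of_nat ((n - m) choose i) * XX ^ i * (1 - XX) ^ (n - m - i)) = (XX + (1 - XX)) ^ (n - m)"
    by (rule binomial_ring[symmetric])
  finally show ?thesis by simp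
qed

text \<open>An operator between 0 and 1 in the order of quadratic forms. Every bounded symmetric
  operator reduces to this case by an affine change, and the unit interval is where the Bernstein
  polynomials are nonnegative.\<close>

locale positive_contraction =
  fixes S :: "'a::{real_inner,complete_space} \<Rightarrow> 'a"
  assumes bl: "bounded_linear S"
    and sym: "inner (S x) y = inner x (S y)"
    and nonneg: "0 \<le> inner x (S x)"
    and le: "inner x (S x) \<le> inner x x"
begin

lemma S_simps: "S (x + y) = S x + S y" "S (r *\<^sub>R x) = r *\<^sub>R S x" "S 0 = 0" "S (x - y) = S x - S y"
  using bl by (simp_all add: linear_simps)

abbreviation "P \<equiv> poly_op S"

lemma P_0 [simp]: "P 0 x = 0" by (simp add: poly_op_def)

lemma P_pCons [simp]: "P (pCons a p) x = a *\<^sub>R x + S (P p x)"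
  by (cases "p = 0 \<and> a = 0") (auto simp: poly_op_def S_simps)

lemma P_add: "P (p + q) x = P p x + P q x"
  by (induction p q rule: poly_induct2) (auto simp: S_simps algebra_simps)

lemma P_smult: "P (smult c p) x = c *\<^sub>R P p x"
  by (induction p) (auto simp: S_simps algebra_simps)

lemma P_diff: "P (p - q) x = P p x - P q x"
  using P_add[of "p - q" q x] by (simp add: algebra_simps)

lemma P_sum: "P (\<Sum>i\<in>I. p i) x = (\<Sum>i\<in>I. P (p i) x)"
  by (induction I rule: infinite_finite_induct) (auto simp: P_add)

lemma P_mult: "P (p * q) x = P p (P q x)"
  by (induction p) (auto simp: P_add P_smult S_simps)

lemma P_1 [simp]: "P 1 x = x"
  unfolding one_pCons by (simp add: S_simps)

lemma P_linear: "P p (x + y) = P p x + P p y" "P p (r *\<^sub>R x) = r *\<^sub>R P p x"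
  by (induction p) (auto simp: S_simps algebra_simps)

lemma P_sym: "inner (P p x) y = inner x (P p y)"
proof (induction p arbitrary: x y)
  case (pCons a p)
  have "S (P p x) = P p (S x)" for x
    using P_mult[of XX p x] P_mult[of p XX x] by (simp add: mult.commute S_simps)
  with pCons show ?case by (simp add: inner_simps sym)
qed simp

lemma P_commute:
  assumes "bounded_linear T" "\<And>x. S (T x) = T (S x)"
  shows "P p (T x) = T (P p x)"
  using assms by (induction p) (auto simp: linear_simps)

text \<open>A square \<open>q * q\<close> can be moved to the two sides of the form by symmetry, so
  the exponents drop by two until both are at most one. The mixed case rests on \<open>XX * (1 - XX)
  = XX\<^sup>2 * (1 - XX) + (1 - XX)\<^sup>2 * XX\<close>, which avoids square roots of
  operators.\<close>

lemma P_bernstein_nonneg: "0 \<le> inner x (P (XX ^ j * (1 - XX) ^ l) x)"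
proof (induction "j + l" arbitrary: j l x rule: less_induct)
  case less
  have sq: "inner x (P (q * q * r) x) = inner (P q x) (P r (P q x))" for q r and x :: 'a
  proof -
    have "P q (P r x) = P r (P q x)"
      unfolding P_mult[symmetric] by (simp only: mult.commute)
    then have "P (q * q * r) x = P q (P r (P q x))" by (simp only: P_mult)
    then show ?thesis by (simp add: P_sym)
  qed
  consider "j \<ge> 2" | "l \<ge> 2" | "j = 0 \<or> j = 1" "l = 0 \<or> l = 1" by linarith
  then show ?case
  proof cases
    case 1
    then obtain j' where j: "j = Suc (Suc j')" by (metis Suc_le_D numeral_2_eq_2 Suc_le_mono)
    have "XX ^ j * (1 - XX) ^ l = XX * XX * (XX ^ j' * (1 - XX) ^ l)" by (simp only: j power_Suc mult_ac)
    then have "inner x (P (XX ^ j * (1 - XX) ^ l) x)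
        = inner (P XX x) (P (XX ^ j' * (1 - XX) ^ l) (P XX x))" by (simp only: sq)
    then show ?thesis using less[of j' l "P XX x"] j by simp
  next
    case 2
    then obtain l' where l: "l = Suc (Suc l')" by (metis Suc_le_D numeral_2_eq_2 Suc_le_mono)
    have "XX ^ j * (1 - XX) ^ l = (1 - XX) * (1 - XX) * (XX ^ j * (1 - XX) ^ l')"
      by (simp only: l power_Suc mult_ac)
    then have "inner x (P (XX ^ j * (1 - XX) ^ l) x)
        = inner (P (1 - XX) x) (P (XX ^ j * (1 - XX) ^ l') (P (1 - XX) x))" by (simp only: sq)
    then show ?thesis using less[of j l' "P (1 - XX) x"] l by simp
  next
    case 3
    have b: "0 \<le> inner y (P XX y)" "0 \<le> inner y (P (1 - XX) y)" for y
      using nonneg le[of y] by (auto simp: S_simps P_diff inner_diff_right)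
    have "XX * (1 - XX) = XX * XX * (1 - XX) + (1 - XX) * (1 - XX) * XX"
      by (simp add: algebra_simps)
    then have "inner x (P (XX * (1 - XX)) x) = inner x (P (XX * XX * (1 - XX)) x + P ((1 - XX) * (1 - XX) * XX) x)"
      by (simp only: P_add)
    also have "\<dots> = inner (P XX x) (P (1 - XX) (P XX x)) + inner (P (1 - XX) x) (P XX (P (1 - XX) x))"
      by (simp only: inner_add_right sq)
    finally have "0 \<le> inner x (P (XX * (1 - XX)) x)" using b by simp
    with 3 b[of x] show ?thesis by (elim disjE) simp_all
  qed
qed

definition bernstein_weight :: "'a \<Rightarrow> nat \<Rightarrow> nat \<Rightarrow> real" where
  "bernstein_weight x n k = inner x (P (bernstein_poly n k) x)"

lemma bernstein_weight_nonneg: "0 \<le> bernstein_weight x n k"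
  using P_bernstein_nonneg[of x k "n - k"]
  by (simp add: bernstein_weight_def bernstein_poly_def P_smult)

lemma sum_bernstein_weight_choose:
  assumes "m \<le> n"
  shows "(\<Sum>k\<le>n. real (k choose m) / real (n choose m) * bernstein_weight x n k) = inner x (P (XX ^ m) x)"
proof -
  have "(\<Sum>k\<le>n. real (k choose m) / real (n choose m) * bernstein_weight x n k)
      = inner x (P (\<Sum>k\<le>n. smult (real (k choose m)) (bernstein_poly n k)) x) / real (n choose m)"
    by (simp add: P_sum P_smult inner_sum_right bernstein_weight_def sum_divide_distrib)
  also have "\<dots> = inner x (P (XX ^ m) x)"
    using assms by (simp add: sum_bernstein_poly_choose P_smult)
  finally show ?thesis .
qed

lemma sum_bernstein_weight: "(\<Sum>k\<le>n. bernstein_weight x n k) = inner x x"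
  using sum_bernstein_weight_choose[of 0 n x] by simp

text \<open>Discrete approximation of the spectral measure: the weight of the atom at
  \<open>k / n\<close> is the form of the corresponding Bernstein polynomial. For
  \<open>n = 0\<close> the division gives 0, so the atoms always lie in the unit interval.\<close>

definition bernstein_measure :: "'a \<Rightarrow> nat \<Rightarrow> real measure" where
  "bernstein_measure x n =
     distr (point_measure {..n} (\<lambda>k. ennreal (bernstein_weight x n k))) borel (\<lambda>k. real k / real n)"

lemma integral_bernstein_measure:
  fixes f :: "real \<Rightarrow> real"
  assumes [measurable]: "f \<in> borel_measurable borel"
  shows "(\<integral>t. f t \<partial>bernstein_measure x n) = (\<Sum>k\<le>n. bernstein_weight x n k * f (real k / real n))"
  unfolding bernstein_measure_def
  by (subst integral_distr)
     (simp_all add: lebesgue_integral_point_measure_finite bernstein_weight_nonneg)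

lemma emeasure_bernstein_measure:
  assumes "B \<in> sets borel" "{0..1} \<subseteq> B"
  shows "emeasure (bernstein_measure x n) B = ennreal (inner x x)"
proof -
  have "emeasure (bernstein_measure x n) B
      = emeasure (point_measure {..n} (\<lambda>k. ennreal (bernstein_weight x n k))) ((\<lambda>k. real k / real n) -` B \<inter> {..n})"
    unfolding bernstein_measure_def using assms(1) by (subst emeasure_distr) (simp_all add: space_point_measure)
  also have "(\<lambda>k. real k / real n) -` B \<inter> {..n} = {..n}"
    using assms(2) by (auto simp: divide_simps intro!: subsetD[OF assms(2)])
  also have "emeasure (point_measure {..n} (\<lambda>k. ennreal (bernstein_weight x n k))) {..n} = ennreal (inner x x)"
    by (simp add: emeasure_point_measure_finite bernstein_weight_nonneg sum_ennreal sum_bernstein_weight)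
  finally show ?thesis .
qed

text \<open>Replacing the power of \<open>k / n\<close> by the quotient of binomial coefficients
  makes the sum exactly the moment; the error of this replacement is of order \<open>1 / n\<close>,
  uniformly in \<open>k\<close>.\<close>

lemma bernstein_measure_moment:
  "(\<lambda>n. \<Sum>k\<le>n. bernstein_weight x n k * (real k / real n) ^ m) \<longlonglongrightarrow> inner x (P (XX ^ m) x)"
proof -
  define d where "d n = (\<Sum>k\<le>n. bernstein_weight x n k * (real k / real n) ^ m) - inner x (P (XX ^ m) x)" for n
  have "d \<longlonglongrightarrow> 0"
  proof (rule Lim_null_comparison)
    have "norm (d n) \<le> real m * (real m / (real n - real m)) * inner x x" if "2 * m < n" for n
    proof -
      have "d n = (\<Sum>k\<le>n. bernstein_weight x n k * ((real k / real n) ^ m - real (k choose m) / real (n choose m)))"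
        using that sum_bernstein_weight_choose[of m n x]
        by (simp add: d_def right_diff_distrib sum_subtractf mult.commute)
      also have "norm \<dots> \<le> (\<Sum>k\<le>n. bernstein_weight x n k * (real m * (real m / (real n - real m))))"
      proof (rule sum_norm_le)
        fix k assume "k \<in> {..n}"
        then show "norm (bernstein_weight x n k * ((real k / real n) ^ m - real (k choose m) / real (n choose m)))
            \<le> bernstein_weight x n k * (real m * (real m / (real n - real m)))"
          using choose_ratio_power_diff[of k n m] that bernstein_weight_nonneg[of x n k]
          by (simp only: real_norm_def abs_mult abs_of_nonneg abs_minus_commute atMost_iff mult_left_mono)
      qed
      also have "\<dots> = real m * (real m / (real n - real m)) * inner x x"
        unfolding sum_distrib_right[symmetric] sum_bernstein_weight by (simp add: mult_ac)
      finally show ?thesis .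
    qed
    then show "\<forall>\<^sub>F n in sequentially. norm (d n) \<le> real m * (real m / (real n - real m)) * inner x x"
      by (rule eventually_mono[OF eventually_gt_at_top[of "2 * m"]])
    show "(\<lambda>n. real m * (real m / (real n - real m)) * inner x x) \<longlonglongrightarrow> 0"
      by real_asymp
  qed
  then show ?thesis unfolding d_def by (simp add: LIM_zero_iff)
qed

end

section \<open>The Hausdorff moment problem\<close>

lemma continuous_on_real_poly: "continuous_on A (poly (p :: real poly))"
  by (intro continuous_at_imp_continuous_on ballI poly_isCont)

lemma poly_measurable [measurable]: "poly (p :: real poly) \<in> borel_measurable borel"
  by (intro borel_measurable_continuous_onI continuous_on_real_poly)

context positive_contraction begin

text \<open>The discrete measures are tight, so a subsequence converges weakly, and the moments pass
  to the limit. Unit vectors make them probability measures. Since weak convergence only tests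
  bounded continuous functions, powers are clipped to the unit interval.\<close>

lemma moment_measure_unit:
  assumes x: "inner x x = 1"
  shows "\<exists>M. sets M = sets borel \<and> finite_measure M \<and> (AE t in M. t \<in> {0..1}) \<and>
           (\<forall>m. (\<integral>t. (max 0 (min 1 t)) ^ m \<partial>M) = inner x (P (XX ^ m) x))"
proof -
  have rd: "real_distribution (bernstein_measure x n)" for n
  proof -
    have "prob_space (bernstein_measure x n)"
      by (rule prob_spaceI) (simp add: bernstein_measure_def[of x n, THEN arg_cong[where f = space]]
          emeasure_bernstein_measure x)
    then show ?thesis
      by (simp add: real_distribution_def real_distribution_axioms_def bernstein_measure_def)
  qed
  have "tight (bernstein_measure x)"
    unfolding tight_def
  proof (intro conjI allI impI rd)
    fix e :: real assume "0 < e"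
    have "measure (bernstein_measure x n) {-1<..1} = 1" for n
      unfolding measure_def by (subst emeasure_bernstein_measure) (auto simp: x)
    then show "\<exists>a b. a < b \<and> (\<forall>n. 1 - e < measure (bernstein_measure x n) {a<..b})"
      using \<open>0 < e\<close> by (intro exI[of _ "-1"] exI[of _ 1]) auto
  qed
  then obtain r M where r: "strict_mono r" "real_distribution M"
      "weak_conv_m (bernstein_measure x \<circ> id \<circ> r) M"
    using tight_imp_convergent_subsubsequence[of "bernstein_measure x" id] by (auto simp: strict_mono_id)
  interpret M: real_distribution M by fact
  have conv: "(\<lambda>n. \<Sum>k\<le>r n. bernstein_weight x (r n) k * f (real k / real (r n))) \<longlonglongrightarrow> (\<integral>t. f t \<partial>M)"
    if "continuous_on UNIV f" "\<And>t. \<bar>f t\<bar> \<le> 1" for f :: "real \<Rightarrow> real"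
  proof -
    have "(\<lambda>n. \<integral>t. f t \<partial>bernstein_measure x (r n)) \<longlonglongrightarrow> (\<integral>t. f t \<partial>M)"
      using weak_conv_imp_integral_bdd_continuous_conv[of "\<lambda>n. bernstein_measure x (r n)" M f 1]
        that r rd by (auto simp: o_def continuous_on_eq_continuous_at)
    then show ?thesis
      using that(1) by (simp add: integral_bernstein_measure borel_measurable_continuous_onI)
  qed
  have atom: "max 0 (min 1 (real k / real n)) = real k / real n" if "k \<le> n" for k n
    using that by (auto simp: divide_simps max_def min_def)
  have "(\<integral>t. (max 0 (min 1 t)) ^ m \<partial>M) = inner x (P (XX ^ m) x)" for m
  proof (rule LIMSEQ_unique)
    show "(\<lambda>n. \<Sum>k\<le>r n. bernstein_weight x (r n) k * (max 0 (min 1 (real k / real (r n)))) ^ m)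
        \<longlonglongrightarrow> (\<integral>t. (max 0 (min 1 t)) ^ m \<partial>M)"
      by (intro conv continuous_intros) (auto intro: power_le_one)
    show "(\<lambda>n. \<Sum>k\<le>r n. bernstein_weight x (r n) k * (max 0 (min 1 (real k / real (r n)))) ^ m)
        \<longlonglongrightarrow> inner x (P (XX ^ m) x)"
    proof -
      have "(\<Sum>k\<le>r n. bernstein_weight x (r n) k * (max 0 (min 1 (real k / real (r n)))) ^ m)
          = (\<Sum>k\<le>r n. bernstein_weight x (r n) k * (real k / real (r n)) ^ m)" for n
        by (intro sum.cong refl) (simp only: atom atMost_iff)
      then show ?thesis
        using LIMSEQ_subseq_LIMSEQ[OF bernstein_measure_moment r(1), of x m] by (simp only: o_def)
    qed
  qed
  moreover have "AE t in M. t \<in> {0..1}"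
  proof -
    \<comment> \<open>A bounded continuous function whose zero set is exactly the unit interval; it
      vanishes on all atoms, hence almost everywhere for the limit.\<close>
    let ?g = "\<lambda>t. min 1 \<bar>t - max 0 (min 1 t)\<bar>"
    have "(\<lambda>n. \<Sum>k\<le>r n. bernstein_weight x (r n) k * ?g (real k / real (r n))) \<longlonglongrightarrow> (\<integral>t. ?g t \<partial>M)"
      by (intro conv continuous_intros) auto
    note lim = this
    have "(\<integral>t. ?g t \<partial>M) = 0"
    proof -
      have "(\<Sum>k\<le>r n. bernstein_weight x (r n) k * ?g (real k / real (r n))) = 0" for n
        by (intro sum.neutral ballI, subst atom) auto
      with lim show ?thesis by (simp add: LIMSEQ_const_iff)
    qed
    moreover have "integrable M ?g"
      by (rule M.integrable_const_bound[of _ 1]) auto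
    ultimately have "AE t in M. ?g t = 0"
      by (subst (asm) integral_nonneg_eq_0_iff_AE) auto
    then show ?thesis
      by eventually_elim (auto simp: min_def max_def split: if_splits)
  qed
  ultimately show ?thesis
    using M.finite_measure_axioms by (intro exI[of _ M]) auto
qed

lemma poly_integrable:
  fixes M :: "real measure"
  assumes "finite_measure M" "sets M = sets borel" "AE t in M. t \<in> {0..1}"
  shows "integrable M (poly p)"
proof -
  interpret finite_measure M by fact
  have [measurable]: "poly p \<in> borel_measurable M"
    unfolding measurable_cong_sets[OF assms(2) refl] by (rule poly_measurable)
  have "compact (poly p ` {0..1})"
    by (intro compact_continuous_image continuous_on_real_poly) auto
  then obtain B where "\<forall>y\<in>poly p ` {0..1}. norm y \<le> B"
    using compact_imp_bounded bounded_iff by metis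
  with assms(3) show ?thesis
    by (intro integrable_const_bound[of _ B]) auto
qed

text \<open>Linearity extends the moments from powers to polynomials. A general vector is a multiple
  of a unit vector and its measure is scaled by the squared norm, the zero vector receiving the null
  measure.\<close>

lemma moment_measure:
  "\<exists>M. sets M = sets borel \<and> finite_measure M \<and> (AE t in M. t \<in> {0..1}) \<and>
      (\<forall>p. (\<integral>t. poly p t \<partial>M) = inner x (P p x))"
proof (cases "x = 0")
  case True
  have "P p 0 = 0" for p by (induction p) (auto simp: S_simps)
  then show ?thesis
    using True by (intro exI[of _ "null_measure borel"])
      (auto intro!: finite_measureI simp: AE_iff_null null_sets_def)
next
  case False
  define e where "e = x /\<^sub>R norm x"
  have "inner e e = 1" "x = norm x *\<^sub>R e"
    using False by (auto simp: e_def power2_norm_eq_inner[symmetric] power2_eq_square)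
  then obtain M where M: "sets M = sets borel" "finite_measure M" "AE t in M. t \<in> {0..1}"
    "\<And>m. (\<integral>t. (max 0 (min 1 t)) ^ m \<partial>M) = inner e (P (XX ^ m) e)"
    using moment_measure_unit[of e] by auto
  interpret finite_measure M by fact
  have int: "(\<integral>t. poly p t \<partial>M) = inner e (P p e)" for p
  proof -
    have mono: "(\<integral>t. t ^ i \<partial>M) = inner e (P (XX ^ i) e)" for i
    proof -
      have "(\<integral>t. t ^ i \<partial>M) = (\<integral>t. (max 0 (min 1 t)) ^ i \<partial>M)"
      proof (rule integral_cong_AE)
        show "AE t in M. t ^ i = max 0 (min 1 t) ^ i"
          using M(3) by eventually_elim (auto simp: max_def min_def)
      qed (simp_all add: measurable_cong_sets[OF M(1) refl])
      then show ?thesis using M(4) by simp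
    qed
    have "(\<integral>t. poly p t \<partial>M) = (\<integral>t. (\<Sum>i\<le>degree p. coeff p i * t ^ i) \<partial>M)"
      by (simp add: poly_altdef)
    also have "\<dots> = (\<Sum>i\<le>degree p. coeff p i * (\<integral>t. t ^ i \<partial>M))"
      using poly_integrable[OF M(2,1,3), of "XX ^ i" for i]
      by (subst Bochner_Integration.integral_sum) (auto simp: poly_power[abs_def])
    also have "\<dots> = (\<Sum>i\<le>degree p. inner e (P (smult (coeff p i) (XX ^ i)) e))"
      by (simp add: mono P_smult)
    also have "\<dots> = inner e (P (\<Sum>i\<le>degree p. smult (coeff p i) (XX ^ i)) e)"
      by (simp add: P_sum inner_sum_right)
    also have "(\<Sum>i\<le>degree p. smult (coeff p i) (XX ^ i)) = p"
      using poly_as_sum_of_monoms[of p] by (simp add: monom_altdef)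
    finally show ?thesis .
  qed
  let ?N = "density M (\<lambda>_. ennreal ((norm x)\<^sup>2))"
  have "finite_measure ?N"
    by (rule finite_measureI)
       (simp add: emeasure_density nn_integral_cmult emeasure_eq_measure ennreal_mult_eq_top_iff)
  moreover have "AE t in ?N. t \<in> {0..1}"
    using M(3) by (subst AE_density) auto
  moreover have "(\<integral>t. poly p t \<partial>?N) = inner x (P p x)" for p
  proof -
    have "(\<integral>t. poly p t \<partial>?N) = (norm x)\<^sup>2 * inner e (P p e)"
      using borel_measurable_integrable[OF poly_integrable[OF M(2,1,3), of p]]
      by (subst integral_density) (auto simp: int)
    also have "\<dots> = inner (norm x *\<^sub>R e) (P p (norm x *\<^sub>R e))"
      by (simp add: P_linear power2_eq_square)
    also have "\<dots> = inner x (P p x)"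
      using \<open>x = norm x *\<^sub>R e\<close> by simp
    finally show ?thesis .
  qed
  ultimately show ?thesis using M(1) by (intro exI[of _ ?N]) auto
qed

section \<open>Spectral projections as limits of polynomials\<close>

definition mu :: "'a \<Rightarrow> real measure" where
  "mu x = (SOME M. sets M = sets borel \<and> finite_measure M \<and> (AE t in M. t \<in> {0..1}) \<and>
      (\<forall>p. (\<integral>t. poly p t \<partial>M) = inner x (P p x)))"

lemma mu: "sets (mu x) = sets borel" "finite_measure (mu x)" "AE t in mu x. t \<in> {0..1}"
  "(\<integral>t. poly p t \<partial>mu x) = inner x (P p x)"
  using someI_ex[OF moment_measure[of x], folded mu_def] by blast+

sublocale mu: finite_measure "mu x" for x by (rule mu)

lemma space_mu [simp]: "space (mu x) = UNIV"
  using sets_eq_imp_space_eq[OF mu(1)] by simp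

lemma sets_mu [measurable_cong, simp]: "sets (mu x) = sets borel" by (rule mu)

lemma mass_mu: "measure (mu x) UNIV = (norm x)\<^sup>2"
  using mu(4)[where p = 1 and x = x] by (simp add: power2_norm_eq_inner)

lemma integrable_mu_poly: "integrable (mu x) (poly p)"
  by (rule poly_integrable[OF mu(2,1,3)])

text \<open>The isometry that sends a polynomial in \<open>S\<close> applied to \<open>x\<close> to
  the same polynomial as a square-integrable function for \<open>mu x\<close>. It turns
  approximation of indicators into convergence of vectors.\<close>

lemma norm_P: "(norm (P p x))\<^sup>2 = (\<integral>t. (poly p t)\<^sup>2 \<partial>mu x)"
proof -
  have "(norm (P p x))\<^sup>2 = inner x (P (p * p) x)"
    by (simp add: power2_norm_eq_inner P_sym P_mult)
  then show ?thesis
    using mu(4)[where p = "p * p" and x = x] by (simp add: power2_eq_square)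
qed

lemma integrable_approx [simp]:
  assumes [measurable]: "B \<in> sets borel"
  shows "integrable (mu x) (\<lambda>t. (poly p t - indicat_real B t)\<^sup>2)"
proof -
  have "integrable (mu x) (\<lambda>t. poly (p * p) t - 2 * (indicat_real B t * poly p t) + indicat_real B t)"
    using integrable_real_mult_indicator[of B "mu x" "poly p"] integrable_mu_poly
    by (intro Bochner_Integration.integrable_add Bochner_Integration.integrable_diff
        Bochner_Integration.integrable_mult_right integrable_mu_poly)
       (auto simp: mult.commute mu.emeasure_finite less_top[symmetric])
  also have "(\<lambda>t. poly (p * p) t - 2 * (indicat_real B t * poly p t) + indicat_real B t)
      = (\<lambda>t. (poly p t - indicat_real B t)\<^sup>2)"
    by (auto simp: power2_eq_square algebra_simps indicator_def)
  finally show ?thesis .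
qed

text \<open>The measures of different vectors were chosen independently, so what relates them is
  that one polynomial approximates an indicator for finitely many vectors at once. Inner regularity
  gives compact parts of \<open>B\<close> and of its complement, Urysohn a continuous function
  between them, and Weierstrass a polynomial.\<close>

lemma poly_approx_ex:
  assumes "finite T" and B [measurable]: "B \<in> sets borel" and e: "0 < (e::real)"
  shows "\<exists>p. \<forall>x\<in>T. (\<integral>t. (poly p t - indicat_real B t)\<^sup>2 \<partial>mu x) < e"
proof -
  have inner: "\<exists>K. K \<subseteq> C \<and> compact K \<and> measure (mu x) (C - K) < e / 8"
    if [measurable]: "C \<in> sets borel" for C x
  proof -
    have "emeasure (mu x) C = (SUP K \<in> {K. K \<subseteq> C \<and> compact K}. emeasure (mu x) K)"
      using inner_regular[of "mu x" C] mu.emeasure_finite[of x UNIV] by simp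
    moreover have "\<exists>K\<in>{K. K \<subseteq> C \<and> compact K}. emeasure (mu x) C < emeasure (mu x) K + ennreal (e / 8)"
    proof (rule ccontr)
      assume "\<not> ?thesis"
      then have *: "emeasure (mu x) K + ennreal (e / 8) \<le> emeasure (mu x) C" if "K \<subseteq> C" "compact K" for K
        using that by (auto simp: not_less)
      have "emeasure (mu x) K \<le> ennreal (measure (mu x) C - e / 8)" if "K \<subseteq> C" "compact K" for K
      proof -
        have "ennreal (measure (mu x) K + e / 8) \<le> ennreal (measure (mu x) C)"
          using *[OF that] e by (simp add: mu.emeasure_eq_measure)
        then have "measure (mu x) K \<le> measure (mu x) C - e / 8" by simp
        then show ?thesis by (simp add: mu.emeasure_eq_measure ennreal_leI)
      qed
      then have "emeasure (mu x) C \<le> ennreal (measure (mu x) C - e / 8)"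
        unfolding calculation by (auto intro!: SUP_least)
      moreover have "0 \<le> measure (mu x) C - e / 8"
      proof -
        have "ennreal (e / 8) \<le> ennreal (measure (mu x) C)"
          using *[of "{}"] by (simp add: mu.emeasure_eq_measure)
        then show ?thesis by simp
      qed
      ultimately show False using e by (simp add: mu.emeasure_eq_measure)
    qed
    then obtain K where K: "K \<subseteq> C" "compact K" "emeasure (mu x) C < emeasure (mu x) K + ennreal (e / 8)"
      by auto
    then have "measure (mu x) C < measure (mu x) K + e / 8"
      using e by (simp add: mu.emeasure_eq_measure ennreal_less_iff flip: ennreal_plus)
    moreover have "measure (mu x) (C - K) = measure (mu x) C - measure (mu x) K"
      using K by (intro mu.finite_measure_Diff) (auto intro: borel_compact)
    ultimately show ?thesis using K by auto
  qed
  obtain K where K: "\<And>x. K x \<subseteq> B" "\<And>x. compact (K x)" "\<And>x. measure (mu x) (B - K x) < e / 8"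
    using inner[of B] by (metis B)
  obtain L where L: "\<And>x. L x \<subseteq> - B" "\<And>x. compact (L x)" "\<And>x. measure (mu x) (- B - L x) < e / 8"
    using inner[of "- B"] by (metis B borel_comp)
  have cl: "closed (\<Union>x\<in>T. K x)" "closed (\<Union>x\<in>T. L x)"
    using assms(1) K(2) L(2) by (auto intro!: closed_UN compact_imp_closed)
  have disj: "(\<Union>x\<in>T. L x) \<inter> (\<Union>x\<in>T. K x) = {}" using K(1) L(1) by blast
  obtain f :: "real \<Rightarrow> real" where f: "continuous_on UNIV f" "\<And>t. f t \<in> closed_segment 0 1"
      "\<And>t. t \<in> (\<Union>x\<in>T. L x) \<Longrightarrow> f t = 0" "\<And>t. t \<in> (\<Union>x\<in>T. K x) \<Longrightarrow> f t = 1"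
    using Urysohn[OF cl(2,1) disj, of 0 1] by metis
  have f01: "0 \<le> f t" "f t \<le> 1" for t using f(2)[of t] by (auto simp: closed_segment_eq_real_ivl)
  \<comment> \<open>\<open>m\<close> dominates every squared norm over \<open>T\<close> and stays
    positive for empty \<open>T\<close>. The uniform error \<open>d\<close> then costs at most
    \<open>2 * d\<^sup>2 * m = e / 2\<close>, and the two uncovered sets of mass below
    \<open>e / 8\<close> cost less than the other \<open>e / 2\<close>.\<close>
  define m where "m = 1 + (\<Sum>x\<in>T. (norm x)\<^sup>2)"
  have m: "m \<ge> 1" by (simp add: m_def sum_nonneg)
  define d where "d = sqrt (e / (4 * m))"
  have d: "d > 0" "d\<^sup>2 = e / (4 * m)" using e m by (auto simp: d_def)
  have f_meas [measurable]: "f \<in> borel_measurable borel" by (rule borel_measurable_continuous_onI[OF f(1)])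
  obtain g where g: "real_polynomial_function g" "\<And>t. t \<in> {0..1} \<Longrightarrow> \<bar>f t - g t\<bar> < d"
    using Stone_Weierstrass_real_polynomial_function[of "{0..1::real}" f d] d f(1)
    by (auto intro: continuous_on_subset)
  obtain a n where an: "g = (\<lambda>t. \<Sum>i\<le>n. a i * t ^ i)"
    using g(1) by (auto simp: real_polynomial_function_iff_sum)
  define p where "p = (\<Sum>i\<le>n. monom (a i) i)"
  have p: "poly p t = g t" for t by (simp add: p_def poly_sum poly_monom an)
  have "(\<integral>t. (poly p t - indicat_real B t)\<^sup>2 \<partial>mu x) < e" if x: "x \<in> T" for x
  proof -
    let ?D = "(B - K x) \<union> (- B - L x)"
    have [measurable]: "K x \<in> sets borel" "L x \<in> sets borel" using K(2) L(2) by (auto intro: borel_compact)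
    have [measurable]: "?D \<in> sets borel" by measurable
    have "(\<integral>t. (poly p t - indicat_real B t)\<^sup>2 \<partial>mu x) \<le> (\<integral>t. 2 * d\<^sup>2 + 2 * indicat_real ?D t \<partial>mu x)"
    proof (rule integral_mono_AE)
      show "AE t in mu x. (poly p t - indicat_real B t)\<^sup>2 \<le> 2 * d\<^sup>2 + 2 * indicat_real ?D t"
        using mu(3)[of x]
      proof eventually_elim
        fix t :: real assume t: "t \<in> {0..1}"
        have "(poly p t - indicat_real B t)\<^sup>2
            \<le> 2 * (poly p t - f t)\<^sup>2 + 2 * (f t - indicat_real B t)\<^sup>2"
          using zero_le_power2[of "(poly p t - f t) - (f t - indicat_real B t)"]
          by (simp add: power2_eq_square algebra_simps)
        also have "(poly p t - f t)\<^sup>2 \<le> d\<^sup>2"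
          using g(2)[OF t] d(1) by (subst abs_le_square_iff[symmetric]) (auto simp: p)
        also have "(f t - indicat_real B t)\<^sup>2 \<le> indicat_real ?D t"
        proof (cases "t \<in> ?D")
          case True
          have "\<bar>f t - indicat_real B t\<bar> \<le> 1" using f01[of t] by (auto simp: indicator_def)
          with True show ?thesis by (simp add: abs_square_le_1)
        next
          case False
          then show ?thesis using f(3,4)[of t] x by (cases "t \<in> B") auto
        qed
        finally show "(poly p t - indicat_real B t)\<^sup>2 \<le> 2 * d\<^sup>2 + 2 * indicat_real ?D t" by simp
      qed
      show "integrable (mu x) (\<lambda>t. 2 * d\<^sup>2 + 2 * indicat_real ?D t)"
        by (auto simp: mu.emeasure_finite less_top[symmetric])
    qed simp
    also have "\<dots> = 2 * d\<^sup>2 * (norm x)\<^sup>2 + 2 * measure (mu x) ?D"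
      by (subst Bochner_Integration.integral_add)
         (auto simp: mu.emeasure_finite less_top[symmetric] mass_mu)
    also have "measure (mu x) ?D \<le> measure (mu x) (B - K x) + measure (mu x) (- B - L x)"
      using K(2) L(2) by (intro measure_Un_le) (auto intro!: borel_compact)
    also have "\<dots> < e / 8 + e / 8" using K(3)[of x] L(3)[of x] by simp
    also have "2 * d\<^sup>2 * (norm x)\<^sup>2 \<le> 2 * d\<^sup>2 * m"
      using member_le_sum[of x T "\<lambda>x. (norm x)\<^sup>2"] x assms(1)
      by (intro mult_left_mono) (auto simp: m_def)
    also have "2 * d\<^sup>2 * m = e / 2" using m by (simp add: d(2))
    finally show ?thesis by simp
  qed
  then show ?thesis by blast
qed

definition approximates :: "(nat \<Rightarrow> real poly) \<Rightarrow> real set \<Rightarrow> 'a \<Rightarrow> bool" where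
  "approximates p B x \<longleftrightarrow> (\<lambda>n. \<integral>t. (poly (p n) t - indicat_real B t)\<^sup>2 \<partial>mu x) \<longlonglongrightarrow> 0"

text \<open>The indicator of \<open>B\<close> as a function of \<open>S\<close>, applied to
  \<open>x\<close> and obtained as a limit along one chosen approximating sequence. Any other
  sequence gives the same limit, which is what all properties of \<open>E\<close> rest on.\<close>

definition E :: "real set \<Rightarrow> 'a \<Rightarrow> 'a" where
  "E B x = lim (\<lambda>n. P ((SOME p. approximates p B x) n) x)"

lemma approximates_ex:
  assumes "finite T" "B \<in> sets borel"
  shows "\<exists>p. \<forall>x\<in>T. approximates p B x"
proof -
  have "\<exists>p. \<forall>x\<in>T. (\<integral>t. (poly p t - indicat_real B t)\<^sup>2 \<partial>mu x) < 1 / real (Suc n)" for n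
    using poly_approx_ex[OF assms, of "1 / real (Suc n)"] by simp
  then obtain p where p: "\<And>n x. x \<in> T \<Longrightarrow> (\<integral>t. (poly (p n) t - indicat_real B t)\<^sup>2 \<partial>mu x) < 1 / real (Suc n)"
    by metis
  have "approximates p B x" if "x \<in> T" for x
    unfolding approximates_def
  proof (rule Lim_null_comparison)
    show "\<forall>\<^sub>F n in sequentially. norm (\<integral>t. (poly (p n) t - indicat_real B t)\<^sup>2 \<partial>mu x) \<le> 1 / real (Suc n)"
      using p[OF that] by (intro always_eventually) (auto intro: less_imp_le)
    show "(\<lambda>n. 1 / real (Suc n)) \<longlonglongrightarrow> 0"
      using LIMSEQ_inverse_real_of_nat by (simp add: inverse_eq_divide)
  qed
  then show ?thesis by blast
qed

lemma norm_P_diff: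
  assumes [measurable]: "B \<in> sets borel"
  shows "(norm (P p x - P q x))\<^sup>2 \<le> 2 * (\<integral>t. (poly p t - indicat_real B t)\<^sup>2 \<partial>mu x)
      + 2 * (\<integral>t. (poly q t - indicat_real B t)\<^sup>2 \<partial>mu x)"
proof -
  have "(norm (P p x - P q x))\<^sup>2 = (\<integral>t. (poly (p - q) t)\<^sup>2 \<partial>mu x)"
    by (simp only: norm_P flip: P_diff)
  also have "\<dots> \<le> (\<integral>t. 2 * (poly p t - indicat_real B t)\<^sup>2 + 2 * (poly q t - indicat_real B t)\<^sup>2 \<partial>mu x)"
  proof (rule integral_mono)
    show "integrable (mu x) (\<lambda>t. (poly (p - q) t)\<^sup>2)"
    proof -
      have "(\<lambda>t. (poly (p - q) t)\<^sup>2) = poly ((p - q) * (p - q))"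
        by (simp only: power2_eq_square poly_mult fun_eq_iff simp_thms)
      then show ?thesis by (simp only: integrable_mu_poly)
    qed
    fix t
    show "(poly (p - q) t)\<^sup>2 \<le> 2 * (poly p t - indicat_real B t)\<^sup>2 + 2 * (poly q t - indicat_real B t)\<^sup>2"
      using zero_le_power2[of "(poly p t - indicat_real B t) + (poly q t - indicat_real B t)"]
      by (simp add: power2_eq_square algebra_simps)
  qed (simp add: assms)
  also have "\<dots> = 2 * (\<integral>t. (poly p t - indicat_real B t)\<^sup>2 \<partial>mu x)
      + 2 * (\<integral>t. (poly q t - indicat_real B t)\<^sup>2 \<partial>mu x)"
    by (simp add: assms)
  finally show ?thesis .
qed

lemma approximates_imp_Cauchy:
  assumes B: "B \<in> sets borel" and p: "approximates p B x"
  shows "Cauchy (\<lambda>n. P (p n) x)"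
proof (rule metric_CauchyI)
  fix e :: real assume "0 < e"
  then have "0 < e\<^sup>2 / 4" by simp
  from order_tendstoD(2)[OF p[unfolded approximates_def] this]
  obtain N where N: "\<And>n. n \<ge> N \<Longrightarrow> (\<integral>t. (poly (p n) t - indicat_real B t)\<^sup>2 \<partial>mu x) < e\<^sup>2 / 4"
    by (auto simp: eventually_at_top_linorder)
  have "dist (P (p m) x) (P (p n) x) < e" if "m \<ge> N" "n \<ge> N" for m n
  proof -
    have "(norm (P (p m) x - P (p n) x))\<^sup>2 < e\<^sup>2"
      using norm_P_diff[OF B, of "p m" x "p n"] N[OF that(1)] N[OF that(2)] by simp
    then show ?thesis
      using \<open>0 < e\<close> by (simp add: dist_norm power2_less_imp_less)
  qed
  then show "\<exists>M. \<forall>m\<ge>M. \<forall>n\<ge>M. dist (P (p m) x) (P (p n) x) < e" by blast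
qed

lemma E_lim:
  assumes B: "B \<in> sets borel" and p: "approximates p B x"
  shows "(\<lambda>n. P (p n) x) \<longlonglongrightarrow> E B x"
proof -
  define q where "q = (SOME p. approximates p B x)"
  have q: "approximates q B x" unfolding q_def by (rule someI[of _ p]) (rule p)
  have "convergent (\<lambda>n. P (q n) x)"
    using approximates_imp_Cauchy[OF B q] by (simp add: Cauchy_convergent_iff)
  then have lim: "(\<lambda>n. P (q n) x) \<longlonglongrightarrow> E B x"
    unfolding E_def q_def[symmetric] by (simp add: convergent_LIMSEQ_iff)
  have "(\<lambda>n. (norm (P (p n) x - P (q n) x))\<^sup>2) \<longlonglongrightarrow> 0"
  proof (rule Lim_null_comparison)
    show "\<forall>\<^sub>F n in sequentially. norm ((norm (P (p n) x - P (q n) x))\<^sup>2)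
        \<le> 2 * (\<integral>t. (poly (p n) t - indicat_real B t)\<^sup>2 \<partial>mu x)
          + 2 * (\<integral>t. (poly (q n) t - indicat_real B t)\<^sup>2 \<partial>mu x)"
      using norm_P_diff[OF B] by (intro always_eventually) simp
    show "(\<lambda>n. 2 * (\<integral>t. (poly (p n) t - indicat_real B t)\<^sup>2 \<partial>mu x)
          + 2 * (\<integral>t. (poly (q n) t - indicat_real B t)\<^sup>2 \<partial>mu x)) \<longlonglongrightarrow> 0"
      using tendsto_add[OF tendsto_mult_left[OF p[unfolded approximates_def], of 2]
          tendsto_mult_left[OF q[unfolded approximates_def], of 2]] by simp
  qed
  then have "(\<lambda>n. norm (P (p n) x - P (q n) x)) \<longlonglongrightarrow> 0"
    using tendsto_real_sqrt[of "\<lambda>n. (norm (P (p n) x - P (q n) x))\<^sup>2" 0 sequentially] by simp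
  then have "(\<lambda>n. P (p n) x - P (q n) x) \<longlonglongrightarrow> 0" by (rule tendsto_norm_zero_cancel)
  from tendsto_add[OF this lim] show ?thesis by simp
qed

text \<open>A single polynomial sequence approximates at \<open>x\<close>, \<open>y\<close> and
  their combination, and each polynomial in \<open>S\<close> is linear. Symmetry and commutation are
  obtained in the same way.\<close>

lemma E_linear:
  assumes "B \<in> sets borel"
  shows "E B (c *\<^sub>R x + y) = c *\<^sub>R E B x + E B y"
proof -
  obtain p where p: "\<forall>z\<in>{x, y, c *\<^sub>R x + y}. approximates p B z"
    using approximates_ex[OF _ assms, of "{x, y, c *\<^sub>R x + y}"] by auto
  have "(\<lambda>n. P (p n) (c *\<^sub>R x + y)) \<longlonglongrightarrow> E B (c *\<^sub>R x + y)"
    using p by (intro E_lim assms) auto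
  moreover have "(\<lambda>n. P (p n) (c *\<^sub>R x + y)) \<longlonglongrightarrow> c *\<^sub>R E B x + E B y"
    using p unfolding P_linear by (intro tendsto_intros E_lim assms) auto
  ultimately show ?thesis by (rule LIMSEQ_unique)
qed

lemma E_sym:
  assumes "B \<in> sets borel"
  shows "inner (E B x) y = inner x (E B y)"
proof -
  obtain p where p: "\<forall>z\<in>{x, y}. approximates p B z"
    using approximates_ex[OF _ assms, of "{x, y}"] by auto
  have "(\<lambda>n. inner (P (p n) x) y) \<longlonglongrightarrow> inner (E B x) y"
    using p by (intro tendsto_intros E_lim assms) auto
  moreover have "(\<lambda>n. inner (P (p n) x) y) \<longlonglongrightarrow> inner x (E B y)"
    using p unfolding P_sym by (intro tendsto_intros E_lim assms) auto
  ultimately show ?thesis by (rule LIMSEQ_unique)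
qed

lemma E_commute:
  assumes "B \<in> sets borel" "bounded_linear T" "\<And>x. S (T x) = T (S x)"
  shows "E B (T x) = T (E B x)"
proof -
  obtain p where p: "\<forall>z\<in>{x, T x}. approximates p B z"
    using approximates_ex[OF _ assms(1), of "{x, T x}"] by auto
  have "(\<lambda>n. P (p n) (T x)) \<longlonglongrightarrow> E B (T x)"
    using p by (intro E_lim assms) auto
  moreover have "(\<lambda>n. P (p n) (T x)) \<longlonglongrightarrow> T (E B x)"
    using p unfolding P_commute[OF assms(2,3)]
    by (intro bounded_linear.tendsto[OF assms(2)] E_lim assms) auto
  ultimately show ?thesis by (rule LIMSEQ_unique)
qed

lemma E_closed_subspace:
  assumes "B \<in> sets borel" "subspace K" "closed K" "\<And>x. x \<in> K \<Longrightarrow> S x \<in> K" "x \<in> K"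
  shows "E B x \<in> K"
proof -
  have "P p x \<in> K" for p
    using assms by (induction p) (auto intro!: subspace_add subspace_scale simp: subspace_0)
  moreover obtain p where "approximates p B x"
    using approximates_ex[OF _ assms(1), of "{x}"] by auto
  ultimately show ?thesis
    using closed_sequentially[OF assms(3), of "\<lambda>n. P (_ n) x"] E_lim[OF assms(1)] by blast
qed

lemma approx_integral_tendsto:
  assumes B [measurable]: "B \<in> sets borel" and p: "approximates p B x"
    and [measurable]: "g \<in> borel_measurable borel" and g: "\<And>t. \<bar>g t\<bar> \<le> 1"
  shows "(\<lambda>n. \<integral>t. g t * (poly (p n) t - indicat_real B t) \<partial>mu x) \<longlonglongrightarrow> 0"
proof -
  have "(\<lambda>n. (\<integral>t. g t * (poly (p n) t - indicat_real B t) \<partial>mu x)\<^sup>2) \<longlonglongrightarrow> 0"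
  proof (rule Lim_null_comparison)
    have "norm ((\<integral>t. g t * (poly (p n) t - indicat_real B t) \<partial>mu x)\<^sup>2)
        \<le> (norm x)\<^sup>2 * (\<integral>t. (poly (p n) t - indicat_real B t)\<^sup>2 \<partial>mu x)" for n
      using integral_square_le[OF mu(2)[of x], of "\<lambda>t. poly (p n) t - indicat_real B t" g] g
      by (simp add: mass_mu)
    then show "\<forall>\<^sub>F n in sequentially. norm ((\<integral>t. g t * (poly (p n) t - indicat_real B t) \<partial>mu x)\<^sup>2)
        \<le> (norm x)\<^sup>2 * (\<integral>t. (poly (p n) t - indicat_real B t)\<^sup>2 \<partial>mu x)" by simp
    show "(\<lambda>n. (norm x)\<^sup>2 * (\<integral>t. (poly (p n) t - indicat_real B t)\<^sup>2 \<partial>mu x)) \<longlonglongrightarrow> 0"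
      using tendsto_mult_left[OF p[unfolded approximates_def], of "(norm x)\<^sup>2"] by simp
  qed
  then show ?thesis
    using tendsto_real_sqrt[of "\<lambda>n. (\<integral>t. g t * (poly (p n) t - indicat_real B t) \<partial>mu x)\<^sup>2" 0 sequentially]
    by (simp add: tendsto_rabs_zero_iff)
qed

lemma integrable_indicator_mult:
  "B \<in> sets borel \<Longrightarrow> integrable (mu x) (\<lambda>t. indicat_real B t * poly p t)"
  using integrable_real_mult_indicator[of B "mu x" "poly p"] integrable_mu_poly by (simp add: mult.commute)

lemma integrable_indicator_mu [simp]: "B \<in> sets borel \<Longrightarrow> integrable (mu x) (indicat_real B)"
  by (simp add: mu.emeasure_finite less_top[symmetric])

lemma inner_E:
  assumes [measurable]: "B \<in> sets borel"
  shows "inner x (E B x) = measure (mu x) B"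
proof -
  obtain p where p: "approximates p B x"
    using approximates_ex[OF _ assms, of "{x}"] by auto
  have "(\<lambda>n. inner x (P (p n) x)) \<longlonglongrightarrow> inner x (E B x)"
    by (intro tendsto_intros E_lim assms p)
  moreover have "inner x (P (p n) x)
      = (\<integral>t. 1 * (poly (p n) t - indicat_real B t) \<partial>mu x) + measure (mu x) B" for n
    using integrable_mu_poly[of x "p n"] by (simp add: mu(4))
  then have "(\<lambda>n. inner x (P (p n) x)) \<longlonglongrightarrow> 0 + measure (mu x) B"
    using tendsto_add[OF approx_integral_tendsto[OF assms p, of "\<lambda>_. 1"] tendsto_const] by simp
  ultimately show ?thesis using LIMSEQ_unique by fastforce
qed

text \<open>With \<open>i\<close> the indicator and \<open>i\<^sup>2 = i\<close>, write
  \<open>p\<^sup>2 = (p - i)\<^sup>2 + 2 * i * (p - i) + i\<close>; the integrals of the first two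
  terms tend to zero.\<close>

lemma norm_E:
  assumes [measurable]: "B \<in> sets borel"
  shows "(norm (E B x))\<^sup>2 = measure (mu x) B"
proof -
  obtain p where p: "approximates p B x"
    using approximates_ex[OF _ assms, of "{x}"] by auto
  have "(\<lambda>n. (norm (P (p n) x))\<^sup>2) \<longlonglongrightarrow> (norm (E B x))\<^sup>2"
    by (intro tendsto_intros E_lim assms p)
  moreover have "(norm (P (p n) x))\<^sup>2 = (\<integral>t. (poly (p n) t - indicat_real B t)\<^sup>2 \<partial>mu x)
      + (2 * (\<integral>t. indicat_real B t * (poly (p n) t - indicat_real B t) \<partial>mu x) + measure (mu x) B)" for n
  proof -
    have i: "integrable (mu x) (\<lambda>t. indicat_real B t * (poly (p n) t - indicat_real B t))"
      using integrable_indicator_mult[OF assms, of x "p n"] assms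
      by (simp add: right_diff_distrib indicator_inter_arith[symmetric])
    have "(norm (P (p n) x))\<^sup>2 = (\<integral>t. (poly (p n) t - indicat_real B t)\<^sup>2
        + (2 * (indicat_real B t * (poly (p n) t - indicat_real B t)) + indicat_real B t) \<partial>mu x)"
      unfolding norm_P by (intro Bochner_Integration.integral_cong refl)
        (auto simp: indicator_def power2_eq_square algebra_simps)
    then show ?thesis
      using i assms by (simp add: Bochner_Integration.integral_add)
  qed
  then have "(\<lambda>n. (norm (P (p n) x))\<^sup>2) \<longlonglongrightarrow> 0 + (2 * 0 + measure (mu x) B)"
    using approx_integral_tendsto[OF assms p, of "indicat_real B"] p[unfolded approximates_def]
    by (simp only:) (intro tendsto_intros, auto simp: indicator_def)
  ultimately show ?thesis using LIMSEQ_unique by fastforce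
qed

text \<open>The squared norm of \<open>E B z\<close> equals its form, both being the measure of
  \<open>B\<close>; polarizing this identity of quadratic forms gives idempotence without any
  product of two limits.\<close>

lemma E_idem:
  assumes [measurable]: "B \<in> sets borel"
  shows "E B (E B x) = E B x"
proof -
  have form: "inner (E B z) z = inner (E B z) (E B z)" for z
    using inner_E[OF assms, of z] norm_E[OF assms, of z]
    by (simp add: power2_norm_eq_inner inner_commute)
  have plus: "E B (x + y) = E B x + E B y" for x y
    using E_linear[OF assms, of 1 x y] by simp
  have "inner (E B x) y = inner (E B x) (E B y)" for y
    using form[of x] form[of y] form[of "x + y"] E_sym[OF assms, of x y]
    by (simp add: plus inner_simps inner_commute)
  then have "inner (E B x - E B (E B x)) y = 0" for y
    using E_sym[OF assms, of "E B x" y] by (simp add: inner_diff_left)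
  from this[of "E B x - E B (E B x)"] show ?thesis by simp
qed

lemma E_UNIV: "E UNIV x = x"
  using E_lim[of UNIV "\<lambda>_. 1" x] by (simp add: approximates_def LIMSEQ_const_iff)

lemma E_disjoint:
  assumes [measurable]: "B \<in> sets borel" "C \<in> sets borel" and disj: "B \<inter> C = {}"
  shows "E (B \<union> C) x = E B x + E C x"
proof -
  obtain p where p: "approximates p B x"
    using approximates_ex[OF _ assms(1), of "{x}"] by auto
  obtain q where q: "approximates q C x"
    using approximates_ex[OF _ assms(2), of "{x}"] by auto
  have BC [measurable]: "B \<union> C \<in> sets borel" by measurable
  have "approximates (\<lambda>n. p n + q n) (B \<union> C) x"
    unfolding approximates_def
  proof (rule Lim_null_comparison)
    let ?r = "\<lambda>n. 2 * (\<integral>t. (poly (p n) t - indicat_real B t)\<^sup>2 \<partial>mu x)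
          + 2 * (\<integral>t. (poly (q n) t - indicat_real C t)\<^sup>2 \<partial>mu x)"
    have "(\<integral>t. (poly (p n + q n) t - indicat_real (B \<union> C) t)\<^sup>2 \<partial>mu x) \<le> ?r n" for n
    proof -
      have "(\<integral>t. (poly (p n + q n) t - indicat_real (B \<union> C) t)\<^sup>2 \<partial>mu x)
          \<le> (\<integral>t. 2 * (poly (p n) t - indicat_real B t)\<^sup>2 + 2 * (poly (q n) t - indicat_real C t)\<^sup>2 \<partial>mu x)"
      proof (rule integral_mono)
        fix t
        have "indicat_real (B \<union> C) t = indicat_real B t + indicat_real C t"
          using disj by (auto simp: indicator_def)
        then show "(poly (p n + q n) t - indicat_real (B \<union> C) t)\<^sup>2
            \<le> 2 * (poly (p n) t - indicat_real B t)\<^sup>2 + 2 * (poly (q n) t - indicat_real C t)\<^sup>2"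
          using zero_le_power2[of "(poly (p n) t - indicat_real B t) - (poly (q n) t - indicat_real C t)"]
          by (simp add: power2_eq_square algebra_simps)
      qed (simp_all add: assms BC del: poly_add)
      then show ?thesis by (simp add: assms)
    qed
    then show "\<forall>\<^sub>F n in sequentially.
        norm (\<integral>t. (poly (p n + q n) t - indicat_real (B \<union> C) t)\<^sup>2 \<partial>mu x) \<le> ?r n"
      by (simp del: poly_add)
    show "?r \<longlonglongrightarrow> 0"
      using tendsto_add[OF tendsto_mult_left[OF p[unfolded approximates_def], of 2]
          tendsto_mult_left[OF q[unfolded approximates_def], of 2]] by simp
  qed
  from E_lim[OF BC this] have "(\<lambda>n. P (p n) x + P (q n) x) \<longlonglongrightarrow> E (B \<union> C) x"
    by (simp add: P_add)
  moreover have "(\<lambda>n. P (p n) x + P (q n) x) \<longlonglongrightarrow> E B x + E C x"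
    by (intro tendsto_intros E_lim assms p q)
  ultimately show ?thesis by (rule LIMSEQ_unique)
qed

lemma E_empty: "E {} x = 0"
  using norm_E[of "{}" x] by simp

lemma E_sum:
  fixes B :: "nat \<Rightarrow> real set"
  assumes "range B \<subseteq> sets borel" "disjoint_family B"
  shows "(\<Sum>n<N. E (B n) x) = E (\<Union>n<N. B n) x"
proof (induction N)
  case (Suc N)
  have "(\<Union>n<Suc N. B n) = (\<Union>n<N. B n) \<union> B N" by (auto simp: less_Suc_eq)
  moreover have "(\<Union>n<N. B n) \<inter> B N = {}"
  proof -
    have "B n \<inter> B N = {}" if "n < N" for n
      using assms(2) that by (simp add: disjoint_family_on_def)
    then show ?thesis by blast
  qed
  moreover have "(\<Union>n<N. B n) \<in> sets borel" "B N \<in> sets borel" using assms(1) by auto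
  ultimately show ?case
    using Suc E_disjoint[of "\<Union>n<N. B n" "B N" x] by simp
qed (simp add: E_empty)

text \<open>Up to sign, the difference from the full union is the projection for the tail, whose
  squared norm is the measure of the tail; continuity of the finite measure finishes.\<close>

lemma E_countably_additive:
  assumes "range B \<subseteq> sets borel" "disjoint_family B"
  shows "(\<lambda>N. norm ((\<Sum>n<N. E (B n) x) - E (\<Union>n. B n) x)) \<longlonglongrightarrow> 0"
proof -
  have [measurable]: "B n \<in> sets borel" for n using assms by auto
  have U [measurable]: "(\<Union>n<N. B n) \<in> sets borel" "(\<Union>n. B n) \<in> sets borel" for N by measurable
  have eq: "(norm ((\<Sum>n<N. E (B n) x) - E (\<Union>n. B n) x))\<^sup>2
      = measure (mu x) (\<Union>n. B n) - measure (mu x) (\<Union>n<N. B n)" for N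
  proof -
    have "E ((\<Union>n<N. B n) \<union> ((\<Union>n. B n) - (\<Union>n<N. B n))) x
        = E (\<Union>n<N. B n) x + E ((\<Union>n. B n) - (\<Union>n<N. B n)) x"
      by (rule E_disjoint) auto
    moreover have "(\<Union>n<N. B n) \<union> ((\<Union>n. B n) - (\<Union>n<N. B n)) = (\<Union>n. B n)" by auto
    ultimately have "(\<Sum>n<N. E (B n) x) - E (\<Union>n. B n) x = - E ((\<Union>n. B n) - (\<Union>n<N. B n)) x"
      by (simp add: E_sum[OF assms])
    then have "(norm ((\<Sum>n<N. E (B n) x) - E (\<Union>n. B n) x))\<^sup>2 = measure (mu x) ((\<Union>n. B n) - (\<Union>n<N. B n))"
      by (simp add: norm_E sets.Diff)
    also have "\<dots> = measure (mu x) (\<Union>n. B n) - measure (mu x) (\<Union>n<N. B n)"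
      by (rule mu.finite_measure_Diff) auto
    finally show ?thesis .
  qed
  have "(\<lambda>N. measure (mu x) (\<Union>n<N. B n)) \<longlonglongrightarrow> measure (mu x) (\<Union>N. \<Union>n<N. B n)"
    by (rule mu.finite_Lim_measure_incseq) (force simp: incseq_def)+
  moreover have "(\<Union>N. \<Union>n<N. B n) = (\<Union>n. B n)" by auto
  ultimately have "(\<lambda>N. (norm ((\<Sum>n<N. E (B n) x) - E (\<Union>n. B n) x))\<^sup>2) \<longlonglongrightarrow> 0"
    unfolding eq using tendsto_diff[OF tendsto_const, of "\<lambda>N. measure (mu x) (\<Union>n<N. B n)"
        "measure (mu x) (\<Union>n. B n)" sequentially "measure (mu x) (\<Union>n. B n)"] by simp
  then show ?thesis
    using tendsto_real_sqrt[of "\<lambda>N. (norm ((\<Sum>n<N. E (B n) x) - E (\<Union>n. B n) x))\<^sup>2" 0 sequentially] by simp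
qed

lemma inner_S: "inner x (S x) = (\<integral>t. t \<partial>mu x)"
  using mu(4)[where p = XX and x = x] by (simp add: S_simps)

end

text \<open>The affine map \<open>h\<close> carries the unit interval to \<open>[-R, R]\<close>, so
  the resolution of \<open>A\<close> is that of \<open>S\<close> pulled back along \<open>h\<close>.
  Commutation with bounded operators is recorded because it later upgrades real linearity to complex
  linearity; invariance of closed subspaces later restricts the projections to functions on a given
  index set.\<close>

theorem bounded_spectral_resolution:
  fixes A :: "'a::{real_inner,complete_space} \<Rightarrow> 'a"
  assumes A: "bounded_linear A" and sym: "\<And>x y. inner (A x) y = inner x (A y)"
  obtains F :: "real set \<Rightarrow> 'a \<Rightarrow> 'a" and \<mu> :: "'a \<Rightarrow> real measure" and R :: real
  where "\<And>x. sets (\<mu> x) = sets borel" "\<And>x. finite_measure (\<mu> x)" "\<And>x. AE t in \<mu> x. \<bar>t\<bar> \<le> R"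
    and "\<And>x B. B \<in> sets borel \<Longrightarrow> inner x (F B x) = measure (\<mu> x) B"
    and "\<And>x. inner x (A x) = (\<integral>t. t \<partial>\<mu> x)"
    and "\<And>B c x y. B \<in> sets borel \<Longrightarrow> F B (c *\<^sub>R x + y) = c *\<^sub>R F B x + F B y"
    and "\<And>B x. B \<in> sets borel \<Longrightarrow> F B (F B x) = F B x"
    and "\<And>B x y. B \<in> sets borel \<Longrightarrow> inner (F B x) y = inner x (F B y)"
    and "\<And>x. F UNIV x = x"
    and "\<And>B x. range B \<subseteq> sets borel \<Longrightarrow> disjoint_family B \<Longrightarrow>
          (\<lambda>N. norm ((\<Sum>n<N. F (B n) x) - F (\<Union>n. B n) x)) \<longlonglongrightarrow> 0"
    and "\<And>B T x. B \<in> sets borel \<Longrightarrow> bounded_linear T \<Longrightarrow> \<forall>x. A (T x) = T (A x) \<Longrightarrow> F B (T x) = T (F B x)"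
    and "\<And>B K x. B \<in> sets borel \<Longrightarrow> subspace K \<Longrightarrow> closed K \<Longrightarrow> \<forall>x\<in>K. A x \<in> K \<Longrightarrow> x \<in> K
          \<Longrightarrow> F B x \<in> K"
proof -
  interpret A: bounded_linear A by fact
  obtain R where R: "0 < R" "\<And>x. norm (A x) \<le> norm x * R" using A.pos_bounded by auto
  have AR: "\<bar>inner x (A x)\<bar> \<le> R * inner x x" for x
  proof -
    have "\<bar>inner x (A x)\<bar> \<le> norm x * norm (A x)" by (rule Cauchy_Schwarz_ineq2)
    also have "\<dots> \<le> norm x * (norm x * R)" using R by (intro mult_left_mono) auto
    also have "\<dots> = R * inner x x" by (simp add: power2_norm_eq_inner[symmetric] power2_eq_square)
    finally show ?thesis .
  qed
  define S where "S x = (1 / (2 * R)) *\<^sub>R (A x + R *\<^sub>R x)" for x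
  have blS: "bounded_linear S"
    unfolding S_def by (intro bounded_linear_const_scaleR bounded_linear_add A bounded_linear_scaleR_right)
  have innS: "inner x (S x) = (inner x (A x) + R * inner x x) / (2 * R)" for x
    by (simp add: S_def inner_simps)
  have symS: "inner (S x) y = inner x (S y)" for x y
    by (simp add: S_def inner_simps sym)
  interpret positive_contraction S
  proof (rule positive_contraction.intro)
    fix x
    show "0 \<le> inner x (S x)" using AR[of x] R(1) by (simp add: innS)
    show "inner x (S x) \<le> inner x x" using AR[of x] R(1) by (simp add: innS field_simps)
  qed (rule blS symS)+
  define h where "h t = 2 * R * t - R" for t :: real
  have h [measurable]: "h \<in> borel_measurable borel" unfolding h_def by measurable
  have hB: "h -` B \<in> sets borel" if "B \<in> sets borel" for B
    using measurable_sets[OF h that] by simp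
  have AS: "A x = (2 * R) *\<^sub>R S x - R *\<^sub>R x" for x
    using R(1) by (simp add: S_def)
  define F where "F B = E (h -` B)" for B
  define \<mu> where "\<mu> x = distr (mu x) borel h" for x
  show thesis
  proof (rule that[of \<mu> R F])
    show "finite_measure (\<mu> x)" for x
      unfolding \<mu>_def by (rule mu.finite_measure_distr) simp
    show "AE t in \<mu> x. \<bar>t\<bar> \<le> R" for x
    proof -
      have "AE t in mu x. \<bar>h t\<bar> \<le> R"
        using mu(3)[of x]
      proof eventually_elim
        case (elim t)
        then have "0 \<le> R * t" "R * t \<le> R * 1" using R(1) by (auto intro!: mult_left_mono simp del: mult_1_right)
        then show ?case by (auto simp: h_def abs_le_iff)
      qed
      then show ?thesis unfolding \<mu>_def by (subst AE_distr_iff) auto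
    qed
    show "inner x (F B x) = measure (\<mu> x) B" if "B \<in> sets borel" for x B
      using that by (simp add: F_def \<mu>_def inner_E hB measure_distr)
    show "inner x (A x) = (\<integral>t. t \<partial>\<mu> x)" for x
    proof -
      have "(\<integral>t. t \<partial>\<mu> x) = (\<integral>t. h t \<partial>mu x)"
        unfolding \<mu>_def by (subst integral_distr) auto
      also have "\<dots> = 2 * R * (\<integral>t. t \<partial>mu x) - R * (norm x)\<^sup>2"
      proof -
        have "poly XX = (\<lambda>t::real. t)" by (simp add: fun_eq_iff)
        then have "integrable (mu x) (\<lambda>t. t)" using integrable_mu_poly[of x XX] by simp
        then show ?thesis by (simp add: h_def mass_mu)
      qed
      also have "\<dots> = inner x (A x)"
        by (simp add: AS inner_simps inner_S power2_norm_eq_inner)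
      finally show ?thesis by simp
    qed
    show "F B (c *\<^sub>R x + y) = c *\<^sub>R F B x + F B y" if "B \<in> sets borel" for B c x y
      unfolding F_def by (rule E_linear[OF hB[OF that]])
    show "F B (F B x) = F B x" if "B \<in> sets borel" for B x
      unfolding F_def by (rule E_idem[OF hB[OF that]])
    show "inner (F B x) y = inner x (F B y)" if "B \<in> sets borel" for B x y
      unfolding F_def by (rule E_sym[OF hB[OF that]])
    show "F UNIV x = x" for x by (simp add: F_def E_UNIV)
    show "(\<lambda>N. norm ((\<Sum>n<N. F (B n) x) - F (\<Union>n. B n) x)) \<longlonglongrightarrow> 0"
      if "range B \<subseteq> sets borel" "disjoint_family B" for B x
    proof -
      have "range (\<lambda>n. h -` B n) \<subseteq> sets borel" using that(1) hB by auto
      moreover have "disjoint_family (\<lambda>n. h -` B n)"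
        using that(2) by (fastforce simp: disjoint_family_on_def)
      ultimately show ?thesis
        unfolding F_def vimage_UN by (rule E_countably_additive)
    qed
    show "F B (T x) = T (F B x)" if "B \<in> sets borel" "bounded_linear T" "\<forall>x. A (T x) = T (A x)" for B T x
      unfolding F_def
    proof (rule E_commute[OF hB[OF that(1)] that(2)])
      show "S (T x) = T (S x)" for x
        using that(2,3) by (simp add: S_def linear_simps)
    qed
    show "F B x \<in> K" if "B \<in> sets borel" "subspace K" "closed K" "\<forall>x\<in>K. A x \<in> K" "x \<in> K" for B K x
      unfolding F_def
    proof (rule E_closed_subspace[OF hB[OF that(1)] that(2,3) _ that(5)])
      show "S x \<in> K" if "x \<in> K" for x
        using that \<open>subspace K\<close> \<open>\<forall>x\<in>K. A x \<in> K\<close> unfolding S_def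
        by (intro subspace_scale subspace_add) auto
    qed
  qed (simp add: \<mu>_def)
qed

section \<open>Consequences of a spectral resolution\<close>

text \<open>\<open>T\<close> need not be symmetric, so the equation is solved through
  \<open>T' (T u - \<phi>) = 0\<close>: the descent step \<open>g\<close> is a contraction of the
  closed subspace, and the lower bound for \<open>T'\<close> shows that the residual of its fixed
  point is zero.\<close>

lemma solve_bounded_below:
  fixes T T' :: "'a::{real_inner,complete_space} \<Rightarrow> 'a"
  assumes K: "subspace K" "closed K"
    and T: "bounded_linear T" "\<And>x. x \<in> K \<Longrightarrow> T x \<in> K" and T': "bounded_linear T'" "\<And>x. x \<in> K \<Longrightarrow> T' x \<in> K"
    and adj: "\<And>x y. inner (T x) y = inner x (T' y)"
    and \<delta>: "0 < \<delta>" "\<And>x. x \<in> K \<Longrightarrow> \<delta> * norm x \<le> norm (T x)" "\<And>x. x \<in> K \<Longrightarrow> \<delta> * norm x \<le> norm (T' x)"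
    and \<phi>: "\<phi> \<in> K"
  shows "\<exists>u\<in>K. T u = \<phi>"
proof -
  interpret T: bounded_linear T by fact
  interpret T': bounded_linear T' by fact
  obtain c0 where c0: "0 < c0" "\<And>x. norm (T' x) \<le> norm x * c0" using T'.pos_bounded by auto
  \<comment> \<open>Adding \<open>\<delta>\<close> makes \<open>c\<close> larger than
    \<open>\<delta>\<close>, so that \<open>1 - \<delta>\<^sup>2 / c\<^sup>2\<close> lies strictly
    between 0 and 1.\<close>
  define c where "c = c0 + \<delta>"
  have c: "0 < c" "\<delta> < c" "\<And>x. norm (T' x) \<le> c * norm x"
    using c0 \<delta>(1) by (auto simp: c_def algebra_simps intro: order_trans[OF c0(2)])
  define q where "q = sqrt (1 - \<delta>\<^sup>2 / c\<^sup>2)"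
  have dc: "\<delta>\<^sup>2 / c\<^sup>2 < 1" "0 < \<delta>\<^sup>2 / c\<^sup>2"
    using c \<delta>(1) by (auto simp: power_strict_mono)
  then have q: "0 \<le> q" "q < 1" "q\<^sup>2 = 1 - \<delta>\<^sup>2 / c\<^sup>2" by (auto simp: q_def)
  define g where "g u = u - (1 / c\<^sup>2) *\<^sub>R T' (T u - \<phi>)" for u
  have contr: "norm (w - (1 / c\<^sup>2) *\<^sub>R T' (T w)) \<le> q * norm w" if "w \<in> K" for w
  proof (rule power2_le_imp_le)
    have "(norm (w - (1 / c\<^sup>2) *\<^sub>R T' (T w)))\<^sup>2
        = (norm w)\<^sup>2 - 2 / c\<^sup>2 * (norm (T w))\<^sup>2 + (1 / c\<^sup>2)\<^sup>2 * (norm (T' (T w)))\<^sup>2"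
      unfolding power2_norm_eq_inner
      by (simp add: inner_simps inner_commute adj power2_eq_square algebra_simps)
    also have "(norm (T' (T w)))\<^sup>2 \<le> (c * norm (T w))\<^sup>2"
      using c by (intro power_mono) auto
    also have "(norm w)\<^sup>2 - 2 / c\<^sup>2 * (norm (T w))\<^sup>2 + (1 / c\<^sup>2)\<^sup>2 * (c * norm (T w))\<^sup>2
        = (norm w)\<^sup>2 - (norm (T w))\<^sup>2 / c\<^sup>2"
      using c(1) by (simp add: power2_eq_square field_simps)
    also have "\<dots> \<le> (norm w)\<^sup>2 - (\<delta> * norm w)\<^sup>2 / c\<^sup>2"
      using \<delta> that c by (intro diff_left_mono divide_right_mono power_mono) auto
    also have "\<dots> = (q * norm w)\<^sup>2"
      by (simp add: power_mult_distrib q algebra_simps)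
    finally show "(norm (w - (1 / c\<^sup>2) *\<^sub>R T' (T w)))\<^sup>2 \<le> (q * norm w)\<^sup>2"
      by (simp add: mult_left_mono)
  qed (use q in auto)
  have "\<exists>!u\<in>K. g u = u"
  proof (rule Banach_fix[OF complete_eq_closed[THEN iffD2, OF K(2)], where c = q])
    show "K \<noteq> {}" using \<phi> by auto
    show "g ` K \<subseteq> K"
      using K(1) T(2) T'(2) \<phi> by (auto simp: g_def intro!: subspace_diff subspace_scale)
    fix x y assume "x \<in> K" "y \<in> K"
    then have "x - y \<in> K" using K(1) by (simp add: subspace_diff)
    moreover have "g x - g y = (x - y) - (1 / c\<^sup>2) *\<^sub>R T' (T (x - y))"
      by (simp add: g_def T.diff T'.diff algebra_simps)
    ultimately show "dist (g x) (g y) \<le> q * dist x y"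
      using contr[of "x - y"] by (simp add: dist_norm)
  qed (use q in auto)
  then obtain u where u: "u \<in> K" "g u = u" by auto
  then have "T' (T u - \<phi>) = 0" using c(1) by (simp add: g_def)
  moreover have "T u - \<phi> \<in> K" using K(1) T(2)[OF u(1)] \<phi> by (simp add: subspace_diff)
  ultimately have "\<delta> * norm (T u - \<phi>) \<le> 0" using \<delta>(3)[of "T u - \<phi>"] by simp
  then have "T u = \<phi>" using \<delta>(1) by (simp add: mult_le_0_iff)
  with u(1) show ?thesis by blast
qed

definition form_measure :: "(real set \<Rightarrow> 'a \<Rightarrow> 'a) \<Rightarrow> 'a::real_inner \<Rightarrow> real measure" where
  "form_measure F x = measure_of UNIV (sets borel) (\<lambda>B. ennreal (inner x (F B x)))"

text \<open>What the definition of a resolution of a bounded operator provides, restated over the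
  reals on a closed invariant subspace: projections, additivity and the diagonal of the form. That
  the projections commute with \<open>A\<close> is not among the assumptions and has to be
  derived.\<close>

locale spectral_family =
  fixes K :: "'a::{real_inner,complete_space} set" and A :: "'a \<Rightarrow> 'a" and F :: "real set \<Rightarrow> 'a \<Rightarrow> 'a"
  assumes K: "subspace K" "closed K"
    and A: "bounded_linear A" "\<And>x. x \<in> K \<Longrightarrow> A x \<in> K"
    and A_sym: "inner (A x) y = inner x (A y)"
    and F_in: "B \<in> sets borel \<Longrightarrow> x \<in> K \<Longrightarrow> F B x \<in> K"
    and F_idem: "B \<in> sets borel \<Longrightarrow> x \<in> K \<Longrightarrow> F B (F B x) = F B x"
    and F_linear: "B \<in> sets borel \<Longrightarrow> x \<in> K \<Longrightarrow> y \<in> K \<Longrightarrow> F B (c *\<^sub>R x + y) = c *\<^sub>R F B x + F B y"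
    and F_sym: "B \<in> sets borel \<Longrightarrow> x \<in> K \<Longrightarrow> y \<in> K \<Longrightarrow> inner (F B x) y = inner x (F B y)"
    and F_UNIV: "x \<in> K \<Longrightarrow> F UNIV x = x"
    and F_sums: "range C \<subseteq> sets borel \<Longrightarrow> disjoint_family C \<Longrightarrow> x \<in> K \<Longrightarrow>
          (\<lambda>N. norm ((\<Sum>n<N. F (C n) x) - F (\<Union>n. C n) x)) \<longlonglongrightarrow> 0"
    and form: "x \<in> K \<Longrightarrow> inner x (A x) = (\<integral>t. t \<partial>form_measure F x)"
    and square: "x \<in> K \<Longrightarrow> (\<integral>\<^sup>+t. ennreal (t\<^sup>2) \<partial>form_measure F x) < \<infinity>"
begin

lemma A_simps: "A (x + y) = A x + A y" "A (x - y) = A x - A y" "A (c *\<^sub>R x) = c *\<^sub>R A x" "A 0 = 0"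
  using A(1) by (simp_all add: linear_simps)

section \<open>Algebra of the projections\<close>

lemma K_0: "0 \<in> K" using K(1) by (rule subspace_0)

context
  fixes B :: "real set" assumes B: "B \<in> sets borel"
begin

lemma F_add: "x \<in> K \<Longrightarrow> y \<in> K \<Longrightarrow> F B (x + y) = F B x + F B y"
  using F_linear[OF B, of x y 1] by simp

lemma F_0: "F B 0 = 0"
  using F_add[of 0 0] K_0 by simp

lemma F_scale: "x \<in> K \<Longrightarrow> F B (c *\<^sub>R x) = c *\<^sub>R F B x"
  using F_linear[OF B, of x 0 c] K_0 by (simp add: F_0)

lemma F_diff: "x \<in> K \<Longrightarrow> y \<in> K \<Longrightarrow> F B (x - y) = F B x - F B y"
  using F_linear[OF B, of y x "-1"] by simp

lemma inner_F: "x \<in> K \<Longrightarrow> inner x (F B x) = (norm (F B x))\<^sup>2"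
  using F_sym[OF B _ F_in[OF B], of x x] F_idem[OF B, of x]
  by (simp add: power2_norm_eq_inner)

lemma norm_F_le: "x \<in> K \<Longrightarrow> norm (F B x) \<le> norm x"
  using inner_F[of x] norm_cauchy_schwarz[of x "F B x"]
  by (cases "norm (F B x) = 0") (auto simp: power2_eq_square mult_le_cancel_right)

end

text \<open>A sequence of empty sets is disjoint, so the sums of \<open>N\<close> copies of one
  vector would converge to that vector; the norms force it to be zero.\<close>

lemma F_empty:
  assumes x: "x \<in> K" shows "F {} x = 0"
proof (rule ccontr)
  assume *: "F {} x \<noteq> 0"
  have lim: "(\<lambda>N::nat. norm ((\<Sum>n<N. F {} x) - F {} x)) \<longlonglongrightarrow> 0"
    using F_sums[of "\<lambda>_. {}", OF _ _ x] by (simp add: disjoint_family_on_def)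
  have "0 < norm (F {} x)" using * by simp
  from order_tendstoD(2)[OF lim this]
  obtain N0 where N0: "\<And>N::nat. N \<ge> N0 \<Longrightarrow> norm ((\<Sum>n<N. F {} x) - F {} x) < norm (F {} x)"
    unfolding eventually_at_top_linorder by blast
  define N where "N = max N0 2"
  have "(\<Sum>n<N. F {} x) - F {} x = (real N - 1) *\<^sub>R F {} x"
    by (simp add: sum_constant_scaleR scaleR_left_diff_distrib)
  then have "\<bar>real N - 1\<bar> * norm (F {} x) < 1 * norm (F {} x)"
    using N0[of N] by (simp add: N_def)
  then have "\<bar>real N - 1\<bar> < 1" using * by (subst (asm) mult_less_cancel_right_pos) simp_all
  moreover have "N \<ge> 2" by (simp add: N_def)
  ultimately show False by auto
qed

lemma F_Un:
  assumes x: "x \<in> K" and [measurable]: "B \<in> sets borel" "C \<in> sets borel" and "B \<inter> C = {}"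
  shows "F (B \<union> C) x = F B x + F C x"
proof -
  have "(\<lambda>N. norm ((\<Sum>n<N. F (binaryset B C n) x) - F (\<Union>n. binaryset B C n) x)) \<longlonglongrightarrow> 0"
    using assms by (intro F_sums) (auto simp: range_binaryset_eq disjoint_family_on_def binaryset_def)
  then have lim: "(\<lambda>N. norm ((\<Sum>n<N. F (binaryset B C n) x) - F (B \<union> C) x)) \<longlonglongrightarrow> 0"
    by (simp add: UN_binaryset_eq)
  have "norm ((\<Sum>n<N. F (binaryset B C n) x) - F (B \<union> C) x) = norm (F B x + F C x - F (B \<union> C) x)"
    if "N \<ge> 2" for N
  proof -
    have "(\<Sum>n<N. F (binaryset B C n) x) = (\<Sum>n\<in>{0,1}. F (binaryset B C n) x)"
      using that x by (intro sum.mono_neutral_right) (auto simp: binaryset_def F_empty)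
    then show ?thesis by (simp add: binaryset_def)
  qed
  then have "(\<lambda>N. norm ((\<Sum>n<N. F (binaryset B C n) x) - F (B \<union> C) x)) \<longlonglongrightarrow> norm (F B x + F C x - F (B \<union> C) x)"
    by (intro tendsto_eventually eventually_sequentiallyI[of 2])
  from LIMSEQ_unique[OF this lim] show ?thesis by simp
qed

text \<open>Orthogonality comes from contraction: for \<open>y\<close> in the range of
  \<open>F C\<close>, the squared norm of \<open>F (B \<union> C) y\<close> exceeds that of
  \<open>y\<close> by the form of \<open>F B\<close> at \<open>y\<close>, which must therefore
  vanish.\<close>

lemma F_disjoint:
  assumes x: "x \<in> K" and B: "B \<in> sets borel" and C: "C \<in> sets borel" and "B \<inter> C = {}"
  shows "F B (F C x) = 0"
proof -
  define y where "y = F C x"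
  have y: "y \<in> K" "F C y = y" using F_in[OF C x] F_idem[OF C x] by (simp_all add: y_def)
  have BC: "B \<union> C \<in> sets borel" using B C by auto
  have "(norm (F (B \<union> C) y))\<^sup>2 = inner y (F B y) + (norm y)\<^sup>2"
    using inner_F[OF BC y(1)] F_Un[OF y(1) B C assms(4)] y(2)
    by (simp add: inner_add_right power2_norm_eq_inner)
  moreover have "(norm (F (B \<union> C) y))\<^sup>2 \<le> (norm y)\<^sup>2"
    using norm_F_le[OF BC y(1)] by (simp add: power_mono)
  ultimately show ?thesis using inner_F[OF B y(1)] by (simp add: y_def)
qed

lemma F_Int:
  assumes x: "x \<in> K" and B: "B \<in> sets borel" and C: "C \<in> sets borel"
  shows "F B (F C x) = F (B \<inter> C) x"
proof -
  have s: "B \<inter> C \<in> sets borel" "C - B \<in> sets borel" "B - C \<in> sets borel" using B C by auto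
  have "(B \<inter> C) \<union> (C - B) = C" "(B \<inter> C) \<inter> (C - B) = {}" by auto
  then have "F C x = F (B \<inter> C) x + F (C - B) x"
    using F_Un[OF x s(1,2)] by simp
  then have "F B (F C x) = F B (F (B \<inter> C) x)"
    using F_add[OF B F_in[OF s(1) x] F_in[OF s(2) x]] F_disjoint[OF x B s(2)] by auto
  also have "\<dots> = F (B \<inter> C) (F (B \<inter> C) x) + F (B - C) (F (B \<inter> C) x)"
  proof -
    have "(B \<inter> C) \<union> (B - C) = B" "(B \<inter> C) \<inter> (B - C) = {}" by auto
    then show ?thesis using F_Un[OF F_in[OF s(1) x] s(1) s(3)] by simp
  qed
  also have "\<dots> = F (B \<inter> C) x"
    using F_disjoint[OF x s(3) s(1)] F_idem[OF s(1) x] by auto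
  finally show ?thesis .
qed

section \<open>Scalar spectral measures\<close>

abbreviation "mu \<equiv> form_measure F"

lemma sets_mu [measurable_cong, simp]: "sets (mu x) = sets borel"
proof -
  have "sets (mu x) = sigma_sets UNIV (sets borel)"
    unfolding form_measure_def by (rule sets_measure_of) simp
  then show ?thesis using sets.sigma_sets_eq[of "borel :: real measure"] by simp
qed

lemma space_mu [simp]: "space (mu x) = UNIV"
  using sets_eq_imp_space_eq[OF sets_mu] by simp

lemma emeasure_mu:
  assumes x: "x \<in> K" and B: "B \<in> sets borel"
  shows "emeasure (mu x) B = ennreal ((norm (F B x))\<^sup>2)"
proof -
  have "emeasure (mu x) B = ennreal (inner x (F B x))"
  proof (rule emeasure_measure_of[OF form_measure_def])
    show "sets borel \<subseteq> Pow (UNIV :: real set)" by simp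
    show "positive (sets (mu x)) (\<lambda>B. ennreal (inner x (F B x)))"
      using x by (simp add: positive_def F_empty)
    show "countably_additive (sets (mu x)) (\<lambda>B. ennreal (inner x (F B x)))"
    proof (rule countably_additiveI)
      fix C :: "nat \<Rightarrow> real set"
      assume C: "range C \<subseteq> sets (mu x)" "disjoint_family C"
      have "(\<lambda>N. (\<Sum>n<N. F (C n) x) - F (\<Union>n. C n) x) \<longlonglongrightarrow> 0"
        by (rule tendsto_norm_zero_cancel, rule F_sums[OF _ C(2) x]) (use C(1) in simp)
      then have "(\<lambda>N. \<Sum>n<N. F (C n) x) \<longlonglongrightarrow> F (\<Union>n. C n) x"
        by (simp add: LIM_zero_iff)
      from tendsto_inner[OF tendsto_const[of x] this]
      have "(\<lambda>n. inner x (F (C n) x)) sums inner x (F (\<Union>n. C n) x)"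
        by (simp add: sums_def inner_sum_right)
      moreover have "0 \<le> inner x (F (C n) x)" for n
        using C x by (subst inner_F) auto
      ultimately show "(\<Sum>n. ennreal (inner x (F (C n) x))) = ennreal (inner x (F (\<Union>n. C n) x))"
        by (rule suminf_ennreal_eq[rotated])
    qed
    show "B \<in> sets (mu x)" using B by simp
  qed
  then show ?thesis using inner_F[OF B x] by simp
qed

lemma finite_mu: "x \<in> K \<Longrightarrow> finite_measure (mu x)"
  by (rule finite_measureI) (simp add: emeasure_mu)

lemma measure_mu: "x \<in> K \<Longrightarrow> B \<in> sets borel \<Longrightarrow> measure (mu x) B = (norm (F B x))\<^sup>2"
  by (simp add: measure_def emeasure_mu)

lemma mu_F:
  assumes x: "x \<in> K" and B [measurable]: "B \<in> sets borel"
  shows "mu (F B x) = density (mu x) (indicator B)"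
proof (rule measure_eqI)
  fix C assume "C \<in> sets (mu (F B x))"
  then have C [measurable]: "C \<in> sets borel" by simp
  then have CB: "C \<inter> B \<in> sets borel" by measurable
  have "emeasure (density (mu x) (indicator B)) C = emeasure (mu x) (C \<inter> B)"
  proof -
    have "emeasure (density (mu x) (indicator B)) C = (\<integral>\<^sup>+t. indicator B t * indicator C t \<partial>mu x)"
      by (rule emeasure_density) auto
    also have "\<dots> = (\<integral>\<^sup>+t. indicator (C \<inter> B) t \<partial>mu x)"
      by (intro nn_integral_cong) (auto simp: indicator_def)
    finally show ?thesis using CB by simp
  qed
  then show "emeasure (mu (F B x)) C = emeasure (density (mu x) (indicator B)) C"
    using F_Int[OF x C B] F_in[OF B x] x CB C by (simp add: emeasure_mu)
qed simp

lemma integral_mu_F: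
  fixes f :: "real \<Rightarrow> real"
  assumes x: "x \<in> K" and B [measurable]: "B \<in> sets borel" and [measurable]: "f \<in> borel_measurable borel"
  shows "(\<integral>t. f t \<partial>mu (F B x)) = (\<integral>t. indicat_real B t * f t \<partial>mu x)"
proof -
  have "density (mu x) (indicator B) = density (mu x) (\<lambda>t. ennreal (indicat_real B t))"
    by (simp add: ennreal_indicator)
  then show ?thesis
    unfolding mu_F[OF x B] by (simp add: integral_density)
qed

lemma integrable_square_mu: "x \<in> K \<Longrightarrow> integrable (mu x) (\<lambda>t. t\<^sup>2)"
  using square[of x] by (intro integrableI_bounded) auto

lemma integrable_id_mu:
  assumes "x \<in> K" shows "integrable (mu x) (\<lambda>t. t)"
proof (rule Bochner_Integration.integrable_bound)
  interpret finite_measure "mu x" using assms by (rule finite_mu)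
  show "integrable (mu x) (\<lambda>t. 1 + t\<^sup>2)" using integrable_square_mu[OF assms] by simp
  have "\<bar>t\<bar> \<le> 1 + t\<^sup>2" for t :: real
    using sum_squares_bound[of 1 "\<bar>t\<bar>"] by simp
  then show "AE t in mu x. norm t \<le> norm (1 + t\<^sup>2)" by auto
qed simp

section \<open>Commutation with the operator and bounded support\<close>

lemma F_Compl:
  assumes x: "x \<in> K" and B: "B \<in> sets borel"
  shows "F (- B) x = x - F B x"
proof -
  have "F B x + F (- B) x = x"
    using F_Un[OF x B, of "- B"] B F_UNIV[OF x] by (simp add: borel_comp)
  then show ?thesis by (metis add_diff_cancel_left')
qed

text \<open>As an integral the form of \<open>x\<close> splits over \<open>B\<close> and its
  complement, while expanded through \<open>A\<close> it also contains twice the mixed term.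
  Comparing the two shows that \<open>A\<close> does not mix the two ranges.\<close>

lemma cross_term:
  assumes B: "B \<in> sets borel" and y: "y \<in> K" and z: "z \<in> K"
  shows "inner (F B y) (A (F (- B) z)) = 0"
proof -
  have B': "- B \<in> sets borel" using B by (rule borel_comp)
  define x where "x = F B y + F (- B) z"
  have x: "x \<in> K" unfolding x_def using F_in[OF B y] F_in[OF B' z] K(1) by (simp add: subspace_add)
  have 1: "F B x = F B y"
    using F_add[OF B F_in[OF B y] F_in[OF B' z]] F_idem[OF B y] F_disjoint[OF z B B'] by (simp add: x_def)
  have 2: "F (- B) x = F (- B) z"
    using F_add[OF B' F_in[OF B y] F_in[OF B' z]] F_idem[OF B' z] F_disjoint[OF y B' B] by (simp add: x_def)
  have "inner x (A x) = (\<integral>t. indicat_real B t * t + indicat_real (- B) t * t \<partial>mu x)"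
    unfolding form[OF x] by (intro Bochner_Integration.integral_cong refl) (auto simp: indicator_def)
  also have "\<dots> = (\<integral>t. indicat_real B t * t \<partial>mu x) + (\<integral>t. indicat_real (- B) t * t \<partial>mu x)"
    using integrable_real_mult_indicator[of B "mu x", OF _ integrable_id_mu[OF x]]
      integrable_real_mult_indicator[of "- B" "mu x", OF _ integrable_id_mu[OF x]] B B'
    by (intro Bochner_Integration.integral_add) (simp_all add: mult.commute)
  also have "\<dots> = inner (F B y) (A (F B y)) + inner (F (- B) z) (A (F (- B) z))"
    using integral_mu_F[OF x B, of "\<lambda>t. t"] integral_mu_F[OF x B', of "\<lambda>t. t"]
      form[OF F_in[OF B y]] form[OF F_in[OF B' z]] by (simp add: 1 2)
  finally show ?thesis
    using A_sym[of "F B y" "F (- B) z"]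
    by (simp add: x_def A_simps inner_simps inner_commute)
qed

lemma F_A_Compl:
  assumes B: "B \<in> sets borel" and z: "z \<in> K"
  shows "F B (A (F (- B) z)) = 0"
proof -
  define y where "y = A (F (- B) z)"
  have y: "y \<in> K" unfolding y_def using A(2) F_in[OF borel_comp[OF B] z] .
  have "inner (F B y) y = 0"
    using cross_term[OF B y z] by (simp add: y_def)
  then show ?thesis using inner_F[OF B y] by (simp add: inner_commute y_def)
qed

lemma F_commute:
  assumes B: "B \<in> sets borel" and x: "x \<in> K"
  shows "F B (A x) = A (F B x)"
proof -
  have B': "- B \<in> sets borel" using B by (rule borel_comp)
  have Bx: "F B x \<in> K" "F (- B) x \<in> K" using F_in[OF B x] F_in[OF B' x] by auto
  have "F (- B) (A (F (- (- B)) x)) = 0" by (rule F_A_Compl[OF B' x])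
  then have 1: "A (F B x) = F B (A (F B x))"
    using F_Compl[OF A(2)[OF Bx(1)] B] by simp
  have "x = F B x + F (- B) x" using F_Compl[OF x B] by simp
  then have "A x = A (F B x) + A (F (- B) x)" by (metis A_simps(1))
  then have "F B (A x) = F B (A (F B x)) + F B (A (F (- B) x))"
    using F_add[OF B A(2)[OF Bx(1)] A(2)[OF Bx(2)]] by simp
  then show ?thesis using 1 F_A_Compl[OF B x] by simp
qed

text \<open>Apply the form to the part of \<open>x\<close> beyond \<open>R\<close>: the integral of
  the nonnegative excess over \<open>R\<close> is at most zero by the operator bound, so the excess
  vanishes almost everywhere. The factor \<open>c\<close> treats both ends at once.\<close>

lemma mu_bounded:
  assumes x: "x \<in> K" and R: "\<And>y. norm (A y) \<le> R * norm y"
  shows "AE t in mu x. \<bar>t\<bar> \<le> R"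
proof -
  interpret finite_measure "mu x" using x by (rule finite_mu)
  have inner_le: "\<bar>inner y (A y)\<bar> \<le> R * (norm y)\<^sup>2" for y
  proof -
    have "\<bar>inner y (A y)\<bar> \<le> norm y * norm (A y)" by (rule Cauchy_Schwarz_ineq2)
    also have "\<dots> \<le> norm y * (R * norm y)" using R by (intro mult_left_mono) auto
    finally show ?thesis by (simp add: power2_eq_square mult_ac)
  qed
  have aux: "AE t in mu x. t \<in> B \<longrightarrow> g t = 0"
    if B [measurable]: "B \<in> sets borel" and g: "\<And>t. t \<in> B \<Longrightarrow> 0 \<le> g t" and c: "c = 1 \<or> c = -1"
      and gdef: "\<And>t. g t = c * t - R" for B g c
  proof -
    define y where "y = F B x"
    have y: "y \<in> K" unfolding y_def using F_in[OF B x] .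
    have i1: "integrable (mu x) (\<lambda>t. indicat_real B t * t)"
      using integrable_real_mult_indicator[of B "mu x", OF _ integrable_id_mu[OF x]] by (simp add: mult.commute)
    have i2: "integrable (mu x) (indicat_real B)" by (simp add: emeasure_finite less_top[symmetric])
    have eq: "indicat_real B t * g t = c * (indicat_real B t * t) - R * indicat_real B t" for t
      by (simp add: gdef algebra_simps)
    have "(\<integral>t. indicat_real B t * g t \<partial>mu x) = c * inner y (A y) - R * (norm y)\<^sup>2"
      unfolding eq using i1 i2 form[OF y] integral_mu_F[OF x B, of "\<lambda>t. t"] measure_mu[OF x B]
      by (simp add: y_def)
    also have "\<dots> \<le> 0" using inner_le[of y] c by auto
    finally have le0: "(\<integral>t. indicat_real B t * g t \<partial>mu x) \<le> 0" .
    have nn: "AE t in mu x. 0 \<le> indicat_real B t * g t"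
      using g by (intro AE_I2) (auto simp: indicator_def)
    have int: "integrable (mu x) (\<lambda>t. indicat_real B t * g t)"
      unfolding eq using i1 i2 by auto
    have "(\<integral>t. indicat_real B t * g t \<partial>mu x) = 0"
      using le0 integral_nonneg_AE[OF nn] by linarith
    then have "AE t in mu x. indicat_real B t * g t = 0"
      using integral_nonneg_eq_0_iff_AE[OF int nn] by simp
    then show ?thesis by eventually_elim (auto simp: indicator_def)
  qed
  have "AE t in mu x. t \<in> {R<..} \<longrightarrow> t - R = 0"
    by (rule aux[where c = 1]) auto
  moreover have "AE t in mu x. t \<in> {..<-R} \<longrightarrow> - t - R = 0"
    by (rule aux[where c = "-1"]) auto
  ultimately show ?thesis
    by eventually_elim (auto simp: not_less abs_le_iff)
qed

end

text \<open>For symmetric operators the norm is governed by the form. Polarization is applied to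
  \<open>x\<close> and to the multiple of \<open>T x\<close> that has the norm of \<open>x\<close>,
  so that the parallelogram law gives the sharp constant.\<close>

lemma symmetric_norm_le_form:
  fixes T :: "'a::real_inner \<Rightarrow> 'a"
  assumes K: "subspace K" and T: "\<And>x y. x \<in> K \<Longrightarrow> y \<in> K \<Longrightarrow> T (x + y) = T x + T y"
    "\<And>x c. x \<in> K \<Longrightarrow> T (c *\<^sub>R x) = c *\<^sub>R T x"
    and TK: "\<And>x. x \<in> K \<Longrightarrow> T x \<in> K"
    and sym: "\<And>x y. x \<in> K \<Longrightarrow> y \<in> K \<Longrightarrow> inner (T x) y = inner x (T y)"
    and h: "\<And>x. x \<in> K \<Longrightarrow> \<bar>inner x (T x)\<bar> \<le> h * (norm x)\<^sup>2" and x: "x \<in> K"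
  shows "norm (T x) \<le> h * norm x"
proof (cases "T x = 0 \<or> x = 0")
  case True
  then show ?thesis
  proof
    assume "T x = 0"
    moreover have "0 \<le> h * norm x"
    proof (cases "x = 0")
      case False
      have "0 \<le> h * (norm x)\<^sup>2" using h[OF x] by linarith
      then show ?thesis using False by (simp add: zero_le_mult_iff)
    qed simp
    ultimately show ?thesis by simp
  next
    assume "x = 0"
    then show ?thesis using T(2)[OF x, of 0] by simp
  qed
next
  case False
  define c where "c = norm x / norm (T x)"
  define y where "y = c *\<^sub>R T x"
  have y: "y \<in> K" unfolding y_def using K TK[OF x] by (rule subspace_scale)
  have my: "- y \<in> K" "T (- y) = - T y" using K y T(2)[OF y, of "-1"] by (auto simp: subspace_neg)
  have s: "x + y \<in> K" "x - y \<in> K" using K x y by (auto simp: subspace_add subspace_diff)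
  have ny: "norm y = norm x" using False by (simp add: y_def c_def)
  have Tm: "T (x - y) = T x - T y" using T(1)[OF x my(1)] my(2) by simp
  have "4 * inner (T x) y = inner (x + y) (T (x + y)) - inner (x - y) (T (x - y))"
    using sym[OF x y] by (simp add: T(1)[OF x y] Tm inner_simps inner_commute)
  also have "\<dots> \<le> h * (norm (x + y))\<^sup>2 + h * (norm (x - y))\<^sup>2"
    using h[OF s(1)] h[OF s(2)] by linarith
  also have "\<dots> = h * (2 * (norm x)\<^sup>2 + 2 * (norm y)\<^sup>2)"
    unfolding power2_norm_eq_inner by (simp add: inner_simps inner_commute algebra_simps)
  also have "\<dots> = 4 * h * (norm x)\<^sup>2" by (simp add: ny)
  finally have "inner (T x) y \<le> h * (norm x)\<^sup>2" by simp
  moreover have "inner (T x) y = norm x * norm (T x)"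
    using False by (simp add: y_def c_def power2_norm_eq_inner[symmetric] power2_eq_square)
  ultimately have "norm x * norm (T x) \<le> norm x * (h * norm x)"
    by (simp add: power2_eq_square mult_ac)
  then show ?thesis using False by simp
qed

context spectral_family begin

section \<open>Quadratic functional calculus by step functions\<close>

lemma F_finite_UN:
  assumes x: "x \<in> K" and "finite I" "\<And>i. i \<in> I \<Longrightarrow> C i \<in> sets borel" "disjoint_family_on C I"
  shows "F (\<Union>i\<in>I. C i) x = (\<Sum>i\<in>I. F (C i) x)"
  using assms(2-)
proof (induction I rule: finite_induct)
  case (insert i I)
  have "C i \<inter> (\<Union>j\<in>I. C j) = {}"
    using insert.hyps insert.prems(2) by (fastforce simp: disjoint_family_on_def)
  moreover have "(\<Union>j\<in>I. C j) \<in> sets borel" using insert.hyps insert.prems(1) by auto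
  moreover have "disjoint_family_on C I"
    using insert.prems(2) by (auto simp: disjoint_family_on_def)
  ultimately show ?case
    using insert F_Un[OF x, of "C i" "\<Union>j\<in>I. C j"] by simp
qed (simp add: F_empty x)

lemma F_full:
  assumes x: "x \<in> K" and B: "B \<in> sets borel" and ae: "AE t in mu x. t \<in> B"
  shows "F B x = x"
proof -
  have "emeasure (mu x) (- B) = 0"
    using ae B by (subst (asm) AE_iff_measurable[where N = "- B"]) (auto simp: borel_comp)
  then have "F (- B) x = 0"
    using emeasure_mu[OF x borel_comp[OF B]] by (simp add: ennreal_eq_0_iff)
  then show ?thesis using F_Compl[OF x B] by simp
qed

lemma norm_sum_F:
  assumes x: "x \<in> K" and I: "finite I" and C: "\<And>i. i \<in> I \<Longrightarrow> C i \<in> sets borel" "disjoint_family_on C I"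
  shows "(norm (\<Sum>i\<in>I. c i *\<^sub>R F (C i) x))\<^sup>2 = (\<Sum>i\<in>I. (c i)\<^sup>2 * measure (mu x) (C i))"
proof -
  have "inner (c i *\<^sub>R F (C i) x) (c j *\<^sub>R F (C j) x) = (if j = i then (c i)\<^sup>2 * measure (mu x) (C i) else 0)"
    if "i \<in> I" "j \<in> I" for i j
  proof (cases "i = j")
    case True
    then show ?thesis
      using measure_mu[OF x C(1)[OF that(1)]] by (simp add: power2_norm_eq_inner) (simp add: power2_eq_square)
  next
    case False
    then have "C i \<inter> C j = {}" using C(2) that by (auto simp: disjoint_family_on_def)
    then have "inner (F (C i) x) (F (C j) x) = 0"
      using F_sym[OF C(1)[OF that(1)] x F_in[OF C(1)[OF that(2)] x]]
        F_disjoint[OF x C(1)[OF that(1)] C(1)[OF that(2)]] by simp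
    with False show ?thesis by simp
  qed
  note orth = this
  have "(norm (\<Sum>i\<in>I. c i *\<^sub>R F (C i) x))\<^sup>2
      = (\<Sum>i\<in>I. \<Sum>j\<in>I. inner (c i *\<^sub>R F (C i) x) (c j *\<^sub>R F (C j) x))"
    unfolding power2_norm_eq_inner by (simp only: inner_sum_left) (simp only: inner_sum_right)
  also have "\<dots> = (\<Sum>i\<in>I. \<Sum>j\<in>I. if j = i then (c i)\<^sup>2 * measure (mu x) (C i) else 0)"
    by (intro sum.cong refl orth)
  finally show ?thesis using I by (simp add: sum.delta)
qed

text \<open>Only the diagonal of the form is known as an integral. Rounding to multiples of
  \<open>h\<close> gives an explicit operator \<open>Ah\<close> whose form at \<open>y\<close>
  differs from that of \<open>A\<close> by at most \<open>h * (norm y)\<^sup>2\<close>; as the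
  difference is symmetric, it moves \<open>x\<close> by at most \<open>h * norm x\<close>, and for
  \<open>Ah\<close> the squared norm is an explicit sum.\<close>

lemma norm_A_minus:
  assumes x: "x \<in> K"
  shows "(norm (A x - s *\<^sub>R x))\<^sup>2 = (\<integral>t. (t - s)\<^sup>2 \<partial>mu x)"
proof -
  interpret A: bounded_linear A by (rule A(1))
  obtain R where R: "0 < R" "\<And>y. norm (A y) \<le> R * norm y"
    using A.pos_bounded by (auto simp: mult.commute)
  define f where "f h t = h * real_of_int \<lfloor>t / h\<rfloor>" for h t :: real
  have f_meas [measurable]: "f h \<in> borel_measurable borel" for h unfolding f_def by measurable
  have f_close: "\<bar>t - f h t\<bar> \<le> h" if "0 < h" for h t
  proof -
    have "t - f h t = h * (t / h - real_of_int \<lfloor>t / h\<rfloor>)"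
      using that by (simp add: f_def algebra_simps)
    moreover have "0 \<le> t / h - real_of_int \<lfloor>t / h\<rfloor>" "t / h - real_of_int \<lfloor>t / h\<rfloor> \<le> 1"
      by linarith+
    ultimately show ?thesis
      using that mult_left_mono[of "t / h - real_of_int \<lfloor>t / h\<rfloor>" 1 h] by (simp add: abs_mult)
  qed
  have step: "\<bar>norm (A x - s *\<^sub>R x) - sqrt (\<integral>t. (f h t - s)\<^sup>2 \<partial>mu x)\<bar> \<le> h * norm x" if h: "0 < h" for h
  proof -
    define C where "C k = {t. \<lfloor>t / h\<rfloor> = k}" for k
    have C: "C k \<in> sets borel" for k
      unfolding C_def by measurable
    \<comment> \<open>The spectral measures live in \<open>[-R, R]\<close>, so finitely many cells
      suffice for all vectors of \<open>K\<close> simultaneously.\<close>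
    define I where "I = {\<lfloor>- R / h\<rfloor>..\<lfloor>R / h\<rfloor>}"
    have disj: "disjoint_family_on C I" by (auto simp: disjoint_family_on_def C_def)
    have fin: "finite I" by (simp add: I_def)
    define U where "U = (\<Union>k\<in>I. C k)"
    have U: "U \<in> sets borel" unfolding U_def using fin C by auto
    have aeU: "AE t in mu y. t \<in> U" if "y \<in> K" for y
      using mu_bounded[OF that R(2)]
    proof eventually_elim
      case (elim t)
      then have "\<lfloor>t / h\<rfloor> \<in> I"
        using h divide_right_mono[of "- R" t h] divide_right_mono[of t R h]
        unfolding I_def atLeastAtMost_iff by (intro conjI floor_mono) auto
      then show ?case by (auto simp: U_def C_def)
    qed
    have full: "(\<Sum>k\<in>I. F (C k) y) = y" if y: "y \<in> K" for y
      using F_full[OF y U aeU[OF y]] F_finite_UN[OF y fin C disj] by (simp add: U_def)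
    define Ah where "Ah y = (\<Sum>k\<in>I. (h * real_of_int k) *\<^sub>R F (C k) y)" for y
    have ind: "(\<Sum>k\<in>I. g (h * real_of_int k) * indicat_real (C k) t) = g (f h t)" if "t \<in> U" for g t
    proof -
      from that have "\<lfloor>t / h\<rfloor> \<in> I" by (auto simp: U_def C_def)
      moreover have "(\<Sum>k\<in>I. g (h * real_of_int k) * indicat_real (C k) t)
          = (\<Sum>k\<in>I. if k = \<lfloor>t / h\<rfloor> then g (f h t) else 0)"
        by (intro sum.cong refl) (auto simp: C_def indicator_def f_def)
      ultimately show ?thesis using fin by simp
    qed
    have int_f: "(\<Sum>k\<in>I. g (h * real_of_int k) * measure (mu y) (C k)) = (\<integral>t. g (f h t) \<partial>mu y)"
      if y: "y \<in> K" and [measurable]: "g \<in> borel_measurable borel" for y and g :: "real \<Rightarrow> real"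
    proof -
      interpret finite_measure "mu y" using y by (rule finite_mu)
      have "(\<Sum>k\<in>I. g (h * real_of_int k) * measure (mu y) (C k))
          = (\<integral>t. (\<Sum>k\<in>I. g (h * real_of_int k) * indicat_real (C k) t) \<partial>mu y)"
        using C by (subst Bochner_Integration.integral_sum) (auto simp: emeasure_finite less_top[symmetric])
      also have "\<dots> = (\<integral>t. g (f h t) \<partial>mu y)"
      proof (rule integral_cong_AE)
        show "AE t in mu y. (\<Sum>k\<in>I. g (h * real_of_int k) * indicat_real (C k) t) = g (f h t)"
          using aeU[OF y] by eventually_elim (rule ind)
      qed (use C in measurable)
      finally show ?thesis .
    qed
    have Ah_K: "Ah y \<in> K" if "y \<in> K" for y
      unfolding Ah_def using K(1) F_in[OF C that] by (auto intro!: subspace_sum subspace_scale)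
    have "norm (A x - Ah x) \<le> h * norm x"
    proof (rule symmetric_norm_le_form[OF K(1), where T = "\<lambda>y. A y - Ah y"])
      show "A (y + z) - Ah (y + z) = A y - Ah y + (A z - Ah z)" if "y \<in> K" "z \<in> K" for y z
        using F_add[OF C that] by (simp add: Ah_def A_simps scaleR_add_right sum.distrib)
      show "A (c *\<^sub>R y) - Ah (c *\<^sub>R y) = c *\<^sub>R (A y - Ah y)" if "y \<in> K" for y c
        using F_scale[OF C that] by (simp add: Ah_def A_simps scaleR_diff_right scaleR_sum_right mult.commute)
      show "A y - Ah y \<in> K" if "y \<in> K" for y
        using A(2)[OF that] Ah_K[OF that] K(1) by (simp add: subspace_diff)
      show "inner (A y - Ah y) z = inner y (A z - Ah z)" if "y \<in> K" "z \<in> K" for y z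
        using F_sym[OF C that] by (simp add: Ah_def A_sym inner_simps inner_sum_left inner_sum_right)
      show "\<bar>inner y (A y - Ah y)\<bar> \<le> h * (norm y)\<^sup>2" if y: "y \<in> K" for y
      proof -
        interpret finite_measure "mu y" using y by (rule finite_mu)
        have m: "measure (mu y) UNIV = (norm y)\<^sup>2" using measure_mu[OF y, of UNIV] F_UNIV[OF y] by simp
        have i1: "integrable (mu y) (\<lambda>t. t - f h t)"
          using f_close[OF h] by (intro integrable_const_bound[of _ h]) auto
        from Bochner_Integration.integrable_diff[OF integrable_id_mu[OF y] this]
        have i2: "integrable (mu y) (f h)" by simp
        have "inner y (Ah y) = (\<Sum>k\<in>I. h * real_of_int k * measure (mu y) (C k))"
          using inner_F[OF C y] measure_mu[OF y C] by (simp add: Ah_def inner_sum_right)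
        also have "\<dots> = (\<integral>t. f h t \<partial>mu y)" using int_f[OF y, of "\<lambda>t. t"] by simp
        finally have "inner y (A y - Ah y) = (\<integral>t. t - f h t \<partial>mu y)"
          using integrable_id_mu[OF y] i2 form[OF y] by (simp add: inner_diff_right)
        also have "\<bar>\<dots>\<bar> \<le> (\<integral>t. h \<partial>mu y)"
          using f_close[OF h] i1 by (intro integral_abs_bound_integral) auto
        also have "\<dots> = h * (norm y)\<^sup>2" using m by simp
        finally show ?thesis .
      qed
    qed (rule x)
    moreover have "norm (Ah x - s *\<^sub>R x) = sqrt (\<integral>t. (f h t - s)\<^sup>2 \<partial>mu x)"
    proof -
      have "Ah x - s *\<^sub>R x = Ah x - s *\<^sub>R (\<Sum>k\<in>I. F (C k) x)" by (simp add: full[OF x])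
      also have "\<dots> = (\<Sum>k\<in>I. (h * real_of_int k - s) *\<^sub>R F (C k) x)"
        by (simp add: Ah_def scaleR_sum_right scaleR_left_diff_distrib sum_subtractf)
      finally have "(norm (Ah x - s *\<^sub>R x))\<^sup>2 = (\<integral>t. (f h t - s)\<^sup>2 \<partial>mu x)"
        using norm_sum_F[OF x fin C disj, of "\<lambda>k. h * real_of_int k - s"] int_f[OF x, of "\<lambda>t. (t - s)\<^sup>2"] by simp
      then show ?thesis by (metis norm_ge_zero real_sqrt_abs abs_of_nonneg)
    qed
    moreover have "\<bar>norm (A x - s *\<^sub>R x) - norm (Ah x - s *\<^sub>R x)\<bar> \<le> norm (A x - Ah x)"
      using norm_triangle_ineq3[of "A x - s *\<^sub>R x" "Ah x - s *\<^sub>R x"] by simp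
    ultimately show ?thesis by linarith
  qed
  interpret finite_measure "mu x" using x by (rule finite_mu)
  define h where "h n = 1 / real (Suc n)" for n
  have h: "0 < h n" "h n \<le> 1" for n by (auto simp: h_def)
  have h0: "h \<longlonglongrightarrow> 0"
    unfolding h_def using LIMSEQ_inverse_real_of_nat by (simp add: inverse_eq_divide)
  have "(\<lambda>n. \<integral>t. (f (h n) t - s)\<^sup>2 \<partial>mu x) \<longlonglongrightarrow> (\<integral>t. (t - s)\<^sup>2 \<partial>mu x)"
  proof (rule integral_dominated_convergence[where w = "\<lambda>t. 2 * t\<^sup>2 + 2 * (1 + \<bar>s\<bar>)\<^sup>2"])
    show "integrable (mu x) (\<lambda>t. 2 * t\<^sup>2 + 2 * (1 + \<bar>s\<bar>)\<^sup>2)" using integrable_square_mu[OF x] by simp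
    have "(\<lambda>n. f (h n) t) \<longlonglongrightarrow> t" for t
    proof -
      have "(\<lambda>n. t - f (h n) t) \<longlonglongrightarrow> 0"
        by (rule Lim_null_comparison[OF _ h0]) (use f_close h in auto)
      from tendsto_diff[OF tendsto_const[of t] this] show ?thesis by simp
    qed
    then show "AE t in mu x. (\<lambda>n. (f (h n) t - s)\<^sup>2) \<longlonglongrightarrow> (t - s)\<^sup>2"
      by (intro AE_I2 tendsto_intros)
    fix n
    have "(f (h n) t - s)\<^sup>2 \<le> 2 * t\<^sup>2 + 2 * (1 + \<bar>s\<bar>)\<^sup>2" for t
    proof -
      have "\<bar>f (h n) t - s\<bar> \<le> \<bar>t\<bar> + (1 + \<bar>s\<bar>)"
        using f_close[OF h(1), of t n] h(2)[of n] by linarith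
      then have "(f (h n) t - s)\<^sup>2 \<le> (\<bar>t\<bar> + (1 + \<bar>s\<bar>))\<^sup>2"
        by (metis abs_ge_zero power2_abs power_mono)
      also have "\<dots> \<le> 2 * t\<^sup>2 + 2 * (1 + \<bar>s\<bar>)\<^sup>2"
        using sum_squares_bound[of "\<bar>t\<bar>" "1 + \<bar>s\<bar>"] by (simp add: power2_sum)
      finally show ?thesis .
    qed
    then show "AE t in mu x. norm ((f (h n) t - s)\<^sup>2) \<le> 2 * t\<^sup>2 + 2 * (1 + \<bar>s\<bar>)\<^sup>2" by simp
  qed auto
  then have "(\<lambda>n. sqrt (\<integral>t. (f (h n) t - s)\<^sup>2 \<partial>mu x)) \<longlonglongrightarrow> sqrt (\<integral>t. (t - s)\<^sup>2 \<partial>mu x)"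
    by (rule tendsto_real_sqrt)
  moreover have "(\<lambda>n. sqrt (\<integral>t. (f (h n) t - s)\<^sup>2 \<partial>mu x)) \<longlonglongrightarrow> norm (A x - s *\<^sub>R x)"
  proof -
    have "(\<lambda>n. norm (A x - s *\<^sub>R x) - sqrt (\<integral>t. (f (h n) t - s)\<^sup>2 \<partial>mu x)) \<longlonglongrightarrow> 0"
      by (rule Lim_null_comparison[where g = "\<lambda>n. h n * norm x"])
         (use step h tendsto_mult_right[OF h0, of "norm x"] in auto)
    from tendsto_diff[OF tendsto_const[of "norm (A x - s *\<^sub>R x)"] this] show ?thesis by simp
  qed
  ultimately have "norm (A x - s *\<^sub>R x) = sqrt (\<integral>t. (t - s)\<^sup>2 \<partial>mu x)"
    by (rule LIMSEQ_unique[rotated])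
  then show ?thesis by simp
qed

lemma integrable_minus_square:
  assumes x: "x \<in> K" shows "integrable (mu x) (\<lambda>t. (t - s)\<^sup>2)"
proof -
  interpret finite_measure "mu x" using x by (rule finite_mu)
  have "integrable (mu x) (\<lambda>t. t\<^sup>2 - 2 * s * t + s\<^sup>2)"
    using integrable_square_mu[OF x] integrable_id_mu[OF x] by auto
  then show ?thesis by (simp add: power2_diff algebra_simps)
qed

text \<open>The source of the lower bounds that exclude a point from a spectrum: the spectral
  measure of \<open>x\<close> keeps the distance \<open>\<delta>\<close> from
  \<open>s\<close>.\<close>

lemma bounded_below_off_interval:
  assumes x: "x \<in> K" and \<delta>: "0 \<le> \<delta>" and F: "F {s - \<delta> <..< s + \<delta>} x = 0"
  shows "\<delta> * norm x \<le> norm (A x - s *\<^sub>R x)"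
proof (rule power2_le_imp_le)
  interpret finite_measure "mu x" using x by (rule finite_mu)
  have "emeasure (mu x) {s - \<delta> <..< s + \<delta>} = 0"
    using emeasure_mu[OF x, of "{s - \<delta> <..< s + \<delta>}"] F by simp
  then have "AE t in mu x. t \<notin> {s - \<delta> <..< s + \<delta>}" by (intro AE_not_in) (auto simp: null_sets_def)
  then have ae: "AE t in mu x. \<delta>\<^sup>2 \<le> (t - s)\<^sup>2"
  proof eventually_elim
    case (elim t)
    then have "\<delta> \<le> \<bar>t - s\<bar>" by auto
    then show ?case using \<delta> by (simp add: abs_le_square_iff[symmetric])
  qed
  have "(\<delta> * norm x)\<^sup>2 = (\<integral>t. \<delta>\<^sup>2 \<partial>mu x)"
    using measure_mu[OF x, of UNIV] F_UNIV[OF x] by (simp add: power_mult_distrib mult.commute)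
  also have "\<dots> \<le> (\<integral>t. (t - s)\<^sup>2 \<partial>mu x)"
    using integrable_minus_square[OF x] ae by (intro integral_mono_AE) auto
  finally show "(\<delta> * norm x)\<^sup>2 \<le> (norm (A x - s *\<^sub>R x))\<^sup>2" by (simp add: norm_A_minus[OF x])
qed simp

text \<open>\<open>J\<close> plays the role of multiplication by the imaginary unit.\<close>

lemma resolvent_poisson_integral:
  assumes J: "\<And>x. x \<in> K \<Longrightarrow> J x \<in> K" "\<And>x. norm (J x) = norm x" "\<And>x y. inner (J x) y = - inner x (J y)"
    "linear J" "\<And>x. A (J x) = J (A x)" "\<And>B x. B \<in> sets borel \<Longrightarrow> x \<in> K \<Longrightarrow> F B (J x) = J (F B x)"
    and u: "u \<in> K" and \<eta>: "0 < \<eta>" and x: "x = (A u - s *\<^sub>R u) - \<eta> *\<^sub>R J u"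
  shows "(\<integral>\<^sup>+t. ennreal (1 / ((t - s)\<^sup>2 + \<eta>\<^sup>2)) \<partial>mu x) = ennreal ((norm u)\<^sup>2)"
proof -
  define w where "w t = (t - s)\<^sup>2 + \<eta>\<^sup>2" for t
  have w [measurable]: "w \<in> borel_measurable borel" unfolding w_def by measurable
  have w_pos: "0 < w t" for t using \<eta> by (simp add: w_def add_nonneg_pos)
  have Au: "A u - s *\<^sub>R u \<in> K" using A(2)[OF u] u K(1) by (simp add: subspace_diff subspace_scale)
  have xK: "x \<in> K" unfolding x using Au J(1)[OF u] K(1) by (simp add: subspace_diff subspace_scale)
  have Jlin: "J (a - b) = J a - J b" "J (c *\<^sub>R a) = c *\<^sub>R J a" for a b c
    using J(4) by (simp_all add: linear_diff linear_scale)
  \<comment> \<open>As \<open>A\<close> is symmetric and commutes with the antisymmetric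
    \<open>J\<close>, the vector \<open>A y - s y\<close> is orthogonal to \<open>J y\<close>; this
    is the Pythagorean identity behind the weight \<open>w\<close>.\<close>
  have orth: "(norm ((A y - s *\<^sub>R y) - \<eta> *\<^sub>R J y))\<^sup>2 = (norm (A y - s *\<^sub>R y))\<^sup>2 + \<eta>\<^sup>2 * (norm y)\<^sup>2" for y
  proof -
    have "inner (A y - s *\<^sub>R y) (J y) = - inner (J (A y - s *\<^sub>R y)) y" by (simp add: J(3))
    also have "\<dots> = - inner (A (J y) - s *\<^sub>R J y) y" by (simp add: Jlin J(5))
    also have "\<dots> = - inner (J y) (A y - s *\<^sub>R y)" by (simp add: inner_diff_left inner_diff_right A_sym)
    finally have 0: "inner (A y - s *\<^sub>R y) (J y) = 0" by (simp add: inner_commute)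
    have "(norm ((A y - s *\<^sub>R y) - \<eta> *\<^sub>R J y))\<^sup>2
        = (norm (A y - s *\<^sub>R y))\<^sup>2 - 2 * \<eta> * inner (A y - s *\<^sub>R y) (J y) + \<eta>\<^sup>2 * (norm (J y))\<^sup>2"
      unfolding power2_norm_eq_inner
      by (simp add: inner_diff_left inner_diff_right inner_commute power2_eq_square algebra_simps)
    then show ?thesis by (simp add: 0 J(2))
  qed
  \<comment> \<open>Since \<open>x\<close> is the image of \<open>u\<close> under the operator with
    symbol \<open>t - s - \<i> \<eta>\<close>, its measure has density \<open>w\<close> with respect
    to that of \<open>u\<close>; dividing by \<open>w\<close> returns the total mass of
    \<open>mu u\<close>.\<close>
  have meas: "emeasure (mu x) B = (\<integral>\<^sup>+t. ennreal (w t) * indicator B t \<partial>mu u)" if B: "B \<in> sets borel" for B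
  proof -
    have Bu: "F B u \<in> K" using F_in[OF B u] .
    interpret finite_measure "mu u" using u by (rule finite_mu)
    have iw: "integrable (mu u) w"
      unfolding w_def using integrable_minus_square[OF u] by simp
    have "F B x = (A (F B u) - s *\<^sub>R F B u) - \<eta> *\<^sub>R J (F B u)"
      unfolding x using Au J(1)[OF u] A(2)[OF u] u K(1) F_commute[OF B u] J(6)[OF B u]
      by (simp add: F_diff[OF B] F_scale[OF B] subspace_scale)
    then have "(norm (F B x))\<^sup>2 = (\<integral>t. (t - s)\<^sup>2 \<partial>mu (F B u)) + \<eta>\<^sup>2 * (norm (F B u))\<^sup>2"
      by (simp add: orth norm_A_minus[OF Bu])
    also have "\<dots> = (\<integral>t. indicat_real B t * (t - s)\<^sup>2 \<partial>mu u) + \<eta>\<^sup>2 * (\<integral>t. indicat_real B t \<partial>mu u)"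
      using B by (simp add: integral_mu_F[OF u B] measure_mu[OF u B])
    also have "\<dots> = (\<integral>t. indicat_real B t * w t \<partial>mu u)"
      using B integrable_real_mult_indicator[of B "mu u", OF _ integrable_minus_square[OF u]]
      by (simp add: w_def distrib_left mult.commute emeasure_finite less_top[symmetric])
    finally have "emeasure (mu x) B = ennreal (\<integral>t. indicat_real B t * w t \<partial>mu u)"
      using emeasure_mu[OF xK B] by simp
    also have "\<dots> = (\<integral>\<^sup>+t. ennreal (indicat_real B t * w t) \<partial>mu u)"
      using B iw w_pos integrable_real_mult_indicator[of B "mu u" w]
      by (intro nn_integral_eq_integral[symmetric]) (auto simp: mult.commute less_imp_le)
    also have "\<dots> = (\<integral>\<^sup>+t. ennreal (w t) * indicator B t \<partial>mu u)"
      by (intro nn_integral_cong) (auto simp: indicator_def)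
    finally show ?thesis .
  qed
  have "mu x = density (mu u) (\<lambda>t. ennreal (w t))"
    by (rule measure_eqI) (auto simp: emeasure_density meas)
  then have "(\<integral>\<^sup>+t. ennreal (1 / w t) \<partial>mu x) = (\<integral>\<^sup>+t. ennreal (w t) * ennreal (1 / w t) \<partial>mu u)"
    by (simp add: nn_integral_density)
  also have "\<dots> = (\<integral>\<^sup>+t. 1 \<partial>mu u)"
    using w_pos by (intro nn_integral_cong) (simp add: less_imp_le order_less_imp_not_eq2 flip: ennreal_mult')
  also have "\<dots> = ennreal ((norm u)\<^sup>2)"
    using emeasure_mu[OF u, of UNIV] F_UNIV[OF u] by simp
  finally show ?thesis by (simp add: w_def)
qed

end

section \<open>Spectral types of bounded self-adjoint operators on square-summable functions\<close>

definition supported :: "'i set \<Rightarrow> 'i l2 set" where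
  "supported G = {x. \<forall>i. i \<notin> G \<longrightarrow> l2_fun x i = 0}"

lemma supported_subspace: "subspace (supported G)"
  by (auto simp: subspace_def supported_def)

lemma scaleC_supported: "x \<in> supported G \<Longrightarrow> scaleC c x \<in> supported G"
  by (auto simp: supported_def)

lemma bounded_linear_l2_fun: "bounded_linear (\<lambda>x. l2_fun x i)"
  by (rule bounded_linear_intro[of _ 1]) (auto simp: cmod_l2_fun_le scaleR_conv_of_real)

lemma supported_closed: "closed (supported (G :: 'a set))"
proof -
  have "supported G = (\<Inter>i\<in>-G. {x :: 'a l2. l2_fun x i = 0})" by (auto simp: supported_def)
  moreover have "closed {x :: 'a l2. l2_fun x i = 0}" for i
    by (intro closed_Collect_eq continuous_on_const bounded_linear.continuous_on[OF bounded_linear_l2_fun] continuous_on_id)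
  ultimately show ?thesis by (simp only:) (rule closed_INT, simp)
qed

lemma infsum_supported:
  "(\<And>i. i \<notin> G \<Longrightarrow> f i = 0) \<Longrightarrow> infsum f G = infsum f UNIV"
  by (rule infsum_cong_neutral) auto

lemma ell2_eq: "ell2 G = l2_fun ` supported G"
proof (intro equalityI subsetI)
  fix f assume f: "f \<in> ell2 G"
  have "(\<lambda>i. (cmod (f i))\<^sup>2) summable_on UNIV"
    using f by (subst summable_on_cong_neutral[where T = G]) (auto simp: ell2_def)
  then have "l2_fun (L2 f) = f" by (simp add: L2_inverse)
  then show "f \<in> l2_fun ` supported G"
    using f by (intro image_eqI[of _ _ "L2 f"]) (auto simp: supported_def ell2_def)
qed (auto simp: ell2_def supported_def l2_fun_summable)

lemma L2_l2_fun [simp]: "L2 (l2_fun x) = x"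
  by (rule l2_fun_inverse)

lemma l2_fun_L2_ell2: "f \<in> ell2 G \<Longrightarrow> l2_fun (L2 f) = f \<and> L2 f \<in> supported G"
  by (auto simp: ell2_eq)

lemma ell2_inner_l2: "x \<in> supported G \<or> y \<in> supported G \<Longrightarrow> ell2_inner G (l2_fun x) (l2_fun y) = cinner x y"
  unfolding ell2_inner_def cinner.rep_eq by (rule infsum_supported) (auto simp: supported_def)

lemma ell2_norm_l2: "x \<in> supported G \<Longrightarrow> ell2_norm G (l2_fun x) = norm x"
proof -
  assume "x \<in> supported G"
  then have "(\<Sum>\<^sub>\<infinity>i\<in>G. (cmod (l2_fun x i))\<^sup>2) = (norm x)\<^sup>2"
    unfolding norm_l2_square by (intro infsum_supported) (auto simp: supported_def)
  then show ?thesis by (simp add: ell2_norm_def)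
qed

lemma Re_cinner: "Re (cinner x y) = inner x y"
  by (simp add: inner_l2_def)

lift_definition delta :: "'i \<Rightarrow> 'i l2" is "\<lambda>i j. if j = i then 1 else 0"
  by (rule summable_on_cong_neutral[THEN iffD1, of UNIV "{_}", rotated -1]) auto

lemma cinner_delta: "cinner (delta i) x = l2_fun x i"
proof -
  have "cinner (delta i) x = (\<Sum>\<^sub>\<infinity>j\<in>{i}. l2_fun x j)"
    unfolding cinner.rep_eq delta.rep_eq by (rule infsum_cong_neutral) auto
  then show ?thesis by simp
qed

lemma delta_supported: "i \<in> G \<Longrightarrow> delta i \<in> supported G"
  by (auto simp: supported_def delta.rep_eq)

locale ell2_operator =
  fixes G :: "'i set" and T :: "'i l2 \<Rightarrow> 'i l2" and t :: "'i op"
  assumes T: "bounded_linear T" "\<And>x. x \<in> supported G \<Longrightarrow> T x \<in> supported G"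
    and T_sym: "inner (T x) y = inner x (T y)"
    and T_scaleC: "T (scaleC c x) = scaleC c (T x)"
    and t: "x \<in> supported G \<Longrightarrow> t (l2_fun x) = l2_fun (T x)"
begin

lemma cinner_T: "cinner x (T x) = complex_of_real (inner x (T x))"
proof -
  have "inner (scaleC \<i> x) (T x) = - inner (scaleC \<i> x) (T x)"
  proof -
    have "inner (scaleC \<i> x) (T x) = inner (T (scaleC \<i> x)) x" by (simp only: T_sym)
    also have "\<dots> = inner (T x) (scaleC (- \<i>) x)" by (simp add: T_scaleC inner_scaleC)
    also have "scaleC (- \<i>) x = - scaleC \<i> x" by (rule l2_eqI) simp
    finally show ?thesis by (simp add: inner_commute)
  qed
  then show ?thesis by (simp add: cinner_eq_inner complex_eq_iff)
qed

text \<open>Complex linearity and symmetry for the complex form follow because the projections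
  commute with every \<open>scaleC c\<close>, as \<open>T\<close> does; they preserve
  \<open>supported G\<close> because this closed subspace is invariant. The domain is everything
  since the measures have bounded support.\<close>

lemma spectral_resolution_exists: "\<exists>E. is_spectral_resolution G (ell2 G) t E"
proof -
  obtain F \<mu> R where
    \<mu>: "\<And>x. sets (\<mu> x) = sets borel" "\<And>x. finite_measure (\<mu> x)" "\<And>x. AE t in \<mu> x. \<bar>t\<bar> \<le> R"
    and inner_F: "\<And>x B. B \<in> sets borel \<Longrightarrow> inner x (F B x) = measure (\<mu> x) B"
    and form: "\<And>x. inner x (T x) = (\<integral>t. t \<partial>\<mu> x)"
    and lin: "\<And>B c x y. B \<in> sets borel \<Longrightarrow> F B (c *\<^sub>R x + y) = c *\<^sub>R F B x + F B y"
    and idem: "\<And>B x. B \<in> sets borel \<Longrightarrow> F B (F B x) = F B x"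
    and sym: "\<And>B x y. B \<in> sets borel \<Longrightarrow> inner (F B x) y = inner x (F B y)"
    and univ: "\<And>x. F UNIV x = x"
    and sums: "\<And>B x. range B \<subseteq> sets borel \<Longrightarrow> disjoint_family B \<Longrightarrow>
          (\<lambda>N. norm ((\<Sum>n<N. F (B n) x) - F (\<Union>n. B n) x)) \<longlonglongrightarrow> 0"
    and comm: "\<And>B S x. B \<in> sets borel \<Longrightarrow> bounded_linear S \<Longrightarrow> \<forall>x. T (S x) = S (T x) \<Longrightarrow> F B (S x) = S (F B x)"
    and inv: "\<And>B K x. B \<in> sets borel \<Longrightarrow> subspace K \<Longrightarrow> closed K \<Longrightarrow> \<forall>x\<in>K. T x \<in> K \<Longrightarrow> x \<in> K
          \<Longrightarrow> F B x \<in> K"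
    by (rule bounded_spectral_resolution[OF T(1) T_sym]) (rule that, assumption+)
  have F_in: "F B x \<in> supported G" if "B \<in> sets borel" "x \<in> supported G" for B x
    using inv[OF that(1) supported_subspace supported_closed _ that(2)] T(2) by blast
  have F_scaleC: "F B (scaleC c x) = scaleC c (F B x)" if "B \<in> sets borel" for B c x
    using comm[OF that bounded_linear_scaleC] T_scaleC by simp
  have F_clin: "F B (scaleC c x + y) = scaleC c (F B x) + F B y" if B: "B \<in> sets borel" for B c x y
    using lin[OF B, of 1 "scaleC c x" y] F_scaleC[OF B] by simp
  have csym: "cinner (F B x) y = cinner x (F B y)" if B: "B \<in> sets borel" for B x y
    using sym[OF B] F_scaleC[OF B, symmetric] by (simp add: cinner_eq_inner)
  define E where "E B f = l2_fun (F B (L2 f))" for B f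
  have E: "E B (l2_fun x) = l2_fun (F B x)" for B x by (simp add: E_def)
  have orth: "orthogonal_projection G (E B)" if B: "B \<in> sets borel" for B
    unfolding orthogonal_projection_def
  proof (intro conjI ballI allI)
    fix f assume "f \<in> ell2 G"
    then obtain x where x: "x \<in> supported G" "f = l2_fun x" by (auto simp: ell2_eq)
    show "E B f \<in> ell2 G" "E B (E B f) = E B f"
      using F_in[OF B x(1)] by (auto simp: x(2) E ell2_eq idem[OF B])
    fix g assume "g \<in> ell2 G"
    then obtain y where y: "y \<in> supported G" "g = l2_fun y" by (auto simp: ell2_eq)
    show "ell2_inner G (E B f) g = ell2_inner G f (E B g)"
      using x y by (simp add: E ell2_inner_l2 csym[OF B])
    fix c
    have "(\<lambda>i. c * f i + g i) = l2_fun (scaleC c x + y)" by (auto simp: x y)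
    then show "E B (\<lambda>i. c * f i + g i) = (\<lambda>i. c * E B f i + E B g i)"
      by (simp only: x y E F_clin[OF B]) auto
  qed
  have vm: "vector_measure G E (l2_fun x) = \<mu> x" if x: "x \<in> supported G" for x
  proof -
    have "vector_measure G E (l2_fun x) = measure_of UNIV (sets borel) (emeasure (\<mu> x))"
      unfolding vector_measure_def
    proof (rule measure_of_eq)
      fix B assume "B \<in> sigma_sets UNIV (sets (borel :: real measure))"
      then have B: "B \<in> sets borel" using sets.sigma_sets_eq[of "borel :: real measure"] by simp
      interpret finite_measure "\<mu> x" by (rule \<mu>)
      show "ennreal (Re (ell2_inner G (l2_fun x) (E B (l2_fun x)))) = emeasure (\<mu> x) B"
        using x by (simp add: E ell2_inner_l2 Re_cinner inner_F[OF B] emeasure_eq_measure)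
    qed simp
    also have "\<dots> = \<mu> x"
      using measure_of_of_measure[of "\<mu> x"] \<mu>(1)[of x] sets_eq_imp_space_eq[OF \<mu>(1)[of x]] by simp
    finally show ?thesis .
  qed
  have sq: "(\<integral>\<^sup>+s. ennreal (s\<^sup>2) \<partial>\<mu> x) < \<infinity>" for x
  proof -
    interpret finite_measure "\<mu> x" by (rule \<mu>)
    have "(\<integral>\<^sup>+s. ennreal (s\<^sup>2) \<partial>\<mu> x) \<le> (\<integral>\<^sup>+s. ennreal (R\<^sup>2) \<partial>\<mu> x)"
      using \<mu>(3)[of x] by (intro nn_integral_mono_AE) (auto elim!: eventually_mono intro!: ennreal_leI simp: abs_le_square_iff[symmetric])
    also have "\<dots> < \<infinity>" by (simp add: less_top[symmetric] emeasure_eq_measure ennreal_mult_eq_top_iff)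
    finally show ?thesis .
  qed
  have "is_spectral_resolution G (ell2 G) t E"
    unfolding is_spectral_resolution_def projection_valued_measure_def
  proof (intro conjI ballI allI impI orth)
    fix f assume "f \<in> ell2 G"
    then obtain x where x: "x \<in> supported G" "f = l2_fun x" by (auto simp: ell2_eq)
    show "E UNIV f = f" by (simp add: x E univ)
    show "t f \<in> ell2 G" using x T(2) by (auto simp: t ell2_eq)
    show "ell2_inner G f (t f) = complex_of_real (\<integral>x. x \<partial>vector_measure G E f)"
      using x T(2) by (simp add: t ell2_inner_l2 cinner_T vm form)
    fix C :: "nat \<Rightarrow> real set"
    assume C: "range C \<subseteq> sets borel" "disjoint_family C"
    have "ell2_norm G (\<lambda>i. (\<Sum>n<N. E (C n) f i) - E (\<Union>n. C n) f i)
        = norm ((\<Sum>n<N. F (C n) x) - F (\<Union>n. C n) x)" for N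
    proof -
      have fs: "l2_fun (\<Sum>n<N. F (C n) x) i = (\<Sum>n<N. l2_fun (F (C n) x) i)" for i
        by (induction N) auto
      have "(\<lambda>i. (\<Sum>n<N. E (C n) f i) - E (\<Union>n. C n) f i) = l2_fun ((\<Sum>n<N. F (C n) x) - F (\<Union>n. C n) x)"
        by (auto simp: x E fs)
      moreover have "(\<Sum>n<N. F (C n) x) - F (\<Union>n. C n) x \<in> supported G"
        using C F_in[OF _ x(1)] supported_subspace by (intro subspace_diff subspace_sum) auto
      ultimately show ?thesis by (simp add: ell2_norm_l2)
    qed
    then show "(\<lambda>N. ell2_norm G (\<lambda>i. (\<Sum>n<N. E (C n) f i) - E (\<Union>n. C n) f i)) \<longlonglongrightarrow> 0"
      using sums[OF C, of x] by simp
  next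
    show "ell2 G = {\<psi> \<in> ell2 G. (\<integral>\<^sup>+x. ennreal (x\<^sup>2) \<partial>vector_measure G E \<psi>) < \<infinity>}"
      using sq by (auto simp: ell2_eq vm)
  qed
  then show ?thesis by blast
qed

abbreviation "resolution \<equiv> spectral_resolution G (ell2 G) t"

text \<open>The projections of the chosen resolution itself, not those built in the existence proof,
  carried over to the Hilbert space type; the spectral subspaces are defined by them.\<close>

definition F :: "real set \<Rightarrow> 'i l2 \<Rightarrow> 'i l2" where
  "F B x = L2 (resolution B (l2_fun x))"

lemma resolution: "is_spectral_resolution G (ell2 G) t resolution"
  unfolding spectral_resolution_def using spectral_resolution_exists by (rule someI_ex)

lemma projection: "B \<in> sets borel \<Longrightarrow> orthogonal_projection G (resolution B)"
  using resolution by (auto simp: is_spectral_resolution_def projection_valued_measure_def)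

lemma
  assumes B: "B \<in> sets borel" and x: "x \<in> supported G"
  shows resolution_eq: "resolution B (l2_fun x) = l2_fun (F B x)" and F_in: "F B x \<in> supported G"
proof -
  have "resolution B (l2_fun x) \<in> ell2 G"
    using projection[OF B] x by (auto simp: orthogonal_projection_def ell2_eq)
  then show "resolution B (l2_fun x) = l2_fun (F B x)" "F B x \<in> supported G"
    by (auto simp: F_def l2_fun_L2_ell2)
qed

lemma F_clinear:
  assumes B: "B \<in> sets borel" and x: "x \<in> supported G" and y: "y \<in> supported G"
  shows "F B (scaleC c x + y) = scaleC c (F B x) + F B y"
proof -
  have "l2_fun (scaleC c x + y) = (\<lambda>i. c * l2_fun x i + l2_fun y i)" by auto
  then have "resolution B (l2_fun (scaleC c x + y))
      = (\<lambda>i. c * resolution B (l2_fun x) i + resolution B (l2_fun y) i)"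
    using projection[OF B] x y by (auto simp: orthogonal_projection_def ell2_eq)
  moreover have "scaleC c x + y \<in> supported G"
    using x y supported_subspace by (auto intro: subspace_add scaleC_supported)
  ultimately have "l2_fun (F B (scaleC c x + y)) = l2_fun (scaleC c (F B x) + F B y)"
    using resolution_eq[OF B] x y by auto
  then show ?thesis by (simp add: l2_fun_inject)
qed

lemma F_scaleC: "B \<in> sets borel \<Longrightarrow> x \<in> supported G \<Longrightarrow> F B (scaleC c x) = scaleC c (F B x)"
proof -
  assume B: "B \<in> sets borel" and x: "x \<in> supported G"
  have 0: "0 \<in> supported G" using supported_subspace by (rule subspace_0)
  have "F B 0 = 0" using F_clinear[OF B 0 0, of 1] by (simp add: scaleC_simps)
  then show ?thesis using F_clinear[OF B x 0, of c] by simp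
qed

lemma vector_measure_eq:
  assumes x: "x \<in> supported G"
  shows "vector_measure G resolution (l2_fun x) = form_measure F x"
  unfolding vector_measure_def form_measure_def
proof (rule measure_of_eq)
  fix B assume "B \<in> sigma_sets UNIV (sets (borel :: real measure))"
  then have B: "B \<in> sets borel" using sets.sigma_sets_eq[of "borel :: real measure"] by simp
  show "ennreal (Re (ell2_inner G (l2_fun x) (resolution B (l2_fun x)))) = ennreal (inner x (F B x))"
    using x by (simp add: resolution_eq[OF B x] ell2_inner_l2 Re_cinner)
qed simp

sublocale spectral_family "supported G" T F
proof (rule spectral_family.intro)
  fix B :: "real set" and x y :: "'i l2" and c :: real
  have ell2: "l2_fun x \<in> ell2 G" if "x \<in> supported G" for x using that by (simp add: ell2_eq)
  {
    assume B: "B \<in> sets borel" and x: "x \<in> supported G"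
    show "F B x \<in> supported G" by (rule F_in[OF B x])
    have "resolution B (resolution B (l2_fun x)) = resolution B (l2_fun x)"
      using projection[OF B] ell2[OF x] by (auto simp: orthogonal_projection_def)
    then show "F B (F B x) = F B x"
      using resolution_eq[OF B x] resolution_eq[OF B F_in[OF B x]] by (simp add: l2_fun_inject)
    assume y: "y \<in> supported G"
    show "F B (c *\<^sub>R x + y) = c *\<^sub>R F B x + F B y"
      using F_clinear[OF B x y, of "complex_of_real c"] by (simp add: scaleR_scaleC)
    have "ell2_inner G (resolution B (l2_fun x)) (l2_fun y) = ell2_inner G (l2_fun x) (resolution B (l2_fun y))"
      using projection[OF B] ell2 x y by (auto simp: orthogonal_projection_def)
    then have "cinner (F B x) y = cinner x (F B y)"
      using x y by (simp add: resolution_eq[OF B] ell2_inner_l2)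
    then show "inner (F B x) y = inner x (F B y)" by (simp add: inner_l2_def)
  }
  assume x: "x \<in> supported G"
  have "resolution UNIV (l2_fun x) = l2_fun x"
    using resolution ell2[OF x] by (auto simp: is_spectral_resolution_def projection_valued_measure_def)
  then show "F UNIV x = x" using resolution_eq[OF _ x, of UNIV] by (simp add: l2_fun_inject)
  have "ell2_inner G (l2_fun x) (t (l2_fun x)) = complex_of_real (\<integral>s. s \<partial>vector_measure G resolution (l2_fun x))"
    using resolution ell2[OF x] unfolding is_spectral_resolution_def by blast
  then show "inner x (T x) = (\<integral>s. s \<partial>form_measure F x)"
    using x by (simp add: t[OF x] ell2_inner_l2 cinner_T vector_measure_eq[OF x])
  have "l2_fun x \<in> {\<psi> \<in> ell2 G. (\<integral>\<^sup>+x. ennreal (x\<^sup>2) \<partial>vector_measure G resolution \<psi>) < \<infinity>}"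
    using resolution ell2[OF x] unfolding is_spectral_resolution_def by blast
  then show "(\<integral>\<^sup>+s. ennreal (s\<^sup>2) \<partial>form_measure F x) < \<infinity>"
    by (simp add: vector_measure_eq[OF x])
  fix C :: "nat \<Rightarrow> real set"
  assume C: "range C \<subseteq> sets borel" "disjoint_family C"
  have "ell2_norm G (\<lambda>i. (\<Sum>n<N. resolution (C n) (l2_fun x) i) - resolution (\<Union>n. C n) (l2_fun x) i)
      = norm ((\<Sum>n<N. F (C n) x) - F (\<Union>n. C n) x)" for N
  proof -
    have fs: "l2_fun (\<Sum>n<N. F (C n) x) i = (\<Sum>n<N. l2_fun (F (C n) x) i)" for i
      by (induction N) auto
    have "resolution (C n) (l2_fun x) = l2_fun (F (C n) x)" for n
      using C by (intro resolution_eq x) auto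
    moreover have "resolution (\<Union>n. C n) (l2_fun x) = l2_fun (F (\<Union>n. C n) x)"
      using C by (intro resolution_eq x) auto
    ultimately have "(\<lambda>i. (\<Sum>n<N. resolution (C n) (l2_fun x) i) - resolution (\<Union>n. C n) (l2_fun x) i)
        = l2_fun ((\<Sum>n<N. F (C n) x) - F (\<Union>n. C n) x)"
      by (auto simp: fs)
    moreover have "(\<Sum>n<N. F (C n) x) - F (\<Union>n. C n) x \<in> supported G"
      using C F_in[OF _ x] supported_subspace by (intro subspace_diff subspace_sum) auto
    ultimately show ?thesis by (simp add: ell2_norm_l2)
  qed
  moreover have "(\<lambda>N. ell2_norm G (\<lambda>i. (\<Sum>n<N. resolution (C n) (l2_fun x) i) - resolution (\<Union>n. C n) (l2_fun x) i)) \<longlonglongrightarrow> 0"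
    using resolution ell2[OF x] C unfolding is_spectral_resolution_def projection_valued_measure_def by blast
  ultimately show "(\<lambda>N. norm ((\<Sum>n<N. F (C n) x) - F (\<Union>n. C n) x)) \<longlonglongrightarrow> 0" by simp
qed (rule supported_subspace supported_closed T T_sym | assumption)+

text \<open>For a symmetric operator a lower bound for \<open>T - s\<close> on a closed invariant
  subspace already yields surjectivity there, because the operator is its own adjoint.\<close>

lemma not_in_spectrum_on:
  assumes L: "subspace L" "closed L" "L \<subseteq> supported G" "\<And>x. x \<in> L \<Longrightarrow> T x \<in> L"
    and \<delta>: "0 < \<delta>" "\<And>x. x \<in> L \<Longrightarrow> \<delta> * norm x \<le> norm (T x - s *\<^sub>R x)"
  shows "complex_of_real s \<notin> spectrum_on G (ell2 G) t (l2_fun ` L)"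
proof -
  let ?R = "\<lambda>x. T x - s *\<^sub>R x"
  have R: "(\<lambda>i. t (l2_fun x) i - complex_of_real s * l2_fun x i) = l2_fun (?R x)" if "x \<in> supported G" for x
    using t[OF that] by auto
  have bl: "bounded_linear ?R"
    by (intro bounded_linear_sub T(1) bounded_linear_scaleR_right)
  have RL: "?R x \<in> L" if "x \<in> L" for x
    using L(1,4) that by (simp add: subspace_diff subspace_scale)
  have surj: "\<exists>u\<in>L. ?R u = \<phi>" if "\<phi> \<in> L" for \<phi>
    by (rule solve_bounded_below[OF L(1,2) bl RL bl RL _ \<delta>(1,2,2) that])
       (auto simp: inner_diff_left inner_diff_right T_sym)
  have dom: "ell2 G \<inter> l2_fun ` L = l2_fun ` L" using L(3) by (auto simp: ell2_eq)
  have inj: "x = y" if "x \<in> L" "y \<in> L" "?R x = ?R y" for x y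
  proof -
    have "x - y \<in> L" using that L(1) by (simp add: subspace_diff)
    moreover have "?R (x - y) = 0" using that(3) by (simp add: A_simps algebra_simps)
    ultimately have "\<delta> * norm (x - y) \<le> 0" using \<delta>(2)[of "x - y"] by simp
    then show ?thesis using \<delta>(1) by (simp add: mult_le_0_iff)
  qed
  have "bij_betw (\<lambda>\<psi> i. t \<psi> i - complex_of_real s * \<psi> i) (l2_fun ` L) (l2_fun ` L)"
    unfolding bij_betw_def
  proof (intro conjI equalityI)
    show "inj_on (\<lambda>\<psi> i. t \<psi> i - complex_of_real s * \<psi> i) (l2_fun ` L)"
    proof (rule inj_onI)
      fix f g assume "f \<in> l2_fun ` L" "g \<in> l2_fun ` L"
        and eq: "(\<lambda>i. t f i - complex_of_real s * f i) = (\<lambda>i. t g i - complex_of_real s * g i)"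
      then obtain x y where xy: "x \<in> L" "f = l2_fun x" "y \<in> L" "g = l2_fun y" by auto
      then have xs: "x \<in> supported G" "y \<in> supported G" using L(3) by auto
      have "l2_fun (?R x) = (\<lambda>i. t (l2_fun x) i - complex_of_real s * l2_fun x i)"
        by (rule R[OF xs(1), symmetric])
      also have "\<dots> = (\<lambda>i. t (l2_fun y) i - complex_of_real s * l2_fun y i)"
        using eq unfolding xy .
      also have "\<dots> = l2_fun (?R y)" by (rule R[OF xs(2)])
      finally have "l2_fun (?R x) = l2_fun (?R y)" .
      then show "f = g" using inj[OF xy(1,3)] xy by (simp only: l2_fun_inject)
    qed
    show "(\<lambda>\<psi> i. t \<psi> i - complex_of_real s * \<psi> i) ` l2_fun ` L \<subseteq> l2_fun ` L"
      using R RL L(3) by (auto simp: image_image)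
    show "l2_fun ` L \<subseteq> (\<lambda>\<psi> i. t \<psi> i - complex_of_real s * \<psi> i) ` l2_fun ` L"
    proof
      fix f assume "f \<in> l2_fun ` L"
      then obtain \<phi> where \<phi>: "\<phi> \<in> L" "f = l2_fun \<phi>" by auto
      obtain u where u: "u \<in> L" "?R u = \<phi>" using surj[OF \<phi>(1)] by auto
      have "f = (\<lambda>i. t (l2_fun u) i - complex_of_real s * l2_fun u i)"
        using R[of u] u L(3) \<phi> by auto
      then show "f \<in> (\<lambda>\<psi> i. t \<psi> i - complex_of_real s * \<psi> i) ` l2_fun ` L"
        using u(1) by (intro image_eqI[of _ _ "l2_fun u"]) auto
    qed
  qed
  moreover have "\<forall>f\<in>l2_fun ` L. ell2_norm G f \<le> (1 / \<delta>) * ell2_norm G (\<lambda>i. t f i - complex_of_real s * f i)"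
  proof
    fix f assume "f \<in> l2_fun ` L"
    then obtain x where x: "x \<in> L" "f = l2_fun x" by auto
    have xs: "x \<in> supported G" "?R x \<in> supported G" using x(1) RL L(3) by auto
    have "ell2_norm G f = norm x" using x(2) xs by (simp add: ell2_norm_l2)
    moreover have "ell2_norm G (\<lambda>i. t f i - complex_of_real s * f i) = norm (?R x)"
      unfolding x(2) R[OF xs(1)] using xs(2) by (rule ell2_norm_l2)
    ultimately show "ell2_norm G f \<le> (1 / \<delta>) * ell2_norm G (\<lambda>i. t f i - complex_of_real s * f i)"
      using \<delta>(2)[OF x(1)] \<delta>(1) by (simp add: field_simps)
  qed
  ultimately show ?thesis unfolding spectrum_on_def dom by blast
qed

section \<open>The subspaces belonging to a spectral type\<close>

lemma F_tendsto:
  assumes B: "B \<in> sets borel" and X: "\<And>n. X n \<in> supported G" "X \<longlonglongrightarrow> x" and x: "x \<in> supported G"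
  shows "(\<lambda>n. F B (X n)) \<longlonglongrightarrow> F B x"
proof -
  have "(\<lambda>n. F B (X n) - F B x) \<longlonglongrightarrow> 0"
  proof (rule Lim_null_comparison)
    have "norm (F B (X n) - F B x) \<le> norm (X n - x)" for n
      using norm_F_le[OF B, of "X n - x"] F_diff[OF B X(1) x] X(1) x K(1)
      by (simp add: subspace_diff)
    then show "\<forall>\<^sub>F n in sequentially. norm (F B (X n) - F B x) \<le> norm (X n - x)" by simp
    show "(\<lambda>n. norm (X n - x)) \<longlonglongrightarrow> 0" using X(2) by (simp add: LIM_zero tendsto_norm_zero)
  qed
  then show ?thesis by (simp add: LIM_zero_iff)
qed

text \<open>Countable sets give the pure point subspace; Lebesgue null sets together with
  \<open>no_atoms\<close> give the singular continuous one. One argument then serves both.\<close>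

definition concentrated :: "real set set \<Rightarrow> 'i l2 set" where
  "concentrated \<N> = {x \<in> supported G. \<exists>C\<in>\<N>. F (- C) x = 0}"

lemma F_Compl_subset_0:
  assumes "x \<in> supported G" "C \<in> sets borel" "D \<in> sets borel" "C \<subseteq> D" "F (- C) x = 0"
  shows "F (- D) x = 0"
proof -
  have "F (- D) x = F (- D) (F (- C) x)"
    using F_Int[OF assms(1), of "- D" "- C"] assms by (simp add: borel_comp Compl_Un[symmetric] sup_absorb1)
  then show ?thesis using assms by (simp add: F_0 borel_comp)
qed

text \<open>Closure under countable unions is what makes the subspace closed: for a convergent
  sequence, the union of the carriers of its members carries the limit as well.\<close>

lemma
  assumes \<N>: "\<N> \<subseteq> sets borel" "{} \<in> \<N>" and UN: "\<And>C :: nat \<Rightarrow> real set. range C \<subseteq> \<N> \<Longrightarrow> (\<Union>n. C n) \<in> \<N>"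
  shows concentrated_subspace: "subspace (concentrated \<N>)"
    and concentrated_closed: "closed (concentrated \<N>)"
    and concentrated_invariant: "x \<in> concentrated \<N> \<Longrightarrow> T x \<in> concentrated \<N>"
proof -
  have Un: "C \<union> D \<in> \<N>" if "C \<in> \<N>" "D \<in> \<N>" for C D
    using UN[of "binaryset C D"] that \<N>(2) by (simp add: UN_binaryset_eq range_binaryset_eq)
  have bor: "C \<in> sets borel" "- C \<in> sets borel" if "C \<in> \<N>" for C
    using that \<N>(1) by (auto intro: borel_comp)
  show "subspace (concentrated \<N>)"
    unfolding subspace_def
  proof (intro conjI ballI allI)
    show "0 \<in> concentrated \<N>"
      using \<N>(2) K_0 by (auto simp: concentrated_def F_0 intro!: bexI[of _ "{}"])
    fix x y c assume x: "x \<in> concentrated \<N>" and y: "y \<in> concentrated \<N>"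
    obtain C where C: "C \<in> \<N>" "F (- C) x = 0" and xs: "x \<in> supported G" using x by (auto simp: concentrated_def)
    obtain D where D: "D \<in> \<N>" "F (- D) y = 0" and ys: "y \<in> supported G" using y by (auto simp: concentrated_def)
    have CD: "C \<union> D \<in> \<N>" using Un[OF C(1) D(1)] .
    have "F (- (C \<union> D)) x = 0"
      by (rule F_Compl_subset_0[OF xs bor(1)[OF C(1)] bor(1)[OF CD] _ C(2)]) auto
    moreover have "F (- (C \<union> D)) y = 0"
      by (rule F_Compl_subset_0[OF ys bor(1)[OF D(1)] bor(1)[OF CD] _ D(2)]) auto
    ultimately have "F (- (C \<union> D)) (x + y) = 0"
      using F_add[OF bor(2)[OF CD] xs ys] by simp
    then show "x + y \<in> concentrated \<N>"
      using CD subspace_add[OF K(1) xs ys] unfolding concentrated_def by blast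
    have "F (- C) (c *\<^sub>R x) = 0" using F_scale[OF bor(2)[OF C(1)] xs] C(2) by simp
    then show "c *\<^sub>R x \<in> concentrated \<N>"
      using C(1) xs K(1) unfolding concentrated_def by (auto simp: subspace_scale)
  qed
  show "closed (concentrated \<N>)"
    unfolding closed_sequential_limits
  proof (intro allI impI, elim conjE)
    fix X x assume X: "\<forall>n. X n \<in> concentrated \<N>" "X \<longlonglongrightarrow> x"
    then have Xs: "X n \<in> supported G" for n by (auto simp: concentrated_def)
    have xs: "x \<in> supported G"
      using closed_sequentially[OF K(2)] Xs X(2) by blast
    obtain C where C: "\<And>n. C n \<in> \<N>" "\<And>n. F (- C n) (X n) = 0"
      using X(1) unfolding concentrated_def by (simp, metis)
    have U: "(\<Union>n. C n) \<in> \<N>" using C(1) by (intro UN) auto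
    have "F (- (\<Union>n. C n)) (X n) = 0" for n
      by (rule F_Compl_subset_0[OF Xs bor(1)[OF C(1)] bor(1)[OF U] _ C(2)]) auto
    then have "(\<lambda>n. 0) \<longlonglongrightarrow> F (- (\<Union>n. C n)) x"
      using F_tendsto[OF bor(2)[OF U] Xs X(2) xs] by simp
    then have "F (- (\<Union>n. C n)) x = 0" by (simp add: LIMSEQ_const_iff)
    then show "x \<in> concentrated \<N>"
      using U xs unfolding concentrated_def by blast
  qed
  show "T x \<in> concentrated \<N>" if x: "x \<in> concentrated \<N>"
  proof -
    obtain C where C: "C \<in> \<N>" "F (- C) x = 0" and xs: "x \<in> supported G"
      using x by (auto simp: concentrated_def)
    then have "F (- C) (T x) = 0" using F_commute[OF bor(2)[OF C(1)] xs] by (simp add: A_simps)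
    then show ?thesis using C(1) T(2)[OF xs] by (auto simp: concentrated_def)
  qed
qed

definition no_atoms :: "'i l2 set" where
  "no_atoms = {x \<in> supported G. \<forall>s. F {s} x = 0}"

lemma
  shows no_atoms_subspace: "subspace no_atoms"
    and no_atoms_closed: "closed no_atoms"
    and no_atoms_invariant: "x \<in> no_atoms \<Longrightarrow> T x \<in> no_atoms"
proof -
  show "subspace no_atoms"
    using K(1)
    by (auto simp: subspace_def no_atoms_def F_0 F_add F_scale)
  show "closed no_atoms"
    unfolding closed_sequential_limits
  proof (intro allI impI, elim conjE)
    fix X x assume X: "\<forall>n. X n \<in> no_atoms" "X \<longlonglongrightarrow> x"
    then have Xs: "X n \<in> supported G" for n by (auto simp: no_atoms_def)
    have xs: "x \<in> supported G"
      using closed_sequentially[OF K(2)] Xs X(2) by blast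
    have "F {s} x = 0" for s
    proof -
      have "F {s} (X n) = 0" for n using X(1) by (simp add: no_atoms_def)
      then have "(\<lambda>n. 0) \<longlonglongrightarrow> F {s} x" using F_tendsto[OF _ Xs X(2) xs, of "{s}"] by simp
      then show ?thesis by (simp add: LIMSEQ_const_iff)
    qed
    then show "x \<in> no_atoms" using xs by (simp add: no_atoms_def)
  qed
  show "T x \<in> no_atoms" if "x \<in> no_atoms"
    using that T(2) F_commute[of "{_}" x] by (auto simp: no_atoms_def A_simps)
qed

lemma Collect_ell2: "{\<psi> \<in> ell2 G. Q \<psi>} = l2_fun ` {x \<in> supported G. Q (l2_fun x)}"
  by (auto simp: ell2_eq)

lemma spectral_measure_eq:
  "x \<in> supported G \<Longrightarrow> spectral_measure G (ell2 G) t (l2_fun x) = mu x"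
  unfolding spectral_measure_def by (rule vector_measure_eq)

lemma emeasure_mu_0: "x \<in> supported G \<Longrightarrow> B \<in> sets borel \<Longrightarrow> emeasure (mu x) B = 0 \<longleftrightarrow> F B x = 0"
  using emeasure_mu[of x B] by (simp add: ennreal_eq_0_iff)

lemma countable_borel: "countable C \<Longrightarrow> (C :: real set) \<in> sets borel"
  by (metis countable_imp_null_set_lborel null_setsD2 sets_lborel)

lemma pp_subspace_eq: "pp_subspace G (ell2 G) t = l2_fun ` concentrated {C. countable C}"
proof -
  have "pure_point_measure (mu x) \<longleftrightarrow> (\<exists>C\<in>{C. countable C}. F (- C) x = 0)" if "x \<in> supported G" for x
    using emeasure_mu_0[OF that] countable_borel unfolding pure_point_measure_def
    by (auto intro: borel_comp)
  then show ?thesis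
    unfolding pp_subspace_def Collect_ell2
    by (intro arg_cong[where f = "(`) l2_fun"]) (auto simp: spectral_measure_eq concentrated_def)
qed

lemma sc_subspace_eq: "sc_subspace G (ell2 G) t = l2_fun ` (no_atoms \<inter> concentrated (null_sets lborel))"
proof -
  have "singular_continuous_measure (mu x) \<longleftrightarrow>
      (\<forall>s. F {s} x = 0) \<and> (\<exists>C\<in>null_sets lborel. F (- C) x = 0)" if "x \<in> supported G" for x
    using emeasure_mu_0[OF that] unfolding singular_continuous_measure_def null_sets_def
    by (auto intro: borel_comp)
  then show ?thesis
    unfolding sc_subspace_def Collect_ell2
    by (intro arg_cong[where f = "(`) l2_fun"]) (auto simp: spectral_measure_eq concentrated_def no_atoms_def)
qed

lemma ac_subspace_eq:
  "ac_subspace G (ell2 G) t = l2_fun ` {x \<in> supported G. \<forall>N\<in>null_sets lborel. F N x = 0}"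
proof -
  have "absolutely_continuous lborel (mu x) \<longleftrightarrow> (\<forall>N\<in>null_sets lborel. F N x = 0)" if "x \<in> supported G" for x
    using emeasure_mu_0[OF that] unfolding absolutely_continuous_def null_sets_def by auto
  then show ?thesis
    unfolding ac_subspace_def Collect_ell2
    by (intro arg_cong[where f = "(`) l2_fun"]) (auto simp: spectral_measure_eq)
qed

context
  fixes l r :: real
  assumes ac: "\<And>N i. N \<in> null_sets lborel \<Longrightarrow> N \<subseteq> {l<..<r} \<Longrightarrow> i \<in> G \<Longrightarrow> F N (delta i) = 0"
begin

text \<open>The coordinates of \<open>F N x\<close> are inner products of \<open>x\<close> with the
  vectors \<open>F N (delta i)\<close>, so checking the basis vectors is enough. Real and imaginary
  parts are separated by letting the scalar be 1 and \<open>\<i>\<close>.\<close>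

lemma F_null:
  assumes N: "N \<in> null_sets lborel" "N \<subseteq> {l<..<r}" and x: "x \<in> supported G"
  shows "F N x = 0"
proof -
  have Nb: "N \<in> sets borel" using N(1) by auto
  have FN: "F N x \<in> supported G" using F_in[OF Nb x] .
  have "l2_fun (F N x) i = 0" for i
  proof (cases "i \<in> G")
    case True
    note d = delta_supported[OF True]
    have "inner (scaleC c (delta i)) (F N x) = 0" for c
    proof -
      have "inner (scaleC c (delta i)) (F N x) = inner (F N (scaleC c (delta i))) x"
        using F_sym[OF Nb scaleC_supported[OF d] x] by simp
      then show ?thesis
        using F_scaleC[OF Nb d] ac[OF N True] by (simp add: scaleC_simps)
    qed
    from this[of 1] this[of \<i>] have "cinner (delta i) (F N x) = 0"
      by (simp add: cinner_eq_inner scaleC_simps complex_eq_iff)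
    then show ?thesis by (simp add: cinner_delta)
  qed (use FN in \<open>auto simp: supported_def\<close>)
  then show ?thesis by (intro l2_eqI) simp
qed

text \<open>Near \<open>s\<close> such a vector has no spectral mass: the part in its null carrier
  is removed by \<open>F_null\<close>, the rest by concentration.\<close>

lemma concentrated_null_bounded_below:
  assumes s: "s \<in> {l<..<r}"
  shows "\<exists>\<delta>>0. \<forall>x\<in>concentrated (null_sets lborel). \<delta> * norm x \<le> norm (T x - s *\<^sub>R x)"
proof -
  define \<delta> where "\<delta> = min (s - l) (r - s)"
  have \<delta>: "0 < \<delta>" "{s - \<delta> <..< s + \<delta>} \<subseteq> {l<..<r}" using s by (auto simp: \<delta>_def)
  have "\<delta> * norm x \<le> norm (T x - s *\<^sub>R x)" if "x \<in> concentrated (null_sets lborel)" for x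
  proof -
    let ?J = "{s - \<delta> <..< s + \<delta>}"
    from that obtain C where C: "C \<in> null_sets lborel" "F (- C) x = 0" and x: "x \<in> supported G"
      by (auto simp: concentrated_def)
    then have [measurable]: "C \<in> sets borel" by auto
    have "F (?J \<inter> C) x = 0"
      using C(1) \<delta>(2) by (intro F_null x null_set_Int1) auto
    moreover have "F (?J \<inter> - C) x = 0"
      using F_Int[OF x, of ?J "- C"] C(2) by (simp add: F_0 borel_comp)
    ultimately have "F ?J x = 0"
      using F_Un[OF x, of "?J \<inter> C" "?J \<inter> - C"] by (simp add: Int_Un_distrib[symmetric] borel_comp)
    then show ?thesis using \<delta>(1) by (intro bounded_below_off_interval x) auto
  qed
  with \<delta>(1) show ?thesis by blast
qed

lemma not_in_spec_pp:
  assumes s: "s \<in> {l<..<r}" shows "complex_of_real s \<notin> spec_pp G (ell2 G) t"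
proof -
  let ?\<N> = "{C :: real set. countable C}"
  have \<N>: "?\<N> \<subseteq> sets borel" "{} \<in> ?\<N>" "\<And>C :: nat \<Rightarrow> real set. range C \<subseteq> ?\<N> \<Longrightarrow> (\<Union>n. C n) \<in> ?\<N>"
    using countable_borel by auto
  have "concentrated ?\<N> \<subseteq> concentrated (null_sets lborel)"
    by (auto simp: concentrated_def countable_imp_null_set_lborel)
  then obtain \<delta> where "\<delta> > 0" "\<forall>x\<in>concentrated ?\<N>. \<delta> * norm x \<le> norm (T x - s *\<^sub>R x)"
    using concentrated_null_bounded_below[OF s] by blast
  then show ?thesis
    unfolding spec_pp_def pp_subspace_eq
    using concentrated_subspace[OF \<N>] concentrated_closed[OF \<N>] concentrated_invariant[OF \<N>]
    by (intro not_in_spectrum_on) (auto simp: concentrated_def)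
qed

lemma not_in_spec_sc:
  assumes s: "s \<in> {l<..<r}" shows "complex_of_real s \<notin> spec_sc G (ell2 G) t"
proof -
  let ?\<N> = "null_sets lborel :: real set set"
  have \<N>: "?\<N> \<subseteq> sets borel" "{} \<in> ?\<N>" "\<And>C :: nat \<Rightarrow> real set. range C \<subseteq> ?\<N> \<Longrightarrow> (\<Union>n. C n) \<in> ?\<N>"
    by auto
  obtain \<delta> where "\<delta> > 0" "\<forall>x\<in>concentrated ?\<N>. \<delta> * norm x \<le> norm (T x - s *\<^sub>R x)"
    using concentrated_null_bounded_below[OF s] by blast
  then show ?thesis
    unfolding spec_sc_def sc_subspace_eq
    using concentrated_subspace[OF \<N>] concentrated_closed[OF \<N>] concentrated_invariant[OF \<N>]
      no_atoms_subspace no_atoms_closed no_atoms_invariant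
    by (intro not_in_spectrum_on) (auto intro!: subspace_inter closed_Int simp: no_atoms_def)
qed

text \<open>Outside the spectrum, the operator would be bounded below on the absolutely continuous
  subspace. Approximate eigenvectors at an inner point \<open>s'\<close> close to \<open>s\<close>
  split into a part near \<open>s'\<close>, which lies in that subspace and is small by this bound,
  and a far part, which is small anyway; this contradicts unit norm. Moving to \<open>s'\<close>
  admits the end points.\<close>

lemma in_spec_ac:
  assumes s: "s \<in> {l..r}" and lr: "l < r"
    and weyl: "\<And>s e. s \<in> {l<..<r} \<Longrightarrow> 0 < e \<Longrightarrow> \<exists>x\<in>supported G. norm x = 1 \<and> norm (T x - s *\<^sub>R x) < e"
  shows "complex_of_real s \<in> spec_ac G (ell2 G) t"
proof (rule ccontr)
  let ?L = "{x \<in> supported G. \<forall>N\<in>null_sets lborel. F N x = 0}"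
  assume "complex_of_real s \<notin> spec_ac G (ell2 G) t"
  then obtain C0 where C0: "\<forall>f\<in>ell2 G \<inter> l2_fun ` ?L.
      ell2_norm G f \<le> C0 * ell2_norm G (\<lambda>i. t f i - complex_of_real s * f i)"
    unfolding spec_ac_def spectrum_on_def ac_subspace_eq by auto
  define C where "C = max C0 1"
  have C: "C \<ge> 1" by (simp add: C_def)
  have bd: "norm y \<le> C * norm (T y - s *\<^sub>R y)" if y: "y \<in> ?L" for y
  proof -
    have ys: "y \<in> supported G" "T y - s *\<^sub>R y \<in> supported G"
      using y T(2) K(1) by (auto intro!: subspace_diff subspace_scale)
    have "(\<lambda>i. t (l2_fun y) i - complex_of_real s * l2_fun y i) = l2_fun (T y - s *\<^sub>R y)"
      using t[OF ys(1)] by auto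
    then have "norm y \<le> C0 * norm (T y - s *\<^sub>R y)"
      using C0[rule_format, of "l2_fun y"] y ys by (auto simp: ell2_eq ell2_norm_l2)
    also have "\<dots> \<le> C * norm (T y - s *\<^sub>R y)" by (intro mult_right_mono) (auto simp: C_def)
    finally show ?thesis .
  qed
  \<comment> \<open>The shift to \<open>s'\<close> must cost at most a quarter of
    \<open>norm y\<close> in the lower bound and must not leave the interval.\<close>
  define d where "d = min (1 / (4 * C)) ((r - l) / 2)"
  have d: "0 < d" using C lr by (simp add: d_def)
  have d': "d \<le> 1 / (4 * C)" "d \<le> (r - l) / 2" by (simp_all only: d_def min.cobounded1 min.cobounded2)
  define s' where "s' = (if s < (l + r) / 2 then s + d / 2 else s - d / 2)"
  have s': "s' \<in> {l<..<r}" "\<bar>s' - s\<bar> \<le> 1 / (4 * C)"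
  proof -
    show "s' \<in> {l<..<r}"
      using s d d'(2) unfolding s'_def by (cases "s < (l + r) / 2") (simp_all add: field_simps)
    show "\<bar>s' - s\<bar> \<le> 1 / (4 * C)" using d d'(1) by (simp add: s'_def)
  qed
  define \<delta> where "\<delta> = min (s' - l) (r - s')"
  have \<delta>: "0 < \<delta>" "{s' - \<delta> <..< s' + \<delta>} \<subseteq> {l<..<r}" using s' by (auto simp: \<delta>_def)
  let ?J = "{s' - \<delta> <..< s' + \<delta>}"
  \<comment> \<open>Chosen so that the bounds \<open>2 * C * e\<close> and
    \<open>e / \<delta>\<close> for the two parts add up to less than one.\<close>
  define e where "e = 1 / (2 * C + 2 / \<delta>)"
  have e: "0 < e" using C \<delta> by (simp add: e_def add_pos_pos)
  obtain x where x: "x \<in> supported G" "norm x = 1" "norm (T x - s' *\<^sub>R x) < e"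
    using weyl[OF s'(1) e] by blast
  define y where "y = F ?J x"
  define z where "z = F (- ?J) x"
  have J: "?J \<in> sets borel" "- ?J \<in> sets borel" by auto
  have R_F: "norm (T (F B x) - s' *\<^sub>R F B x) < e" if B: "B \<in> sets borel" for B
  proof -
    have "T (F B x) - s' *\<^sub>R F B x = F B (T x - s' *\<^sub>R x)"
      using F_commute[OF B x(1)] F_diff[OF B T(2)[OF x(1)], of "s' *\<^sub>R x"] F_scale[OF B x(1)]
        x(1) K(1) by (simp add: subspace_scale)
    moreover have "norm (F B (T x - s' *\<^sub>R x)) \<le> norm (T x - s' *\<^sub>R x)"
      using x(1) T(2) K(1) by (intro norm_F_le B) (auto intro!: subspace_diff subspace_scale)
    ultimately show ?thesis using x(3) by simp
  qed
  have "y \<in> ?L"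
  proof (intro CollectI conjI ballI)
    show "y \<in> supported G" unfolding y_def using F_in[OF J(1) x(1)] .
    fix N :: "real set" assume N: "N \<in> null_sets lborel"
    then have "N \<in> sets borel" by auto
    then have "F N y = F (N \<inter> ?J) x" unfolding y_def by (rule F_Int[OF x(1) _ J(1)])
    also have "\<dots> = 0" using N \<delta>(2) by (intro F_null x null_set_Int2) auto
    finally show "F N y = 0" .
  qed
  from bd[OF this] have "norm y \<le> C * norm (T y - s *\<^sub>R y)" .
  also have "\<dots> \<le> C * (norm (T y - s' *\<^sub>R y) + \<bar>s' - s\<bar> * norm y)"
  proof -
    have "T y - s *\<^sub>R y = (T y - s' *\<^sub>R y) + (s' - s) *\<^sub>R y" by (simp add: algebra_simps)
    then have "norm (T y - s *\<^sub>R y) \<le> norm (T y - s' *\<^sub>R y) + \<bar>s' - s\<bar> * norm y"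
      by (metis norm_triangle_ineq norm_scaleR)
    then show "C * norm (T y - s *\<^sub>R y) \<le> C * (norm (T y - s' *\<^sub>R y) + \<bar>s' - s\<bar> * norm y)"
      using C by (intro mult_left_mono) auto
  qed
  also have "\<dots> \<le> C * (e + 1 / (4 * C) * norm y)"
    using R_F[OF J(1)] s'(2) C by (intro mult_left_mono add_mono mult_right_mono) (auto simp: y_def)
  also have "\<dots> = C * e + norm y / 4" using C by (simp add: field_simps)
  finally have "norm y \<le> C * e + norm y / 4" .
  moreover have "0 < C * e" using C e by simp
  ultimately have ny: "norm y \<le> 2 * C * e" by linarith
  have "F ?J z = 0"
    unfolding z_def using F_disjoint[OF x(1) J] by auto
  then have "\<delta> * norm z \<le> norm (T z - s' *\<^sub>R z)"
    unfolding z_def using \<delta>(1) F_in[OF J(2) x(1)] by (intro bounded_below_off_interval) auto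
  also have "\<dots> < e" unfolding z_def by (rule R_F[OF J(2)])
  finally have nz: "norm z < e / \<delta>" using \<delta>(1) by (simp add: field_simps)
  have "x = y + z" using F_Compl[OF x(1) J(1)] by (simp add: y_def z_def)
  then have "1 \<le> norm y + norm z" using x(2) norm_triangle_ineq[of y z] by simp
  also have "\<dots> < 2 * C * e + e / \<delta>" using ny nz by simp
  also have "\<dots> \<le> (2 * C + 2 / \<delta>) * e" using e \<delta>(1) by (simp add: field_simps)
  also have "\<dots> = 1" using C \<delta>(1) by (simp add: e_def add_pos_pos order_less_imp_not_eq2)
  finally show False by simp
qed

end

end

section \<open>The strip operator\<close>

subsection \<open>Matrix norms\<close>

text \<open>The supremum in the norm is a real one and meaningful only for a bounded set; the sum of
  the moduli of the entries is a crude bound.\<close>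

lemma mat_norm_bdd_above:
  "bdd_above ((\<lambda>x :: nat \<Rightarrow> complex. L2_set (\<lambda>i. cmod (\<Sum>j\<in>{1..k}. A i j * x j)) {1..k})
     ` {x. L2_set (\<lambda>j. cmod (x j)) {1..k} \<le> 1})"
proof (rule bdd_aboveI2)
  fix x :: "nat \<Rightarrow> complex"
  assume "x \<in> {x. L2_set (\<lambda>j. cmod (x j)) {1..k} \<le> 1}"
  then have x: "cmod (x j) \<le> 1" if "j \<in> {1..k}" for j
    using member_le_L2_set[of "{1..k}" j "\<lambda>j. cmod (x j)"] that by auto
  have "L2_set (\<lambda>i. cmod (\<Sum>j\<in>{1..k}. A i j * x j)) {1..k} \<le> (\<Sum>i\<in>{1..k}. cmod (\<Sum>j\<in>{1..k}. A i j * x j))"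
    by (rule L2_set_le_sum) simp
  also have "\<dots> \<le> (\<Sum>i\<in>{1..k}. \<Sum>j\<in>{1..k}. cmod (A i j))"
    using x by (intro sum_mono sum_norm_le) (auto simp: norm_mult intro: mult_left_le)
  finally show "L2_set (\<lambda>i. cmod (\<Sum>j\<in>{1..k}. A i j * x j)) {1..k} \<le> (\<Sum>i\<in>{1..k}. \<Sum>j\<in>{1..k}. cmod (A i j))" .
qed

lemma mat_norm_upper:
  "L2_set (\<lambda>j. cmod (x j)) {1..k} \<le> 1 \<Longrightarrow>
    L2_set (\<lambda>i. cmod (\<Sum>j\<in>{1..k}. A i j * x j)) {1..k} \<le> mat_norm k A"
  unfolding mat_norm_def by (rule cSUP_upper[OF _ mat_norm_bdd_above]) simp

lemma mat_norm_nonneg: "0 \<le> mat_norm k A"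
  using mat_norm_upper[of "\<lambda>_. 0" k A] by (simp add: L2_set_def)

lemma mat_norm_apply:
  "L2_set (\<lambda>i. cmod (\<Sum>j\<in>{1..k}. A i j * x j)) {1..k} \<le> mat_norm k A * L2_set (\<lambda>j. cmod (x j)) {1..k}"
proof (cases "L2_set (\<lambda>j. cmod (x j)) {1..k} = 0")
  case True
  then have "x j = 0" if "j \<in> {1..k}" for j
    using that by (simp add: L2_set_eq_0_iff)
  then have "(\<Sum>j\<in>{1..k}. A i j * x j) = 0" for i by (intro sum.neutral) auto
  then show ?thesis using True by (simp add: L2_set_def)
next
  case False
  define r where "r = L2_set (\<lambda>j. cmod (x j)) {1..k}"
  have r: "0 < r" using False by (simp add: r_def L2_set_nonneg order_less_le)
  let ?y = "\<lambda>j. x j / complex_of_real r"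
  have "L2_set (\<lambda>j. cmod (?y j)) {1..k} = L2_set (\<lambda>j. (1 / r) * cmod (x j)) {1..k}"
    using r by (intro L2_set_cong refl) (simp add: norm_divide)
  also have "\<dots> = (1 / r) * r"
    using r by (subst L2_set_right_distrib[symmetric]) (auto simp: r_def)
  finally have "L2_set (\<lambda>i. cmod (\<Sum>j\<in>{1..k}. A i j * ?y j)) {1..k} \<le> mat_norm k A"
    using r by (intro mat_norm_upper) simp
  also have "L2_set (\<lambda>i. cmod (\<Sum>j\<in>{1..k}. A i j * ?y j)) {1..k}
      = L2_set (\<lambda>i. (1 / r) * cmod (\<Sum>j\<in>{1..k}. A i j * x j)) {1..k}"
    using r by (intro L2_set_cong refl) (simp add: norm_divide flip: sum_divide_distrib)
  also have "\<dots> = (1 / r) * L2_set (\<lambda>i. cmod (\<Sum>j\<in>{1..k}. A i j * x j)) {1..k}"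
    using r by (subst L2_set_right_distrib[symmetric]) auto
  finally show ?thesis using r by (simp add: field_simps r_def)
qed

lemma mat_norm_apply_square:
  "(\<Sum>i\<in>{1..k}. (cmod (\<Sum>j\<in>{1..k}. A i j * x j))\<^sup>2) \<le> (mat_norm k A)\<^sup>2 * (\<Sum>j\<in>{1..k}. (cmod (x j))\<^sup>2)"
proof -
  have "(L2_set (\<lambda>i. cmod (\<Sum>j\<in>{1..k}. A i j * x j)) {1..k})\<^sup>2
      \<le> (mat_norm k A * L2_set (\<lambda>j. cmod (x j)) {1..k})\<^sup>2"
    by (intro power_mono mat_norm_apply L2_set_nonneg)
  then show ?thesis by (simp add: L2_set_def power_mult_distrib sum_nonneg)
qed

lemma hermitian_form_swap:
  assumes "hermitian k A"
  shows "(\<Sum>j\<in>{1..k}. cnj (\<Sum>i\<in>{1..k}. A j i * x i) * y j) = (\<Sum>j\<in>{1..k}. cnj (x j) * (\<Sum>i\<in>{1..k}. A j i * y i))"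
proof -
  have "(\<Sum>j\<in>{1..k}. cnj (\<Sum>i\<in>{1..k}. A j i * x i) * y j)
      = (\<Sum>j\<in>{1..k}. \<Sum>i\<in>{1..k}. cnj (x i) * (A i j * y j))"
  proof (intro sum.cong refl)
    fix j assume j: "j \<in> {1..k}"
    have "cnj (A j i) = A i j" if "i \<in> {1..k}" for i
      using assms that j unfolding hermitian_def by (metis complex_cnj_cnj)
    then show "cnj (\<Sum>i\<in>{1..k}. A j i * x i) * y j = (\<Sum>i\<in>{1..k}. cnj (x i) * (A i j * y j))"
      unfolding cnj_sum sum_distrib_right complex_cnj_mult by (intro sum.cong refl) (simp only: mult_ac)
  qed
  also have "\<dots> = (\<Sum>i\<in>{1..k}. \<Sum>j\<in>{1..k}. cnj (x i) * (A i j * y j))" by (rule sum.swap)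
  finally show ?thesis by (simp add: sum_distrib_left)
qed

subsection \<open>The operator on the Hilbert space\<close>

lemma square_norm_sum4_le: "(cmod (- p - q + r + u))\<^sup>2 \<le> 4 * ((cmod p)\<^sup>2 + (cmod q)\<^sup>2 + (cmod r)\<^sup>2 + (cmod u)\<^sup>2)"
proof -
  have "(cmod (- p - q + r + u))\<^sup>2 \<le> 2 * (cmod (- p - q))\<^sup>2 + 2 * (cmod (r + u))\<^sup>2"
    using square_norm_add_le[of "- p - q" "r + u"] by (simp add: add.assoc)
  moreover have "(cmod (- p - q))\<^sup>2 \<le> 2 * (cmod p)\<^sup>2 + 2 * (cmod q)\<^sup>2"
    using square_norm_add_le[of "- p" "- q"] by simp
  ultimately show ?thesis using square_norm_add_le[of r u] by simp
qed

lemma sum_inj_le_norm_l2: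
  assumes "finite A" "inj_on h A"
  shows "(\<Sum>y\<in>A. (cmod (l2_fun x (h y)))\<^sup>2) \<le> (norm x)\<^sup>2"
  using sum_le_norm_l2[of "h ` A" x] assms by (simp add: sum.reindex)

text \<open>One realization of the potential, with a uniform bound \<open>B\<close>, which makes the
  operator bounded and everywhere defined.\<close>

locale strip =
  fixes s :: "nat \<Rightarrow> nat" and a :: "nat \<Rightarrow> real" and W :: "nat \<Rightarrow> nat \<Rightarrow> nat \<Rightarrow> complex"
    and A0 B :: real
  assumes s_pos: "0 < s n" and s_mono: "s n \<le> s (Suc n)"
    and a_bound: "1 \<le> j \<Longrightarrow> \<bar>a j\<bar> \<le> A0"
    and W_hermitian: "hermitian (s n) (W n)" and W_bound: "mat_norm (s n) (W n) \<le> B"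
begin

definition levels :: "nat \<Rightarrow> (nat \<times> nat) set" where
  "levels N = (SIGMA n:{..<N}. {1..s n})"

lemma finite_levels [simp]: "finite (levels N)"
  by (simp add: levels_def)

lemma levels_subset: "levels N \<subseteq> G1 s"
  by (auto simp: levels_def G1_def)

lemma sum_levels: "(\<Sum>x\<in>levels N. f x) = (\<Sum>n<N. \<Sum>j\<in>{1..s n}. f (n, j))"
  unfolding levels_def by (subst sum.Sigma) auto

lemma finite_subset_levels:
  assumes "finite S" shows "\<exists>N. S \<inter> G1 s \<subseteq> levels N"
proof -
  have "S \<inter> G1 s \<subseteq> levels (Suc (Max (insert 0 (fst ` S))))"
  proof
    fix x assume x: "x \<in> S \<inter> G1 s"
    then have "fst x \<le> Max (insert 0 (fst ` S))" using assms by (intro Max_ge) auto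
    then show "x \<in> levels (Suc (Max (insert 0 (fst ` S))))"
      using x by (auto simp: levels_def G1_def)
  qed
  then show ?thesis ..
qed

lemma sum_block_op_le:
  assumes "\<And>n. n \<in> I \<Longrightarrow> mat_norm (s n) (W n) \<le> C" "finite I" "0 \<le> C"
  shows "(\<Sum>n\<in>I. \<Sum>j\<in>{1..s n}. (cmod (block_op s W \<psi> (n, j)))\<^sup>2)
      \<le> C\<^sup>2 * (\<Sum>n\<in>I. \<Sum>j\<in>{1..s n}. (cmod (\<psi> (n, j)))\<^sup>2)"
proof -
  have "(\<Sum>j\<in>{1..s n}. (cmod (block_op s W \<psi> (n, j)))\<^sup>2) \<le> C\<^sup>2 * (\<Sum>j\<in>{1..s n}. (cmod (\<psi> (n, j)))\<^sup>2)"
    if "n \<in> I" for n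
  proof -
    have "(\<Sum>j\<in>{1..s n}. (cmod (block_op s W \<psi> (n, j)))\<^sup>2)
        = (\<Sum>j\<in>{1..s n}. (cmod (\<Sum>k\<in>{1..s n}. W n j k * \<psi> (n, k)))\<^sup>2)"
      by (intro sum.cong refl) (simp add: block_op_def G1_def)
    also have "\<dots> \<le> (mat_norm (s n) (W n))\<^sup>2 * (\<Sum>j\<in>{1..s n}. (cmod (\<psi> (n, j)))\<^sup>2)"
      by (rule mat_norm_apply_square)
    also have "\<dots> \<le> C\<^sup>2 * (\<Sum>j\<in>{1..s n}. (cmod (\<psi> (n, j)))\<^sup>2)"
      using assms(1)[OF that] by (intro mult_right_mono power_mono sum_nonneg mat_norm_nonneg) auto
    finally show ?thesis .
  qed
  then show ?thesis unfolding sum_distrib_left by (rule sum_mono)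
qed

lemma B_nonneg: "0 \<le> B"
  using mat_norm_nonneg W_bound order_trans by blast

definition C0 :: real where "C0 = sqrt (4 * (2 + A0\<^sup>2 + B\<^sup>2))"

lemma sum_H1_op_le:
  "(\<Sum>y\<in>levels N. (cmod (H1_op s a W (l2_fun x) y))\<^sup>2) \<le> (C0 * norm x)\<^sup>2"
proof -
  let ?\<psi> = "l2_fun x"
  let ?up = "\<lambda>(n, j). if n = 0 \<or> j > s (n - 1) then 0 else ?\<psi> (n - 1, j)"
  let ?down = "\<lambda>(n, j). ?\<psi> (n + 1, j)"
  let ?diag = "\<lambda>(n, j). complex_of_real (a j) * ?\<psi> (n, j)"
  let ?q = "\<lambda>f. \<Sum>y\<in>levels N. (cmod (f y))\<^sup>2"
  have "?q (H1_op s a W ?\<psi>) \<le> (\<Sum>y\<in>levels N. 4 * ((cmod (?up y))\<^sup>2 + (cmod (?down y))\<^sup>2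
      + (cmod (?diag y))\<^sup>2 + (cmod (block_op s W ?\<psi> y))\<^sup>2))"
  proof (rule sum_mono)
    fix y assume y: "y \<in> levels N"
    obtain n j where nj: "y = (n, j)" by (cases y)
    have "y \<in> G1 s" using y levels_subset by auto
    then have "H1_op s a W ?\<psi> y = - ?up y - ?down y + ?diag y + block_op s W ?\<psi> y"
      by (simp add: H1_op_def free_op_def nj)
    then show "(cmod (H1_op s a W ?\<psi> y))\<^sup>2 \<le> 4 * ((cmod (?up y))\<^sup>2 + (cmod (?down y))\<^sup>2
        + (cmod (?diag y))\<^sup>2 + (cmod (block_op s W ?\<psi> y))\<^sup>2)"
      by (simp only: square_norm_sum4_le)
  qed
  also have "\<dots> = 4 * (?q ?up + ?q ?down + ?q ?diag + ?q (block_op s W ?\<psi>))"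
    by (simp only: sum_distrib_left[symmetric] sum.distrib)
  also have "?q ?up \<le> (norm x)\<^sup>2"
  proof -
    let ?A = "{y \<in> levels N. fst y \<noteq> 0 \<and> snd y \<le> s (fst y - 1)}"
    have "?q ?up = (\<Sum>y\<in>?A. (cmod (?\<psi> (fst y - 1, snd y)))\<^sup>2)"
      by (rule sum.mono_neutral_cong_right) (auto split: if_splits)
    also have "\<dots> \<le> (norm x)\<^sup>2"
      by (rule sum_inj_le_norm_l2) (auto simp: inj_on_def)
    finally show ?thesis .
  qed
  also have "?q ?down \<le> (norm x)\<^sup>2"
    using sum_inj_le_norm_l2[of "levels N" "\<lambda>(n, j). (n + 1, j)" x]
    by (simp add: inj_on_def case_prod_unfold prod_eq_iff)
  also have "?q ?diag \<le> A0\<^sup>2 * (norm x)\<^sup>2"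
  proof -
    have "?q ?diag \<le> (\<Sum>y\<in>levels N. A0\<^sup>2 * (cmod (?\<psi> y))\<^sup>2)"
    proof (rule sum_mono)
      fix y assume "y \<in> levels N"
      then have "\<bar>a (snd y)\<bar> \<le> A0" by (intro a_bound) (auto simp: levels_def)
      then have "\<bar>a (snd y)\<bar>\<^sup>2 \<le> A0\<^sup>2" by (intro power_mono) auto
      then show "(cmod (?diag y))\<^sup>2 \<le> A0\<^sup>2 * (cmod (?\<psi> y))\<^sup>2"
        by (cases y) (simp add: norm_mult power_mult_distrib mult_right_mono)
    qed
    also have "\<dots> \<le> A0\<^sup>2 * (norm x)\<^sup>2"
      unfolding sum_distrib_left[symmetric] by (intro mult_left_mono sum_le_norm_l2) auto
    finally show ?thesis .
  qed
  also have "?q (block_op s W ?\<psi>) \<le> B\<^sup>2 * (norm x)\<^sup>2"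
  proof -
    have "?q (block_op s W ?\<psi>) \<le> B\<^sup>2 * (\<Sum>y\<in>levels N. (cmod (?\<psi> y))\<^sup>2)"
      unfolding sum_levels by (rule sum_block_op_le) (auto simp: W_bound B_nonneg)
    also have "\<dots> \<le> B\<^sup>2 * (norm x)\<^sup>2"
      by (intro mult_left_mono sum_le_norm_l2) auto
    finally show ?thesis .
  qed
  finally show ?thesis
    by (simp add: C0_def power_mult_distrib algebra_simps)
qed

lemma H1_op_outside: "y \<notin> G1 s \<Longrightarrow> H1_op s a W \<psi> y = 0"
  by (cases y) (simp add: H1_op_def free_op_def block_op_def)

lemma C0_nonneg: "0 \<le> C0" by (simp add: C0_def)

lemma sum_H1_op_le_finite:
  assumes "finite S"
  shows "(\<Sum>y\<in>S. (cmod (H1_op s a W (l2_fun x) y))\<^sup>2) \<le> (C0 * norm x)\<^sup>2"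
proof -
  obtain N where N: "S \<inter> G1 s \<subseteq> levels N" using finite_subset_levels[OF assms] ..
  have "(\<Sum>y\<in>S. (cmod (H1_op s a W (l2_fun x) y))\<^sup>2) = (\<Sum>y\<in>S \<inter> G1 s. (cmod (H1_op s a W (l2_fun x) y))\<^sup>2)"
    using assms by (intro sum.mono_neutral_right) (auto simp: H1_op_outside)
  also have "\<dots> \<le> (\<Sum>y\<in>levels N. (cmod (H1_op s a W (l2_fun x) y))\<^sup>2)"
    using N by (intro sum_mono2) auto
  also have "\<dots> \<le> (C0 * norm x)\<^sup>2" by (rule sum_H1_op_le)
  finally show ?thesis .
qed

section \<open>The bounded operator, Green's identity and symmetry\<close>

definition H :: "(nat \<times> nat) l2 \<Rightarrow> (nat \<times> nat) l2" where
  "H x = L2 (H1_op s a W (l2_fun x))"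

lemma l2_fun_H: "l2_fun (H x) = H1_op s a W (l2_fun x)"
  unfolding H_def
proof (rule L2_inverse, rule CollectI, rule nonneg_bdd_above_summable_on)
  show "bdd_above (sum (\<lambda>y. (cmod (H1_op s a W (l2_fun x) y))\<^sup>2) ` {F. F \<subseteq> UNIV \<and> finite F})"
    using sum_H1_op_le_finite[of _ x] by (intro bdd_aboveI2[where M = "(C0 * norm x)\<^sup>2"]) auto
qed simp

lemma norm_H_le: "norm (H x) \<le> C0 * norm x"
  using sum_H1_op_le_finite[of _ x] C0_nonneg by (intro norm_l2_le) (simp_all add: l2_fun_H)

lemma H_add: "H (x + y) = H x + H y"
proof (rule l2_eqI)
  fix p show "l2_fun (H (x + y)) p = l2_fun (H x + H y) p"
    by (cases p) (simp add: l2_fun_H H1_op_def free_op_def block_op_def algebra_simps sum.distrib)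
qed

lemma H_scaleC: "H (scaleC c x) = scaleC c (H x)"
proof (rule l2_eqI)
  fix p show "l2_fun (H (scaleC c x)) p = l2_fun (scaleC c (H x)) p"
    by (cases p) (simp add: l2_fun_H H1_op_def free_op_def block_op_def algebra_simps sum_distrib_left)
qed

lemma bounded_linear_H: "bounded_linear H"
  by (rule bounded_linear_intro[of _ C0])
     (simp_all only: H_add scaleR_scaleC H_scaleC norm_H_le mult.commute[of "norm _"])

text \<open>The Wronskian between the levels \<open>n\<close> and \<open>Suc n\<close>. Only
  channels up to \<open>s n\<close> enter, as a channel opening at \<open>Suc n\<close> is not
  coupled to level \<open>n\<close>.\<close>

definition boundary :: "nat \<Rightarrow> (nat \<times> nat \<Rightarrow> complex) \<Rightarrow> (nat \<times> nat \<Rightarrow> complex) \<Rightarrow> complex" where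
  "boundary n \<phi> \<psi> = (\<Sum>j\<in>{1..s n}. cnj (\<phi> (n, j)) * \<psi> (Suc n, j) - cnj (\<phi> (Suc n, j)) * \<psi> (n, j))"

text \<open>The diagonal and the Hermitian block cancel. Channels that open at level
  \<open>n\<close> have no coupling to the previous level, so the sum left over shrinks to the
  channels of level \<open>n - 1\<close>.\<close>

lemma green_level:
  "(\<Sum>j\<in>{1..s n}. cnj (H1_op s a W \<phi> (n, j)) * \<psi> (n, j) - cnj (\<phi> (n, j)) * H1_op s a W \<psi> (n, j))
    = boundary n \<phi> \<psi> - (if n = 0 then 0 else boundary (n - 1) \<phi> \<psi>)"
proof -
  define up where "up f j = (if n = 0 \<or> j > s (n - 1) then 0 else f (n - 1, j))"
    for f :: "nat \<times> nat \<Rightarrow> complex" and j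
  have op: "H1_op s a W f (n, j) = - up f j - f (Suc n, j) + complex_of_real (a j) * f (n, j)
      + (\<Sum>k\<in>{1..s n}. W n j k * f (n, k))" if "j \<in> {1..s n}" for f j
    using that by (simp add: H1_op_def free_op_def block_op_def G1_def up_def)
  have "(\<Sum>j\<in>{1..s n}. cnj (H1_op s a W \<phi> (n, j)) * \<psi> (n, j) - cnj (\<phi> (n, j)) * H1_op s a W \<psi> (n, j))
    = (\<Sum>j\<in>{1..s n}. (cnj (\<phi> (n, j)) * \<psi> (Suc n, j) - cnj (\<phi> (Suc n, j)) * \<psi> (n, j))
        - (cnj (up \<phi> j) * \<psi> (n, j) - cnj (\<phi> (n, j)) * up \<psi> j)
        + (cnj (\<Sum>k\<in>{1..s n}. W n j k * \<phi> (n, k)) * \<psi> (n, j)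
            - cnj (\<phi> (n, j)) * (\<Sum>k\<in>{1..s n}. W n j k * \<psi> (n, k))))"
    by (intro sum.cong refl) (simp only: op complex_cnj_add complex_cnj_diff complex_cnj_minus
        complex_cnj_mult complex_cnj_complex_of_real, simp add: algebra_simps)
  also have "\<dots> = boundary n \<phi> \<psi> - (\<Sum>j\<in>{1..s n}. cnj (up \<phi> j) * \<psi> (n, j) - cnj (\<phi> (n, j)) * up \<psi> j)"
    using hermitian_form_swap[OF W_hermitian, of n "\<lambda>k. \<phi> (n, k)" "\<lambda>k. \<psi> (n, k)"]
    by (simp only: sum.distrib sum_subtractf boundary_def, simp)
  also have "(\<Sum>j\<in>{1..s n}. cnj (up \<phi> j) * \<psi> (n, j) - cnj (\<phi> (n, j)) * up \<psi> j)
      = (if n = 0 then 0 else boundary (n - 1) \<phi> \<psi>)"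
  proof (cases n)
    case (Suc m)
    have "(\<Sum>j\<in>{1..s n}. cnj (up \<phi> j) * \<psi> (n, j) - cnj (\<phi> (n, j)) * up \<psi> j)
        = (\<Sum>j\<in>{1..s m}. cnj (\<phi> (m, j)) * \<psi> (Suc m, j) - cnj (\<phi> (Suc m, j)) * \<psi> (m, j))"
      using s_mono[of m] by (intro sum.mono_neutral_cong_right) (auto simp: up_def Suc)
    then show ?thesis by (simp add: boundary_def Suc)
  qed (simp add: up_def)
  finally show ?thesis .
qed

lemma green:
  "(\<Sum>y\<in>levels (Suc N). cnj (H1_op s a W \<phi> y) * \<psi> y - cnj (\<phi> y) * H1_op s a W \<psi> y) = boundary N \<phi> \<psi>"
proof (induction N)
  case 0
  show ?case using green_level[where n = 0] by (simp add: sum_levels)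
next
  case (Suc N)
  then show ?case
    using green_level[where n = "Suc N"] unfolding sum_levels sum.lessThan_Suc[of _ "Suc N"] by simp
qed

text \<open>Turns an unordered sum into a limit of sums over full levels, on which Green's identity
  telescopes.\<close>

lemma levels_tendsto:
  assumes "f summable_on UNIV" "\<And>y. y \<notin> G1 s \<Longrightarrow> f y = 0"
  shows "(\<lambda>N. \<Sum>y\<in>levels N. f y) \<longlonglongrightarrow> infsum f UNIV"
proof -
  have "(f has_sum infsum f UNIV) UNIV" using assms(1) by simp
  then have "(f has_sum infsum f UNIV) (G1 s)"
    using has_sum_cong_neutral[of "G1 s" UNIV f f] assms(2) by auto
  then have "(sum f \<longlongrightarrow> infsum f UNIV) (finite_subsets_at_top (G1 s))"
    by (simp add: has_sum_def)
  moreover have "filterlim levels (finite_subsets_at_top (G1 s)) sequentially"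
    unfolding filterlim_finite_subsets_at_top
  proof (intro allI impI)
    fix X assume X: "finite X \<and> X \<subseteq> G1 s"
    then obtain N where "X \<inter> G1 s \<subseteq> levels N" using finite_subset_levels by blast
    then have N: "X \<subseteq> levels N" using X by auto
    have "levels N \<subseteq> levels M" if "N \<le> M" for M using that by (auto simp: levels_def)
    with N have "finite (levels M) \<and> X \<subseteq> levels M \<and> levels M \<subseteq> G1 s" if "N \<le> M" for M
      using that levels_subset by auto
    then show "\<forall>\<^sub>F M in sequentially. finite (levels M) \<and> X \<subseteq> levels M \<and> levels M \<subseteq> G1 s"
      by (intro eventually_sequentiallyI[of N]) auto
  qed
  ultimately show ?thesis by (rule filterlim_compose)
qed

lemma level_mass_tendsto: "(\<lambda>n. \<Sum>j\<in>{1..s n}. (cmod (l2_fun x (n, j)))\<^sup>2) \<longlonglongrightarrow> 0"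
proof -
  let ?m = "\<lambda>n. \<Sum>j\<in>{1..s n}. (cmod (l2_fun x (n, j)))\<^sup>2"
  have "(\<Sum>n<N. ?m n) \<le> (norm x)\<^sup>2" for N
    using sum_le_norm_l2[OF finite_levels[of N], of x] by (simp add: sum_levels)
  then have "summable ?m"
    by (intro bounded_imp_summable[where B = "(norm x)\<^sup>2"])
       (simp_all only: sum_nonneg zero_le_power2 lessThan_Suc_atMost[symmetric])
  then show ?thesis by (rule summable_LIMSEQ_zero)
qed

text \<open>The level masses of a vector tend to zero, being the terms of a convergent series; hence
  no boundary term survives at infinity and the operator is symmetric.\<close>

lemma boundary_tendsto: "(\<lambda>n. boundary n (l2_fun x) (l2_fun y)) \<longlonglongrightarrow> 0"
proof (rule Lim_null_comparison)
  let ?m = "\<lambda>x n. \<Sum>j\<in>{1..s n}. (cmod (l2_fun x (n, j)))\<^sup>2"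
  have "norm (boundary n (l2_fun x) (l2_fun y)) \<le> ?m x n + ?m x (Suc n) + ?m y n + ?m y (Suc n)" for n
  proof -
    have le: "(\<Sum>j\<in>{1..s n}. (cmod (l2_fun z (Suc n, j)))\<^sup>2) \<le> ?m z (Suc n)" for z
      using s_mono[of n] by (intro sum_mono2) auto
    have "norm (boundary n (l2_fun x) (l2_fun y)) \<le> (\<Sum>j\<in>{1..s n}.
        (cmod (l2_fun x (n, j)))\<^sup>2 + (cmod (l2_fun x (Suc n, j)))\<^sup>2 + (cmod (l2_fun y (n, j)))\<^sup>2 + (cmod (l2_fun y (Suc n, j)))\<^sup>2)"
      unfolding boundary_def
    proof (rule sum_norm_le)
      fix j
      have ab: "cmod p * cmod q \<le> (cmod p)\<^sup>2 + (cmod q)\<^sup>2" for p q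
        using sum_squares_bound[of "cmod p" "cmod q"] mult_nonneg_nonneg[of "cmod p" "cmod q"]
        by (simp del: mult_nonneg_nonneg)
      show "norm (cnj (l2_fun x (n, j)) * l2_fun y (Suc n, j) - cnj (l2_fun x (Suc n, j)) * l2_fun y (n, j))
          \<le> (cmod (l2_fun x (n, j)))\<^sup>2 + (cmod (l2_fun x (Suc n, j)))\<^sup>2 + (cmod (l2_fun y (n, j)))\<^sup>2 + (cmod (l2_fun y (Suc n, j)))\<^sup>2"
        using norm_triangle_ineq4[of "cnj (l2_fun x (n, j)) * l2_fun y (Suc n, j)" "cnj (l2_fun x (Suc n, j)) * l2_fun y (n, j)"]
          ab[of "l2_fun x (n, j)" "l2_fun y (Suc n, j)"] ab[of "l2_fun x (Suc n, j)" "l2_fun y (n, j)"]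
        by (simp add: norm_mult)
    qed
    then show ?thesis using le[of x] le[of y] by (simp add: sum.distrib)
  qed
  then show "\<forall>\<^sub>F n in sequentially. norm (boundary n (l2_fun x) (l2_fun y)) \<le> ?m x n + ?m x (Suc n) + ?m y n + ?m y (Suc n)"
    by simp
  show "(\<lambda>n. ?m x n + ?m x (Suc n) + ?m y n + ?m y (Suc n)) \<longlonglongrightarrow> 0"
    using tendsto_add[OF tendsto_add[OF tendsto_add[OF level_mass_tendsto[of x] LIMSEQ_Suc[OF level_mass_tendsto[of x]]]
        level_mass_tendsto[of y]] LIMSEQ_Suc[OF level_mass_tendsto[of y]]] by simp
qed

lemma H_symmetric: "inner (H x) y = inner x (H y)"
proof -
  have sm: "(\<lambda>z. cnj (l2_fun u z) * l2_fun v z) summable_on UNIV" for u v :: "(nat \<times> nat) l2"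
    by (rule product_summable[OF l2_fun_summable l2_fun_summable])
  have 1: "(\<lambda>N. \<Sum>z\<in>levels N. cnj (l2_fun (H x) z) * l2_fun y z) \<longlonglongrightarrow> cinner (H x) y"
    unfolding cinner.rep_eq by (rule levels_tendsto[OF sm]) (simp add: l2_fun_H H1_op_outside)
  have 2: "(\<lambda>N. \<Sum>z\<in>levels N. cnj (l2_fun x z) * l2_fun (H y) z) \<longlonglongrightarrow> cinner x (H y)"
    unfolding cinner.rep_eq by (rule levels_tendsto[OF sm]) (simp add: l2_fun_H H1_op_outside)
  have "(\<lambda>N. (\<Sum>z\<in>levels (Suc N). cnj (l2_fun (H x) z) * l2_fun y z)
      - (\<Sum>z\<in>levels (Suc N). cnj (l2_fun x z) * l2_fun (H y) z)) \<longlonglongrightarrow> cinner (H x) y - cinner x (H y)"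
    by (intro tendsto_diff LIMSEQ_Suc[OF 1] LIMSEQ_Suc[OF 2])
  then have "(\<lambda>N. boundary N (l2_fun x) (l2_fun y)) \<longlonglongrightarrow> cinner (H x) y - cinner x (H y)"
    by (simp only: green[symmetric] l2_fun_H sum_subtractf)
  from LIMSEQ_unique[OF this boundary_tendsto] show ?thesis by (simp add: inner_l2_def)
qed

lemma H_supported: "H x \<in> supported (G1 s)"
  by (simp add: supported_def l2_fun_H H1_op_outside)

sublocale ell2_operator "G1 s" H "H1_op s a W"
  by (rule ell2_operator.intro)
     (simp_all only: bounded_linear_H H_supported H_symmetric H_scaleC l2_fun_H)

lemma H1_dom_eq: "H1_dom s a W = ell2 (G1 s)"
proof -
  have "H1_op s a W \<psi> \<in> ell2 (G1 s)" if "\<psi> \<in> ell2 (G1 s)" for \<psi>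
    using that H_supported by (auto simp: ell2_eq l2_fun_H[symmetric])
  then show ?thesis by (auto simp: H1_dom_def)
qed

text \<open>A truncated plane wave on the first channel, which is present at every level. Inside the
  window the free equation holds exactly; the four sites at its ends contribute a bounded defect,
  while the squared norm equals the length \<open>L\<close>.\<close>

lemma weyl_sequence:
  assumes l: "\<bar>l - a 1\<bar> \<le> 2" and W0: "(\<lambda>n. mat_norm (s n) (W n)) \<longlonglongrightarrow> 0" and e: "0 < e"
  shows "\<exists>x\<in>supported (G1 s). norm x = 1 \<and> norm (H x - l *\<^sub>R x) < e"
proof -
  define c where "c = (a 1 - l) / 2"
  \<comment> \<open>\<open>c\<close> is the cosine of the wave number, so \<open>\<omega>\<close> is
    a root of modulus one of \<open>\<omega>\<^sup>2 - 2 * c * \<omega> + 1 = 0\<close>, the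
    characteristic equation of the free recursion.\<close>
  define \<omega> where "\<omega> = Complex c (sqrt (1 - c\<^sup>2))"
  have c: "c\<^sup>2 \<le> 1" unfolding abs_square_le_1 c_def using l by simp
  have \<omega>: "cmod \<omega> = 1" using c by (simp add: \<omega>_def complex_norm)
  then have \<omega>0: "\<omega> \<noteq> 0" by auto
  have sum: "\<omega> + inverse \<omega> = complex_of_real (a 1 - l)"
  proof -
    have "inverse \<omega> = cnj \<omega>"
      by (rule inverse_unique) (use \<omega> complex_norm_square[of \<omega>] in simp)
    then have "\<omega> + inverse \<omega> = \<omega> + cnj \<omega>" by (simp only:)
    also have "\<dots> = complex_of_real (a 1 - l)" by (simp add: complex_eq_iff \<omega>_def c_def)
    finally show ?thesis .
  qed
  define \<epsilon> where "\<epsilon> = e / 4"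
  have \<epsilon>: "0 < \<epsilon>" using e by (simp add: \<epsilon>_def)
  obtain N0 where N0: "\<And>n. n \<ge> N0 \<Longrightarrow> mat_norm (s n) (W n) < \<epsilon>"
    using order_tendstoD(2)[OF W0 \<epsilon>] unfolding eventually_at_top_linorder by blast
  \<comment> \<open>Starting after \<open>N0\<close> makes the potential smaller than
    \<open>\<epsilon>\<close> throughout the window, and a positive \<open>N\<close> makes
    \<open>N - 1\<close> a genuine level.\<close>
  define N where "N = Suc N0"
  \<comment> \<open>The total squared error is \<open>8 + 2 * \<epsilon>\<^sup>2 * L\<close> with
    \<open>\<epsilon> = e / 4\<close>; any \<open>L\<close> above \<open>100 / e\<^sup>2\<close>
    keeps it below \<open>e\<^sup>2 * L\<close>. A length above two keeps the end sites
    apart.\<close>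
  obtain L where L: "real L > 2 + 100 / e\<^sup>2" using reals_Archimedean2 by blast
  have "100 / e\<^sup>2 > 0" using e by simp
  then have L2: "L > 2" using L by linarith
  define I where "I = {N..<N + L}"
  define f where "f p = (if snd p = 1 \<and> fst p \<in> I then \<omega> ^ fst p else 0)" for p :: "nat \<times> nat"
  have fin: "finite {p. f p \<noteq> 0}"
    by (rule finite_subset[of _ "I \<times> {1}"]) (auto simp: f_def I_def)
  have "(\<lambda>p. (cmod (f p))\<^sup>2) summable_on UNIV"
    using summable_on_finite[OF fin, of "\<lambda>p. (cmod (f p))\<^sup>2"]
      summable_on_cong_neutral[of "{p. f p \<noteq> 0}" UNIV "\<lambda>p. (cmod (f p))\<^sup>2" "\<lambda>p. (cmod (f p))\<^sup>2"] by auto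
  then have xf: "l2_fun (L2 f) = f" by (simp add: L2_inverse)
  define x where "x = L2 f"
  have lx: "l2_fun x = f" by (simp add: x_def xf)
  have nx: "(norm x)\<^sup>2 = real L"
  proof -
    have "(norm x)\<^sup>2 = (\<Sum>\<^sub>\<infinity>p\<in>I \<times> {1}. (cmod (f p))\<^sup>2)"
      unfolding norm_l2_square lx by (rule infsum_cong_neutral) (auto simp: f_def)
    also have "\<dots> = (\<Sum>p\<in>I \<times> {1}. (cmod (f p))\<^sup>2)" by (simp add: I_def)
    also have "\<dots> = (\<Sum>p\<in>I \<times> {1::nat}. 1)"
      by (intro sum.cong refl) (auto simp: f_def norm_power \<omega>)
    also have "\<dots> = real L" by (simp add: I_def)
    finally show ?thesis .
  qed
  have xs: "x \<in> supported (G1 s)"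
    using s_pos by (auto simp: supported_def lx f_def G1_def Suc_le_eq)
  define g where "g p = free_op s a f p - complex_of_real l * f p" for p
  define D where "D = {(N - 1, 1), (N, 1), (N + L - 1, 1), (N + L, 1::nat)}"
  have s1: "1 \<le> s n" for n using s_pos[of n] by simp
  have g: "cmod (g p) \<le> (if p \<in> D then 1 else 0)" for p
  proof (cases "snd p = 1")
    case False
    then show ?thesis by (cases p) (auto simp: g_def free_op_def f_def)
  next
    case True
    then obtain n where p: "p = (n, 1)" by (cases p) auto
    have G: "(n, 1) \<in> G1 s" using s1 by (simp add: G1_def)
    define h where "h k = (if k \<in> I then \<omega> ^ k else 0)" for k
    have gp: "g p = - (if n = 0 then 0 else h (n - 1)) - h (n + 1) + complex_of_real (a 1 - l) * h n"
      using G s1[of "n - 1"] by (simp add: g_def p free_op_def f_def h_def algebra_simps)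
    have rec: "- (\<omega> ^ k) - \<omega> ^ (k + 2) + complex_of_real (a 1 - l) * \<omega> ^ (k + 1) = 0" for k
    proof -
      have "(\<omega> + inverse \<omega>) * \<omega> = complex_of_real (a 1 - l) * \<omega>" by (simp only: sum)
      then have e: "\<omega> * \<omega> + 1 = complex_of_real (a 1 - l) * \<omega>"
        using \<omega>0 by (simp add: distrib_right)
      have quad: "complex_of_real (a 1 - l) * \<omega> - \<omega> * \<omega> - 1 = 0"
        by (simp only: e[symmetric]) simp
      have "- (\<omega> ^ k) - \<omega> ^ (k + 2) + complex_of_real (a 1 - l) * \<omega> ^ (k + 1)
          = \<omega> ^ k * (complex_of_real (a 1 - l) * \<omega> - \<omega> * \<omega> - 1)"
        by (simp add: right_diff_distrib mult_ac)
      then show ?thesis by (simp only: quad mult_zero_right)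
    qed
    have N1: "N \<ge> 1" by (simp add: N_def)
    consider "n + 1 < N" | "n + 1 = N" | "n = N" | "N < n" "n + 1 < N + L" | "n + 1 = N + L" | "n = N + L" | "n > N + L"
      by linarith
    then show ?thesis
    proof cases
      case 1
      then show ?thesis by (auto simp: gp h_def I_def)
    next
      case 2
      then have "g p = - (\<omega> ^ N)" using L2 by (auto simp: gp h_def I_def)
      then show ?thesis using 2 by (auto simp: D_def p norm_mult norm_power \<omega>)
    next
      case 3
      then have "g p = - (\<omega> ^ (N + 1)) + complex_of_real (a 1 - l) * \<omega> ^ N" using L2 by (auto simp: gp h_def I_def)
      also have "\<dots> = \<omega> ^ (N - 1)" using rec[of "N - 1"] N1 by (simp add: algebra_simps)
      finally show ?thesis using 3 by (auto simp: D_def p norm_mult norm_power \<omega>)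
    next
      case 4
      then have "g p = - (\<omega> ^ (n - 1)) - \<omega> ^ (n + 1) + complex_of_real (a 1 - l) * \<omega> ^ n"
        by (auto simp: gp h_def I_def)
      also have "\<dots> = 0" using rec[of "n - 1"] 4(1) by (simp add: algebra_simps)
      finally show ?thesis by auto
    next
      case 5
      then have "g p = - (\<omega> ^ (n - 1)) + complex_of_real (a 1 - l) * \<omega> ^ n" using L2 N1 by (auto simp: gp h_def I_def)
      also have "\<dots> = \<omega> ^ (n + 1)"
      proof -
        obtain k where k: "n = Suc k" using 5 L2 by (cases n) auto
        show ?thesis using rec[of k] by (simp add: k algebra_simps)
      qed
      finally show ?thesis using 5 by (auto simp: D_def p norm_mult norm_power \<omega>)
    next
      case 6
      then have "g p = - (\<omega> ^ (n - 1))" using L2 N1 by (auto simp: gp h_def I_def)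
      then show ?thesis using 6 by (auto simp: D_def p norm_mult norm_power \<omega>)
    next
      case 7
      then show ?thesis by (auto simp: gp h_def I_def)
    qed
  qed
  have gsum: "(\<Sum>p\<in>S. (cmod (g p))\<^sup>2) \<le> 4" if "finite S" for S
  proof -
    have "(\<Sum>p\<in>S. (cmod (g p))\<^sup>2) \<le> (\<Sum>p\<in>S. if p \<in> D then 1 else 0)"
    proof (rule sum_mono)
      fix p assume "p \<in> S"
      show "(cmod (g p))\<^sup>2 \<le> (if p \<in> D then 1 else 0)"
        using g[of p] by (cases "p \<in> D") (auto simp: power_le_one)
    qed
    also have "\<dots> = real (card (S \<inter> D))" using that by (simp add: sum.If_cases Int_def)
    also have "\<dots> \<le> real (card D)" by (intro of_nat_mono card_mono) (auto simp: D_def)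
    also have "\<dots> \<le> 4"
      unfolding D_def by (simp add: card_insert_if)
    finally show ?thesis .
  qed
  have b0: "block_op s W f (n, j) = 0" if "n < N" for n j
    using that by (simp add: block_op_def f_def I_def)
  have bsum: "(\<Sum>p\<in>levels M. (cmod (block_op s W f p))\<^sup>2) \<le> \<epsilon>\<^sup>2 * real L" for M
  proof -
    have "(\<Sum>p\<in>levels M. (cmod (block_op s W f p))\<^sup>2)
        = (\<Sum>n\<in>{..<M} \<inter> {N..}. \<Sum>j\<in>{1..s n}. (cmod (block_op s W f (n, j)))\<^sup>2)"
      unfolding sum_levels
    proof (rule sum.mono_neutral_right)
      show "\<forall>n\<in>{..<M} - {..<M} \<inter> {N..}. (\<Sum>j\<in>{1..s n}. (cmod (block_op s W f (n, j)))\<^sup>2) = 0"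
      proof
        fix n assume "n \<in> {..<M} - {..<M} \<inter> {N..}"
        then have "n < N" by auto
        then show "(\<Sum>j\<in>{1..s n}. (cmod (block_op s W f (n, j)))\<^sup>2) = 0" by (simp add: b0)
      qed
    qed auto
    also have "\<dots> \<le> \<epsilon>\<^sup>2 * (\<Sum>n\<in>{..<M} \<inter> {N..}. \<Sum>j\<in>{1..s n}. (cmod (f (n, j)))\<^sup>2)"
      using \<epsilon> N0 by (intro sum_block_op_le) (auto simp: N_def intro: less_imp_le)
    also have "\<dots> \<le> \<epsilon>\<^sup>2 * (\<Sum>n<M. \<Sum>j\<in>{1..s n}. (cmod (f (n, j)))\<^sup>2)"
      by (intro mult_left_mono sum_mono2) (auto intro: sum_nonneg)
    also have "\<dots> \<le> \<epsilon>\<^sup>2 * real L"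
      using sum_le_norm_l2[OF finite_levels[of M], of x] nx by (intro mult_left_mono) (simp_all add: sum_levels lx)
    finally show ?thesis .
  qed
  define C where "C = sqrt (8 + 2 * \<epsilon>\<^sup>2 * real L)"
  have C: "0 \<le> C" "C\<^sup>2 = 8 + 2 * \<epsilon>\<^sup>2 * real L" by (auto simp: C_def)
  have "norm (H x - l *\<^sub>R x) \<le> C"
  proof (rule norm_l2_le[OF _ C(1)])
    fix S :: "(nat \<times> nat) set" assume S: "finite S"
    obtain M where M: "S \<inter> G1 s \<subseteq> levels M" using finite_subset_levels[OF S] ..
    have eq: "l2_fun (H x - l *\<^sub>R x) p = g p + block_op s W f p" for p
      by (simp add: l2_fun_H lx H1_op_def g_def)
    have "(\<Sum>p\<in>S. (cmod (l2_fun (H x - l *\<^sub>R x) p))\<^sup>2)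
        \<le> (\<Sum>p\<in>S. 2 * (cmod (g p))\<^sup>2 + 2 * (cmod (block_op s W f p))\<^sup>2)"
      unfolding eq by (intro sum_mono square_norm_add_le)
    also have "\<dots> = 2 * (\<Sum>p\<in>S. (cmod (g p))\<^sup>2) + 2 * (\<Sum>p\<in>S. (cmod (block_op s W f p))\<^sup>2)"
      by (simp add: sum.distrib sum_distrib_left)
    also have "(\<Sum>p\<in>S. (cmod (block_op s W f p))\<^sup>2) = (\<Sum>p\<in>S \<inter> G1 s. (cmod (block_op s W f p))\<^sup>2)"
      using S by (intro sum.mono_neutral_right) (auto simp: block_op_def split: if_splits)
    also have "\<dots> \<le> (\<Sum>p\<in>levels M. (cmod (block_op s W f p))\<^sup>2)"
      using M by (intro sum_mono2) auto
    also have "\<dots> \<le> \<epsilon>\<^sup>2 * real L" by (rule bsum)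
    finally show "(\<Sum>p\<in>S. (cmod (l2_fun (H x - l *\<^sub>R x) p))\<^sup>2) \<le> C\<^sup>2"
      using gsum[OF S] by (simp add: C(2))
  qed
  moreover have "C < e * norm x"
  proof (rule power2_less_imp_less)
    have "100 / e\<^sup>2 < real L" using L by linarith
    then have "100 < real L * e\<^sup>2" using e by (simp add: pos_divide_less_eq)
    then have "8 + 2 * (e / 4)\<^sup>2 * real L < e\<^sup>2 * real L" by (simp add: power_divide field_simps)
    then show "C\<^sup>2 < (e * norm x)\<^sup>2" by (simp add: C(2) power_mult_distrib nx \<epsilon>_def)
  qed (use e in auto)
  ultimately have lt: "norm (H x - l *\<^sub>R x) < e * norm x" by simp
  have x0: "0 < norm x" using nx L2 by auto
  define y where "y = x /\<^sub>R norm x"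
  have Hy: "H y - l *\<^sub>R y = (H x - l *\<^sub>R x) /\<^sub>R norm x"
    by (simp add: y_def A_simps scaleR_diff_right)
  have "norm (H y - l *\<^sub>R y) = norm (H x - l *\<^sub>R x) / norm x"
    unfolding Hy using x0 by (simp add: divide_inverse mult.commute)
  then have "norm (H y - l *\<^sub>R y) < e"
    using lt x0 by (simp add: pos_divide_less_eq)
  moreover have "norm y = 1" using x0 by (simp add: y_def)
  moreover have "y \<in> supported (G1 s)" unfolding y_def using xs K(1) by (rule subspace_scale[rotated])
  ultimately show ?thesis by blast
qed

end

subsection \<open>A measure-theoretic criterion for absolute continuity\<close>

text \<open>Within \<open>1 / L\<close> of \<open>t\<close> the kernel is at least
  \<open>L / 2\<close>, and this interval has length \<open>2 / L\<close>, which already gives mass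
  one as soon as the interval lies in \<open>Y\<close>.\<close>

lemma poisson_kernel_lower:
  fixes t :: real
  assumes Y: "open Y" "t \<in> Y"
  shows "\<forall>\<^sub>F L in sequentially.
    1 \<le> (\<integral>\<^sup>+l. ennreal ((1 / real L) * (1 / ((t - l)\<^sup>2 + (1 / real L)\<^sup>2))) * indicator Y l \<partial>lborel)"
proof -
  obtain r where r: "0 < r" "ball t r \<subseteq> Y" using Y openE by blast
  obtain L0 where L0: "real L0 > 1 / r" using reals_Archimedean2 by blast
  have "1 \<le> (\<integral>\<^sup>+l. ennreal ((1 / real L) * (1 / ((t - l)\<^sup>2 + (1 / real L)\<^sup>2))) * indicator Y l \<partial>lborel)"
    if "L \<ge> L0" for L
  proof -
    have "1 / r < real L" using L0 that by linarith
    moreover have "0 < 1 / r" using r(1) by simp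
    ultimately have L0: "0 < real L" by linarith
    with \<open>1 / r < real L\<close> have L: "0 < real L" "1 / real L < r"
      using r(1) by (auto simp: divide_less_eq mult.commute)
    define I where "I = {t - 1 / real L<..<t + 1 / real L}"
    have I: "I \<subseteq> Y" using r(2) L by (auto simp: I_def dist_real_def intro!: subsetD[OF r(2)])
    have "(1 :: ennreal) = ennreal (real L / 2) * emeasure lborel I"
      using L by (simp add: I_def ennreal_mult'[symmetric])
    also have "\<dots> = (\<integral>\<^sup>+l. ennreal (real L / 2) * indicator I l \<partial>lborel)"
      by (simp add: nn_integral_cmult_indicator I_def)
    also have "\<dots> \<le> (\<integral>\<^sup>+l. ennreal ((1 / real L) * (1 / ((t - l)\<^sup>2 + (1 / real L)\<^sup>2))) * indicator Y l \<partial>lborel)"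
    proof (rule nn_integral_mono)
      fix l :: real
      show "ennreal (real L / 2) * indicator I l
          \<le> ennreal ((1 / real L) * (1 / ((t - l)\<^sup>2 + (1 / real L)\<^sup>2))) * indicator Y l"
      proof (cases "l \<in> I")
        case True
        then have "\<bar>t - l\<bar> \<le> 1 / real L" by (auto simp: I_def)
        then have "\<bar>t - l\<bar>\<^sup>2 \<le> (1 / real L)\<^sup>2" by (intro power_mono) auto
        then have le: "(t - l)\<^sup>2 + (1 / real L)\<^sup>2 \<le> 2 * (1 / real L)\<^sup>2" by simp
        have "real L / 2 = (1 / real L) * (1 / (2 * (1 / real L)\<^sup>2))"
          using L by (simp add: power2_eq_square)
        also have "\<dots> \<le> (1 / real L) * (1 / ((t - l)\<^sup>2 + (1 / real L)\<^sup>2))"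
          using le L by (intro mult_left_mono frac_le) (auto simp: add_nonneg_pos)
        finally show ?thesis using True I by (auto intro!: ennreal_leI)
      qed simp
    qed
    finally show ?thesis .
  qed
  then show ?thesis by (rule eventually_sequentiallyI)
qed

text \<open>Splitting at height \<open>k\<close> trades a mean value for a second moment; with
  \<open>k\<close> large this is uniform integrability in the form used below.\<close>

lemma le_add_square_div: "0 < k \<Longrightarrow> 0 \<le> w \<Longrightarrow> w \<le> k + w\<^sup>2 / (k :: real)"
proof (cases "w \<le> k")
  case False
  assume "0 < k" "0 \<le> w"
  with False have "w * k \<le> w * w" by (intro mult_left_mono) auto
  with \<open>0 < k\<close> have "w \<le> w\<^sup>2 / k" by (simp add: power2_eq_square pos_le_divide_eq)
  with \<open>0 < k\<close> show ?thesis by linarith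
qed (simp add: add_increasing2)

text \<open>On an open set \<open>Y\<close> the Poisson integrals dominate the measure and are
  dominated by the averages of \<open>w\<close>; splitting these at height \<open>k\<close> bounds
  the measure of \<open>Y\<close> by \<open>18 * k\<close> times its length plus
  \<open>9 * D / k\<close>. A null set is covered by open sets of small length after
  \<open>k\<close> has been fixed large.\<close>

lemma poisson_bound_imp_null:
  fixes \<mu> :: "real measure" and w :: "nat \<Rightarrow> real \<Rightarrow> real" and l r :: real
  assumes \<mu>: "finite_measure \<mu>" "sets \<mu> = sets borel"
    and w [measurable]: "\<And>m. w m \<in> borel_measurable borel" and w0: "\<And>m x. 0 \<le> w m x"
    and bound: "\<And>x L. x \<in> {l<..<r} \<Longrightarrow> 1 \<le> L \<Longrightarrow>
      ennreal (1 / real L) * (\<integral>\<^sup>+t. ennreal (1 / ((t - x)\<^sup>2 + (1 / real L)\<^sup>2)) \<partial>\<mu>)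
        \<le> ennreal (9 / real L * (\<Sum>m\<le>L. w m x))"
    and D: "\<exists>\<^sub>F L in sequentially.
      (\<integral>\<^sup>+x. ennreal (1 / real L * (\<Sum>m\<le>L. (w m x)\<^sup>2)) * indicator {l<..<r} x \<partial>lborel) \<le> ennreal D"
    and D0: "0 \<le> D"
    and N: "N \<in> null_sets lborel" "N \<subseteq> {l<..<r}"
  shows "emeasure \<mu> N = 0"
proof -
  interpret finite_measure \<mu> by fact
  note [measurable_cong] = \<mu>(2)
  interpret pair_sigma_finite \<mu> lborel ..
  have key: "emeasure \<mu> Y \<le> ennreal (18 * k) * emeasure lborel Y + ennreal (9 / k * D)"
    if Y: "open Y" "Y \<subseteq> {l<..<r}" and k: "0 < k" for Y k
  proof -
    define p where "p L t x = ennreal ((1 / real L) * (1 / ((t - x)\<^sup>2 + (1 / real L)\<^sup>2))) * indicator Y x" for L t x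
    have [measurable]: "Y \<in> sets borel" using Y(1) by auto
    have p_meas [measurable]: "case_prod (p L) \<in> borel_measurable (borel \<Otimes>\<^sub>M borel)" for L
      unfolding p_def by measurable
    have "emeasure \<mu> Y = (\<integral>\<^sup>+t. indicator Y t \<partial>\<mu>)" by (simp add: \<mu>(2))
    also have "\<dots> \<le> (\<integral>\<^sup>+t. liminf (\<lambda>L. \<integral>\<^sup>+x. p L t x \<partial>lborel) \<partial>\<mu>)"
    proof (rule nn_integral_mono)
      fix t
      show "indicator Y t \<le> liminf (\<lambda>L. \<integral>\<^sup>+x. p L t x \<partial>lborel)"
        using poisson_kernel_lower[OF Y(1), of t] unfolding p_def
        by (cases "t \<in> Y") (auto intro: Liminf_bounded)
    qed
    also have "\<dots> \<le> liminf (\<lambda>L. \<integral>\<^sup>+t. \<integral>\<^sup>+x. p L t x \<partial>lborel \<partial>\<mu>)"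
      by (rule nn_integral_liminf) (simp add: lborel.borel_measurable_nn_integral measurable_cong_sets[OF sets_pair_measure_cong[OF \<mu>(2) sets_lborel]])
    also have "\<dots> \<le> ennreal (18 * k) * emeasure lborel Y + ennreal (9 / k * D)"
    proof -
      have le: "(\<integral>\<^sup>+t. \<integral>\<^sup>+x. p L t x \<partial>lborel \<partial>\<mu>)
          \<le> ennreal (18 * k) * emeasure lborel Y + ennreal (9 / k) *
             (\<integral>\<^sup>+x. ennreal (1 / real L * (\<Sum>m\<le>L. (w m x)\<^sup>2)) * indicator {l<..<r} x \<partial>lborel)" if L: "1 \<le> L" for L
      proof -
        have "(\<integral>\<^sup>+t. \<integral>\<^sup>+x. p L t x \<partial>lborel \<partial>\<mu>) = (\<integral>\<^sup>+x. \<integral>\<^sup>+t. p L t x \<partial>\<mu> \<partial>lborel)"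
          by (rule Fubini'[symmetric]) measurable
        also have "\<dots> \<le> (\<integral>\<^sup>+x. ennreal (18 * k) * indicator Y x + ennreal (9 / k) *
            (ennreal (1 / real L * (\<Sum>m\<le>L. (w m x)\<^sup>2)) * indicator {l<..<r} x) \<partial>lborel)"
        proof (rule nn_integral_mono)
          fix x :: real
          show "(\<integral>\<^sup>+t. p L t x \<partial>\<mu>) \<le> ennreal (18 * k) * indicator Y x + ennreal (9 / k) *
            (ennreal (1 / real L * (\<Sum>m\<le>L. (w m x)\<^sup>2)) * indicator {l<..<r} x)"
          proof (cases "x \<in> Y")
            case True
            then have x: "x \<in> {l<..<r}" using Y(2) by auto
            have "(\<integral>\<^sup>+t. p L t x \<partial>\<mu>) = (\<integral>\<^sup>+t. ennreal (1 / real L) * ennreal (1 / ((t - x)\<^sup>2 + (1 / real L)\<^sup>2)) \<partial>\<mu>)"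
              using True by (intro nn_integral_cong) (simp add: p_def ennreal_mult'[symmetric])
            also have "\<dots> = ennreal (1 / real L) * (\<integral>\<^sup>+t. ennreal (1 / ((t - x)\<^sup>2 + (1 / real L)\<^sup>2)) \<partial>\<mu>)"
              by (rule nn_integral_cmult) measurable
            also have "\<dots> \<le> ennreal (9 / real L * (\<Sum>m\<le>L. w m x))" by (rule bound[OF x L])
            also have "9 / real L * (\<Sum>m\<le>L. w m x) \<le> 9 / real L * (\<Sum>m\<le>L. k + (w m x)\<^sup>2 / k)"
              by (intro mult_left_mono sum_mono le_add_square_div k w0) auto
            also have "\<dots> = 9 * (real L + 1) / real L * k + 9 / k * (1 / real L * (\<Sum>m\<le>L. (w m x)\<^sup>2))"
              using k L by (simp add: sum.distrib sum_divide_distrib[symmetric] field_simps)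
            \<comment> \<open>The sum has \<open>L + 1\<close> terms, which is at most twice
              \<open>L\<close>; hence 18 in place of 9.\<close>
            also have "9 * (real L + 1) / real L * k \<le> 18 * k"
              using k L by (intro mult_right_mono) (auto simp: field_simps)
            finally show ?thesis
              using True x k by (simp add: ennreal_leI sum_nonneg ennreal_plus[symmetric] ennreal_mult[symmetric] del: ennreal_plus)
          qed (simp add: p_def)
        qed
        also have "\<dots> = ennreal (18 * k) * emeasure lborel Y + ennreal (9 / k) *
             (\<integral>\<^sup>+x. ennreal (1 / real L * (\<Sum>m\<le>L. (w m x)\<^sup>2)) * indicator {l<..<r} x \<partial>lborel)"
          by (subst nn_integral_add) (auto simp: nn_integral_cmult_indicator nn_integral_cmult)
        finally show ?thesis .
      qed
      have "\<exists>\<^sub>F L in sequentially. (\<integral>\<^sup>+t. \<integral>\<^sup>+x. p L t x \<partial>lborel \<partial>\<mu>)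
          \<le> ennreal (18 * k) * emeasure lborel Y + ennreal (9 / k * D)"
      proof (rule frequently_elim1[OF frequently_eventually_frequently[OF D eventually_ge_at_top[of 1]]], elim conjE)
        fix L :: nat
        assume "(\<integral>\<^sup>+x. ennreal (1 / real L * (\<Sum>m\<le>L. (w m x)\<^sup>2)) * indicator {l<..<r} x \<partial>lborel) \<le> ennreal D"
          and L: "1 \<le> L"
        then have "ennreal (9 / k) * (\<integral>\<^sup>+x. ennreal (1 / real L * (\<Sum>m\<le>L. (w m x)\<^sup>2)) * indicator {l<..<r} x \<partial>lborel)
            \<le> ennreal (9 / k) * ennreal D" by (intro mult_left_mono) auto
        also have "\<dots> = ennreal (9 / k * D)" using k D0 by (simp add: ennreal_mult[symmetric])
        finally show "(\<integral>\<^sup>+t. \<integral>\<^sup>+x. p L t x \<partial>lborel \<partial>\<mu>)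
          \<le> ennreal (18 * k) * emeasure lborel Y + ennreal (9 / k * D)"
          using le[OF L] by (meson add_left_mono order_trans)
      qed
      note freq = this
      \<comment> \<open>The second moments are bounded only for infinitely many \<open>L\<close>.
        This is enough: a lower limit above the bound would put all late terms above it.\<close>
      show ?thesis
      proof (rule ccontr)
        assume "\<not> ?thesis"
        then have "ennreal (18 * k) * emeasure lborel Y + ennreal (9 / k * D)
            < liminf (\<lambda>L. \<integral>\<^sup>+t. \<integral>\<^sup>+x. p L t x \<partial>lborel \<partial>\<mu>)" by (simp only: not_le)
        from less_LiminfD[OF this] freq show False
          unfolding frequently_def by (simp add: not_le)
      qed
    qed
    finally show ?thesis .
  qed
  have N': "N \<in> sets lebesgue" using N(1) by auto
  have le: "measure \<mu> N \<le> e" if e: "0 < e" for e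
  proof -
    \<comment> \<open>\<open>k\<close> brings \<open>9 * D / k\<close> below \<open>e / 2\<close>,
      with \<open>D + 1\<close> keeping \<open>k\<close> positive; then \<open>d\<close> is matched
      to give \<open>18 * k * d = e / 2\<close>.\<close>
    define k where "k = 18 * (D + 1) / e"
    have k: "0 < k" "9 / k * D \<le> e / 2" using e D0 by (auto simp: k_def field_simps)
    define d where "d = e / (36 * k)"
    have d: "0 < d" "18 * k * d = e / 2" using e k by (auto simp: d_def)
    obtain U where U: "open U" "N \<subseteq> U" "U - N \<in> lmeasurable" "emeasure lebesgue (U - N) < ennreal d"
      by (rule sets_lebesgue_outer_open[OF N' d(1)])
    define Y where "Y = U \<inter> {l<..<r}"
    have Y: "open Y" "Y \<subseteq> {l<..<r}" "N \<subseteq> Y" using U N(2) by (auto simp: Y_def)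
    have "emeasure lborel Y \<le> emeasure lborel U" using U(1) by (intro emeasure_mono) (auto simp: Y_def)
    also have "\<dots> = emeasure lborel (U - N)"
      using N(1) U(1) by (intro emeasure_Diff_null_set[symmetric]) auto
    also have "\<dots> = emeasure lebesgue (U - N)"
    proof -
      have UN: "U - N \<in> sets lborel" using N(1) U(1) by auto
      show ?thesis
        unfolding emeasure_completion[OF sets_completionI_sets[OF UN]] main_part[OF UN] ..
    qed
    also have "\<dots> \<le> ennreal d" using U(4) by simp
    finally have dO: "emeasure lborel Y \<le> ennreal d" .
    have "emeasure \<mu> N \<le> emeasure \<mu> Y" using Y by (intro emeasure_mono) (auto simp: \<mu>(2))
    also have "\<dots> \<le> ennreal (18 * k) * emeasure lborel Y + ennreal (9 / k * D)" by (rule key[OF Y(1,2) k(1)])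
    also have "\<dots> \<le> ennreal (18 * k) * ennreal d + ennreal (e / 2)"
      using dO k by (intro add_mono mult_left_mono ennreal_leI) auto
    also have "\<dots> = ennreal e" using d k e by (simp add: ennreal_mult[symmetric] ennreal_plus[symmetric] del: ennreal_plus)
    finally show ?thesis using e by (simp add: emeasure_eq_measure)
  qed
  have "measure \<mu> N \<le> 0" by (rule field_le_epsilon) (use le in auto)
  then show ?thesis by (simp add: emeasure_eq_measure measure_le_0_iff)
qed

subsection \<open>Formal solutions and the Green function\<close>

text \<open>The formal solution of \<open>(H - l) v = \<delta>\<close> at the site \<open>(n0, j0)\<close> which vanishes on the levels up to \<open>n0\<close>
  and on every channel at the level where the channel opens; index \<open>m\<close> is the level \<open>n0 + m\<close>.\<close>

fun formal_solution ::
    "(nat \<Rightarrow> nat) \<Rightarrow> (nat \<Rightarrow> real) \<Rightarrow> (nat \<Rightarrow> nat \<Rightarrow> nat \<Rightarrow> complex) \<Rightarrow> nat \<Rightarrow> nat \<Rightarrow> real \<Rightarrow> nat \<Rightarrow> nat \<Rightarrow> complex"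
    where
  "formal_solution s a W n0 j0 l 0 j = 0"
| "formal_solution s a W n0 j0 l (Suc 0) j = (if j = j0 then - 1 else 0)"
| "formal_solution s a W n0 j0 l (Suc (Suc m)) j =
     (if j \<in> {1..s (n0 + Suc m)} then
        complex_of_real (a j - l) * formal_solution s a W n0 j0 l (Suc m) j
        + (\<Sum>k\<in>{1..s (n0 + Suc m)}. W (n0 + Suc m) j k * formal_solution s a W n0 j0 l (Suc m) k)
        - formal_solution s a W n0 j0 l m j
      else 0)"

definition solution_mass ::
    "(nat \<Rightarrow> nat) \<Rightarrow> (nat \<Rightarrow> real) \<Rightarrow> (nat \<Rightarrow> nat \<Rightarrow> nat \<Rightarrow> complex) \<Rightarrow> nat \<Rightarrow> nat \<Rightarrow> nat \<Rightarrow> real \<Rightarrow> real" where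
  "solution_mass s a W n0 j0 m l = (\<Sum>j\<in>{1..s (n0 + m)}. (cmod (formal_solution s a W n0 j0 l m j))\<^sup>2)"

lemma solution_mass_nonneg: "0 \<le> solution_mass s a W n0 j0 m l"
  by (simp add: solution_mass_def sum_nonneg)

text \<open>Only the potential on levels below \<open>n0 + m\<close> enters; this restriction is
  what later makes the solution a function of the past.\<close>

lemma formal_solution_measurable:
  assumes l [measurable]: "l \<in> borel_measurable M"
    and W: "\<And>i j k. i < n0 + m \<Longrightarrow> j \<in> {1..s i} \<Longrightarrow> k \<in> {1..s i} \<Longrightarrow> (\<lambda>x. W x i j k) \<in> borel_measurable M"
  shows "(\<lambda>x. formal_solution s a (W x) n0 j0 (l x) m j) \<in> borel_measurable M"
  using W
proof (induction m arbitrary: j rule: induct_nat_012)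
  case (ge2 m)
  have [measurable]: "(\<lambda>x. formal_solution s a (W x) n0 j0 (l x) (Suc m) j) \<in> borel_measurable M" for j
    using ge2.prems by (intro ge2.IH(2)) auto
  have [measurable]: "(\<lambda>x. formal_solution s a (W x) n0 j0 (l x) m j) \<in> borel_measurable M" for j
    using ge2.prems by (intro ge2.IH(1)) auto
  have W': "(\<lambda>x. W x (n0 + Suc m) j k) \<in> borel_measurable M"
    if "j \<in> {1..s (n0 + Suc m)}" "k \<in> {1..s (n0 + Suc m)}" for j k
    using ge2.prems that by auto
  show ?case
  proof (cases "j \<in> {1..s (n0 + Suc m)}")
    case True
    have [measurable]: "(\<lambda>x. \<Sum>k\<in>{1..s (n0 + Suc m)}. W x (n0 + Suc m) j k * formal_solution s a (W x) n0 j0 (l x) (Suc m) k)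
        \<in> borel_measurable M"
      by (intro borel_measurable_sum borel_measurable_times W'[OF True]) auto
    show ?thesis unfolding formal_solution.simps if_P[OF True] by measurable
  next
    case False
    then show ?thesis unfolding formal_solution.simps if_not_P[OF False] by simp
  qed
qed simp_all

lemma solution_mass_measurable [measurable]: "solution_mass s a W n0 j0 m \<in> borel_measurable borel"
proof -
  have [measurable]: "(\<lambda>l. formal_solution s a W n0 j0 l m j) \<in> borel_measurable borel" for j
    by (rule formal_solution_measurable[where W = "\<lambda>_. W"]) auto
  show ?thesis unfolding solution_mass_def by measurable
qed

context strip begin

context
  fixes n0 j0 :: nat and l :: real
  assumes site: "(n0, j0) \<in> G1 s"
begin

abbreviation "v \<equiv> formal_solution s a W n0 j0 l"

lemma s_le: "m \<le> n \<Longrightarrow> s m \<le> s n"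
  using s_mono by (rule lift_Suc_mono_le)

text \<open>The shift by one matters: at level \<open>n0 + Suc m\<close> the solution lives only on
  channels already open one level earlier, so it vanishes on every channel that opens there.\<close>

lemma v_support: "j \<notin> {1..s (n0 + m)} \<Longrightarrow> v (Suc m) j = 0"
  using site by (cases m) (auto simp: G1_def)

definition vx :: "nat \<times> nat \<Rightarrow> complex" where
  "vx p = (if fst p < n0 then 0 else v (fst p - n0) (snd p))"

lemma H1_vx:
  assumes p: "p \<in> G1 s"
  shows "H1_op s a W vx p = complex_of_real l * vx p + (if p = (n0, j0) then 1 else 0)"
proof -
  obtain n j where nj: "p = (n, j)" by (cases p)
  have j: "j \<in> {1..s n}" using p by (auto simp: nj G1_def)
  have op: "H1_op s a W vx p = - (if n = 0 \<or> j > s (n - 1) then 0 else vx (n - 1, j)) - vx (Suc n, j)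
      + complex_of_real (a j) * vx (n, j) + (\<Sum>k\<in>{1..s n}. W n j k * vx (n, k))"
    using p by (simp add: nj H1_op_def free_op_def block_op_def)
  consider "Suc n < n0" | "Suc n = n0" | "n = n0" | m where "n = n0 + Suc m"
    by (metis add_Suc_right less_imp_Suc_add linorder_neqE_nat Suc_lessI)
  then show ?thesis
  proof cases
    case 4
    \<comment> \<open>At an opening channel the operator drops the term from the previous level,
      whereas the recursion keeps it; both agree because \<open>v\<close> is zero there, the channel
      not being open yet.\<close>
    have up: "(if n = 0 \<or> j > s (n - 1) then 0 else vx (n - 1, j)) = v m j"
    proof (cases "j > s (n - 1)")
      case True
      have "v m j = 0"
      proof (cases m)
        case (Suc k)
        have "s (n0 + k) \<le> s (n - 1)" using 4 Suc by (intro s_le) simp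
        then show ?thesis using v_support[of j k] True Suc by auto
      qed simp
      then show ?thesis using True by simp
    qed (use 4 in \<open>simp add: vx_def\<close>)
    have "vx (Suc n, j) = v (Suc (Suc m)) j" using 4 by (simp add: vx_def del: formal_solution.simps)
    moreover have "vx (n, k) = v (Suc m) k" for k using 4 by (simp add: vx_def del: formal_solution.simps)
    moreover have "v (Suc (Suc m)) j = complex_of_real (a j - l) * v (Suc m) j
        + (\<Sum>k\<in>{1..s n}. W n j k * v (Suc m) k) - v m j"
      using j 4 by simp
    ultimately show ?thesis
      unfolding op up using 4 by (simp add: nj algebra_simps del: formal_solution.simps)
  qed (use j op[unfolded nj] in \<open>auto simp: vx_def nj\<close>)
qed

lemma l2_inner_bound:
  assumes "finite A"
  shows "(\<Sum>i\<in>A. cmod (f i) * cmod (g i)) \<le> sqrt (\<Sum>i\<in>A. (cmod (f i))\<^sup>2) * sqrt (\<Sum>i\<in>A. (cmod (g i))\<^sup>2)"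
  using L2_set_mult_ineq[of "\<lambda>i. cmod (f i)" "\<lambda>i. cmod (g i)" A] by (simp add: L2_set_def)

lemma sum_levels_vx:
  assumes "N \<le> n0 + Suc L"
  shows "(\<Sum>p\<in>levels N. (cmod (vx p))\<^sup>2) \<le> (\<Sum>m\<le>L. solution_mass s a W n0 j0 m l)"
proof -
  have "(\<Sum>p\<in>levels N. (cmod (vx p))\<^sup>2) \<le> (\<Sum>p\<in>levels (n0 + Suc L). (cmod (vx p))\<^sup>2)"
    using assms by (intro sum_mono2) (auto simp: levels_def)
  also have "\<dots> = (\<Sum>n\<in>{n0..<n0 + Suc L}. \<Sum>j\<in>{1..s n}. (cmod (vx (n, j)))\<^sup>2)"
    unfolding sum_levels by (rule sum.mono_neutral_right) (auto simp: vx_def)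
  also have "\<dots> = (\<Sum>m\<le>L. \<Sum>j\<in>{1..s (n0 + m)}. (cmod (vx (n0 + m, j)))\<^sup>2)"
    by (rule sum.reindex_bij_witness[of _ "\<lambda>m. n0 + m" "\<lambda>n. n - n0"]) auto
  also have "\<dots> = (\<Sum>m\<le>L. solution_mass s a W n0 j0 m l)"
    by (simp add: solution_mass_def vx_def)
  finally show ?thesis .
qed

text \<open>Green's identity on the levels up to \<open>n0 + m\<close> is averaged over \<open>m < L\<close>; with \<open>\<eta> = 1 / L\<close> all
  terms are controlled by the masses of \<open>v\<close> and the norm of \<open>u\<close>.\<close>

lemma resolvent_norm_bound:
  assumes L: "1 \<le> L" and u: "u \<in> supported (G1 s)"
    and eq: "H u - l *\<^sub>R u - (1 / real L) *\<^sub>R scaleC \<i> u = delta (n0, j0)"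
  shows "(1 / real L) * (norm u)\<^sup>2 \<le> 9 / real L * (\<Sum>m\<le>L. solution_mass s a W n0 j0 m l)"
proof -
  define \<eta> where "\<eta> = 1 / real L"
  have \<eta>: "0 < \<eta>" using L by (simp add: \<eta>_def)
  define \<psi> where "\<psi> = l2_fun u"
  define V where "V = (\<Sum>m\<le>L. solution_mass s a W n0 j0 m l)"
  have V0: "0 \<le> V" by (simp add: V_def sum_nonneg solution_mass_nonneg)
  define R where "R = sqrt V * norm u"
  have Hu: "H1_op s a W \<psi> p = (complex_of_real l + \<i> * complex_of_real \<eta>) * \<psi> p + (if p = (n0, j0) then 1 else 0)" for p
  proof -
    have "l2_fun (H u - l *\<^sub>R u - \<eta> *\<^sub>R scaleC \<i> u) p = l2_fun (delta (n0, j0)) p"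
      using eq by (simp add: \<eta>_def)
    then show ?thesis
      by (simp add: l2_fun_H delta.rep_eq \<psi>_def algebra_simps)
  qed
  \<comment> \<open>Cauchy-Schwarz along two injective relabellings of the sites, so that it serves
    the bulk sum and both shifted products in the boundary terms.\<close>
  have cs: "(\<Sum>p\<in>A. cmod (vx (h p)) * cmod (\<psi> (k p))) \<le> R"
    if A: "finite A" and h: "inj_on h A" "h ` A \<subseteq> levels (n0 + Suc L)" and k: "inj_on k A"
    for A :: "'b set" and h k
  proof -
    have "(\<Sum>p\<in>A. cmod (vx (h p)) * cmod (\<psi> (k p)))
        \<le> sqrt (\<Sum>p\<in>A. (cmod (vx (h p)))\<^sup>2) * sqrt (\<Sum>p\<in>A. (cmod (\<psi> (k p)))\<^sup>2)"
      by (rule l2_inner_bound[OF A])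
    also have "\<dots> \<le> sqrt V * sqrt ((norm u)\<^sup>2)"
    proof (intro mult_mono real_sqrt_le_mono)
      show "(\<Sum>p\<in>A. (cmod (vx (h p)))\<^sup>2) \<le> V"
    proof -
      have "(\<Sum>p\<in>A. (cmod (vx (h p)))\<^sup>2) = (\<Sum>p\<in>h ` A. (cmod (vx p))\<^sup>2)"
        using h(1) by (simp add: sum.reindex)
      also have "\<dots> \<le> (\<Sum>p\<in>levels (n0 + Suc L). (cmod (vx p))\<^sup>2)"
        using h(2) by (intro sum_mono2) auto
      also have "\<dots> \<le> V" unfolding V_def by (rule sum_levels_vx) simp
      finally show ?thesis .
      qed
      show "(\<Sum>p\<in>A. (cmod (\<psi> (k p)))\<^sup>2) \<le> (norm u)\<^sup>2"
        unfolding \<psi>_def by (rule sum_inj_le_norm_l2[OF A k])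
    qed (use V0 in \<open>auto intro: sum_nonneg\<close>)
    finally show ?thesis by (simp add: R_def)
  qed
  \<comment> \<open>The source of \<open>vx\<close> evaluates \<open>\<psi>\<close> at the site; the
    source of \<open>\<psi>\<close> contributes nothing, since \<open>vx\<close> vanishes
    there.\<close>
  have green: "\<psi> (n0, j0) = boundary N vx \<psi> + \<i> * complex_of_real \<eta> * (\<Sum>p\<in>levels (Suc N). cnj (vx p) * \<psi> p)"
    if N: "n0 \<le> N" for N
  proof -
    have x: "(n0, j0) \<in> levels (Suc N)" using site N by (auto simp: levels_def G1_def)
    have v0: "vx (n0, j0) = 0" by (simp add: vx_def)
    have "boundary N vx \<psi> = (\<Sum>p\<in>levels (Suc N). cnj (H1_op s a W vx p) * \<psi> p - cnj (vx p) * H1_op s a W \<psi> p)"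
      by (rule green[symmetric])
    also have "\<dots> = (\<Sum>p\<in>levels (Suc N). (if p = (n0, j0) then \<psi> p else 0)
        - \<i> * complex_of_real \<eta> * (cnj (vx p) * \<psi> p))"
    proof (intro sum.cong refl)
      fix p assume "p \<in> levels (Suc N)"
      then have "p \<in> G1 s" using levels_subset by auto
      then show "cnj (H1_op s a W vx p) * \<psi> p - cnj (vx p) * H1_op s a W \<psi> p
          = (if p = (n0, j0) then \<psi> p else 0) - \<i> * complex_of_real \<eta> * (cnj (vx p) * \<psi> p)"
        using v0 by (auto simp: H1_vx Hu algebra_simps)
    qed
    also have "\<dots> = \<psi> (n0, j0) - \<i> * complex_of_real \<eta> * (\<Sum>p\<in>levels (Suc N). cnj (vx p) * \<psi> p)"
      using x by (simp add: sum_subtractf sum_distrib_left sum.delta)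
    finally show ?thesis by simp
  qed
  define t where "t f n = (\<Sum>j\<in>{1..s n}. cmod (vx (n + fst f, j)) * cmod (\<psi> (n + snd f, j)))" for f :: "nat \<times> nat" and n
  have single: "cmod (\<psi> (n0, j0)) \<le> t (0, 1) (n0 + m) + t (1, 0) (n0 + m) + \<eta> * R" if m: "m < L" for m
  proof -
    have "cmod (boundary (n0 + m) vx \<psi>) \<le> (\<Sum>j\<in>{1..s (n0 + m)}.
        cmod (vx (n0 + m, j)) * cmod (\<psi> (Suc (n0 + m), j)) + cmod (vx (Suc (n0 + m), j)) * cmod (\<psi> (n0 + m, j)))"
      unfolding boundary_def
      by (intro sum_norm_le order_trans[OF norm_triangle_ineq4]) (simp add: norm_mult)
    also have "\<dots> = t (0, 1) (n0 + m) + t (1, 0) (n0 + m)" by (simp add: t_def sum.distrib)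
    finally have 1: "cmod (boundary (n0 + m) vx \<psi>) \<le> t (0, 1) (n0 + m) + t (1, 0) (n0 + m)" .
    have "cmod (\<Sum>p\<in>levels (Suc (n0 + m)). cnj (vx p) * \<psi> p) \<le> (\<Sum>p\<in>levels (Suc (n0 + m)). cmod (vx p) * cmod (\<psi> p))"
      by (intro sum_norm_le) (simp add: norm_mult)
    also have "\<dots> \<le> R"
      using cs[of "levels (Suc (n0 + m))" "\<lambda>p. p" "\<lambda>p. p"] m by (force simp: levels_def)
    finally have "cmod (\<i> * complex_of_real \<eta> * (\<Sum>p\<in>levels (Suc (n0 + m)). cnj (vx p) * \<psi> p)) \<le> \<eta> * R"
      using \<eta> by (simp add: norm_mult)
    with 1 show ?thesis
      using norm_triangle_ineq[of "boundary (n0 + m) vx \<psi>"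
          "\<i> * complex_of_real \<eta> * (\<Sum>p\<in>levels (Suc (n0 + m)). cnj (vx p) * \<psi> p)"]
      by (subst green[of "n0 + m"]) auto
  qed
  have tsum: "(\<Sum>m<L. t f (n0 + m)) \<le> R" if "f = (0, 1) \<or> f = (1, 0)" for f
  proof -
    let ?A = "SIGMA m:{..<L}. {1..s (n0 + m)}"
    have "(\<Sum>m<L. t f (n0 + m)) = (\<Sum>p\<in>?A. cmod (vx (n0 + fst p + fst f, snd p)) * cmod (\<psi> (n0 + fst p + snd f, snd p)))"
      unfolding t_def by (subst sum.Sigma) (auto simp: case_prod_unfold)
    also have "\<dots> \<le> R"
    proof (rule cs)
      show "(\<lambda>p. (n0 + fst p + fst f, snd p)) ` ?A \<subseteq> levels (n0 + Suc L)"
      proof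
        fix q assume "q \<in> (\<lambda>p. (n0 + fst p + fst f, snd p)) ` ?A"
        then obtain m j where "m < L" "1 \<le> j" "j \<le> s (n0 + m)" "q = (n0 + m + fst f, j)" by auto
        moreover have "s (n0 + m) \<le> s (n0 + m + fst f)" by (rule s_le) simp
        ultimately show "q \<in> levels (n0 + Suc L)" using that by (auto simp: levels_def)
      qed
    qed (auto simp: inj_on_def)
    finally show ?thesis .
  qed
  \<comment> \<open>Over \<open>m < L\<close> the two kinds of boundary products sum to at most
    \<open>R\<close> each, and the bulk terms to \<open>L * \<eta> * R = R\<close>. The resulting
    factor 3, once squared, is the constant 9.\<close>
  have "real L * cmod (\<psi> (n0, j0)) = (\<Sum>m<L. cmod (\<psi> (n0, j0)))" by simp
  also have "\<dots> \<le> (\<Sum>m<L. t (0, 1) (n0 + m) + t (1, 0) (n0 + m) + \<eta> * R)"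
    using single by (intro sum_mono) auto
  also have "\<dots> = (\<Sum>m<L. t (0, 1) (n0 + m)) + (\<Sum>m<L. t (1, 0) (n0 + m)) + R"
    using L by (simp add: sum.distrib \<eta>_def)
  also have "\<dots> \<le> 3 * R" using tsum[of "(0, 1)"] tsum[of "(1, 0)"] by simp
  finally have G: "real L * cmod (\<psi> (n0, j0)) \<le> 3 * R" .
  \<comment> \<open>Pairing the resolvent equation with \<open>\<i> u\<close> removes
    \<open>H - l\<close>, whose form is real, and leaves \<open>\<eta>\<close> times the squared
    norm against the value of \<open>u\<close> at the site.\<close>
  have "\<eta> * (norm u)\<^sup>2 \<le> cmod (\<psi> (n0, j0))"
  proof -
    have "inner (scaleC \<i> u) (delta (n0, j0)) = inner (scaleC \<i> u) (H u) - l * inner (scaleC \<i> u) u - \<eta> * inner (scaleC \<i> u) (scaleC \<i> u)"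
      by (simp add: eq[symmetric] \<eta>_def inner_diff_right)
    moreover have "inner (scaleC \<i> u) (H u) = 0"
      using cinner_T[of u] by (simp add: cinner_eq_inner complex_eq_iff)
    moreover have "inner (scaleC \<i> u) u = 0"
      using cinner_same[of u] by (simp add: cinner_eq_inner complex_eq_iff)
    moreover have "inner (scaleC \<i> u) (scaleC \<i> u) = (norm u)\<^sup>2"
      by (simp add: power2_norm_eq_inner[symmetric] norm_scaleC)
    ultimately have "\<eta> * (norm u)\<^sup>2 = - inner (scaleC \<i> u) (delta (n0, j0))" by simp
    also have "\<dots> \<le> cmod (cinner (delta (n0, j0)) (scaleC \<i> u))"
      using abs_Re_le_cmod[of "cinner (delta (n0, j0)) (scaleC \<i> u)"]
      by (simp add: Re_cinner inner_commute)
    also have "\<dots> = cmod (\<psi> (n0, j0))" by (simp add: cinner_delta \<psi>_def norm_mult)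
    finally show ?thesis .
  qed
  then have "real L * (\<eta> * (norm u)\<^sup>2) \<le> real L * cmod (\<psi> (n0, j0))" by (rule mult_left_mono) simp
  then have "(norm u)\<^sup>2 \<le> 3 * sqrt V * norm u" using G L by (simp add: \<eta>_def R_def)
  then have "norm u \<le> 3 * sqrt V"
    using V0 by (cases "norm u = 0") (auto simp: power2_eq_square)
  then have "(norm u)\<^sup>2 \<le> (3 * sqrt V)\<^sup>2" by (intro power_mono) auto
  then have "(norm u)\<^sup>2 \<le> 9 * V" using V0 by (simp add: power_mult_distrib)
  then have "\<eta> * (norm u)\<^sup>2 \<le> \<eta> * (9 * V)" using \<eta> by (intro mult_left_mono) auto
  then show ?thesis by (simp add: \<eta>_def V_def)
qed

text \<open>Since \<open>H u - l u\<close> is orthogonal to \<open>\<i> u\<close>, both the operator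
  and its adjoint are bounded below by \<open>\<eta>\<close>.\<close>

lemma resolvent_exists:
  assumes \<eta>: "0 < \<eta>" and \<phi>: "\<phi> \<in> supported (G1 s)"
  shows "\<exists>u\<in>supported (G1 s). H u - l *\<^sub>R u - \<eta> *\<^sub>R scaleC \<i> u = \<phi>"
proof (rule solve_bounded_below[OF K, where T' = "\<lambda>u. H u - l *\<^sub>R u + \<eta> *\<^sub>R scaleC \<i> u" and \<delta> = \<eta>])
  have blJ: "bounded_linear (\<lambda>u. \<eta> *\<^sub>R scaleC \<i> u)"
    by (intro bounded_linear_const_scaleR bounded_linear_scaleC)
  have blH: "bounded_linear (\<lambda>u. H u - l *\<^sub>R u)"
    by (intro bounded_linear_sub bounded_linear_H bounded_linear_scaleR_right)
  show "bounded_linear (\<lambda>u. H u - l *\<^sub>R u - \<eta> *\<^sub>R scaleC \<i> u)" "bounded_linear (\<lambda>u. H u - l *\<^sub>R u + \<eta> *\<^sub>R scaleC \<i> u)"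
    using blJ blH by (auto intro: bounded_linear_sub bounded_linear_add)
  show "H x - l *\<^sub>R x - \<eta> *\<^sub>R scaleC \<i> x \<in> supported (G1 s)" "H x - l *\<^sub>R x + \<eta> *\<^sub>R scaleC \<i> x \<in> supported (G1 s)"
    if "x \<in> supported (G1 s)" for x
    using that H_supported K(1) by (auto intro!: subspace_diff subspace_add subspace_scale scaleC_supported)
  show "inner (H x - l *\<^sub>R x - \<eta> *\<^sub>R scaleC \<i> x) y = inner x (H y - l *\<^sub>R y + \<eta> *\<^sub>R scaleC \<i> y)" for x y
    by (simp add: inner_diff_left inner_diff_right inner_add_right inner_scaleC_ii H_symmetric)
  have orth: "inner (H x - l *\<^sub>R x) (scaleC \<i> x) = 0" for x
  proof -
    have "inner (scaleC \<i> x) (H x) = 0" "inner (scaleC \<i> x) x = 0"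
      using cinner_T[of x] cinner_same[of x] by (simp_all add: cinner_eq_inner complex_eq_iff)
    then have "inner (H x) (scaleC \<i> x) = 0" "inner x (scaleC \<i> x) = 0"
      by (simp_all only: inner_commute)
    then show ?thesis by (simp add: inner_diff_left)
  qed
  have n: "\<eta>\<^sup>2 * (norm x)\<^sup>2 \<le> (norm (H x - l *\<^sub>R x + c *\<^sub>R scaleC \<i> x))\<^sup>2" if "c\<^sup>2 = \<eta>\<^sup>2" for c x
  proof -
    have "(norm (H x - l *\<^sub>R x + c *\<^sub>R scaleC \<i> x))\<^sup>2 = (norm (H x - l *\<^sub>R x))\<^sup>2 + 2 * c * inner (H x - l *\<^sub>R x) (scaleC \<i> x)
        + c\<^sup>2 * (norm (scaleC \<i> x))\<^sup>2"
      unfolding power2_norm_eq_inner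
      by (simp add: inner_diff_left inner_diff_right inner_add_left inner_add_right inner_commute power2_eq_square algebra_simps)
    then show ?thesis by (simp add: orth that norm_scaleC)
  qed
  show "\<eta> * norm x \<le> norm (H x - l *\<^sub>R x - \<eta> *\<^sub>R scaleC \<i> x)" for x
    by (rule power2_le_imp_le) (use n[of "- \<eta>" x] in \<open>simp_all add: power_mult_distrib\<close>)
  show "\<eta> * norm x \<le> norm (H x - l *\<^sub>R x + \<eta> *\<^sub>R scaleC \<i> x)" for x
    by (rule power2_le_imp_le) (use n[of \<eta> x] in \<open>simp_all add: power_mult_distrib\<close>)
qed (use \<eta> \<phi> in auto)

end

lemma null_of_solution_mass:
  assumes site: "(n0, j0) \<in> G1 s"
    and D: "\<exists>\<^sub>F L in sequentially. (\<integral>\<^sup>+x. ennreal (1 / real L * (\<Sum>m\<le>L. (solution_mass s a W n0 j0 m x)\<^sup>2))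
        * indicator {l<..<r} x \<partial>lborel) \<le> ennreal D" "0 \<le> D"
    and N: "N \<in> null_sets lborel" "N \<subseteq> {l<..<r}"
  shows "F N (delta (n0, j0)) = 0"
proof -
  let ?\<delta> = "delta (n0, j0)"
  have d: "?\<delta> \<in> supported (G1 s)" using site by (rule delta_supported)
  have "emeasure (mu ?\<delta>) N = 0"
  proof (rule poisson_bound_imp_null[OF finite_mu[OF d] sets_mu solution_mass_measurable solution_mass_nonneg _ D N])
    fix x :: real and L :: nat
    assume L: "1 \<le> L"
    define \<eta> where "\<eta> = 1 / real L"
    have \<eta>: "0 < \<eta>" using L by (simp add: \<eta>_def)
    obtain u where u: "u \<in> supported (G1 s)" "H u - x *\<^sub>R u - \<eta> *\<^sub>R scaleC \<i> u = ?\<delta>"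
      using resolvent_exists[OF site \<eta> d] by blast
    have "(\<integral>\<^sup>+t. ennreal (1 / ((t - x)\<^sup>2 + \<eta>\<^sup>2)) \<partial>mu ?\<delta>) = ennreal ((norm u)\<^sup>2)"
      by (rule resolvent_poisson_integral[where J = "scaleC \<i>", OF _ _ _ _ _ _ u(1) \<eta> u(2)[symmetric]])
         (auto simp: scaleC_supported norm_scaleC inner_scaleC_ii H_scaleC F_scaleC bounded_linear.linear[OF bounded_linear_scaleC])
    then have "ennreal (1 / real L) * (\<integral>\<^sup>+t. ennreal (1 / ((t - x)\<^sup>2 + (1 / real L)\<^sup>2)) \<partial>mu ?\<delta>)
        = ennreal (1 / real L * (norm u)\<^sup>2)"
      by (simp add: \<eta>_def ennreal_mult[symmetric])
    also have "\<dots> \<le> ennreal (9 / real L * (\<Sum>m\<le>L. solution_mass s a W n0 j0 m x))"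
      using resolvent_norm_bound[OF site L u(1)] u(2) by (intro ennreal_leI) (simp add: \<eta>_def)
    finally show "ennreal (1 / real L) * (\<integral>\<^sup>+t. ennreal (1 / ((t - x)\<^sup>2 + (1 / real L)\<^sup>2)) \<partial>mu ?\<delta>)
        \<le> ennreal (9 / real L * (\<Sum>m\<le>L. solution_mass s a W n0 j0 m x))" .
  qed
  then show ?thesis using emeasure_mu_0[OF d] N(1) by auto
qed

end

section \<open>Random potentials\<close>

text \<open>The supremum runs over an uncountable set, but each competitor depends continuously on
  finitely many entries, so the superlevel sets are unions of open sets. Entries outside the block,
  of which no measurability is known, are first set to zero.\<close>

lemma mat_norm_measurable:
  assumes "\<And>i j. i \<in> {1..k} \<Longrightarrow> j \<in> {1..k} \<Longrightarrow> (\<lambda>\<omega>. A \<omega> i j) \<in> borel_measurable M"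
  shows "(\<lambda>\<omega>. mat_norm k (A \<omega>)) \<in> borel_measurable M"
proof -
  define f where "f \<omega> p = (if p \<in> {1..k} \<times> {1..k} then A \<omega> (fst p) (snd p) else 0)" for \<omega> p
  have [measurable]: "f \<in> borel_measurable M"
  proof (rule measurable_coordinatewise_then_product)
    fix p :: "nat \<times> nat"
    show "(\<lambda>\<omega>. f \<omega> p) \<in> borel_measurable M"
      using assms[of "fst p" "snd p"] by (cases "p \<in> {1..k} \<times> {1..k}") (auto simp: f_def)
  qed
  have "(\<lambda>g :: nat \<times> nat \<Rightarrow> complex. mat_norm k (\<lambda>i j. g (i, j))) \<in> borel_measurable borel"
  proof (rule borel_measurableI_greater)
    fix c :: real
    have "{g :: nat \<times> nat \<Rightarrow> complex. c < mat_norm k (\<lambda>i j. g (i, j))}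
        = (\<Union>x\<in>{x. L2_set (\<lambda>j. cmod (x j)) {1..k} \<le> 1}.
            {g. c < L2_set (\<lambda>i. cmod (\<Sum>j\<in>{1..k}. g (i, j) * x j)) {1..k}})"
    proof -
      have "{x :: nat \<Rightarrow> complex. L2_set (\<lambda>j. cmod (x j)) {1..k} \<le> 1} \<noteq> {}"
        by (auto intro!: exI[of _ "\<lambda>_. 0"] simp: L2_set_def)
      then show ?thesis
        unfolding mat_norm_def using less_cSUP_iff[OF _ mat_norm_bdd_above, of k] by auto
    qed
    also have "open \<dots>"
      unfolding L2_set_def
      by (intro open_UN ballI open_Collect_less continuous_intros continuous_on_product_coordinates)
    finally show "{g \<in> space borel. c < mat_norm k (\<lambda>i j. (g :: nat \<times> nat \<Rightarrow> complex) (i, j))} \<in> sets borel" by simp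
  qed
  then have "(\<lambda>\<omega>. mat_norm k (\<lambda>i j. f \<omega> (i, j))) \<in> borel_measurable M"
    by measurable
  moreover have "mat_norm k (\<lambda>i j. f \<omega> (i, j)) = mat_norm k (A \<omega>)" for \<omega>
    unfolding mat_norm_def
    by (intro SUP_cong refl L2_set_cong arg_cong[where f = cmod] sum.cong) (auto simp: f_def)
  ultimately show ?thesis by simp
qed

lemma formal_solution_cong:
  assumes "\<And>i j k. i < n0 + m \<Longrightarrow> j \<in> {1..s i} \<Longrightarrow> k \<in> {1..s i} \<Longrightarrow> W i j k = W' i j k"
  shows "formal_solution s a W n0 j0 l m j = formal_solution s a W' n0 j0 l m j"
  using assms
proof (induction m arbitrary: j rule: induct_nat_012)
  case (ge2 m)
  have "formal_solution s a W n0 j0 l (Suc m) j = formal_solution s a W' n0 j0 l (Suc m) j" for j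
    using ge2.prems by (intro ge2.IH(2)) auto
  moreover have "formal_solution s a W n0 j0 l m j = formal_solution s a W' n0 j0 l m j" for j
    using ge2.prems by (intro ge2.IH(1)) auto
  moreover have "W (n0 + Suc m) j k = W' (n0 + Suc m) j k"
    if "j \<in> {1..s (n0 + Suc m)}" "k \<in> {1..s (n0 + Suc m)}" for j k
    using ge2.prems that by auto
  ultimately show ?case
    unfolding formal_solution.simps by (auto intro!: sum.cong)
qed simp_all

subsection \<open>The energy of a formal solution\<close>

definition energy :: "real \<Rightarrow> complex \<Rightarrow> complex \<Rightarrow> real" where
  "energy b \<alpha> \<beta> = (cmod \<alpha>)\<^sup>2 + (cmod \<beta>)\<^sup>2 - b * Re (cnj \<alpha> * \<beta>)"

lemma cmod_square: "(cmod z)\<^sup>2 = (Re z)\<^sup>2 + (Im z)\<^sup>2"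
  by (simp add: cmod_def)

lemma cmod_plus_square: "(cmod (f + y))\<^sup>2 = (cmod f)\<^sup>2 + 2 * Re (cnj f * y) + (cmod y)\<^sup>2"
  unfolding cmod_square by (simp add: power2_eq_square algebra_simps)

lemma energy_free: "energy b \<beta> (complex_of_real b * \<beta> - \<alpha>) = energy b \<alpha> \<beta>"
  unfolding energy_def cmod_square by (simp add: power2_eq_square algebra_simps)

text \<open>The perturbation \<open>y\<close> enters linearly against the gradient of the energy in
  its second argument, which at the free image is twice
  \<open>b / 2 * \<beta> - \<alpha>\<close>.\<close>

lemma energy_step:
  "energy b \<beta> (complex_of_real b * \<beta> - \<alpha> + y) = energy b \<alpha> \<beta>
     + (2 * Re (cnj (complex_of_real (b / 2) * \<beta> - \<alpha>) * y) + (cmod y)\<^sup>2)"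
proof -
  let ?f = "complex_of_real b * \<beta> - \<alpha>"
  have "energy b \<beta> (?f + y) = energy b \<beta> ?f + (2 * Re (cnj ?f * y) - b * Re (cnj \<beta> * y) + (cmod y)\<^sup>2)"
  proof -
    have "Re (cnj \<beta> * (?f + y)) = Re (cnj \<beta> * ?f) + Re (cnj \<beta> * y)"
      by (simp only: distrib_left plus_complex.sel)
    then show ?thesis unfolding energy_def cmod_plus_square by (simp only: distrib_left)
  qed
  moreover have "2 * Re (cnj ?f * y) - b * Re (cnj \<beta> * y) = 2 * Re (cnj (complex_of_real (b / 2) * \<beta> - \<alpha>) * y)"
  proof -
    have R: "Re (cnj (complex_of_real r * \<beta> - \<alpha>) * y) = r * Re (cnj \<beta> * y) - Re (cnj \<alpha> * y)" for r
      by (simp add: algebra_simps)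
    show ?thesis unfolding R by (simp add: right_diff_distrib)
  qed
  ultimately show ?thesis by (simp only: energy_free)
qed

text \<open>The form has the eigenvalues \<open>1 - b / 2\<close> and \<open>1 + b / 2\<close>, and
  the condition on \<open>b\<close> says that both are at least \<open>1 / \<kappa>\<close>.\<close>

lemma energy_lower:
  assumes "\<bar>b\<bar> \<le> 2 - 2 / \<kappa>" "0 < \<kappa>"
  shows "(cmod \<alpha>)\<^sup>2 + (cmod \<beta>)\<^sup>2 \<le> \<kappa> * energy b \<alpha> \<beta>"
proof -
  have "\<bar>Re (cnj \<alpha> * \<beta>)\<bar> \<le> cmod \<alpha> * cmod \<beta>"
    using abs_Re_le_cmod[of "cnj \<alpha> * \<beta>"] by (simp add: norm_mult)
  also have "\<dots> \<le> ((cmod \<alpha>)\<^sup>2 + (cmod \<beta>)\<^sup>2) / 2"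
    using sum_squares_bound[of "cmod \<alpha>" "cmod \<beta>"] by simp
  finally have "\<bar>b\<bar> * \<bar>Re (cnj \<alpha> * \<beta>)\<bar> \<le> (2 - 2 / \<kappa>) * (((cmod \<alpha>)\<^sup>2 + (cmod \<beta>)\<^sup>2) / 2)"
    using assms by (intro mult_mono) auto
  then have "b * Re (cnj \<alpha> * \<beta>) \<le> (2 - 2 / \<kappa>) * (((cmod \<alpha>)\<^sup>2 + (cmod \<beta>)\<^sup>2) / 2)"
    using abs_ge_self[of "b * Re (cnj \<alpha> * \<beta>)"] unfolding abs_mult by linarith
  also have "\<dots> = ((cmod \<alpha>)\<^sup>2 + (cmod \<beta>)\<^sup>2) - ((cmod \<alpha>)\<^sup>2 + (cmod \<beta>)\<^sup>2) / \<kappa>"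
    using assms(2) by (simp add: field_simps)
  finally have "((cmod \<alpha>)\<^sup>2 + (cmod \<beta>)\<^sup>2) / \<kappa> \<le> energy b \<alpha> \<beta>" by (simp add: energy_def)
  then show ?thesis using assms(2) by (simp add: pos_divide_le_eq mult.commute)
qed

definition total_energy :: "nat \<Rightarrow> (nat \<Rightarrow> real) \<Rightarrow> (nat \<Rightarrow> complex) \<Rightarrow> (nat \<Rightarrow> complex) \<Rightarrow> real" where
  "total_energy k b p q = (\<Sum>j\<in>{1..k}. energy (b j) (p j) (q j))"

definition next_vector ::
    "nat \<Rightarrow> (nat \<Rightarrow> real) \<Rightarrow> (nat \<Rightarrow> complex) \<Rightarrow> (nat \<Rightarrow> complex) \<Rightarrow> (nat \<Rightarrow> nat \<Rightarrow> complex) \<Rightarrow> nat \<Rightarrow> complex" where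
  "next_vector k b p q A j = complex_of_real (b j) * q j - p j + (\<Sum>i\<in>{1..k}. A j i * q i)"

definition energy_gain_linear ::
    "nat \<Rightarrow> (nat \<Rightarrow> real) \<Rightarrow> (nat \<Rightarrow> complex) \<Rightarrow> (nat \<Rightarrow> complex) \<Rightarrow> (nat \<Rightarrow> nat \<Rightarrow> complex) \<Rightarrow> real" where
  "energy_gain_linear k b p q A
     = Re (\<Sum>j\<in>{1..k}. cnj (complex_of_real (b j / 2) * q j - p j) * (\<Sum>i\<in>{1..k}. A j i * q i))"

definition energy_gain_quadratic :: "nat \<Rightarrow> (nat \<Rightarrow> complex) \<Rightarrow> (nat \<Rightarrow> nat \<Rightarrow> complex) \<Rightarrow> real" where
  "energy_gain_quadratic k q A = (\<Sum>j\<in>{1..k}. (cmod (\<Sum>i\<in>{1..k}. A j i * q i))\<^sup>2)"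

lemma total_energy_next:
  "total_energy k b q (next_vector k b p q A)
     = total_energy k b p q + (2 * energy_gain_linear k b p q A + energy_gain_quadratic k q A)"
  unfolding total_energy_def next_vector_def energy_step energy_gain_linear_def energy_gain_quadratic_def
  by (simp only: sum.distrib Re_sum sum_distrib_left)

lemma total_energy_next_cong:
  assumes "\<And>i j. i \<in> {1..k} \<Longrightarrow> j \<in> {1..k} \<Longrightarrow> A i j = A' i j"
  shows "total_energy k b q (next_vector k b p q A) = total_energy k b q (next_vector k b p q A')"
  unfolding total_energy_def next_vector_def
  using assms by (intro sum.cong refl arg_cong[where f = "energy _ _"] arg_cong2[where f = "(+)"]) auto

section \<open>Growth of the total energy in one step\<close>

context
  fixes k :: nat and b :: "nat \<Rightarrow> real" and \<kappa> :: real
  assumes b: "\<And>j. j \<in> {1..k} \<Longrightarrow> \<bar>b j\<bar> \<le> 2 - 2 / \<kappa>" and \<kappa>: "1 \<le> \<kappa>"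
begin

lemma total_energy_lower:
  "(\<Sum>j\<in>{1..k}. (cmod (p j))\<^sup>2) + (\<Sum>j\<in>{1..k}. (cmod (q j))\<^sup>2) \<le> \<kappa> * total_energy k b p q"
  unfolding total_energy_def sum_distrib_left sum.distrib[symmetric]
  using b \<kappa> by (intro sum_mono energy_lower) auto

lemma total_energy_nonneg: "0 \<le> total_energy k b p q"
proof -
  have "0 \<le> \<kappa> * total_energy k b p q"
    by (rule order_trans[OF _ total_energy_lower]) (simp add: sum_nonneg add_nonneg_nonneg)
  then show ?thesis using \<kappa> by (simp add: zero_le_mult_iff)
qed

lemma energy_gain_quadratic_bound:
  "energy_gain_quadratic k q A \<le> \<kappa> * (mat_norm k A)\<^sup>2 * total_energy k b p q"
proof -
  have "energy_gain_quadratic k q A \<le> (mat_norm k A)\<^sup>2 * (\<Sum>j\<in>{1..k}. (cmod (q j))\<^sup>2)"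
    unfolding energy_gain_quadratic_def by (rule mat_norm_apply_square)
  also have "\<dots> \<le> (mat_norm k A)\<^sup>2 * (\<kappa> * total_energy k b p q)"
    using total_energy_lower[of p q] sum_nonneg[of "{1..k}" "\<lambda>j. (cmod (p j))\<^sup>2"]
    by (intro mult_left_mono) auto
  finally show ?thesis by (simp add: mult_ac)
qed

lemma energy_gain_quadratic_nonneg: "0 \<le> energy_gain_quadratic k q A"
  by (simp add: energy_gain_quadratic_def sum_nonneg)

text \<open>Cauchy-Schwarz over the channels, with the matrix acting on \<open>q\<close> as a whole,
  so that no constant depends on \<open>k\<close>. The factor 2 rounds up
  \<open>sqrt 2\<close>.\<close>

lemma energy_gain_linear_bound:
  "\<bar>energy_gain_linear k b p q A\<bar> \<le> 2 * \<kappa> * mat_norm k A * total_energy k b p q"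
proof -
  define l where "l j = complex_of_real (b j / 2) * q j - p j" for j
  define y where "y j = (\<Sum>i\<in>{1..k}. A j i * q i)" for j
  let ?Q = "total_energy k b p q"
  have Q: "0 \<le> ?Q" by (rule total_energy_nonneg)
  have "\<bar>energy_gain_linear k b p q A\<bar> \<le> cmod (\<Sum>j\<in>{1..k}. cnj (l j) * y j)"
    unfolding energy_gain_linear_def l_def y_def by (rule abs_Re_le_cmod)
  also have "\<dots> \<le> (\<Sum>j\<in>{1..k}. \<bar>cmod (l j)\<bar> * \<bar>cmod (y j)\<bar>)"
    by (intro sum_norm_le) (simp add: norm_mult)
  also have "\<dots> \<le> L2_set (\<lambda>j. cmod (l j)) {1..k} * L2_set (\<lambda>j. cmod (y j)) {1..k}"
    by (rule L2_set_mult_ineq)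
  also have "\<dots> \<le> sqrt (2 * \<kappa> * ?Q) * (mat_norm k A * sqrt (\<kappa> * ?Q))"
  proof (intro mult_mono)
    have "(cmod (l j))\<^sup>2 \<le> 2 * ((cmod (p j))\<^sup>2 + (cmod (q j))\<^sup>2)" if j: "j \<in> {1..k}" for j
    proof -
      have "\<bar>b j\<bar> \<le> 2" using b[OF j] \<kappa> by (smt (verit) divide_nonneg_nonneg)
      then have "(b j / 2)\<^sup>2 \<le> 1" by (simp add: abs_square_le_1)
      then have "(cmod (complex_of_real (b j / 2) * q j))\<^sup>2 \<le> (cmod (q j))\<^sup>2"
        using mult_right_mono[of "(b j / 2)\<^sup>2" 1 "(cmod (q j))\<^sup>2"]
        by (simp add: norm_mult power_mult_distrib power_divide)
      note q = this
      have "l j = complex_of_real (b j / 2) * q j + - p j" by (simp add: l_def)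
      then have "(cmod (l j))\<^sup>2 \<le> 2 * (cmod (complex_of_real (b j / 2) * q j))\<^sup>2 + 2 * (cmod (- p j))\<^sup>2"
        by (simp only: square_norm_add_le)
      also have "\<dots> \<le> 2 * (cmod (q j))\<^sup>2 + 2 * (cmod (p j))\<^sup>2"
        using q by (intro add_mono mult_left_mono) auto
      finally show ?thesis by (simp add: algebra_simps)
    qed
    then have "(\<Sum>j\<in>{1..k}. (cmod (l j))\<^sup>2) \<le> (\<Sum>j\<in>{1..k}. 2 * ((cmod (p j))\<^sup>2 + (cmod (q j))\<^sup>2))"
      by (rule sum_mono)
    also have "\<dots> \<le> 2 * (\<kappa> * ?Q)"
      using total_energy_lower[of p q] by (simp add: sum_distrib_left[symmetric] sum.distrib)
    finally show "L2_set (\<lambda>j. cmod (l j)) {1..k} \<le> sqrt (2 * \<kappa> * ?Q)" by (simp add: L2_set_def mult.assoc)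
    have "L2_set (\<lambda>j. cmod (y j)) {1..k} \<le> mat_norm k A * L2_set (\<lambda>j. cmod (q j)) {1..k}"
      unfolding y_def by (rule mat_norm_apply)
    also have "\<dots> \<le> mat_norm k A * sqrt (\<kappa> * ?Q)"
      using total_energy_lower[of p q] sum_nonneg[of "{1..k}" "\<lambda>j. (cmod (p j))\<^sup>2"]
      by (intro mult_left_mono mat_norm_nonneg) (auto simp: L2_set_def)
    finally show "L2_set (\<lambda>j. cmod (y j)) {1..k} \<le> mat_norm k A * sqrt (\<kappa> * ?Q)" .
  qed (use Q \<kappa> in \<open>auto intro: L2_set_nonneg\<close>)
  also have "\<dots> = sqrt 2 * \<kappa> * mat_norm k A * ?Q"
  proof -
    have "sqrt (2 * \<kappa> * ?Q) * (mat_norm k A * sqrt (\<kappa> * ?Q)) = sqrt 2 * mat_norm k A * (sqrt (\<kappa> * ?Q) * sqrt (\<kappa> * ?Q))"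
      by (simp add: real_sqrt_mult mult_ac)
    also have "sqrt (\<kappa> * ?Q) * sqrt (\<kappa> * ?Q) = \<kappa> * ?Q" using Q \<kappa> by simp
    finally show ?thesis by (simp add: mult_ac)
  qed
  also have "\<dots> \<le> 2 * \<kappa> * mat_norm k A * ?Q"
    using Q \<kappa> sqrt2_less_2 by (intro mult_right_mono mat_norm_nonneg) auto
  finally show ?thesis .
qed

text \<open>The linear gain only enters through its mean; the quadratic growth of the energy is thus
  governed by \<open>\<parallel>\<bbbE> A\<parallel> + \<bbbE> (\<parallel>A\<parallel>\<^sup>2 + \<parallel>A\<parallel>\<^sup>4)\<close>.\<close>

lemma energy_square_expectation:
  fixes A :: "'w \<Rightarrow> nat \<Rightarrow> nat \<Rightarrow> complex" and M :: "'w measure"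
  assumes M: "prob_space M"
    and A: "\<And>i j. i \<in> {1..k} \<Longrightarrow> j \<in> {1..k} \<Longrightarrow> (\<lambda>\<omega>. A \<omega> i j) \<in> borel_measurable M"
    and c: "(\<integral>\<^sup>+\<omega>. ennreal ((mat_norm k (A \<omega>)) ^ 2 + (mat_norm k (A \<omega>)) ^ 4) \<partial>M) \<le> ennreal d" "0 \<le> d"
  shows "(\<integral>\<^sup>+\<omega>. ennreal ((total_energy k b q (next_vector k b p q (A \<omega>)))\<^sup>2) \<partial>M)
    \<le> ennreal ((1 + 42 * \<kappa>\<^sup>2 * (mat_norm k (\<lambda>i j. \<integral>\<omega>. A \<omega> i j \<partial>M) + d)) * (total_energy k b p q)\<^sup>2)"
proof -
  interpret prob_space M by fact
  let ?N = "\<lambda>\<omega>. mat_norm k (A \<omega>)"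
  let ?E = "\<lambda>i j. \<integral>\<omega>. A \<omega> i j \<partial>M"
  let ?Q = "total_energy k b p q"
  have Q: "0 \<le> ?Q" by (rule total_energy_nonneg)
  have N [measurable]: "?N \<in> borel_measurable M" by (rule mat_norm_measurable[OF A])
  have N0: "0 \<le> ?N \<omega>" for \<omega> by (rule mat_norm_nonneg)
  have int: "integrable M (\<lambda>\<omega>. ?N \<omega> ^ 2 + ?N \<omega> ^ 4)"
    using c(1) N0 by (intro integrableI_nonneg) (auto simp: less_top[symmetric] top_unique add_nonneg_nonneg)
  have i2: "integrable M (\<lambda>\<omega>. ?N \<omega> ^ 2)" and i4: "integrable M (\<lambda>\<omega>. ?N \<omega> ^ 4)"
    using N0 by (auto intro!: Bochner_Integration.integrable_bound[OF int])
  have d: "(\<integral>\<omega>. ?N \<omega> ^ 2 \<partial>M) + (\<integral>\<omega>. ?N \<omega> ^ 4 \<partial>M) \<le> d"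
  proof -
    have "ennreal (\<integral>\<omega>. ?N \<omega> ^ 2 + ?N \<omega> ^ 4 \<partial>M) \<le> ennreal d"
      using c(1) nn_integral_eq_integral[OF int] N0 by (simp add: add_nonneg_nonneg)
    then have "(\<integral>\<omega>. ?N \<omega> ^ 2 + ?N \<omega> ^ 4 \<partial>M) \<le> d" by (simp only: ennreal_le_iff[OF c(2)])
    then show ?thesis using i2 i4 by simp
  qed
  have i1: "integrable M ?N"
  proof (rule Bochner_Integration.integrable_bound)
    show "integrable M (\<lambda>\<omega>. 1 + ?N \<omega> ^ 2)" using i2 by simp
    have "?N \<omega> \<le> 1 + ?N \<omega> ^ 2" for \<omega>
      using sum_squares_bound[of 1 "?N \<omega>"] N0[of \<omega>] by simp
    then show "AE \<omega> in M. norm (?N \<omega>) \<le> norm (1 + ?N \<omega> ^ 2)" using N0 by (auto simp: add_nonneg_nonneg)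
  qed simp
  \<comment> \<open>Testing the norm on a coordinate vector bounds single entries, which makes them
    integrable and the mean matrix meaningful.\<close>
  have entry: "cmod (A \<omega> i j) \<le> ?N \<omega>" if ij: "i \<in> {1..k}" "j \<in> {1..k}" for \<omega> i j
  proof -
    let ?e = "\<lambda>m. if m = j then 1 else 0 :: complex"
    have "cmod (A \<omega> i j) = cmod (\<Sum>m\<in>{1..k}. A \<omega> i m * ?e m)"
      using ij by (simp add: if_distrib sum.delta cong: if_cong)
    also have "\<dots> \<le> L2_set (\<lambda>i. cmod (\<Sum>m\<in>{1..k}. A \<omega> i m * ?e m)) {1..k}"
      using ij by (intro member_le_L2_set) auto
    also have "\<dots> \<le> ?N \<omega>"
    proof (rule mat_norm_upper)
      have "L2_set (\<lambda>m. cmod (?e m)) {1..k} \<le> (\<Sum>m\<in>{1..k}. cmod (?e m))" by (rule L2_set_le_sum) simp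
      also have "\<dots> = 1" using ij by (simp add: if_distrib sum.delta cong: if_cong)
      finally show "L2_set (\<lambda>m. cmod (?e m)) {1..k} \<le> 1" .
    qed
    finally show ?thesis .
  qed
  have iA: "integrable M (\<lambda>\<omega>. A \<omega> i j)" if "i \<in> {1..k}" "j \<in> {1..k}" for i j
    by (rule Bochner_Integration.integrable_bound[OF i1 A[OF that]]) (use entry[OF that] N0 in auto)
  define lin where "lin \<omega> = energy_gain_linear k b p q (A \<omega>)" for \<omega>
  define quad where "quad \<omega> = energy_gain_quadratic k q (A \<omega>)" for \<omega>
  have lin_sum: "energy_gain_linear k b p q B
      = Re (\<Sum>j\<in>{1..k}. \<Sum>i\<in>{1..k}. (cnj (complex_of_real (b j / 2) * q j - p j) * q i) * B j i)" for B
    unfolding energy_gain_linear_def by (simp only: sum_distrib_left) (simp only: mult_ac)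
  have lin_int: "integrable M lin" and lin_E: "(\<integral>\<omega>. lin \<omega> \<partial>M) = energy_gain_linear k b p q ?E"
  proof -
    let ?c = "\<lambda>\<omega>. \<Sum>j\<in>{1..k}. \<Sum>i\<in>{1..k}. (cnj (complex_of_real (b j / 2) * q j - p j) * q i) * A \<omega> j i"
    have ci: "integrable M ?c" by (intro Bochner_Integration.integrable_sum integrable_mult_right iA)
    show "integrable M lin" unfolding lin_def lin_sum by (rule integrable_Re[OF ci])
    have "(\<integral>\<omega>. lin \<omega> \<partial>M) = Re (\<integral>\<omega>. ?c \<omega> \<partial>M)"
      unfolding lin_def lin_sum by (rule integral_Re[OF ci])
    also have "(\<integral>\<omega>. ?c \<omega> \<partial>M) = (\<Sum>j\<in>{1..k}. \<Sum>i\<in>{1..k}. (cnj (complex_of_real (b j / 2) * q j - p j) * q i) * ?E j i)"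
    proof -
      let ?d = "\<lambda>j i. cnj (complex_of_real (b j / 2) * q j - p j) * q i"
      have "(\<integral>\<omega>. ?c \<omega> \<partial>M) = (\<Sum>j\<in>{1..k}. \<integral>\<omega>. (\<Sum>i\<in>{1..k}. ?d j i * A \<omega> j i) \<partial>M)"
        by (rule Bochner_Integration.integral_sum)
           (intro Bochner_Integration.integrable_sum integrable_mult_right iA)
      also have "\<dots> = (\<Sum>j\<in>{1..k}. \<Sum>i\<in>{1..k}. \<integral>\<omega>. ?d j i * A \<omega> j i \<partial>M)"
        by (rule sum.cong[OF refl], rule Bochner_Integration.integral_sum)
           (intro integrable_mult_right iA)
      finally show ?thesis by (simp only: integral_mult_right_zero)
    qed
    finally show "(\<integral>\<omega>. lin \<omega> \<partial>M) = energy_gain_linear k b p q ?E" unfolding lin_sum .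
  qed
  have [measurable]: "lin \<in> borel_measurable M" using lin_int by (rule borel_measurable_integrable)
  have quad_meas [measurable]: "quad \<in> borel_measurable M"
    unfolding quad_def energy_gain_quadratic_def
  proof (intro borel_measurable_sum)
    fix j assume j: "j \<in> {1..k}"
    have [measurable]: "(\<lambda>\<omega>. \<Sum>i\<in>{1..k}. A \<omega> j i * q i) \<in> borel_measurable M"
      by (intro borel_measurable_sum borel_measurable_times A[OF j]) auto
    show "(\<lambda>\<omega>. (cmod (\<Sum>i\<in>{1..k}. A \<omega> j i * q i))\<^sup>2) \<in> borel_measurable M"
      by measurable
  qed
  have quad0: "0 \<le> quad \<omega>" for \<omega> unfolding quad_def by (rule energy_gain_quadratic_nonneg)
  have quad_le: "quad \<omega> \<le> \<kappa> * ?Q * ?N \<omega> ^ 2" for \<omega>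
    unfolding quad_def using energy_gain_quadratic_bound[of q "A \<omega>" p] by (simp add: mult_ac)
  have quad_int: "integrable M quad"
    by (rule Bochner_Integration.integrable_bound[of M "\<lambda>\<omega>. \<kappa> * ?Q * ?N \<omega> ^ 2"])
       (use i2 quad0 quad_le Q \<kappa> in auto)
  have lin_le: "\<bar>lin \<omega>\<bar> \<le> 2 * \<kappa> * ?Q * ?N \<omega>" for \<omega>
    unfolding lin_def using energy_gain_linear_bound[of p q "A \<omega>"] by (simp add: mult_ac)
  define X where "X \<omega> = 2 * lin \<omega> + quad \<omega>" for \<omega>
  have X_int: "integrable M X" unfolding X_def using lin_int quad_int by auto
  have [measurable]: "X \<in> borel_measurable M" using X_int by (rule borel_measurable_integrable)
  \<comment> \<open>Squaring the gain doubles the order in the potential, which is where the fourth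
    moment comes from. The constant 32 is \<open>2 * 4\<^sup>2\<close>.\<close>
  have X2_le: "(X \<omega>)\<^sup>2 \<le> 32 * \<kappa>\<^sup>2 * ?Q\<^sup>2 * ?N \<omega> ^ 2 + 2 * \<kappa>\<^sup>2 * ?Q\<^sup>2 * ?N \<omega> ^ 4" for \<omega>
  proof -
    have "(X \<omega>)\<^sup>2 \<le> 2 * (2 * lin \<omega>)\<^sup>2 + 2 * (quad \<omega>)\<^sup>2"
      unfolding X_def using zero_le_power2[of "2 * lin \<omega> - quad \<omega>"] by (simp add: power2_eq_square algebra_simps)
    also have "(2 * lin \<omega>)\<^sup>2 \<le> (2 * (2 * \<kappa> * ?Q * ?N \<omega>))\<^sup>2"
      using lin_le[of \<omega>] Q \<kappa> N0[of \<omega>] by (subst abs_le_square_iff[symmetric]) auto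
    also have "(quad \<omega>)\<^sup>2 \<le> (\<kappa> * ?Q * ?N \<omega> ^ 2)\<^sup>2" using quad_le quad0 by (intro power_mono) auto
    finally show ?thesis by (simp add: power_mult_distrib)
  qed
  have X2_int: "integrable M (\<lambda>\<omega>. (X \<omega>)\<^sup>2)"
  proof (rule Bochner_Integration.integrable_bound)
    show "integrable M (\<lambda>\<omega>. 32 * \<kappa>\<^sup>2 * ?Q\<^sup>2 * ?N \<omega> ^ 2 + 2 * \<kappa>\<^sup>2 * ?Q\<^sup>2 * ?N \<omega> ^ 4)" using i2 i4 by auto
    show "AE \<omega> in M. norm ((X \<omega>)\<^sup>2) \<le> norm (32 * \<kappa>\<^sup>2 * ?Q\<^sup>2 * ?N \<omega> ^ 2 + 2 * \<kappa>\<^sup>2 * ?Q\<^sup>2 * ?N \<omega> ^ 4)"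
      using X2_le by (intro AE_I2) (simp add: order_trans[OF _ abs_ge_self])
  qed simp
  let ?m = "mat_norm k ?E"
  have m0: "0 \<le> ?m" by (rule mat_norm_nonneg)
  have E2: "0 \<le> (\<integral>\<omega>. ?N \<omega> ^ 2 \<partial>M)" "0 \<le> (\<integral>\<omega>. ?N \<omega> ^ 4 \<partial>M)" using N0 by (auto intro!: integral_nonneg)
  have EX: "(\<integral>\<omega>. X \<omega> \<partial>M) \<le> 4 * \<kappa> * ?Q * ?m + \<kappa> * ?Q * d"
  proof -
    have "(\<integral>\<omega>. X \<omega> \<partial>M) = 2 * energy_gain_linear k b p q ?E + (\<integral>\<omega>. quad \<omega> \<partial>M)"
      unfolding X_def using lin_int quad_int by (simp add: lin_E)
    also have "(\<integral>\<omega>. quad \<omega> \<partial>M) \<le> (\<integral>\<omega>. \<kappa> * ?Q * ?N \<omega> ^ 2 \<partial>M)"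
      using quad_int i2 quad_le by (intro integral_mono) auto
    also have "\<dots> = \<kappa> * ?Q * (\<integral>\<omega>. ?N \<omega> ^ 2 \<partial>M)" by simp
    also have "\<dots> \<le> \<kappa> * ?Q * d"
    proof (rule mult_left_mono)
      show "(\<integral>\<omega>. ?N \<omega> ^ 2 \<partial>M) \<le> d" using d E2(2) by linarith
    qed (use Q \<kappa> in auto)
    also have "energy_gain_linear k b p q ?E \<le> 2 * \<kappa> * ?m * ?Q"
      using energy_gain_linear_bound[of p q ?E] by linarith
    finally show ?thesis by (simp add: mult_ac)
  qed
  have EX2: "(\<integral>\<omega>. (X \<omega>)\<^sup>2 \<partial>M) \<le> 32 * \<kappa>\<^sup>2 * ?Q\<^sup>2 * d"
  proof -
    have "(\<integral>\<omega>. (X \<omega>)\<^sup>2 \<partial>M) \<le> (\<integral>\<omega>. 32 * \<kappa>\<^sup>2 * ?Q\<^sup>2 * ?N \<omega> ^ 2 + 2 * \<kappa>\<^sup>2 * ?Q\<^sup>2 * ?N \<omega> ^ 4 \<partial>M)"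
      using X2_int i2 i4 X2_le by (intro integral_mono) auto
    also have "\<dots> = 32 * \<kappa>\<^sup>2 * ?Q\<^sup>2 * (\<integral>\<omega>. ?N \<omega> ^ 2 \<partial>M) + 2 * \<kappa>\<^sup>2 * ?Q\<^sup>2 * (\<integral>\<omega>. ?N \<omega> ^ 4 \<partial>M)"
      using i2 i4 by simp
    also have "\<dots> \<le> 32 * \<kappa>\<^sup>2 * ?Q\<^sup>2 * (\<integral>\<omega>. ?N \<omega> ^ 2 \<partial>M) + 32 * \<kappa>\<^sup>2 * ?Q\<^sup>2 * (\<integral>\<omega>. ?N \<omega> ^ 4 \<partial>M)"
      using E2(2) by (intro add_left_mono mult_right_mono) auto
    also have "\<dots> = 32 * \<kappa>\<^sup>2 * ?Q\<^sup>2 * ((\<integral>\<omega>. ?N \<omega> ^ 2 \<partial>M) + (\<integral>\<omega>. ?N \<omega> ^ 4 \<partial>M))"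
      by (simp add: distrib_left)
    also have "\<dots> \<le> 32 * \<kappa>\<^sup>2 * ?Q\<^sup>2 * d" using d by (intro mult_left_mono) auto
    finally show ?thesis .
  qed
  have T: "total_energy k b q (next_vector k b p q (A \<omega>)) = ?Q + X \<omega>" for \<omega>
    by (simp add: total_energy_next X_def lin_def quad_def)
  have sq_int: "integrable M (\<lambda>\<omega>. (?Q + X \<omega>)\<^sup>2)"
    unfolding power2_sum using X_int X2_int by (auto simp: mult_ac)
  have "(\<integral>\<omega>. (?Q + X \<omega>)\<^sup>2 \<partial>M) = ?Q\<^sup>2 + 2 * ?Q * (\<integral>\<omega>. X \<omega> \<partial>M) + (\<integral>\<omega>. (X \<omega>)\<^sup>2 \<partial>M)"
  proof -
    have "(\<integral>\<omega>. (?Q + X \<omega>)\<^sup>2 \<partial>M) = (\<integral>\<omega>. (?Q\<^sup>2 + 2 * ?Q * X \<omega>) + (X \<omega>)\<^sup>2 \<partial>M)"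
      by (simp add: power2_sum algebra_simps)
    then show ?thesis using X_int X2_int by (simp add: prob_space)
  qed
  also have "\<dots> \<le> ?Q\<^sup>2 + 2 * ?Q * (4 * \<kappa> * ?Q * ?m + \<kappa> * ?Q * d) + 32 * \<kappa>\<^sup>2 * ?Q\<^sup>2 * d"
    using EX EX2 Q by (intro add_mono mult_left_mono) auto
  also have "\<dots> = ?Q\<^sup>2 * (1 + 8 * \<kappa> * ?m + 2 * \<kappa> * d + 32 * \<kappa>\<^sup>2 * d)"
    by (simp add: power2_eq_square algebra_simps)
  also have "\<dots> \<le> ?Q\<^sup>2 * (1 + 42 * \<kappa>\<^sup>2 * (?m + d))"
  proof (rule mult_left_mono)
    \<comment> \<open>Everything is rounded up to one constant by
      \<open>\<kappa> \<le> \<kappa>\<^sup>2\<close>: the contributions 8, 2 and 32 add up to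
      42.\<close>
    have kk: "\<kappa> \<le> \<kappa>\<^sup>2" using \<kappa> by (simp add: self_le_power)
    have "8 * \<kappa> * ?m \<le> 42 * \<kappa>\<^sup>2 * ?m" using kk m0 \<kappa> by (intro mult_right_mono) auto
    moreover have "2 * \<kappa> * d \<le> 2 * \<kappa>\<^sup>2 * d" using kk c(2) by (intro mult_right_mono) auto
    moreover have "0 \<le> \<kappa>\<^sup>2 * d" using c(2) by simp
    moreover have "42 * \<kappa>\<^sup>2 * (?m + d) = 42 * \<kappa>\<^sup>2 * ?m + (2 * \<kappa>\<^sup>2 * d + (32 * \<kappa>\<^sup>2 * d + 8 * (\<kappa>\<^sup>2 * d)))"
      by (simp add: distrib_left)
    ultimately show "1 + 8 * \<kappa> * ?m + 2 * \<kappa> * d + 32 * \<kappa>\<^sup>2 * d \<le> 1 + 42 * \<kappa>\<^sup>2 * (?m + d)"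
      by linarith
  qed simp
  finally have fin: "(\<integral>\<omega>. (?Q + X \<omega>)\<^sup>2 \<partial>M) \<le> (1 + 42 * \<kappa>\<^sup>2 * (?m + d)) * ?Q\<^sup>2" by (simp add: mult.commute)
  have "(\<integral>\<^sup>+\<omega>. ennreal ((?Q + X \<omega>)\<^sup>2) \<partial>M) = ennreal (\<integral>\<omega>. (?Q + X \<omega>)\<^sup>2 \<partial>M)"
    by (rule nn_integral_eq_integral[OF sq_int]) simp
  then show ?thesis unfolding T using fin by (simp add: ennreal_leI)
qed

end

text \<open>Fatou only controls a lower limit, so a finite bound is available for infinitely many
  indices rather than for almost all.\<close>

lemma le_liminf_finite_frequently:
  fixes f :: "nat \<Rightarrow> ennreal"
  assumes "liminf f \<noteq> \<infinity>"
  shows "\<exists>D\<ge>0. \<exists>\<^sub>F n in sequentially. f n \<le> ennreal D"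
proof -
  define D where "D = enn2real (liminf f) + 1"
  have "liminf f < ennreal D"
  proof -
    have "liminf f = ennreal (enn2real (liminf f))" using assms by (simp add: less_top)
    also have "\<dots> < ennreal D" unfolding D_def by (intro ennreal_lessI) (auto simp: add_pos_nonneg enn2real_nonneg add_nonneg_pos)
    finally show ?thesis .
  qed
  have "\<exists>\<^sub>F n in sequentially. f n \<le> ennreal D"
  proof (rule ccontr)
    assume "\<not> ?thesis"
    then have "\<forall>\<^sub>F n in sequentially. ennreal D \<le> f n"
      unfolding frequently_def by (auto elim!: eventually_mono)
    then have "ennreal D \<le> liminf f" by (rule Liminf_bounded)
    with \<open>liminf f < ennreal D\<close> show False by simp
  qed
  moreover have "0 \<le> D" by (simp add: D_def)
  ultimately show ?thesis by blast
qed

locale random_strip = prob_space M for M :: "'w measure" +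
  fixes s :: "nat \<Rightarrow> nat" and a :: "nat \<Rightarrow> real" and V :: "nat \<Rightarrow> 'w \<Rightarrow> nat \<Rightarrow> nat \<Rightarrow> complex"
  assumes s_pos: "\<And>n. 0 < s n" and s_mono: "\<And>n. s n \<le> s (Suc n)"
    and V_hermitian: "\<And>n \<omega>. \<omega> \<in> space M \<Longrightarrow> hermitian (s n) (V n \<omega>)"
    and V_indep: "indep_vars (\<lambda>n. PiM ({1..s n} \<times> {1..s n}) (\<lambda>_. borel))
           (\<lambda>n \<omega>. restrict (\<lambda>(i, j). V n \<omega> i j) ({1..s n} \<times> {1..s n})) UNIV"
    and V_summable: "(\<Sum>n. ennreal (mat_norm (s (Suc n)) (\<lambda>i j. \<integral>\<omega>. V (Suc n) \<omega> i j \<partial>M))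
           + (\<integral>\<^sup>+\<omega>. ennreal ((mat_norm (s (Suc n)) (V (Suc n) \<omega>)) ^ 2
                              + (mat_norm (s (Suc n)) (V (Suc n) \<omega>)) ^ 4) \<partial>M)) < \<infinity>"
begin

abbreviation "index n \<equiv> {1..s n} \<times> {1..s n}"
abbreviation "entries n \<omega> \<equiv> restrict (\<lambda>(i, j). V n \<omega> i j) (index n)"
abbreviation "entry_space n \<equiv> PiM (index n) (\<lambda>_. borel :: complex measure)"

definition mean_norm :: "nat \<Rightarrow> real" where
  "mean_norm n = mat_norm (s n) (\<lambda>i j. \<integral>\<omega>. V n \<omega> i j \<partial>M)"

definition moment :: "nat \<Rightarrow> ennreal" where
  "moment n = (\<integral>\<^sup>+\<omega>. ennreal ((mat_norm (s n) (V n \<omega>)) ^ 2 + (mat_norm (s n) (V n \<omega>)) ^ 4) \<partial>M)"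

text \<open>\<open>enn2real\<close> would turn an infinite moment into 0. The estimates only visit
  levels from 1 on, where the summability hypothesis makes every moment finite.\<close>

definition rate :: "nat \<Rightarrow> real" where
  "rate n = mean_norm n + enn2real (moment n)"

lemma entries_measurable: "entries n \<in> measurable M (entry_space n)"
  using V_indep unfolding indep_vars_def by auto

lemma V_measurable [measurable]:
  assumes "i \<in> {1..s n}" "j \<in> {1..s n}" shows "(\<lambda>\<omega>. V n \<omega> i j) \<in> borel_measurable M"
proof -
  have "(\<lambda>\<omega>. entries n \<omega> (i, j)) \<in> borel_measurable M"
    by (rule measurable_compose[OF entries_measurable measurable_component_singleton]) (use assms in auto)
  then show ?thesis using assms by simp
qed

lemma mat_norm_V_measurable [measurable]: "(\<lambda>\<omega>. mat_norm (s n) (V n \<omega>)) \<in> borel_measurable M"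
  by (rule mat_norm_measurable) (rule V_measurable)

lemma mean_norm_nonneg: "0 \<le> mean_norm n" by (simp add: mean_norm_def mat_norm_nonneg)

lemma rate_nonneg: "0 \<le> rate n" by (simp add: rate_def mean_norm_nonneg)

definition total_rate :: real where
  "total_rate = enn2real (\<Sum>n. ennreal (mean_norm (Suc n)) + moment (Suc n))"

lemma total_finite: "(\<Sum>n. ennreal (mean_norm (Suc n)) + moment (Suc n)) < \<infinity>"
  using V_summable by (simp add: mean_norm_def moment_def)

lemma moment_finite: "moment (Suc n) < \<infinity>"
proof -
  have "moment (Suc n) \<le> (\<Sum>n\<in>{n}. ennreal (mean_norm (Suc n)) + moment (Suc n))" by simp
  also have "\<dots> \<le> (\<Sum>n. ennreal (mean_norm (Suc n)) + moment (Suc n))" by (rule sum_le_suminf) auto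
  finally show ?thesis using total_finite by simp
qed

lemma moment_eq: "moment (Suc n) = ennreal (enn2real (moment (Suc n)))"
  using moment_finite[of n] by simp

lemma sum_rate_le:
  assumes "finite I" shows "(\<Sum>n\<in>I. rate (Suc n)) \<le> total_rate"
proof -
  have "ennreal (\<Sum>n\<in>I. rate (Suc n)) = (\<Sum>n\<in>I. ennreal (rate (Suc n)))"
    by (simp add: rate_nonneg)
  also have "\<dots> = (\<Sum>n\<in>I. ennreal (mean_norm (Suc n)) + moment (Suc n))"
  proof (rule sum.cong[OF refl])
    fix n
    have "ennreal (rate (Suc n)) = ennreal (mean_norm (Suc n)) + ennreal (enn2real (moment (Suc n)))"
      by (simp add: rate_def mean_norm_nonneg)
    then show "ennreal (rate (Suc n)) = ennreal (mean_norm (Suc n)) + moment (Suc n)"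
      by (simp only: moment_eq[symmetric])
  qed
  also have "\<dots> \<le> (\<Sum>n. ennreal (mean_norm (Suc n)) + moment (Suc n))"
    using assms by (intro sum_le_suminf) auto
  also have "\<dots> = ennreal total_rate" using total_finite by (simp add: total_rate_def)
  finally show ?thesis by (simp add: total_rate_def)
qed

text \<open>The expected sum of the squared norms is finite, so the sum is finite almost surely and
  its terms tend to zero.\<close>

lemma AE_potential_tendsto: "AE \<omega> in M. (\<lambda>n. mat_norm (s n) (V n \<omega>)) \<longlonglongrightarrow> 0"
proof -
  let ?N = "\<lambda>n \<omega>. mat_norm (s (Suc n)) (V (Suc n) \<omega>)"
  have "(\<integral>\<^sup>+\<omega>. (\<Sum>n. ennreal (?N n \<omega> ^ 2)) \<partial>M) = (\<Sum>n. \<integral>\<^sup>+\<omega>. ennreal (?N n \<omega> ^ 2) \<partial>M)"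
    by (rule nn_integral_suminf) simp
  also have "\<dots> \<le> (\<Sum>n. ennreal (mean_norm (Suc n)) + moment (Suc n))"
  proof (rule suminf_le)
    fix n
    have "(\<integral>\<^sup>+\<omega>. ennreal (?N n \<omega> ^ 2) \<partial>M) \<le> moment (Suc n)"
      unfolding moment_def by (intro nn_integral_mono ennreal_leI) (simp add: mat_norm_nonneg)
    then show "(\<integral>\<^sup>+\<omega>. ennreal (?N n \<omega> ^ 2) \<partial>M) \<le> ennreal (mean_norm (Suc n)) + moment (Suc n)"
      by (simp add: add_increasing)
  qed auto
  finally have "(\<integral>\<^sup>+\<omega>. (\<Sum>n. ennreal (?N n \<omega> ^ 2)) \<partial>M) \<noteq> \<infinity>" using total_finite by auto
  then have "AE \<omega> in M. (\<Sum>n. ennreal (?N n \<omega> ^ 2)) \<noteq> \<infinity>"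
    by (intro nn_integral_PInf_AE) auto
  then show ?thesis
  proof eventually_elim
    case (elim \<omega>)
    then have "summable (\<lambda>n. ?N n \<omega> ^ 2)" by (intro summable_suminf_not_top) auto
    then have "(\<lambda>n. ?N n \<omega> ^ 2) \<longlonglongrightarrow> 0" by (rule summable_LIMSEQ_zero)
    then have "(\<lambda>n. sqrt (?N n \<omega> ^ 2)) \<longlonglongrightarrow> sqrt 0" by (rule tendsto_real_sqrt)
    then have "(\<lambda>n. ?N n \<omega>) \<longlonglongrightarrow> 0" by (simp add: mat_norm_nonneg)
    then show ?case by (rule LIMSEQ_imp_Suc)
  qed
qed

context
  fixes n0 j0 :: nat and \<kappa> :: real
  assumes site: "(n0, j0) \<in> G1 s" and \<kappa>: "1 \<le> \<kappa>"
begin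

section \<open>Mean energy of the formal solution along the strip\<close>

definition solution_energy :: "(nat \<Rightarrow> nat \<Rightarrow> nat \<Rightarrow> complex) \<Rightarrow> real \<Rightarrow> nat \<Rightarrow> real" where
  "solution_energy W l m = total_energy (s (n0 + m)) (\<lambda>j. a j - l)
     (formal_solution s a W n0 j0 l m) (formal_solution s a W n0 j0 l (Suc m))"

lemma formal_solution_support:
  "j \<notin> {1..s (n0 + m)} \<Longrightarrow> formal_solution s a W n0 j0 l (Suc m) j = 0"
  using site by (cases m) (auto simp: G1_def)

lemma s_le: "m \<le> n \<Longrightarrow> s m \<le> s n"
  using s_mono by (rule lift_Suc_mono_le)

lemma solution_energy_0: "solution_energy W l 0 = 1"
proof -
  have "solution_energy W l 0 = (\<Sum>j\<in>{1..s n0}. if j = j0 then 1 else 0)"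
    unfolding solution_energy_def total_energy_def by (intro sum.cong) (auto simp: energy_def)
  also have "\<dots> = 1" using site by (simp add: G1_def)
  finally show ?thesis .
qed

lemma solution_energy_Suc:
  "solution_energy W l (Suc m) = total_energy (s (n0 + Suc m)) (\<lambda>j. a j - l)
     (formal_solution s a W n0 j0 l (Suc m))
     (next_vector (s (n0 + Suc m)) (\<lambda>j. a j - l) (formal_solution s a W n0 j0 l m)
        (formal_solution s a W n0 j0 l (Suc m)) (W (n0 + Suc m)))"
  unfolding solution_energy_def total_energy_def
  by (intro sum.cong refl arg_cong[where f = "energy _ _"]) (simp add: next_vector_def del: of_real_diff)

text \<open>Passing to more channels adds only pairs of zeros, since on the new channels the
  solution vanishes at both levels. The one-step bound can thus be stated with the block size of the
  next level.\<close>

lemma total_energy_extend: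
  "total_energy (s (n0 + Suc m)) (\<lambda>j. a j - l) (formal_solution s a W n0 j0 l m) (formal_solution s a W n0 j0 l (Suc m))
    = solution_energy W l m"
  unfolding solution_energy_def total_energy_def
proof (rule sum.mono_neutral_right)
  have le: "s (n0 + m) \<le> s (n0 + Suc m)" by (rule s_le) simp
  then show "{1..s (n0 + m)} \<subseteq> {1..s (n0 + Suc m)}" by auto
  show "\<forall>j\<in>{1..s (n0 + Suc m)} - {1..s (n0 + m)}.
      energy (a j - l) (formal_solution s a W n0 j0 l m j) (formal_solution s a W n0 j0 l (Suc m) j) = 0"
  proof
    fix j assume j: "j \<in> {1..s (n0 + Suc m)} - {1..s (n0 + m)}"
    have "formal_solution s a W n0 j0 l m j = 0"
    proof (cases m)
      case (Suc k)
      have "s (n0 + k) \<le> s (n0 + m)" using Suc by (intro s_le) simp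
      then show ?thesis using j Suc formal_solution_support[of j k] by auto
    qed simp
    moreover have "formal_solution s a W n0 j0 l (Suc m) j = 0"
      using j by (intro formal_solution_support) auto
    ultimately show "energy (a j - l) (formal_solution s a W n0 j0 l m j) (formal_solution s a W n0 j0 l (Suc m) j) = 0"
      by (simp add: energy_def)
  qed
qed simp

lemma energy_measurable:
  assumes [measurable]: "f \<in> borel_measurable N" "g \<in> borel_measurable N" "h \<in> borel_measurable N"
  shows "(\<lambda>x. energy (f x) (g x) (h x)) \<in> borel_measurable N"
proof -
  have [measurable]: "Re \<in> borel_measurable borel" "cnj \<in> borel_measurable borel"
    by (intro borel_measurable_continuous_onI continuous_intros)+
  show ?thesis unfolding energy_def by measurable
qed

lemma solution_energy_measurable:
  assumes "\<And>i j k. i < n0 + Suc m \<Longrightarrow> j \<in> {1..s i} \<Longrightarrow> k \<in> {1..s i} \<Longrightarrow> (\<lambda>x. W x i j k) \<in> borel_measurable N"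
    and "f \<in> borel_measurable N"
  shows "(\<lambda>x. solution_energy (W x) (f x) m) \<in> borel_measurable N"
  unfolding solution_energy_def total_energy_def
  by (intro borel_measurable_sum energy_measurable formal_solution_measurable borel_measurable_diff
      borel_measurable_const assms) auto

abbreviation "Vpot \<omega> \<equiv> \<lambda>n. V n \<omega>"

definition growth :: real where "growth = 42 * \<kappa>\<^sup>2"

text \<open>The joint distribution of the past levels and the next level is a product measure, so the
  one-step estimate may be applied with the past frozen.\<close>

lemma solution_energy_expectation_Suc:
  assumes l: "\<And>j. 1 \<le> j \<Longrightarrow> \<bar>a j - l\<bar> \<le> 2 - 2 / \<kappa>"
  shows "(\<integral>\<^sup>+\<omega>. ennreal ((solution_energy (Vpot \<omega>) l (Suc m))\<^sup>2) \<partial>M)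
    \<le> ennreal (1 + growth * rate (n0 + Suc m)) * (\<integral>\<^sup>+\<omega>. ennreal ((solution_energy (Vpot \<omega>) l m)\<^sup>2) \<partial>M)"
proof -
  define n where "n = n0 + Suc m"
  define K where "K = s n"
  define b where "b = (\<lambda>j. a j - l)"
  let ?A = "PiM {..<n} entry_space" and ?B = "PiM {n} entry_space"
  \<comment> \<open>\<open>Y\<close> collects the levels below \<open>n\<close>, on which the
    vectors \<open>p\<close> and \<open>q\<close> depend, and \<open>Z\<close> the single level
    \<open>n\<close>, which enters only through the next step.\<close>
  define Y where "Y \<omega> = restrict (\<lambda>i. entries i \<omega>) {..<n}" for \<omega>
  define Z where "Z \<omega> = restrict (\<lambda>i. entries i \<omega>) {n}" for \<omega>
  have ind: "indep_var ?A Y ?B Z"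
    unfolding Y_def Z_def by (rule indep_var_restrict[OF V_indep]) auto
  have Ym [measurable]: "Y \<in> measurable M ?A" and Zm [measurable]: "Z \<in> measurable M ?B"
    and joint: "distr M ?A Y \<Otimes>\<^sub>M distr M ?B Z = distr M (?A \<Otimes>\<^sub>M ?B) (\<lambda>\<omega>. (Y \<omega>, Z \<omega>))"
    using ind unfolding indep_var_distribution_eq by auto
  define WY where "WY y i j k = (y :: nat \<Rightarrow> nat \<times> nat \<Rightarrow> complex) i (j, k)" for y i j k
  have comp: "(\<lambda>y. WY y i j k) \<in> borel_measurable (PiM I entry_space)"
    if "i \<in> I" "j \<in> {1..s i}" "k \<in> {1..s i}" for I i j k
    unfolding WY_def
    by (rule measurable_compose[OF measurable_component_singleton[OF that(1)] measurable_component_singleton])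
       (use that in auto)
  define p where "p y = formal_solution s a (WY y) n0 j0 l m" for y
  define q where "q y = formal_solution s a (WY y) n0 j0 l (Suc m)" for y
  have pq_meas: "(\<lambda>y. p y j) \<in> borel_measurable ?A" "(\<lambda>y. q y j) \<in> borel_measurable ?A" for j
    unfolding p_def q_def
    by (rule formal_solution_measurable, rule borel_measurable_const, rule comp, simp add: n_def, assumption+)+
  define h where "h y z = ennreal ((total_energy K b (q y) (next_vector K b (p y) (q y) (WY z n)))\<^sup>2)" for y z
  have h_meas [measurable]: "case_prod h \<in> borel_measurable (?A \<Otimes>\<^sub>M ?B)"
  proof -
    have p1: "(\<lambda>x. p (fst x) j) \<in> borel_measurable (?A \<Otimes>\<^sub>M ?B)" for j
      by (rule measurable_compose[OF measurable_fst pq_meas(1)])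
    have q1: "(\<lambda>x. q (fst x) j) \<in> borel_measurable (?A \<Otimes>\<^sub>M ?B)" for j
      by (rule measurable_compose[OF measurable_fst pq_meas(2)])
    have z1: "(\<lambda>x. WY (snd x) n i j) \<in> borel_measurable (?A \<Otimes>\<^sub>M ?B)" if "i \<in> {1..K}" "j \<in> {1..K}" for i j
      by (rule measurable_compose[OF measurable_snd comp]) (use that in \<open>auto simp: K_def\<close>)
    show ?thesis
      unfolding h_def case_prod_unfold total_energy_def next_vector_def
      by (intro measurable_ennreal[THEN measurable_compose[rotated]] borel_measurable_power borel_measurable_sum
          energy_measurable borel_measurable_const borel_measurable_add borel_measurable_diff borel_measurable_times
          p1 q1 z1) auto
  qed
  have VY: "formal_solution s a (Vpot \<omega>) n0 j0 l m' = formal_solution s a (WY (Y \<omega>)) n0 j0 l m'" if "m' \<le> Suc m" for m' \<omega>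
  proof
    fix j
    show "formal_solution s a (Vpot \<omega>) n0 j0 l m' j = formal_solution s a (WY (Y \<omega>)) n0 j0 l m' j"
      using that by (intro formal_solution_cong) (auto simp: WY_def Y_def n_def)
  qed
  have VZ: "WY (Z \<omega>) n i j = V n \<omega> i j" if "i \<in> {1..K}" "j \<in> {1..K}" for \<omega> i j
    using that by (simp add: WY_def Z_def K_def)
  have hVZ: "h y (Z \<omega>) = ennreal ((total_energy K b (q y) (next_vector K b (p y) (q y) (V n \<omega>)))\<^sup>2)" for y \<omega>
    unfolding h_def using total_energy_next_cong[of K "WY (Z \<omega>) n" "V n \<omega>"] VZ by simp
  have eq: "ennreal ((solution_energy (Vpot \<omega>) l (Suc m))\<^sup>2) = h (Y \<omega>) (Z \<omega>)" for \<omega>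
    unfolding hVZ solution_energy_Suc p_def q_def by (simp only: VY le_refl le_SucI K_def n_def b_def)
  have Q: "total_energy K b (p (Y \<omega>)) (q (Y \<omega>)) = solution_energy (Vpot \<omega>) l m" for \<omega>
    unfolding total_energy_extend[symmetric] p_def q_def by (simp only: VY le_refl le_SucI K_def n_def b_def)
  have b: "\<bar>b j\<bar> \<le> 2 - 2 / \<kappa>" if "j \<in> {1..K}" for j
    using l[of j] that by (simp add: b_def)
  have n': "n = Suc (n0 + m)" by (simp add: n_def)
  interpret PY: prob_space "distr M ?A Y" by (rule prob_space_distr) (rule Ym)
  interpret PZ: prob_space "distr M ?B Z" by (rule prob_space_distr) (rule Zm)
  let ?c = "1 + growth * rate n"
  have c0: "0 \<le> ?c" by (simp add: growth_def rate_nonneg)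
  have "(\<integral>\<^sup>+\<omega>. ennreal ((solution_energy (Vpot \<omega>) l (Suc m))\<^sup>2) \<partial>M)
      = (\<integral>\<^sup>+\<omega>. case_prod h (Y \<omega>, Z \<omega>) \<partial>M)" by (simp add: eq)
  also have "\<dots> = (\<integral>\<^sup>+x. case_prod h x \<partial>distr M (?A \<Otimes>\<^sub>M ?B) (\<lambda>\<omega>. (Y \<omega>, Z \<omega>)))"
    by (subst nn_integral_distr) measurable
  also have "\<dots> = (\<integral>\<^sup>+x. case_prod h x \<partial>(distr M ?A Y \<Otimes>\<^sub>M distr M ?B Z))"
    by (simp only: joint)
  also have "\<dots> = (\<integral>\<^sup>+y. \<integral>\<^sup>+z. h y z \<partial>distr M ?B Z \<partial>distr M ?A Y)"
  proof -
    have "case_prod h \<in> borel_measurable (distr M ?A Y \<Otimes>\<^sub>M distr M ?B Z)"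
      unfolding measurable_cong_sets[OF sets_pair_measure_cong[OF sets_distr sets_distr] refl] by (rule h_meas)
    from PZ.nn_integral_fst[OF this] show ?thesis by (simp only: case_prod_conv)
  qed
  also have "\<dots> \<le> (\<integral>\<^sup>+y. ennreal (?c * (total_energy K b (p y) (q y))\<^sup>2) \<partial>distr M ?A Y)"
  proof (rule nn_integral_mono)
    fix y assume "y \<in> space (distr M ?A Y)"
    then have y: "y \<in> space ?A" by simp
    have "(\<integral>\<^sup>+z. h y z \<partial>distr M ?B Z) = (\<integral>\<^sup>+\<omega>. h y (Z \<omega>) \<partial>M)"
    proof (rule nn_integral_distr[OF Zm])
      show "h y \<in> borel_measurable (distr M ?B Z)"
        using measurable_compose[OF measurable_Pair1'[OF y, of ?B] h_meas]
        by (simp only: measurable_distr_eq1 case_prod_conv)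
    qed
    also have "\<dots> \<le> ennreal ((1 + 42 * \<kappa>\<^sup>2 * (mat_norm K (\<lambda>i j. \<integral>\<omega>. V n \<omega> i j \<partial>M) + enn2real (moment n)))
        * (total_energy K b (p y) (q y))\<^sup>2)"
      unfolding hVZ
    proof (rule energy_square_expectation[OF b \<kappa> prob_space_axioms])
      show "(\<integral>\<^sup>+\<omega>. ennreal ((mat_norm K (V n \<omega>)) ^ 2 + (mat_norm K (V n \<omega>)) ^ 4) \<partial>M) \<le> ennreal (enn2real (moment n))"
        unfolding n' moment_eq[symmetric] by (simp add: K_def n' moment_def)
    qed (use K_def in auto)
    finally show "(\<integral>\<^sup>+z. h y z \<partial>distr M ?B Z) \<le> ennreal (?c * (total_energy K b (p y) (q y))\<^sup>2)"
      by (simp add: growth_def rate_def mean_norm_def K_def)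
  qed
  also have "\<dots> = (\<integral>\<^sup>+\<omega>. ennreal (?c * (total_energy K b (p (Y \<omega>)) (q (Y \<omega>)))\<^sup>2) \<partial>M)"
  proof (rule nn_integral_distr[OF Ym])
    show "(\<lambda>y. ennreal (?c * (total_energy K b (p y) (q y))\<^sup>2)) \<in> borel_measurable (distr M ?A Y)"
      unfolding total_energy_def measurable_distr_eq1
      by (intro measurable_ennreal[THEN measurable_compose[rotated]] borel_measurable_power borel_measurable_sum
          energy_measurable borel_measurable_const borel_measurable_times pq_meas)
  qed
  also have "\<dots> = (\<integral>\<^sup>+\<omega>. ennreal ?c * ennreal ((solution_energy (Vpot \<omega>) l m)\<^sup>2) \<partial>M)"
    unfolding Q using c0 by (intro nn_integral_cong) (rule ennreal_mult, auto)
  also have "\<dots> = ennreal ?c * (\<integral>\<^sup>+\<omega>. ennreal ((solution_energy (Vpot \<omega>) l m)\<^sup>2) \<partial>M)"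
  proof (rule nn_integral_cmult)
    have "(\<lambda>\<omega>. solution_energy (Vpot \<omega>) l m) \<in> borel_measurable M"
      by (rule solution_energy_measurable[where f = "\<lambda>_. l"]) auto
    then show "(\<lambda>\<omega>. ennreal ((solution_energy (Vpot \<omega>) l m)\<^sup>2)) \<in> borel_measurable M" by measurable
  qed
  finally show ?thesis by (simp add: n_def)
qed

definition energy_bound :: real where "energy_bound = exp (growth * total_rate)"

text \<open>Iterating the one-step bound gives a product of factors
  \<open>1 + growth * rate\<close>, at most the exponential of the sum of rates; the bound is
  uniform in \<open>m\<close>, in \<open>l\<close> and in the starting site.\<close>

lemma solution_energy_expectation:
  assumes l: "\<And>j. 1 \<le> j \<Longrightarrow> \<bar>a j - l\<bar> \<le> 2 - 2 / \<kappa>"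
  shows "(\<integral>\<^sup>+\<omega>. ennreal ((solution_energy (Vpot \<omega>) l m)\<^sup>2) \<partial>M) \<le> ennreal energy_bound"
proof -
  have g: "0 \<le> growth" by (simp add: growth_def)
  have "(\<integral>\<^sup>+\<omega>. ennreal ((solution_energy (Vpot \<omega>) l m)\<^sup>2) \<partial>M) \<le> ennreal (\<Prod>i<m. 1 + growth * rate (n0 + Suc i))"
  proof (induction m)
    case 0
    then show ?case by (simp add: solution_energy_0 emeasure_space_1)
  next
    case (Suc m)
    have "(\<integral>\<^sup>+\<omega>. ennreal ((solution_energy (Vpot \<omega>) l (Suc m))\<^sup>2) \<partial>M)
        \<le> ennreal (1 + growth * rate (n0 + Suc m)) * (\<integral>\<^sup>+\<omega>. ennreal ((solution_energy (Vpot \<omega>) l m)\<^sup>2) \<partial>M)"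
      by (rule solution_energy_expectation_Suc[OF l])
    also have "\<dots> \<le> ennreal (1 + growth * rate (n0 + Suc m)) * ennreal (\<Prod>i<m. 1 + growth * rate (n0 + Suc i))"
      by (intro mult_left_mono Suc) auto
    also have "\<dots> = ennreal ((1 + growth * rate (n0 + Suc m)) * (\<Prod>i<m. 1 + growth * rate (n0 + Suc i)))"
      using g rate_nonneg by (intro ennreal_mult[symmetric] prod_nonneg) (auto simp: add_nonneg_nonneg)
    also have "\<dots> = ennreal (\<Prod>i<Suc m. 1 + growth * rate (n0 + Suc i))"
      by (simp only: prod.lessThan_Suc mult.commute)
    finally show ?case .
  qed
  also have "(\<Prod>i<m. 1 + growth * rate (n0 + Suc i)) \<le> (\<Prod>i<m. exp (growth * rate (n0 + Suc i)))"
    using g rate_nonneg by (intro prod_mono) (auto simp: add_nonneg_nonneg)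
  also have "\<dots> = exp (growth * (\<Sum>i<m. rate (Suc (n0 + i))))"
    by (simp add: exp_sum sum_distrib_left)
  also have "(\<Sum>i<m. rate (Suc (n0 + i))) = (\<Sum>i\<in>(+) n0 ` {..<m}. rate (Suc i))"
    by (simp add: sum.reindex)
  also have "\<dots> \<le> total_rate" by (rule sum_rate_le) simp
  finally show ?thesis using g by (simp add: energy_bound_def mult_left_mono ennreal_leI)
qed

lemma solution_mass_le:
  assumes l: "\<And>j. 1 \<le> j \<Longrightarrow> \<bar>a j - l\<bar> \<le> 2 - 2 / \<kappa>"
  shows "(solution_mass s a W n0 j0 m l)\<^sup>2 \<le> \<kappa>\<^sup>2 * (solution_energy W l m)\<^sup>2"
proof -
  have "solution_mass s a W n0 j0 m l \<le> \<kappa> * solution_energy W l m"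
    using total_energy_lower[of "s (n0 + m)" "\<lambda>j. a j - l" \<kappa> "formal_solution s a W n0 j0 l m" "formal_solution s a W n0 j0 l (Suc m)"] l \<kappa>
      sum_nonneg[of "{1..s (n0 + m)}" "\<lambda>j. (cmod (formal_solution s a W n0 j0 l (Suc m) j))\<^sup>2"]
    by (simp add: solution_mass_def solution_energy_def del: formal_solution.simps)
  then show ?thesis
    unfolding power_mult_distrib[symmetric] by (intro power_mono solution_mass_nonneg)
qed

text \<open>Fubini exchanges the mean with the integral over \<open>x\<close>, where the moment
  bound is uniform; Fatou then gives almost surely a finite lower limit of the averages.\<close>

lemma AE_solution_mass_bound:
  assumes l: "\<And>x j. x \<in> {\<alpha><..<\<beta>} \<Longrightarrow> 1 \<le> j \<Longrightarrow> \<bar>a j - x\<bar> \<le> 2 - 2 / \<kappa>"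
  shows "AE \<omega> in M. \<exists>D\<ge>0. \<exists>\<^sub>F L in sequentially.
    (\<integral>\<^sup>+x. ennreal (1 / real L * (\<Sum>m\<le>L. (solution_mass s a (Vpot \<omega>) n0 j0 m x)\<^sup>2)) * indicator {\<alpha><..<\<beta>} x \<partial>lborel)
      \<le> ennreal D"
proof -
  define f where "f L \<omega> x = ennreal (1 / real L * (\<Sum>m\<le>L. (solution_mass s a (Vpot \<omega>) n0 j0 m x)\<^sup>2)) * indicator {\<alpha><..<\<beta>} x"
    for L \<omega> x
  have mass_meas [measurable]: "(\<lambda>(\<omega>, x). solution_mass s a (Vpot \<omega>) n0 j0 m x) \<in> borel_measurable (M \<Otimes>\<^sub>M borel)" for m
  proof -
    have [measurable]: "(\<lambda>p. formal_solution s a (Vpot (fst p)) n0 j0 (snd p) m j) \<in> borel_measurable (M \<Otimes>\<^sub>M borel)" for j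
      by (rule formal_solution_measurable) (auto intro: measurable_compose[OF measurable_fst V_measurable])
    show ?thesis unfolding solution_mass_def case_prod_unfold by measurable
  qed
  have f_meas [measurable]: "case_prod (f L) \<in> borel_measurable (M \<Otimes>\<^sub>M borel)" for L
    unfolding f_def by measurable
  have f_meas' [measurable]: "case_prod (f L) \<in> borel_measurable (M \<Otimes>\<^sub>M lborel)" for L
    using f_meas by simp
  interpret pair_sigma_finite M lborel ..
  \<comment> \<open>The average has \<open>L + 1\<close> terms divided by \<open>L\<close>, at most
    twice the uniform bound.\<close>
  define D where "D = 2 * \<kappa>\<^sup>2 * energy_bound"
  have D0: "0 \<le> D" by (simp add: D_def energy_bound_def)
  have mean: "(\<integral>\<^sup>+\<omega>. f L \<omega> x \<partial>M) \<le> ennreal D * indicator {\<alpha><..<\<beta>} x" if L: "1 \<le> L" for L x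
  proof (cases "x \<in> {\<alpha><..<\<beta>}")
    case True
    have m [measurable]: "(\<lambda>\<omega>. solution_mass s a (Vpot \<omega>) n0 j0 m x) \<in> borel_measurable M" for m
      using measurable_compose[OF measurable_Pair2'[of x borel M] mass_meas] by simp
    have "(\<integral>\<^sup>+\<omega>. f L \<omega> x \<partial>M) = (\<integral>\<^sup>+\<omega>. ennreal (1 / real L) * (\<Sum>m\<le>L. ennreal ((solution_mass s a (Vpot \<omega>) n0 j0 m x)\<^sup>2)) \<partial>M)"
      using True by (intro nn_integral_cong) (simp add: f_def ennreal_mult' del: times_divide_eq_left)
    also have "\<dots> = ennreal (1 / real L) * (\<Sum>m\<le>L. \<integral>\<^sup>+\<omega>. ennreal ((solution_mass s a (Vpot \<omega>) n0 j0 m x)\<^sup>2) \<partial>M)"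
      by (subst nn_integral_cmult) (auto simp: nn_integral_sum simp del: sum_ennreal)
    also have "\<dots> \<le> ennreal (1 / real L) * (\<Sum>m\<le>L. ennreal (\<kappa>\<^sup>2 * energy_bound))"
    proof (intro mult_left_mono sum_mono)
      fix m
      have [measurable]: "(\<lambda>\<omega>. solution_energy (Vpot \<omega>) x m) \<in> borel_measurable M"
        by (rule solution_energy_measurable[where f = "\<lambda>_. x"]) auto
      have "(\<integral>\<^sup>+\<omega>. ennreal ((solution_mass s a (Vpot \<omega>) n0 j0 m x)\<^sup>2) \<partial>M)
          \<le> (\<integral>\<^sup>+\<omega>. ennreal (\<kappa>\<^sup>2) * ennreal ((solution_energy (Vpot \<omega>) x m)\<^sup>2) \<partial>M)"
        using solution_mass_le[OF l[OF True]] by (intro nn_integral_mono) (simp add: ennreal_mult[symmetric] ennreal_leI)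
      also have "\<dots> = ennreal (\<kappa>\<^sup>2) * (\<integral>\<^sup>+\<omega>. ennreal ((solution_energy (Vpot \<omega>) x m)\<^sup>2) \<partial>M)"
        by (rule nn_integral_cmult) measurable
      also have "\<dots> \<le> ennreal (\<kappa>\<^sup>2) * ennreal energy_bound"
        by (intro mult_left_mono solution_energy_expectation l[OF True]) auto
      finally show "(\<integral>\<^sup>+\<omega>. ennreal ((solution_mass s a (Vpot \<omega>) n0 j0 m x)\<^sup>2) \<partial>M) \<le> ennreal (\<kappa>\<^sup>2 * energy_bound)"
        by (simp add: ennreal_mult energy_bound_def)
    qed auto
    also have "\<dots> = ennreal (1 / real L * (real (Suc L) * (\<kappa>\<^sup>2 * energy_bound)))"
      by (simp add: energy_bound_def ennreal_mult[symmetric] ennreal_of_nat_eq_real_of_nat del: of_nat_Suc)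
    also have "\<dots> \<le> ennreal D"
    proof (rule ennreal_leI)
      have "1 / real L * (real (Suc L) * (\<kappa>\<^sup>2 * energy_bound)) = (real (Suc L) / real L) * (\<kappa>\<^sup>2 * energy_bound)" by simp
      also have "\<dots> \<le> 2 * (\<kappa>\<^sup>2 * energy_bound)"
        using L by (intro mult_right_mono) (auto simp: field_simps energy_bound_def)
      finally show "1 / real L * (real (Suc L) * (\<kappa>\<^sup>2 * energy_bound)) \<le> D" by (simp add: D_def)
    qed
    finally show ?thesis using True by simp
  qed (simp add: f_def)
  have "(\<integral>\<^sup>+\<omega>. liminf (\<lambda>L. \<integral>\<^sup>+x. f L \<omega> x \<partial>lborel) \<partial>M) \<le> liminf (\<lambda>L. \<integral>\<^sup>+\<omega>. \<integral>\<^sup>+x. f L \<omega> x \<partial>lborel \<partial>M)"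
    by (rule nn_integral_liminf) measurable
  also have "\<dots> \<le> ennreal D * emeasure lborel {\<alpha><..<\<beta>}"
  proof (rule Liminf_le)
    have "(\<integral>\<^sup>+\<omega>. \<integral>\<^sup>+x. f L \<omega> x \<partial>lborel \<partial>M) \<le> ennreal D * emeasure lborel {\<alpha><..<\<beta>}" if L: "1 \<le> L" for L
    proof -
      have "(\<integral>\<^sup>+\<omega>. \<integral>\<^sup>+x. f L \<omega> x \<partial>lborel \<partial>M) = (\<integral>\<^sup>+x. \<integral>\<^sup>+\<omega>. f L \<omega> x \<partial>M \<partial>lborel)"
        by (rule Fubini'[symmetric]) (rule f_meas')
      also have "\<dots> \<le> (\<integral>\<^sup>+x. ennreal D * indicator {\<alpha><..<\<beta>} x \<partial>lborel)"
        by (intro nn_integral_mono mean L)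
      also have "\<dots> = ennreal D * emeasure lborel {\<alpha><..<\<beta>}" by (rule nn_integral_cmult_indicator) simp
      finally show ?thesis .
    qed
    then show "\<forall>\<^sub>F L in sequentially. (\<integral>\<^sup>+\<omega>. \<integral>\<^sup>+x. f L \<omega> x \<partial>lborel \<partial>M) \<le> ennreal D * emeasure lborel {\<alpha><..<\<beta>}"
      by (rule eventually_sequentiallyI)
  qed simp
  also have "\<dots> < \<infinity>" by (cases "\<alpha> \<le> \<beta>") (auto simp: ennreal_mult_less_top)
  finally have "AE \<omega> in M. liminf (\<lambda>L. \<integral>\<^sup>+x. f L \<omega> x \<partial>lborel) \<noteq> \<infinity>"
    by (intro nn_integral_PInf_AE) auto
  then show ?thesis
  proof eventually_elim
    case (elim \<omega>)
    then show ?case using le_liminf_finite_frequently[OF elim] by (simp add: f_def)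
  qed
qed

end

end

text \<open>The supremum lies above \<open>a 1\<close> and the infimum below it, so an infinite
  value of either would make the extended difference infinite; hence both are real.\<close>

lemma SUP_INF_real_bounds:
  fixes a :: "nat \<Rightarrow> real"
  assumes "(SUP j\<in>{1..}. ereal (a j)) - (INF j\<in>{1..}. ereal (a j)) < 4"
  obtains u v where "\<And>j. 1 \<le> j \<Longrightarrow> a j \<le> u" "\<And>j. 1 \<le> j \<Longrightarrow> v \<le> a j" "u - v < 4"
    "\<And>c. \<forall>j\<ge>1. a j \<le> c \<Longrightarrow> u \<le> c" "\<And>c. \<forall>j\<ge>1. c \<le> a j \<Longrightarrow> c \<le> v"
proof -
  let ?S = "SUP j\<in>{1..}. ereal (a j)" and ?I = "INF j\<in>{1..}. ereal (a j)"
  have S: "ereal (a j) \<le> ?S" if "1 \<le> j" for j using that by (intro SUP_upper) auto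
  have I: "?I \<le> ereal (a j)" if "1 \<le> j" for j using that by (intro INF_lower) auto
  have "?S \<noteq> - \<infinity>" "?I \<noteq> \<infinity>" using S[of 1] I[of 1] by auto
  moreover have "?S \<noteq> \<infinity>" "?I \<noteq> - \<infinity>" using assms calculation by auto
  ultimately obtain u v where uv: "?S = ereal u" "?I = ereal v"
    by (metis ereal_cases uminus_ereal.simps(2))
  show ?thesis
  proof (rule that[of u v])
    show "a j \<le> u" if "1 \<le> j" for j using S[OF that] uv(1) by simp
    show "v \<le> a j" if "1 \<le> j" for j using I[OF that] uv(2) by simp
    show "u - v < 4" using assms unfolding uv by simp
    show "u \<le> c" if "\<forall>j\<ge>1. a j \<le> c" for c
    proof -
      have "?S \<le> ereal c" using that by (intro SUP_least) auto
      then show ?thesis unfolding uv by simp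
    qed
    show "c \<le> v" if "\<forall>j\<ge>1. c \<le> a j" for c
    proof -
      have "ereal c \<le> ?I" using that by (intro INF_greatest) auto
      then show ?thesis unfolding uv by simp
    qed
  qed
qed

theorem theorem5:
  fixes s :: "nat \<Rightarrow> nat" and a :: "nat \<Rightarrow> real"
    and M :: "'w measure" and V :: "nat \<Rightarrow> 'w \<Rightarrow> nat \<Rightarrow> nat \<Rightarrow> complex"
  assumes "prob_space M"
    and "\<And>n. 0 < s n" and "\<And>n. s n \<le> s (Suc n)"
    and "(SUP j\<in>{1..}. ereal (a j)) - (INF j\<in>{1..}. ereal (a j)) < 4"
    and "\<And>n \<omega>. \<omega> \<in> space M \<Longrightarrow> hermitian (s n) (V n \<omega>)"
    and "prob_space.indep_vars M
           (\<lambda>n. PiM ({1..s n} \<times> {1..s n}) (\<lambda>_. borel))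
           (\<lambda>n \<omega>. restrict (\<lambda>(i, j). V n \<omega> i j) ({1..s n} \<times> {1..s n})) UNIV"
    and "(\<Sum>n. ennreal (mat_norm (s (Suc n)) (\<lambda>i j. \<integral>\<omega>. V (Suc n) \<omega> i j \<partial>M))
           + (\<integral>\<^sup>+\<omega>. ennreal ((mat_norm (s (Suc n)) (V (Suc n) \<omega>)) ^ 2
                              + (mat_norm (s (Suc n)) (V (Suc n) \<omega>)) ^ 4) \<partial>M)) < \<infinity>"
  shows "AE \<omega> in M.
           complex_of_real ` I1 a
             \<subseteq> spec_ac (G1 s) (H1_dom s a (\<lambda>n. V n \<omega>)) (H1_op s a (\<lambda>n. V n \<omega>)) \<and>
           complex_of_real ` interior (I1 a)
             \<inter> spec_pp (G1 s) (H1_dom s a (\<lambda>n. V n \<omega>)) (H1_op s a (\<lambda>n. V n \<omega>)) = {} \<and>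
           complex_of_real ` interior (I1 a)
             \<inter> spec_sc (G1 s) (H1_dom s a (\<lambda>n. V n \<omega>)) (H1_op s a (\<lambda>n. V n \<omega>)) = {}"
proof -
  interpret prob_space M by fact
  interpret random_strip M s a V
    by (intro random_strip.intro random_strip_axioms.intro assms)
  obtain u v where uv: "\<And>j. 1 \<le> j \<Longrightarrow> a j \<le> u" "\<And>j. 1 \<le> j \<Longrightarrow> v \<le> a j" "u - v < 4"
    "\<And>c. \<forall>j\<ge>1. a j \<le> c \<Longrightarrow> u \<le> c" "\<And>c. \<forall>j\<ge>1. c \<le> a j \<Longrightarrow> c \<le> v"
    by (rule SUP_INF_real_bounds[OF assms(4)]) (rule that, assumption+)
  define \<alpha> where "\<alpha> = u - 2"
  define \<beta> where "\<beta> = v + 2"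
  have \<alpha>\<beta>: "\<alpha> < \<beta>" using uv(3) by (simp add: \<alpha>_def \<beta>_def)
  have I1: "\<bar>a j - x\<bar> < 2" if "x \<in> I1 a" "1 \<le> j" for x j
  proof -
    have "x \<in> {- 2 + a j <..< 2 + a j}" using that unfolding I1_def by blast
    then show ?thesis by (simp add: abs_less_iff)
  qed
  \<comment> \<open>The intersection may contain an end point when an extremum of \<open>a\<close>
    is not attained; the closed interval suffices for the first claim, which holds up to the end
    points.\<close>
  have closed: "x \<in> {\<alpha>..\<beta>}" if x: "x \<in> I1 a" for x
  proof -
    have "a j \<le> x + 2" "x - 2 \<le> a j" if "1 \<le> j" for j
      using I1[OF x that] by linarith+
    then have "u \<le> x + 2" "x - 2 \<le> v" by (auto intro: uv(4,5))
    then show ?thesis by (simp add: \<alpha>_def \<beta>_def)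
  qed
  have "open": "x \<in> {\<alpha><..<\<beta>}" if x: "x \<in> interior (I1 a)" for x
  proof -
    obtain e where e: "0 < e" "cball x e \<subseteq> I1 a" using x by (auto simp: mem_interior_cball)
    have "x - e \<in> I1 a" "x + e \<in> I1 a" using e by (auto intro!: subsetD[OF e(2)] simp: dist_real_def)
    then show ?thesis using closed[of "x - e"] closed[of "x + e"] e(1) by auto
  qed
  \<comment> \<open>The energy constant \<open>\<kappa>\<close> degenerates at \<alpha> and \<beta>,
    so the interval is exhausted by the \<open>J i\<close>; together with the countably many sites
    this leaves only countably many exceptional null sets.\<close>
  define r where "r i = 1 / real (Suc i)" for i
  define J where "J i = {\<alpha> + r i<..<\<beta> - r i}" for i
  have AE_mass: "AE \<omega> in M. \<forall>i n0 j0. (n0, j0) \<in> G1 s \<longrightarrow> (\<exists>D\<ge>0. \<exists>\<^sub>F L in sequentially.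
    (\<integral>\<^sup>+x. ennreal (1 / real L * (\<Sum>m\<le>L. (solution_mass s a (\<lambda>n. V n \<omega>) n0 j0 m x)\<^sup>2)) * indicator (J i) x \<partial>lborel)
      \<le> ennreal D)"
  proof (intro AE_all_countable[THEN iffD2] allI)
    fix i n0 j0
    show "AE \<omega> in M. (n0, j0) \<in> G1 s \<longrightarrow> (\<exists>D\<ge>0. \<exists>\<^sub>F L in sequentially.
      (\<integral>\<^sup>+x. ennreal (1 / real L * (\<Sum>m\<le>L. (solution_mass s a (\<lambda>n. V n \<omega>) n0 j0 m x)\<^sup>2)) * indicator (J i) x \<partial>lborel)
        \<le> ennreal D)"
    proof (cases "(n0, j0) \<in> G1 s")
      case True
      define \<kappa> where "\<kappa> = 2 * real (Suc i)"
      have \<kappa>: "1 \<le> \<kappa>" "2 / \<kappa> = r i" by (auto simp: \<kappa>_def r_def field_simps)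
      have "\<bar>a j - x\<bar> \<le> 2 - 2 / \<kappa>" if "x \<in> {\<alpha> + r i<..<\<beta> - r i}" "1 \<le> j" for x j
        using that uv(1,2)[OF that(2)] by (auto simp: \<alpha>_def \<beta>_def \<kappa>(2) abs_le_iff)
      from AE_solution_mass_bound[OF True \<kappa>(1), of "\<alpha> + r i" "\<beta> - r i", OF this]
      show ?thesis using True by (simp add: J_def)
    qed simp
  qed
  show ?thesis
    using AE_mass AE_potential_tendsto AE_space
  proof eventually_elim
    case (elim \<omega>)
    let ?W = "\<lambda>n. V n \<omega>"
    \<comment> \<open>Convergence to zero bounds the norms uniformly in the level, but with a bound
      that depends on \<omega>; the deterministic theory is therefore entered separately for each
      \<omega>.\<close>
    have "Bseq (\<lambda>n. mat_norm (s n) (V n \<omega>))"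
      using elim(2) by (intro convergent_imp_Bseq convergentI)
    then obtain B where norm_B: "\<forall>n. norm (mat_norm (s n) (V n \<omega>)) \<le> B" by (rule BseqE)
    have B: "mat_norm (s n) (V n \<omega>) \<le> B" for n
      by (rule order_trans[OF abs_ge_self norm_B[rule_format, unfolded real_norm_def]])
    interpret strip s a ?W "\<bar>u\<bar> + \<bar>v\<bar>" B
    proof
      show "\<bar>a j\<bar> \<le> \<bar>u\<bar> + \<bar>v\<bar>" if "1 \<le> j" for j using uv(1,2)[OF that] by linarith
      show "hermitian (s n) (V n \<omega>)" for n using elim(3) by (rule V_hermitian)
    qed (rule s_pos s_mono B)+
    have null: "F N (delta p) = 0" if N: "N \<in> null_sets lborel" "N \<subseteq> {\<alpha><..<\<beta>}" and p: "p \<in> G1 s" for N p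
    proof -
      obtain n0 j0 where p': "p = (n0, j0)" by (cases p)
      have d: "delta p \<in> supported (G1 s)" using p by (rule delta_supported)
      have "N \<inter> J i \<in> null_sets (mu (delta p))" for i
      proof -
        have Ni: "N \<inter> J i \<in> null_sets lborel" using N(1) by (intro null_set_Int2) (auto simp: J_def)
        obtain D where D: "0 \<le> D" "\<exists>\<^sub>F L in sequentially.
            (\<integral>\<^sup>+x. ennreal (1 / real L * (\<Sum>m\<le>L. (solution_mass s a ?W n0 j0 m x)\<^sup>2)) * indicator {\<alpha> + r i<..<\<beta> - r i} x \<partial>lborel)
            \<le> ennreal D"
          using elim(1) p unfolding p' J_def by blast
        have "F (N \<inter> J i) (delta p) = 0"
          unfolding p' by (rule null_of_solution_mass[OF _ D(2,1) Ni]) (use p p' in \<open>auto simp: J_def\<close>)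
        moreover have "N \<inter> J i \<in> sets borel" using null_setsD2[OF Ni] by simp
        ultimately show ?thesis using emeasure_mu_0[OF d, of "N \<inter> J i"] by (intro null_setsI) simp_all
      qed
      then have "(\<Union>i. N \<inter> J i) \<in> null_sets (mu (delta p))" by (rule null_sets_UN)
      moreover have "(\<Union>i. N \<inter> J i) = N"
      proof -
        have "\<exists>i. x \<in> J i" if "x \<in> N" for x
        proof -
          have "0 < min (x - \<alpha>) (\<beta> - x)" using N(2) that by auto
          then obtain i where "r i < min (x - \<alpha>) (\<beta> - x)"
            unfolding r_def by (metis nat_approx_posE)
          then show ?thesis by (auto simp: J_def intro!: exI[of _ i])
        qed
        then show ?thesis by blast
      qed
      moreover have "N \<in> sets borel" using null_setsD2[OF N(1)] by simp
      ultimately show ?thesis using emeasure_mu_0[OF d, of N] by (simp add: null_setsD1)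
    qed
    have weyl: "\<exists>x\<in>supported (G1 s). norm x = 1 \<and> norm (H x - t *\<^sub>R x) < e"
      if "t \<in> {\<alpha><..<\<beta>}" "0 < e" for t e
    proof (rule weyl_sequence[OF _ elim(2) that(2)])
      show "\<bar>t - a 1\<bar> \<le> 2" using that(1) uv(1,2)[of 1] by (auto simp: \<alpha>_def \<beta>_def abs_le_iff)
    qed
    have "complex_of_real x \<in> spec_ac (G1 s) (ell2 (G1 s)) (H1_op s a ?W)" if "x \<in> I1 a" for x
      by (rule in_spec_ac[OF null closed[OF that] \<alpha>\<beta> weyl]) auto
    moreover have "complex_of_real x \<notin> spec_pp (G1 s) (ell2 (G1 s)) (H1_op s a ?W)" if "x \<in> interior (I1 a)" for x
      by (rule not_in_spec_pp[OF null "open"[OF that]]) auto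
    moreover have "complex_of_real x \<notin> spec_sc (G1 s) (ell2 (G1 s)) (H1_op s a ?W)" if "x \<in> interior (I1 a)" for x
      by (rule not_in_spec_sc[OF null "open"[OF that]]) auto
    ultimately show ?case unfolding H1_dom_eq by blast
  qed
qed

end
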